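(* Let $K$ be a field, and let $b\ge 3$ and $n\ge 1$ be integers. Then $$\sum_{i,d\ge 0}\beta_{i,d}(nB_b)\,u^iv^d=P_b(u,v)^n,$$ or equivalently, $\beta_{i,d}(nB_b)=[u^iv^d]\,P_b(u,v)^n$, where $[u^iv^d]$ denotes extraction of the coefficient of $u^iv^d$, and where $$P_b(u,v)=1+\sum_{r=1}^{2b-2}\lambda_r u^rv^{r+1}+\sum_{r=1}^{2b-2}\mu_r u^rv^{r+2}.$$
   Context: All graphs are finite, simple and undirected. For $b\ge 2$, $B_b$ is the graph with vertices $x_1,\dots,x_b,y_1,\dots,y_b$ and edges $\{x_i,x_j\}$ and $\{y_i,y_j\}$ for $1\le i<j\le b$, and $\{x_i,y_i\}$ for $1\le i\le b$. $nB_b$ is the disjoint union of $n$ copies of $B_b$. For a graph $G$, $R_G$ is the standard graded polynomial ring over $K$ whose variables are the vertices of $G$, $I(G)=(xy:\{x,y\}\in E(G))\subseteq R_G$ is the edge ideal, and $\beta_{i,d}(G)$ denotes the graded Betti number of $R_G/I(G)$ over $R_G$ in homological degree $i$ and internal degree $d$. For fixed $b\ge3$ the integers $\lambda_i,\mu_i$ are defined as follows, with the convention $\binom{u}{v}=0$ if $v<0$ or $v>u$. For $1\le i\le 2b-2$: $\lambda_1=2\binom{b}{2}+b$; $\lambda_3=6\binom{b}{4}+2b\binom{b-1}{2}+\binom{b}{2}$; and $\lambda_i=2i\binom{b}{i+1}+2b\binom{b-1}{i-1}$ for $i\ne1,3$. Also $\lambda_i=0$ outside $1\le i\le 2b-2$.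 For $1\le i\le 2b-2$, $$\mu_i=\lambda_{i+1}+\binom{2b-2}{i+2}-(2b-2)\binom{2b-2}{i+1}+(b^2-3b+1)\binom{2b-2}{i}.$$ *)

theory Defs
  imports "HOL-Library.Poly_Mapping" "HOL-Computational_Algebra.Polynomial"
begin

type_synonym ('v, 'k) mpol = "('v \<Rightarrow>\<^sub>0 nat) \<Rightarrow>\<^sub>0 'k"

definition poly_ring :: "'v set \<Rightarrow> ('v, 'k::field) mpol set" where
  "poly_ring V = {p. \<forall>m \<in> Poly_Mapping.keys p. Poly_Mapping.keys m \<subseteq> V}"

definition irrelevant_ideal :: "'v set \<Rightarrow> ('v, 'k::field) mpol set" where
  "irrelevant_ideal V = {p \<in> poly_ring V. Poly_Mapping.lookup p 0 = 0}"

definition variable :: "'v \<Rightarrow> ('v, 'k::field) mpol" where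
  "variable x = Poly_Mapping.single (Poly_Mapping.single x 1) 1"

definition mon_degree :: "('v \<Rightarrow>\<^sub>0 nat) \<Rightarrow> nat" where
  "mon_degree m = (\<Sum>x \<in> Poly_Mapping.keys m. Poly_Mapping.lookup m x)"

definition homogeneous :: "nat \<Rightarrow> ('v, 'k::field) mpol \<Rightarrow> bool" where
  "homogeneous d p \<longleftrightarrow> (\<forall>m \<in> Poly_Mapping.keys p. mon_degree m = d)"

definition generated_ideal ::
    "'v set \<Rightarrow> ('v, 'k::field) mpol set \<Rightarrow> ('v, 'k) mpol set" where
  "generated_ideal V S =
     {(\<Sum>s\<in>T. c s * s) | T c. finite T \<and> T \<subseteq> S \<and> (\<forall>s\<in>T. c s \<in> poly_ring V)}"

text \<open>
  A free module over \<open>poly_ring V\<close> with basis \<open>B\<close> consists of the finitely supported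
  coefficient vectors \<open>vectors (poly_ring V) B\<close>. For an ideal \<open>A\<close> of the ring,
  \<open>vectors A B\<close> is the submodule \<open>A F\<close> of this free module \<open>F\<close>.
\<close>

definition vectors ::
    "('v, 'k::field) mpol set \<Rightarrow> nat set \<Rightarrow> (nat \<Rightarrow>\<^sub>0 ('v, 'k) mpol) set" where
  "vectors A B = {f. Poly_Mapping.keys f \<subseteq> B \<and>
                     (\<forall>k \<in> Poly_Mapping.keys f. Poly_Mapping.lookup f k \<in> A)}"

text \<open>Here \<open>deg j\<close> is the degree of the basis vector \<open>j\<close>.\<close>

definition homogeneous_vector ::
    "(nat \<Rightarrow> nat) \<Rightarrow> nat \<Rightarrow> (nat \<Rightarrow>\<^sub>0 ('v, 'k::field) mpol) \<Rightarrow> bool" where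
  "homogeneous_vector deg d f \<longleftrightarrow>
     (\<forall>j \<in> Poly_Mapping.keys f. deg j \<le> d \<and> homogeneous (d - deg j) (Poly_Mapping.lookup f j))"

definition extend_ring ::
    "(nat \<Rightarrow> ('v, 'k::field) mpol) \<Rightarrow> (nat \<Rightarrow>\<^sub>0 ('v, 'k) mpol) \<Rightarrow> ('v, 'k) mpol" where
  "extend_ring e f = (\<Sum>k \<in> Poly_Mapping.keys f. Poly_Mapping.lookup f k * e k)"

definition extend_free ::
    "(nat \<Rightarrow> (nat \<Rightarrow>\<^sub>0 ('v, 'k::field) mpol)) \<Rightarrow> (nat \<Rightarrow>\<^sub>0 ('v, 'k) mpol) \<Rightarrow> (nat \<Rightarrow>\<^sub>0 ('v, 'k) mpol)" where
  "extend_free D f =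
     (\<Sum>k \<in> Poly_Mapping.keys f. Poly_Mapping.map ((*) (Poly_Mapping.lookup f k)) (D k))"

text \<open>
  A minimal graded free resolution
  \<open>\<dots> \<rightarrow> F 2 \<rightarrow> F 1 \<rightarrow> F 0 \<rightarrow> R/I \<rightarrow> 0\<close> of \<open>R/I\<close> for \<open>R = poly_ring V\<close>: the module \<open>F i\<close> has the
  basis \<open>B i\<close>, whose element \<open>k\<close> has degree \<open>deg i k\<close>; the differential \<open>F (Suc i) \<rightarrow> F i\<close>
  maps \<open>k\<close> to \<open>D i k\<close>; and \<open>F 0 \<rightarrow> R/I\<close> maps \<open>k\<close> to the class of the homogeneous
  polynomial \<open>e k\<close>. All maps preserve degrees, the sequence is exact, and the last clause is
  minimality: the image of \<open>F (Suc i)\<close> lies in \<open>\<mm> F i\<close>, \<open>\<mm>\<close> being the irrelevant ideal.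
\<close>

definition minimal_graded_free_resolution ::
    "'v set \<Rightarrow> ('v, 'k::field) mpol set \<Rightarrow> (nat \<Rightarrow> nat set) \<Rightarrow> (nat \<Rightarrow> nat \<Rightarrow> nat) \<Rightarrow>
     (nat \<Rightarrow> ('v, 'k) mpol) \<Rightarrow> (nat \<Rightarrow> nat \<Rightarrow> (nat \<Rightarrow>\<^sub>0 ('v, 'k) mpol)) \<Rightarrow> bool" where
  "minimal_graded_free_resolution V I B deg e D \<longleftrightarrow>
     (let R = poly_ring V; F = (\<lambda>i. vectors R (B i)) in
        (\<forall>k \<in> B 0. e k \<in> R \<and> homogeneous (deg 0 k) (e k)) \<and>
        (\<forall>i. \<forall>k \<in> B (Suc i). D i k \<in> F i \<and> homogeneous_vector (deg i) (deg (Suc i) k) (D i k)) \<and>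
        (\<forall>p \<in> R. \<exists>f \<in> F 0. p - extend_ring e f \<in> I) \<and>
        {f \<in> F 0. extend_ring e f \<in> I} = extend_free (D 0) ` F 1 \<and>
        (\<forall>i. {f \<in> F (Suc i). extend_free (D i) f = 0} = extend_free (D (Suc i)) ` F (Suc (Suc i))) \<and>
        (\<forall>i. extend_free (D i) ` F (Suc i) \<subseteq> vectors (irrelevant_ideal V) (B i)))"

text \<open>
  The number of basis elements of degree \<open>d\<close> in \<open>F i\<close>, for any minimal graded free
  resolution of \<open>R/I\<close>. For finite \<open>V\<close> and homogeneous \<open>I\<close> such a resolution exists and this
  number is finite and does not depend on it, so the description is proper. Finite rank of the
  \<open>F i\<close> is not required because it is automatic in this case, as is nonnegativity of the degrees.
\<close>

definition graded_betti :: "'v set \<Rightarrow> ('v, 'k::field) mpol set \<Rightarrow> nat \<Rightarrow> nat \<Rightarrow> nat" where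
  "graded_betti V I i d =
     (THE c. \<exists>B deg e D. minimal_graded_free_resolution V I B deg e D \<and>
                         c = card {k \<in> B i. deg i k = d})"

text \<open>A graph is a vertex set with a set of edges, which are two-element sets of vertices.\<close>

type_synonym 'v graph = "'v set \<times> 'v set set"

definition edge_ideal :: "'v graph \<Rightarrow> ('v, 'k::field) mpol set" where
  "edge_ideal G =
     generated_ideal (fst G) {variable x * variable y | x y. {x, y} \<in> snd G}"

definition graph_betti :: "'k::field itself \<Rightarrow> 'v graph \<Rightarrow> nat \<Rightarrow> nat \<Rightarrow> nat" where
  "graph_betti K G i d = graded_betti (fst G) (edge_ideal G :: ('v, 'k) mpol set) i d"

text \<open>The vertices \<open>x\<^sub>i\<close> and \<open>y\<^sub>i\<close> are \<open>Inl i\<close> and \<open>Inr i\<close>.\<close>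

definition B_graph :: "nat \<Rightarrow> (nat + nat) graph" where
  "B_graph b =
     (Inl ` {1..b} \<union> Inr ` {1..b},
      {{Inl i, Inl j} | i j. 1 \<le> i \<and> i < j \<and> j \<le> b} \<union>
      {{Inr i, Inr j} | i j. 1 \<le> i \<and> i < j \<and> j \<le> b} \<union>
      {{Inl i, Inr i} | i. 1 \<le> i \<and> i \<le> b})"

definition copies :: "nat \<Rightarrow> 'v graph \<Rightarrow> (nat \<times> 'v) graph" where
  "copies n G = ({1..n} \<times> fst G, {Pair c ` E | c E. c \<in> {1..n} \<and> E \<in> snd G})"

definition lam :: "nat \<Rightarrow> nat \<Rightarrow> int" where
  "lam b i =
     (if i < 1 \<or> 2 * b - 2 < i then 0
      else if i = 1 then int (2 * (b choose 2) + b)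
      else if i = 3 then int (6 * (b choose 4) + 2 * b * ((b - 1) choose 2) + (b choose 2))
      else int (2 * i * (b choose (i + 1)) + 2 * b * ((b - 1) choose (i - 1))))"

definition mu :: "nat \<Rightarrow> nat \<Rightarrow> int" where
  "mu b i =
     lam b (i + 1) + int ((2 * b - 2) choose (i + 2))
     - (2 * int b - 2) * int ((2 * b - 2) choose (i + 1))
     + (int b ^ 2 - 3 * int b + 1) * int ((2 * b - 2) choose i)"

text \<open>Polynomials in \<open>u\<close> with coefficients in \<open>\<int>[v]\<close>.\<close>

definition uv_monom :: "int \<Rightarrow> nat \<Rightarrow> nat \<Rightarrow> int poly poly" where
  "uv_monom a i d = monom (monom a d) i"

definition uv_coeff :: "int poly poly \<Rightarrow> nat \<Rightarrow> nat \<Rightarrow> int" where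
  "uv_coeff p i d = coeff (coeff p i) d"

definition P_poly :: "nat \<Rightarrow> int poly poly" where
  "P_poly b =
     1 + (\<Sum>r = 1..2 * b - 2. uv_monom (lam b r) r (r + 1))
       + (\<Sum>r = 1..2 * b - 2. uv_monom (mu b r) r (r + 2))"

end

theory Submission
  imports Defs "HOL-Library.Function_Algebras" "HOL-Library.Nat_Bijection"
begin

text \<open>
  By dimension shifting along the syzygies, the number of basis elements of degree \<open>d\<close> in the
  \<open>i\<close>-th term of any minimal resolution of \<open>R/I(G)\<close> is the dimension of the degree-\<open>d\<close> part of
  the \<open>i\<close>-th Koszul homology of \<open>R/I(G)\<close>. Only squarefree multidegrees contribute to the latter,
  so it is the homology of a finite complex of pairs \<open>(S, \<sigma>)\<close> of disjoint vertex sets with \<open>\<sigma>\<close>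
  independent (Hochster's formula). For a disjoint union of graphs this complex is a tensor product,
  hence the generating polynomials multiply. Independent sets of \<open>B\<^sub>b\<close> have at most two elements, so
  for \<open>B\<^sub>b\<close> itself everything is determined by the numbers of components of the complement graphs of
  induced subgraphs and by an Euler characteristic.
\<close>

subsection \<open>Linear algebra\<close>

text \<open>Homology is never formed as a quotient. It enters only as a difference of two
  dimensions, so an isomorphism of homologies becomes rank-nullity for a map whose kernel lies in
  the smaller space (\<open>dim_diff_image\<close>). As \<open>graded_betti\<close> is a definite
  description, a minimal resolution must be constructed, and the count must be shown not to depend
  on it. Minimality makes the basis elements of degree d a basis of the free module modulo the
  variables, which agrees with the syzygy module modulo the variables; free modules are acyclic, so
  each syzygy step costs one homological degree. Resolutions are not assumed to have finite rank,
  hence finiteness of the graded pieces has to travel along the same induction. All modules share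
  one type; R/I(G) is represented by standard monomials with truncated multiplication. For
  \<open>B_b\<close>, in every positive internal degree the cycles are trivial at one end of the
  complex and everything at the other; the single unknown dimension, on the linear strand, yields
  both \<open>lam\<close> and \<open>mu\<close>.\<close>

definition fin_dim :: "('k::field \<Rightarrow> 'b::ab_group_add \<Rightarrow> 'b) \<Rightarrow> 'b set \<Rightarrow> bool" where
  "fin_dim scale A \<longleftrightarrow> (\<exists>S. finite S \<and> A \<subseteq> module.span scale S)"

lemma fin_dim_subset: "fin_dim scale A \<Longrightarrow> B \<subseteq> A \<Longrightarrow> fin_dim scale B"
  unfolding fin_dim_def by blast

context vector_space
begin

lemma fin_dim_independent: "fin_dim scale A \<Longrightarrow> S \<subseteq> A \<Longrightarrow> independent S \<Longrightarrow> finite S"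
  unfolding fin_dim_def using independent_span_bound by (meson subset_trans)

lemma dim_zero_space: "dim {0} = 0"
  using dim_unique[of "{}" "{0}" 0] by (simp add: independent_empty)

end

context vector_space_pair
begin

text \<open>Finiteness is asked of \<open>U\<close>, since the ambient spaces of functions, module
  elements and chains may be infinite-dimensional. A basis \<open>A\<close> of the kernel is
  extended to a basis \<open>B\<close> of \<open>U\<close>; the added vectors \<open>C\<close> map
  injectively onto a basis of the image.\<close>

lemma rank_nullity:
  assumes f: "Vector_Spaces.linear s1 s2 f" and U: "vs1.subspace U" and fd: "fin_dim s1 U"
  shows "vs1.dim U = vs1.dim {x \<in> U. f x = 0} + vs2.dim (f ` U)"
proof -
  let ?K = "{x \<in> U. f x = 0}"
  have K: "vs1.subspace ?K"
    using vs1.subspace_inter[OF U linear_subspace_kernel[OF f]] by (simp add: Int_def)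
  obtain A where A: "A \<subseteq> ?K" "vs1.independent A" "?K \<subseteq> vs1.span A" "card A = vs1.dim ?K"
    using vs1.basis_exists[of ?K] by blast
  obtain B where B: "A \<subseteq> B" "B \<subseteq> U" "vs1.independent B" "U \<subseteq> vs1.span B"
    using vs1.maximal_independent_subset_extend[of A U] A by blast
  have finB: "finite B" using vs1.fin_dim_independent[OF fd] B by blast
  define C where "C = B - A"
  have spA: "vs1.span A = ?K" using vs1.span_subspace[OF A(1) A(3) K] .
  have inj: "inj_on f (vs1.span C)"
  proof (subst linear_inj_on_iff_eq_0[OF f])
    show "vs1.subspace (vs1.span C)" by simp
    show "\<forall>x\<in>vs1.span C. f x = 0 \<longrightarrow> x = 0"
    proof (intro ballI impI)
      fix x assume x: "x \<in> vs1.span C" "f x = 0"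
      have CB: "C \<subseteq> B" by (simp add: C_def)
      have "x \<in> vs1.span B" using vs1.span_mono[OF CB] x(1) by blast
      then have "x \<in> U" using vs1.span_subspace[OF B(2) B(4) U] by simp
      then have "x \<in> vs1.span A" using x(2) spA by simp
      then obtain u where u: "x = (\<Sum>v\<in>A. s1 (u v) v)"
        using vs1.span_finite[of A] finB B(1) finite_subset by blast
      obtain w where w: "x = (\<Sum>v\<in>C. s1 (w v) v)"
        using vs1.span_finite[of C] finB x(1) CB finite_subset by blast
      \<comment> \<open>Two expansions of \<open>x\<close>, over \<open>A\<close> and over
        \<open>C\<close>, differ by one relation on the basis \<open>B\<close>, whose coefficients
        must vanish.\<close>
      let ?g = "\<lambda>v. if v \<in> A then u v else - w v"
      have "(\<Sum>v\<in>B. s1 (?g v) v) = (\<Sum>v\<in>A. s1 (?g v) v) + (\<Sum>v\<in>C. s1 (?g v) v)"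
        unfolding C_def using finB B(1)
        by (metis (no_types, lifting) add.commute sum.subset_diff)
      also have "(\<Sum>v\<in>A. s1 (?g v) v) = x" unfolding u by (rule sum.cong) auto
      also have "(\<Sum>v\<in>C. s1 (?g v) v) = (\<Sum>v\<in>C. - s1 (w v) v)"
        by (rule sum.cong) (auto simp: C_def)
      also have "x + \<dots> = 0" unfolding w by (simp add: sum_negf)
      finally have "?g v = 0" if "v \<in> B" for v
        using vs1.independentD[OF B(3) finB subset_refl, of ?g] that by simp
      then have "\<forall>v\<in>A. u v = 0" using B(1) by (metis subsetD)
      then show "x = 0" unfolding u by simp
    qed
  qed
  have iC: "vs1.independent C" using B(3) vs1.independent_mono C_def by blast
  have ifC: "vs2.independent (f ` C)" using linear_independent_injective_image[OF f iC inj] .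
  have sub: "f ` U \<subseteq> vs2.span (f ` C)"
  proof
    fix y assume "y \<in> f ` U"
    then obtain x where x: "x \<in> U" "y = f x" by blast
    have "f ` U \<subseteq> vs2.span (f ` B)" using linear_spans_image[OF f B(4)] .
    moreover have "f ` B \<subseteq> insert 0 (f ` C)" using A(1) by (auto simp: C_def)
    ultimately have "f ` U \<subseteq> vs2.span (insert 0 (f ` C))" using vs2.span_mono by blast
    then show "y \<in> vs2.span (f ` C)" using x by auto
  qed
  have CU: "f ` C \<subseteq> f ` U" using B(2) C_def by blast
  have "vs2.dim (f ` U) = card (f ` C)"
    using vs2.basis_card_eq_dim[OF CU sub ifC] by simp
  also have "\<dots> = card C" by (rule card_image[OF inj_on_subset[OF inj vs1.span_superset]])
  finally have 1: "vs2.dim (f ` U) = card C" .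
  have "vs1.dim U = card B" using vs1.basis_card_eq_dim[OF B(2) B(4) B(3)] by simp
  moreover have "card B = card A + card C"
    unfolding C_def using finB B(1) by (metis card_Diff_subset card_mono finite_subset le_add_diff_inverse)
  ultimately show ?thesis using 1 A(4) by simp
qed

text \<open>The map induces an isomorphism from \<open>U\<close> modulo \<open>U0\<close> to the
  quotient of the images, because its kernel on \<open>U\<close> lies in \<open>U0\<close>. All
  comparisons of Koszul homologies below have this form.\<close>

lemma dim_diff_image:
  assumes f: "Vector_Spaces.linear s1 s2 f" and U: "vs1.subspace U" "vs1.subspace U0" and fd: "fin_dim s1 U"
    and sub: "U0 \<subseteq> U" and ker: "\<And>x. x \<in> U \<Longrightarrow> f x = 0 \<Longrightarrow> x \<in> U0"
  shows "int (vs1.dim U) - int (vs1.dim U0) = int (vs2.dim (f ` U)) - int (vs2.dim (f ` U0))"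
proof -
  have "{x \<in> U. f x = 0} = {x \<in> U0. f x = 0}" using sub ker by blast
  then show ?thesis
    using rank_nullity[OF f U(1) fd] rank_nullity[OF f U(2) fin_dim_subset[OF fd sub]] by simp
qed

end

section \<open>Spaces of functions and their pivot coordinates\<close>

definition fscale :: "'k::field \<Rightarrow> ('i \<Rightarrow> 'k) \<Rightarrow> ('i \<Rightarrow> 'k)" where
  "fscale a f = (\<lambda>i. a * f i)"

lemma fscale_apply: "fscale a f i = a * f i"
  by (simp add: fscale_def)

global_interpretation fv: vector_space fscale
  by unfold_locales (auto simp: fun_eq_iff algebra_simps fscale_apply)

lemma sum_fun_apply: "(\<Sum>x\<in>A. f x) i = (\<Sum>x\<in>A. (f x i :: 'k::comm_monoid_add))"
  by (induction A rule: infinite_finite_induct) auto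

lemma sum_mult_delta:
  "finite J \<Longrightarrow> j' \<in> J \<Longrightarrow> (\<Sum>j\<in>J. f j * (if j = j' then 1 else 0)) = (f j' :: 'k::semiring_1)"
proof -
  assume "finite J" "j' \<in> J"
  have "(\<Sum>j\<in>J. f j * (if j = j' then 1 else 0)) = (\<Sum>j\<in>J. if j = j' then f j else 0)"
    by (rule sum.cong) auto
  then show ?thesis using \<open>finite J\<close> \<open>j' \<in> J\<close> by simp
qed

text \<open>Reduced echelon form without an order: \<open>J\<close> is a set of pivot positions that
  determine a vector of \<open>A\<close>, and \<open>e j\<close> is the vector of \<open>A\<close>
  that restricts to a unit vector on the pivots. Unlike an arbitrary basis, pivots can be cut down
  to one degree and multiplied in a tensor product.\<close>

definition coords :: "('i \<Rightarrow> 'k::field) set \<Rightarrow> 'i set \<Rightarrow> ('i \<Rightarrow> 'i \<Rightarrow> 'k) \<Rightarrow> bool" where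
  "coords A J e \<longleftrightarrow> finite J \<and> (\<forall>j\<in>J. e j \<in> A) \<and>
     (\<forall>j\<in>J. \<forall>j'\<in>J. e j j' = (if j = j' then 1 else 0)) \<and>
     (\<forall>f\<in>A. (\<forall>j\<in>J. f j = 0) \<longrightarrow> f = 0)"

lemma coords_expand:
  assumes "coords A J e" "fv.subspace A" "f \<in> A"
  shows "f = (\<Sum>j\<in>J. fscale (f j) (e j))"
proof -
  let ?g = "f - (\<Sum>j\<in>J. fscale (f j) (e j))"
  have J: "finite J" using assms by (simp add: coords_def)
  have "?g \<in> A"
    using assms by (intro fv.subspace_diff fv.subspace_sum fv.subspace_scale) (auto simp: coords_def)
  moreover have "\<forall>j'\<in>J. ?g j' = 0"
  proof
    fix j' assume j': "j' \<in> J"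
    have "(\<Sum>j\<in>J. fscale (f j) (e j)) j' = (\<Sum>j\<in>J. f j * (if j = j' then 1 else 0))"
      unfolding sum_fun_apply using assms(1) j' by (intro sum.cong) (auto simp: coords_def fscale_apply)
    also have "\<dots> = f j'" by (rule sum_mult_delta[OF J j'])
    finally show "?g j' = 0" by simp
  qed
  ultimately have "?g = 0" using assms(1) unfolding coords_def by blast
  then show ?thesis by simp
qed

lemma coords_dim:
  assumes "coords A J e" "fv.subspace A"
  shows "fv.dim A = card J"
proof -
  have J: "finite J" using assms by (simp add: coords_def)
  have inj: "inj_on e J"
  proof (rule inj_onI)
    fix x y assume "x \<in> J" "y \<in> J" "e x = e y"
    then show "x = y" using assms(1) unfolding coords_def by (metis zero_neq_one)
  qed
  have "fv.independent (e ` J)"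
  proof (rule fv.independent_if_scalars_zero)
    show "finite (e ` J)" using J by simp
    fix g x assume 0: "(\<Sum>x\<in>e ` J. fscale (g x) x) = 0" and "x \<in> e ` J"
    then obtain j where j: "j \<in> J" "x = e j" by blast
    have "0 = (\<Sum>i\<in>J. fscale (g (e i)) (e i)) j"
      using 0 by (simp add: sum.reindex[OF inj] o_def)
    also have "\<dots> = (\<Sum>i\<in>J. g (e i) * (if i = j then 1 else 0))"
      unfolding sum_fun_apply using assms(1) j by (intro sum.cong) (auto simp: coords_def fscale_apply)
    also have "\<dots> = g x" using j(2) by (subst sum_mult_delta[OF J j(1)]) simp
    finally show "g x = 0" by simp
  qed
  moreover have "e ` J \<subseteq> A" using assms by (auto simp: coords_def)
  moreover have "A \<subseteq> fv.span (e ` J)"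
  proof
    fix f assume "f \<in> A"
    have "(\<Sum>j\<in>J. fscale (f j) (e j)) \<in> fv.span (e ` J)"
      by (intro fv.span_sum fv.span_scale fv.span_base) auto
    then show "f \<in> fv.span (e ` J)" by (metis coords_expand[OF assms \<open>f \<in> A\<close>])
  qed
  ultimately have "fv.dim A = card (e ` J)" using fv.dim_unique by blast
  then show ?thesis using card_image[OF inj] by simp
qed

definition supp_in :: "'i set \<Rightarrow> ('i \<Rightarrow> 'k::field) set" where
  "supp_in I = {f. \<forall>i. i \<notin> I \<longrightarrow> f i = 0}"

lemma subspace_supp_in: "fv.subspace (supp_in I)"
  by (rule fv.subspaceI) (auto simp: supp_in_def fscale_apply)

text \<open>Gaussian elimination, one position at a time: either all of \<open>A\<close> vanishes at
  \<open>i\<close>, or \<open>i\<close> becomes a pivot and the others come from the subspace of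
  vectors vanishing there.\<close>

lemma coords_exist:
  assumes "finite I" "fv.subspace A" "A \<subseteq> supp_in I"
  shows "\<exists>J e. J \<subseteq> I \<and> coords A J e"
  using assms
proof (induction I arbitrary: A rule: finite_induct)
  case empty
  then have "coords A {} undefined" by (auto simp: coords_def supp_in_def fun_eq_iff)
  then show ?case by blast
next
  case (insert i I)
  show ?case
  proof (cases "\<forall>f\<in>A. f i = 0")
    case True
    then have "A \<subseteq> supp_in I" using insert.prems(2) unfolding supp_in_def by fastforce
    then show ?thesis using insert.IH[OF insert.prems(1)] by blast
  next
    case False
    then obtain f1 where f1: "f1 \<in> A" "f1 i \<noteq> 0" by blast
    define f0 where "f0 = fscale (inverse (f1 i)) f1"
    have f0: "f0 \<in> A" "f0 i = 1"
      unfolding f0_def using f1 fv.subspace_scale[OF insert.prems(1)] by (auto simp: fscale_apply)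
    let ?A = "{f \<in> A. f i = 0}"
    have sA: "fv.subspace ?A"
      using insert.prems(1) unfolding fv.subspace_def by (simp add: fscale_apply)
    have "?A \<subseteq> supp_in I" using insert.prems by (auto simp: supp_in_def)
    then obtain J e where J: "J \<subseteq> I" "coords ?A J e" using insert.IH[OF sA] by blast
    have finJ: "finite J" using J by (simp add: coords_def)
    \<comment> \<open>Subtracting the entries of \<open>f0\<close> at the old pivots makes the new
      vector zero there; it keeps the value 1 at \<open>i\<close> because the old \<open>e j\<close>
      vanish at \<open>i\<close>.\<close>
    define ei where "ei = f0 - (\<Sum>j\<in>J. fscale (f0 j) (e j))"
    have iJ: "i \<notin> J" using J(1) insert.hyps by blast
    have eA: "e j \<in> A" "e j i = 0" if "j \<in> J" for j using J(2) that by (auto simp: coords_def)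
    have ei: "ei \<in> A"
      unfolding ei_def using eA f0 insert.prems(1)
      by (intro fv.subspace_diff fv.subspace_sum fv.subspace_scale) auto
    have eii: "ei i = 1" unfolding ei_def using f0 eA by (simp add: sum_fun_apply fscale_apply)
    have eij: "ei j' = 0" if "j' \<in> J" for j'
    proof -
      have "(\<Sum>j\<in>J. fscale (f0 j) (e j)) j' = (\<Sum>j\<in>J. f0 j * (if j = j' then 1 else 0))"
        unfolding sum_fun_apply using J(2) that by (intro sum.cong) (auto simp: coords_def fscale_apply)
      also have "\<dots> = f0 j'" by (rule sum_mult_delta[OF finJ that])
      finally show ?thesis by (simp add: ei_def)
    qed
    have "coords A (insert i J) (e(i := ei))"
      unfolding coords_def
    proof (intro conjI ballI impI)
      show "finite (insert i J)" using finJ by simp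
      show "(e(i := ei)) j \<in> A" if "j \<in> insert i J" for j using that eA ei by auto
      show "(e(i := ei)) j j' = (if j = j' then 1 else 0)" if "j \<in> insert i J" "j' \<in> insert i J" for j j'
        using that eA eii eij J(2) iJ by (auto simp: coords_def)
      show "f = 0" if "f \<in> A" "\<forall>j\<in>insert i J. f j = 0" for f
        using that J(2) by (auto simp: coords_def)
    qed
    then show ?thesis using J(1) by blast
  qed
qed

lemma fin_dim_supp_in:
  assumes "finite I"
  shows "fin_dim fscale (supp_in I :: ('i \<Rightarrow> 'k::field) set)"
proof -
  let ?e = "\<lambda>(j::'i) i. if i = j then 1 else (0::'k)"
  have c: "coords (supp_in I) I ?e"
    using assms by (auto simp: coords_def supp_in_def fun_eq_iff)
  have "supp_in I \<subseteq> fv.span (?e ` I)"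
  proof
    fix f :: "'i \<Rightarrow> 'k" assume "f \<in> supp_in I"
    have "(\<Sum>j\<in>I. fscale (f j) (?e j)) \<in> fv.span (?e ` I)"
      by (intro fv.span_sum fv.span_scale fv.span_base) auto
    then show "f \<in> fv.span (?e ` I)"
      by (metis coords_expand[OF c subspace_supp_in \<open>f \<in> supp_in I\<close>])
  qed
  then show ?thesis unfolding fin_dim_def using assms by blast
qed

lemma dim_supp_in: "finite I \<Longrightarrow> fv.dim (supp_in I :: ('i \<Rightarrow> 'k::field) set) = card I"
proof -
  assume "finite I"
  then have "coords (supp_in I) I (\<lambda>j i. if i = j then 1 else (0::'k))"
    by (auto simp: coords_def supp_in_def fun_eq_iff)
  then show ?thesis by (rule coords_dim) (rule subspace_supp_in)
qed

subsection \<open>Graded coordinate spaces and based complexes\<close>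

global_interpretation fvp: vector_space_pair fscale fscale ..

lemma uv_coeff_simps:
  "uv_coeff (p + q) i d = uv_coeff p i d + uv_coeff q i d"
  "uv_coeff (p - q) i d = uv_coeff p i d - uv_coeff q i d"
  "uv_coeff 0 i d = 0"
  by (simp_all add: uv_coeff_def)

lemma uv_coeff_sum: "uv_coeff (\<Sum>x\<in>A. f x) i d = (\<Sum>x\<in>A. uv_coeff (f x) i d)"
  by (simp add: uv_coeff_def coeff_sum)

lemma uv_coeff_monom: "uv_coeff (uv_monom a k l) i d = (if i = k \<and> d = l then a else 0)"
  by (simp add: uv_coeff_def uv_monom_def)

lemma uv_poly_eqI: "(\<And>i d. uv_coeff p i d = uv_coeff q i d) \<Longrightarrow> p = q"
  by (auto simp: uv_coeff_def poly_eq_iff)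

definition grade_monom :: "nat \<times> nat \<Rightarrow> int poly poly" where
  "grade_monom t = uv_monom 1 (fst t) (snd t)"

definition u_var :: "int poly poly" where
  "u_var = monom 1 1"

lemma uv_coeff_u_var_mult: "uv_coeff (u_var * p) i d = (case i of 0 \<Rightarrow> 0 | Suc k \<Rightarrow> uv_coeff p k d)"
  by (cases i) (simp_all add: uv_coeff_def u_var_def coeff_monom_mult)

lemma uv_coeff_sum_grade_monom:
  assumes "finite J"
  shows "uv_coeff (\<Sum>j\<in>J. grade_monom (\<gamma> j)) i d = int (card {j \<in> J. \<gamma> j = (i, d)})"
proof -
  have "uv_coeff (\<Sum>j\<in>J. grade_monom (\<gamma> j)) i d = (\<Sum>j\<in>J. if \<gamma> j = (i, d) then 1 else 0)"
    unfolding uv_coeff_sum grade_monom_def uv_coeff_monom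
    by (rule sum.cong) (auto simp: prod_eq_iff)
  also have "\<dots> = int (card {j \<in> J. \<gamma> j = (i, d)})"
    using assms by (simp add: sum.inter_filter[symmetric])
  finally show ?thesis .
qed

definition comp_part :: "('i \<Rightarrow> 'g) \<Rightarrow> 'g \<Rightarrow> ('i \<Rightarrow> 'k::field) \<Rightarrow> ('i \<Rightarrow> 'k)" where
  "comp_part \<gamma> t f = (\<lambda>i. if \<gamma> i = t then f i else 0)"

definition graded_part :: "('i \<Rightarrow> 'g) \<Rightarrow> 'g \<Rightarrow> ('i \<Rightarrow> 'k::field) set \<Rightarrow> ('i \<Rightarrow> 'k) set" where
  "graded_part \<gamma> t A = {f \<in> A. \<forall>i. f i \<noteq> 0 \<longrightarrow> \<gamma> i = t}"

definition graded_space :: "'i set \<Rightarrow> ('i \<Rightarrow> 'g) \<Rightarrow> ('i \<Rightarrow> 'k::field) set \<Rightarrow> bool" where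
  "graded_space I \<gamma> A \<longleftrightarrow> fv.subspace A \<and> A \<subseteq> supp_in I \<and> (\<forall>f\<in>A. \<forall>t. comp_part \<gamma> t f \<in> A)"

text \<open>Bigraded Hilbert series. The sum runs over the set of occurring degrees, not over
  \<open>I\<close>, so a degree shared by several indices enters once.\<close>

definition hilb :: "'i set \<Rightarrow> ('i \<Rightarrow> nat \<times> nat) \<Rightarrow> ('i \<Rightarrow> 'k::field) set \<Rightarrow> int poly poly" where
  "hilb I \<gamma> A = (\<Sum>t\<in>\<gamma> ` I. uv_monom (int (fv.dim (graded_part \<gamma> t A))) (fst t) (snd t))"

lemma comp_part_eq: "f \<in> graded_part \<gamma> t A \<Longrightarrow> comp_part \<gamma> t f = f"
  by (auto simp: graded_part_def comp_part_def fun_eq_iff)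

lemma subspace_graded_part: "fv.subspace A \<Longrightarrow> fv.subspace (graded_part \<gamma> t A)"
proof (rule fv.subspaceI)
  assume A: "fv.subspace A"
  show "0 \<in> graded_part \<gamma> t A" using fv.subspace_0[OF A] by (simp add: graded_part_def)
  fix f g assume f: "f \<in> graded_part \<gamma> t A"
  show "fscale c f \<in> graded_part \<gamma> t A" for c
    using f fv.subspace_scale[OF A] by (auto simp: graded_part_def fscale_def)
  assume g: "g \<in> graded_part \<gamma> t A"
  have "(f + g) i \<noteq> 0 \<Longrightarrow> \<gamma> i = t" for i
    using f g by (cases "f i = 0") (auto simp: graded_part_def)
  then show "f + g \<in> graded_part \<gamma> t A"
    using f g fv.subspace_add[OF A] by (simp add: graded_part_def)
qed

lemma uv_coeff_hilb:
  assumes "finite I" "A \<subseteq> supp_in I"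
  shows "uv_coeff (hilb I \<gamma> A) i d = int (fv.dim (graded_part \<gamma> (i, d) A))"
proof (cases "(i, d) \<in> \<gamma> ` I")
  case True
  have "uv_coeff (hilb I \<gamma> A) i d =
    (\<Sum>t\<in>\<gamma> ` I. if t = (i, d) then int (fv.dim (graded_part \<gamma> t A)) else 0)"
    unfolding hilb_def uv_coeff_sum uv_coeff_monom by (rule sum.cong) (auto simp: prod_eq_iff)
  also have "\<dots> = int (fv.dim (graded_part \<gamma> (i, d) A))"
    using True assms by simp
  finally show ?thesis .
next
  case False
  have "uv_coeff (hilb I \<gamma> A) i d = 0"
    unfolding hilb_def uv_coeff_sum uv_coeff_monom using False by (intro sum.neutral) (auto simp: prod_eq_iff)
  moreover have "graded_part \<gamma> (i, d) A \<subseteq> {0}"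
  proof
    fix f assume f: "f \<in> graded_part \<gamma> (i, d) A"
    have "f x = 0" for x
      using f assms(2) False unfolding graded_part_def supp_in_def by (cases "x \<in> I") force+
    then show "f \<in> {0}" by (simp add: fun_eq_iff)
  qed
  then have "fv.dim (graded_part \<gamma> (i, d) A) \<le> 0"
    using fv.dim_le_card[of "graded_part \<gamma> (i, d) A" "{}"] by simp
  ultimately show ?thesis by simp
qed

text \<open>The degree-\<open>t\<close> part of a pivot vector still is a unit vector on the pivots
  of degree \<open>t\<close>, and a vector of pure degree \<open>t\<close> vanishes at all other
  pivots anyway.\<close>

lemma coords_graded_part:
  assumes "coords A J e" "graded_space I \<gamma> A"
  shows "coords (graded_part \<gamma> t A) {j \<in> J. \<gamma> j = t} (\<lambda>j. comp_part \<gamma> t (e j))"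
  unfolding coords_def
proof (intro conjI ballI impI)
  show "finite {j \<in> J. \<gamma> j = t}" using assms(1) by (simp add: coords_def)
  fix j assume j: "j \<in> {j \<in> J. \<gamma> j = t}"
  show "comp_part \<gamma> t (e j) \<in> graded_part \<gamma> t A"
    using j assms by (auto simp: graded_part_def coords_def graded_space_def comp_part_def split: if_splits)
  fix j' assume "j' \<in> {j \<in> J. \<gamma> j = t}"
  then show "comp_part \<gamma> t (e j) j' = (if j = j' then 1 else 0)"
    using j assms(1) by (auto simp: comp_part_def coords_def)
next
  fix f assume "f \<in> graded_part \<gamma> t A" "\<forall>j\<in>{j \<in> J. \<gamma> j = t}. f j = 0"
  then have "f \<in> A" "\<forall>j\<in>J. f j = 0" by (auto simp: graded_part_def)
  then show "f = 0" using assms(1) by (auto simp: coords_def)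
qed

lemma hilb_coords:
  assumes I: "finite I" and c: "coords A J e" and g: "graded_space I \<gamma> A"
  shows "hilb I \<gamma> A = (\<Sum>j\<in>J. grade_monom (\<gamma> j))"
proof (rule uv_poly_eqI)
  fix i d
  have J: "finite J" using c by (simp add: coords_def)
  have sA: "fv.subspace A" "A \<subseteq> supp_in I" using g by (auto simp: graded_space_def)
  show "uv_coeff (hilb I \<gamma> A) i d = uv_coeff (\<Sum>j\<in>J. grade_monom (\<gamma> j)) i d"
    unfolding uv_coeff_sum_grade_monom[OF J] uv_coeff_hilb[OF I sA(2)]
    using coords_dim[OF coords_graded_part[OF c g] subspace_graded_part[OF sA(1)]] by simp
qed

lemma graded_space_supp_in: "graded_space I \<gamma> (supp_in I)"
  by (auto simp: graded_space_def subspace_supp_in) (auto simp: comp_part_def supp_in_def)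

lemma hilb_supp_in:
  assumes "finite I"
  shows "hilb I \<gamma> (supp_in I :: ('i \<Rightarrow> 'k::field) set) = (\<Sum>i\<in>I. grade_monom (\<gamma> i))"
proof -
  have "coords (supp_in I) I (\<lambda>j i. if i = j then 1 else (0::'k))"
    using assms by (auto simp: coords_def supp_in_def fun_eq_iff)
  then show ?thesis using hilb_coords[OF assms _ graded_space_supp_in] by blast
qed

text \<open>The map lowers the first grade by one, so the image in grade \<open>(k, d)\<close> comes
  from grade \<open>(Suc k, d)\<close>; this shift is the factor \<open>u_var\<close>. Grade zero
  has no lower neighbour, hence the separate hypothesis \<open>zero\<close>.\<close>

lemma hilb_rank_nullity:
  fixes \<phi> :: "('i \<Rightarrow> 'k::field) \<Rightarrow> ('i \<Rightarrow> 'k)"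
  assumes I: "finite I" and g: "graded_space I \<gamma> A" and lin: "Vector_Spaces.linear fscale fscale \<phi>"
    and im: "\<phi> ` A \<subseteq> supp_in I"
    and shift: "\<And>f k d. f \<in> A \<Longrightarrow> comp_part \<gamma> (k, d) (\<phi> f) = \<phi> (comp_part \<gamma> (Suc k, d) f)"
    and zero: "\<And>f d. f \<in> A \<Longrightarrow> \<phi> (comp_part \<gamma> (0, d) f) = 0"
  shows "hilb I \<gamma> A = hilb I \<gamma> {f \<in> A. \<phi> f = 0} + u_var * hilb I \<gamma> (\<phi> ` A)"
proof (rule uv_poly_eqI)
  fix i d
  have sA: "fv.subspace A" "A \<subseteq> supp_in I" using g by (auto simp: graded_space_def)
  let ?Z = "{f \<in> A. \<phi> f = 0}" and ?P = "graded_part \<gamma> (i, d) A"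
  have fd: "fin_dim fscale ?P"
    by (rule fin_dim_subset[OF fin_dim_supp_in[OF I]]) (use sA in \<open>auto simp: graded_part_def\<close>)
  have rn: "fv.dim ?P = fv.dim {x \<in> ?P. \<phi> x = 0} + fv.dim (\<phi> ` ?P)"
    by (rule fvp.rank_nullity[OF lin subspace_graded_part[OF sA(1)] fd])
  have 1: "{x \<in> ?P. \<phi> x = 0} = graded_part \<gamma> (i, d) ?Z" by (auto simp: graded_part_def)
  have 2: "int (fv.dim (\<phi> ` ?P)) = uv_coeff (u_var * hilb I \<gamma> (\<phi> ` A)) i d"
  proof (cases i)
    case 0
    have "\<phi> ` ?P \<subseteq> {0}"
    proof (rule image_subsetI)
      fix f assume "f \<in> ?P"
      then show "\<phi> f \<in> {0}" using zero[of f d] comp_part_eq[of f \<gamma> "(0, d)" A] 0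
        by (simp add: graded_part_def)
    qed
    then have "fv.dim (\<phi> ` ?P) \<le> 0" using fv.dim_le_card[of "\<phi> ` ?P" "{}"] by simp
    then show ?thesis using 0 by (simp add: uv_coeff_u_var_mult)
  next
    case (Suc k)
    have "\<phi> ` ?P = graded_part \<gamma> (k, d) (\<phi> ` A)"
    proof (intro equalityI subsetI)
      fix h assume "h \<in> \<phi> ` ?P"
      then obtain f where f: "f \<in> ?P" "h = \<phi> f" by blast
      have fA: "f \<in> A" using f by (simp add: graded_part_def)
      have "comp_part \<gamma> (k, d) h = h" using shift[OF fA] f Suc comp_part_eq by metis
      then have "h x \<noteq> 0 \<longrightarrow> \<gamma> x = (k, d)" for x by (metis comp_part_def)
      then show "h \<in> graded_part \<gamma> (k, d) (\<phi> ` A)" using f fA by (simp add: graded_part_def)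
    next
      fix h assume h: "h \<in> graded_part \<gamma> (k, d) (\<phi> ` A)"
      then obtain f where f: "f \<in> A" "h = \<phi> f" by (auto simp: graded_part_def)
      have "h = \<phi> (comp_part \<gamma> (Suc k, d) f)" using shift[OF f(1)] comp_part_eq[OF h] f by metis
      moreover have "comp_part \<gamma> (Suc k, d) f \<in> ?P"
        using g f Suc by (auto simp: graded_part_def graded_space_def comp_part_def split: if_splits)
      ultimately show "h \<in> \<phi> ` ?P" by blast
    qed
    then show ?thesis using Suc uv_coeff_hilb[OF I im] by (simp add: uv_coeff_u_var_mult)
  qed
  have "?Z \<subseteq> supp_in I" using sA by blast
  from uv_coeff_hilb[OF I this, of \<gamma> i d]
  have 3: "uv_coeff (hilb I \<gamma> ?Z) i d = int (fv.dim (graded_part \<gamma> (i, d) ?Z))" .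
  show "uv_coeff (hilb I \<gamma> A) i d = uv_coeff (hilb I \<gamma> ?Z + u_var * hilb I \<gamma> (\<phi> ` A)) i d"
    unfolding uv_coeff_simps 2[symmetric] 3 uv_coeff_hilb[OF I sA(2)] using rn unfolding 1 by simp
qed

section \<open>Complexes given by a matrix on a finite graded index set\<close>

definition dif :: "'i set \<Rightarrow> ('i \<Rightarrow> 'i \<Rightarrow> 'k::field) \<Rightarrow> ('i \<Rightarrow> 'k) \<Rightarrow> ('i \<Rightarrow> 'k)" where
  "dif I a f = (\<lambda>i. if i \<in> I then \<Sum>j\<in>I. a i j * f j else 0)"

text \<open>The entry \<open>a i j\<close> is the coefficient of \<open>i\<close> in the boundary of
  \<open>j\<close>, so \<open>j\<close> sits one homological degree above \<open>i\<close> in the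
  same internal degree.\<close>

definition based_complex :: "'i set \<Rightarrow> ('i \<Rightarrow> nat \<times> nat) \<Rightarrow> ('i \<Rightarrow> 'i \<Rightarrow> 'k::field) \<Rightarrow> bool" where
  "based_complex I \<gamma> a \<longleftrightarrow> finite I \<and>
     (\<forall>i\<in>I. \<forall>j\<in>I. a i j \<noteq> 0 \<longrightarrow> \<gamma> j = (Suc (fst (\<gamma> i)), snd (\<gamma> i))) \<and>
     (\<forall>f. dif I a (dif I a f) = 0)"

definition cycles :: "'i set \<Rightarrow> ('i \<Rightarrow> 'i \<Rightarrow> 'k::field) \<Rightarrow> ('i \<Rightarrow> 'k) set" where
  "cycles I a = {f \<in> supp_in I. dif I a f = 0}"

definition boundaries :: "'i set \<Rightarrow> ('i \<Rightarrow> 'i \<Rightarrow> 'k::field) \<Rightarrow> ('i \<Rightarrow> 'k) set" where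
  "boundaries I a = dif I a ` supp_in I"

definition hom_poly :: "'i set \<Rightarrow> ('i \<Rightarrow> nat \<times> nat) \<Rightarrow> ('i \<Rightarrow> 'i \<Rightarrow> 'k::field) \<Rightarrow> int poly poly" where
  "hom_poly I \<gamma> a = hilb I \<gamma> (cycles I a) - hilb I \<gamma> (boundaries I a)"

lemma linear_dif: "Vector_Spaces.linear fscale fscale (dif I a)"
proof -
  have "dif I a (f + g) = dif I a f + dif I a g" for f g
    by (auto simp: dif_def fun_eq_iff algebra_simps sum.distrib)
  moreover have "dif I a (fscale c f) = fscale c (dif I a f)" for c f
    by (auto simp: dif_def fun_eq_iff fscale_apply sum_distrib_left algebra_simps)
  ultimately show ?thesis unfolding Vector_Spaces.linear_iff
    by (auto simp: fv.vector_space_axioms)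
qed

lemma dif_supp_in: "dif I a f \<in> supp_in I"
  by (simp add: dif_def supp_in_def)

lemma dif_comp_part:
  assumes "based_complex I \<gamma> a"
  shows "comp_part \<gamma> (k, d) (dif I a f) = dif I a (comp_part \<gamma> (Suc k, d) f)"
    and "dif I a (comp_part \<gamma> (0, d) f) = 0"
proof -
  have *: "a i j * comp_part \<gamma> (Suc k, d) f j = (if \<gamma> i = (k, d) then a i j * f j else 0)"
    if "i \<in> I" "j \<in> I" for i j
    using assms that by (cases "a i j = 0") (auto simp: based_complex_def comp_part_def prod_eq_iff)
  have "dif I a (comp_part \<gamma> (Suc k, d) f) i = comp_part \<gamma> (k, d) (dif I a f) i" for i
    using * by (cases "\<gamma> i = (k, d)") (auto simp: dif_def comp_part_def[of _ "(k,d)"])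
  then show "comp_part \<gamma> (k, d) (dif I a f) = dif I a (comp_part \<gamma> (Suc k, d) f)" by auto
  have "a i j * comp_part \<gamma> (0, d) f j = 0" if "i \<in> I" "j \<in> I" for i j
    using assms that by (cases "a i j = 0") (auto simp: based_complex_def comp_part_def prod_eq_iff)
  then have "(\<Sum>j\<in>I. a i j * comp_part \<gamma> (0, d) f j) = 0" if "i \<in> I" for i
    using that by (intro sum.neutral) auto
  then show "dif I a (comp_part \<gamma> (0, d) f) = 0" by (simp add: dif_def fun_eq_iff)
qed

lemma graded_space_cycles:
  fixes a :: "'i \<Rightarrow> 'i \<Rightarrow> 'k::field"
  assumes "based_complex I \<gamma> a"
  shows "graded_space I \<gamma> (cycles I a)"
  unfolding graded_space_def
proof (intro conjI ballI allI)
  show "fv.subspace (cycles I a)"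
    using fv.subspace_inter[OF subspace_supp_in fvp.linear_subspace_kernel[OF linear_dif[of I a]], of I]
    by (simp add: cycles_def Int_def)
  show "cycles I a \<subseteq> supp_in I" by (auto simp: cycles_def)
  fix f and t :: "nat \<times> nat" assume f: "f \<in> cycles I a"
  obtain k d where t: "t = (k, d)" by force
  have "dif I a (comp_part \<gamma> t f) = 0"
  proof (cases k)
    case 0
    then show ?thesis using dif_comp_part(2)[OF assms] t by simp
  next
    case (Suc k')
    then show ?thesis using dif_comp_part(1)[OF assms, of k' d f, symmetric] f t
      by (simp add: cycles_def comp_part_def fun_eq_iff)
  qed
  then show "comp_part \<gamma> t f \<in> cycles I a"
    using f by (auto simp: cycles_def supp_in_def comp_part_def)
qed

lemma graded_space_boundaries:
  fixes a :: "'i \<Rightarrow> 'i \<Rightarrow> 'k::field"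
  assumes "based_complex I \<gamma> a"
  shows "graded_space I \<gamma> (boundaries I a)"
  unfolding graded_space_def boundaries_def
proof (intro conjI ballI allI)
  show "fv.subspace (dif I a ` supp_in I)"
    by (rule fvp.linear_subspace_image[OF linear_dif subspace_supp_in])
  show "dif I a ` supp_in I \<subseteq> supp_in I" using dif_supp_in by blast
  fix h and t :: "nat \<times> nat" assume "h \<in> dif I a ` supp_in I"
  then obtain f where f: "f \<in> supp_in I" "h = dif I a f" by blast
  obtain k d where t: "t = (k, d)" by force
  have "comp_part \<gamma> (Suc k, d) f \<in> supp_in I" using f by (auto simp: supp_in_def comp_part_def)
  then show "comp_part \<gamma> t h \<in> dif I a ` supp_in I"
    using dif_comp_part(1)[OF assms, of k d f] f t by blast
qed

lemma based_complex_finite: "based_complex I \<gamma> a \<Longrightarrow> finite I"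
  by (simp add: based_complex_def)

text \<open>Boundaries of homological degree i are images of chains of degree i + 1, which is why
  they are counted with the factor \<open>u_var\<close>.\<close>

lemma hilb_cycles_boundaries:
  fixes a :: "'i \<Rightarrow> 'i \<Rightarrow> 'k::field"
  assumes "based_complex I \<gamma> a"
  shows "(\<Sum>i\<in>I. grade_monom (\<gamma> i)) = hilb I \<gamma> (cycles I a) + u_var * hilb I \<gamma> (boundaries I a)"
proof -
  have I: "finite I" using assms by (rule based_complex_finite)
  show ?thesis
    unfolding hilb_supp_in[OF I, where 'k='k, symmetric] cycles_def boundaries_def
    by (rule hilb_rank_nullity[OF I graded_space_supp_in linear_dif])
      (use dif_supp_in dif_comp_part[OF assms] in auto)
qed

subsection \<open>The tensor product of based complexes\<close>

lemma hilb_transport: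
  fixes A' :: "('j \<Rightarrow> 'k::field) set" and h :: "'i \<Rightarrow> 'j"
  defines "\<psi> \<equiv> \<lambda>I (f' :: 'j \<Rightarrow> 'k) i. if i \<in> I then f' (h i) else 0"
  assumes h: "bij_betw h I I'" and I: "finite I" and \<gamma>: "\<And>i. i \<in> I \<Longrightarrow> \<gamma>' (h i) = \<gamma> i"
    and A': "fv.subspace A'" "A' \<subseteq> supp_in I'"
  shows "hilb I \<gamma> (\<psi> I ` A') = hilb I' \<gamma>' A'"
proof (rule uv_poly_eqI)
  fix k d
  have I': "finite I'" using h I bij_betw_finite by blast
  have lin: "Vector_Spaces.linear fscale fscale (\<psi> I)"
    unfolding Vector_Spaces.linear_iff by (auto simp: fv.vector_space_axioms \<psi>_def fun_eq_iff fscale_apply)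
  have hI: "\<And>i. i \<in> I \<Longrightarrow> h i \<in> I'" using h by (auto simp: bij_betw_def)
  have onto: "\<exists>i\<in>I. j = h i" if "j \<in> I'" for j using h that by (auto simp: bij_betw_def)
  have ker: "f = 0" if "f \<in> A'" "\<psi> I f = 0" for f
  proof
    fix j
    show "f j = 0 j"
    proof (cases "j \<in> I'")
      case True
      then obtain i where "i \<in> I" "j = h i" using onto by blast
      then show ?thesis using fun_cong[OF that(2), of i] by (simp add: \<psi>_def)
    next
      case False
      then show ?thesis using A' that by (auto simp: supp_in_def)
    qed
  qed
  have gp: "graded_part \<gamma> (k, d) (\<psi> I ` A') = \<psi> I ` graded_part \<gamma>' (k, d) A'"
  proof (intro equalityI subsetI)
    fix f assume "f \<in> graded_part \<gamma> (k, d) (\<psi> I ` A')"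
    then obtain f' where f': "f' \<in> A'" "f = \<psi> I f'" "\<And>i. f i \<noteq> 0 \<Longrightarrow> \<gamma> i = (k, d)"
      by (auto simp: graded_part_def)
    have "f' j \<noteq> 0 \<Longrightarrow> \<gamma>' j = (k, d)" for j
    proof -
      assume j: "f' j \<noteq> 0"
      then have "j \<in> I'" using f' A' by (auto simp: supp_in_def)
      then obtain i where i: "i \<in> I" "j = h i" using onto by blast
      then show ?thesis using f'(3)[of i] j \<gamma> by (simp add: f' \<psi>_def)
    qed
    then show "f \<in> \<psi> I ` graded_part \<gamma>' (k, d) A'" using f' by (auto simp: graded_part_def)
  next
    fix f assume "f \<in> \<psi> I ` graded_part \<gamma>' (k, d) A'"
    then show "f \<in> graded_part \<gamma> (k, d) (\<psi> I ` A')"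
      using \<gamma> by (auto simp: graded_part_def \<psi>_def split: if_splits)
  qed
  let ?P = "graded_part \<gamma>' (k, d) A'"
  have fd: "fin_dim fscale ?P"
    by (rule fin_dim_subset[OF fin_dim_supp_in[OF I']]) (use A' in \<open>auto simp: graded_part_def\<close>)
  have "{x \<in> ?P. \<psi> I x = 0} \<subseteq> {0}" using ker by (auto simp: graded_part_def)
  then have "fv.dim {x \<in> ?P. \<psi> I x = 0} \<le> 0"
    using fv.dim_le_card[of "{x \<in> ?P. \<psi> I x = 0}" "{}"] by simp
  then have 1: "fv.dim ?P = fv.dim (\<psi> I ` ?P)"
    using fvp.rank_nullity[OF lin subspace_graded_part[OF A'(1)] fd] by simp
  have "\<psi> I ` A' \<subseteq> supp_in I" by (auto simp: supp_in_def \<psi>_def)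
  from uv_coeff_hilb[OF I this, of \<gamma> k d]
  show "uv_coeff (hilb I \<gamma> (\<psi> I ` A')) k d = uv_coeff (hilb I' \<gamma>' A') k d"
    unfolding uv_coeff_hilb[OF I' A'(2)] gp using 1 by simp
qed

text \<open>Pulling functions back along \<open>h\<close> is a bijection between supported functions
  that commutes with the differentials, so it matches cycles with cycles and boundaries with
  boundaries.\<close>

lemma hom_poly_transport:
  fixes a :: "'i \<Rightarrow> 'i \<Rightarrow> 'k::field" and a' :: "'j \<Rightarrow> 'j \<Rightarrow> 'k"
  assumes h: "bij_betw h I I'" and bc: "based_complex I' \<gamma>' a'"
    and \<gamma>: "\<And>i. i \<in> I \<Longrightarrow> \<gamma>' (h i) = \<gamma> i"
    and a: "\<And>i j. i \<in> I \<Longrightarrow> j \<in> I \<Longrightarrow> a' (h i) (h j) = a i j"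
  shows "hom_poly I \<gamma> a = hom_poly I' \<gamma>' a'"
proof -
  have I': "finite I'" using bc by (rule based_complex_finite)
  then have I: "finite I" using h bij_betw_finite by blast
  define \<psi> where "\<psi> = (\<lambda>(f' :: 'j \<Rightarrow> 'k) i. if i \<in> I then f' (h i) else 0)"
  have hI: "\<And>i. i \<in> I \<Longrightarrow> h i \<in> I'" using h by (auto simp: bij_betw_def)
  have hinj: "inj_on h I" and hst: "h ` I = I'" using h by (auto simp: bij_betw_def)
  have comm: "\<psi> (dif I' a' f) = dif I a (\<psi> f)" for f
  proof
    fix i
    show "\<psi> (dif I' a' f) i = dif I a (\<psi> f) i"
    proof (cases "i \<in> I")
      case True
      have "(\<Sum>j\<in>I'. a' (h i) j * f j) = (\<Sum>j\<in>I. a' (h i) (h j) * f (h j))"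
        unfolding hst[symmetric] by (simp add: sum.reindex[OF hinj])
      also have "\<dots> = (\<Sum>j\<in>I. a i j * \<psi> f j)"
        using a True by (intro sum.cong) (auto simp: \<psi>_def)
      finally show ?thesis using True hI by (simp add: \<psi>_def dif_def)
    next
      case False
      then show ?thesis by (simp add: \<psi>_def dif_def)
    qed
  qed
  have surj: "\<exists>f'\<in>supp_in I'. f = \<psi> f'" if "f \<in> supp_in I" for f
  proof (rule bexI)
    let ?f' = "\<lambda>j. if j \<in> I' then f (the_inv_into I h j) else 0"
    show "f = \<psi> ?f'"
      using that by (auto simp: \<psi>_def fun_eq_iff hI the_inv_into_f_f[OF hinj] supp_in_def)
    show "?f' \<in> supp_in I'" by (simp add: supp_in_def)
  qed
  have ker: "f = 0" if "f \<in> supp_in I'" "\<psi> f = 0" for f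
  proof
    fix j
    show "f j = 0 j"
    proof (cases "j \<in> I'")
      case True
      then obtain i where "i \<in> I" "j = h i" using hst by blast
      then show ?thesis using fun_cong[OF that(2), of i] by (simp add: \<psi>_def)
    next
      case False
      then show ?thesis using that by (auto simp: supp_in_def)
    qed
  qed
  have \<psi>_supp: "\<psi> f \<in> supp_in I" for f by (simp add: \<psi>_def supp_in_def)
  have \<psi>0: "\<psi> 0 = 0" by (simp add: \<psi>_def fun_eq_iff)
  have cyc: "cycles I a = \<psi> ` cycles I' a'"
  proof (intro equalityI subsetI)
    fix f assume f: "f \<in> cycles I a"
    then obtain f' where f': "f' \<in> supp_in I'" "f = \<psi> f'" using surj by (auto simp: cycles_def)
    have "\<psi> (dif I' a' f') = 0" using comm[of f'] f f' by (simp add: cycles_def)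
    then have "dif I' a' f' = 0" using ker[OF dif_supp_in] by blast
    then show "f \<in> \<psi> ` cycles I' a'" using f' by (auto simp: cycles_def)
  next
    fix f assume "f \<in> \<psi> ` cycles I' a'"
    then obtain f' where f': "f' \<in> supp_in I'" "f = \<psi> f'" "dif I' a' f' = 0" by (auto simp: cycles_def)
    then have "dif I a f = 0" using comm[of f'] \<psi>0 by simp
    then show "f \<in> cycles I a" using f' \<psi>_supp by (simp add: cycles_def)
  qed
  have bnd: "boundaries I a = \<psi> ` boundaries I' a'"
  proof (intro equalityI subsetI)
    fix f assume "f \<in> boundaries I a"
    then obtain g where g: "g \<in> supp_in I" "f = dif I a g" by (auto simp: boundaries_def)
    then obtain g' where "g' \<in> supp_in I'" "g = \<psi> g'" using surj by blast
    then show "f \<in> \<psi> ` boundaries I' a'" using g comm[of g', symmetric] by (auto simp: boundaries_def)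
  next
    fix f assume "f \<in> \<psi> ` boundaries I' a'"
    then obtain g' where "f = \<psi> (dif I' a' g')" by (auto simp: boundaries_def)
    then show "f \<in> boundaries I a" using comm \<psi>_supp by (auto simp: boundaries_def)
  qed
  have "hilb I \<gamma> (\<psi> ` cycles I' a') = hilb I' \<gamma>' (cycles I' a')"
    using graded_space_cycles[OF bc] unfolding \<psi>_def
    by (intro hilb_transport[OF h I]) (auto simp: \<gamma> graded_space_def)
  moreover have "hilb I \<gamma> (\<psi> ` boundaries I' a') = hilb I' \<gamma>' (boundaries I' a')"
    using graded_space_boundaries[OF bc] unfolding \<psi>_def
    by (intro hilb_transport[OF h I]) (auto simp: \<gamma> graded_space_def)
  ultimately show ?thesis unfolding hom_poly_def cyc bnd by simp
qed

text \<open>The tensor product of \<open>A\<close> and \<open>A'\<close> inside the functions on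
  pairs, as the intersection of (\<open>A\<close> tensor everything) with (everything tensor
  \<open>A'\<close>). Membership thus becomes a statement about slices.\<close>

definition box :: "('i \<Rightarrow> 'k::field) set \<Rightarrow> ('j \<Rightarrow> 'k) set \<Rightarrow> ('i \<times> 'j \<Rightarrow> 'k) set" where
  "box A A' = {f. (\<forall>i'. (\<lambda>i. f (i, i')) \<in> A) \<and> (\<forall>i. (\<lambda>i'. f (i, i')) \<in> A')}"

definition add_grade :: "('i \<Rightarrow> nat \<times> nat) \<Rightarrow> ('j \<Rightarrow> nat \<times> nat) \<Rightarrow> 'i \<times> 'j \<Rightarrow> nat \<times> nat" where
  "add_grade \<gamma> \<gamma>' = (\<lambda>(i, j). (fst (\<gamma> i) + fst (\<gamma>' j), snd (\<gamma> i) + snd (\<gamma>' j)))"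

definition elem_tensor :: "('i \<Rightarrow> 'k::field) \<Rightarrow> ('j \<Rightarrow> 'k) \<Rightarrow> ('i \<times> 'j \<Rightarrow> 'k)" where
  "elem_tensor x y = (\<lambda>(i, j). x i * y j)"

lemma subspace_box:
  assumes "fv.subspace A" "fv.subspace A'"
  shows "fv.subspace (box A A')"
proof (rule fv.subspaceI)
  show "0 \<in> box A A'"
    using fv.subspace_0[OF assms(1)] fv.subspace_0[OF assms(2)] by (simp add: box_def zero_fun_def)
  fix f g
  assume f: "f \<in> box A A'"
  show "fscale c f \<in> box A A'" for c
    using f fv.subspace_scale[OF assms(1), of _ c] fv.subspace_scale[OF assms(2), of _ c]
    by (simp add: box_def fscale_def)
  assume "g \<in> box A A'"
  then show "f + g \<in> box A A'"
    using f fv.subspace_add[OF assms(1)] fv.subspace_add[OF assms(2)]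
    by (simp add: box_def plus_fun_def)
qed

lemma elem_tensor_box:
  assumes "fv.subspace A" "fv.subspace A'" "x \<in> A" "y \<in> A'"
  shows "elem_tensor x y \<in> box A A'"
proof -
  have "(\<lambda>i. x i * y j) \<in> A" for j
    using fv.subspace_scale[OF assms(1,3), of "y j"] by (simp add: fscale_def mult.commute)
  moreover have "(\<lambda>j. x i * y j) \<in> A'" for i
    using fv.subspace_scale[OF assms(2,4), of "x i"] by (simp add: fscale_def)
  ultimately show ?thesis by (simp add: box_def elem_tensor_def)
qed

text \<open>A function of the box that is zero at all pairs of pivots vanishes on the slices through
  pivots of the first factor, and then on every slice in the other direction.\<close>

lemma coords_box:
  assumes "coords A J e" "coords A' J' e'" "fv.subspace A" "fv.subspace A'"
  shows "coords (box A A') (J \<times> J') (\<lambda>(j, j'). elem_tensor (e j) (e' j'))"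
  unfolding coords_def
proof (intro conjI ballI impI)
  show "finite (J \<times> J')" using assms by (simp add: coords_def)
  fix x assume "x \<in> J \<times> J'"
  then obtain j j' where x: "x = (j, j')" "j \<in> J" "j' \<in> J'" by blast
  show "(case x of (j, j') \<Rightarrow> elem_tensor (e j) (e' j')) \<in> box A A'"
    using x assms(1,2) elem_tensor_box[OF assms(3,4)] by (simp add: coords_def)
  fix y assume "y \<in> J \<times> J'"
  then obtain i i' where y: "y = (i, i')" "i \<in> J" "i' \<in> J'" by blast
  have "e j i = (if j = i then 1 else 0)" "e' j' i' = (if j' = i' then 1 else 0)"
    using assms(1,2) x y by (simp_all add: coords_def)
  then show "(case x of (j, j') \<Rightarrow> elem_tensor (e j) (e' j')) y = (if x = y then 1 else 0)"
    by (simp add: x y elem_tensor_def)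
next
  fix f assume f: "f \<in> box A A'" "\<forall>j\<in>J \<times> J'. f j = 0"
  have zero: "g = 0" if "coords B K c" "g \<in> B" "\<forall>j\<in>K. g j = 0" for B K g and c :: "'x \<Rightarrow> 'x \<Rightarrow> 'b"
    using that unfolding coords_def by blast
  have 1: "(\<lambda>i'. f (j, i')) = 0" if "j \<in> J" for j
    by (rule zero[OF assms(2)]) (use f that in \<open>simp_all add: box_def\<close>)
  have "(\<lambda>i. f (i, i')) = 0" for i'
    by (rule zero[OF assms(1)]) (use f fun_cong[OF 1] in \<open>simp_all add: box_def\<close>)
  then show "f = 0" by (auto simp: fun_eq_iff)
qed

lemma box_supp_in: "A \<subseteq> supp_in I \<Longrightarrow> A' \<subseteq> supp_in I' \<Longrightarrow> box A A' \<subseteq> supp_in (I \<times> I')"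
proof
  fix f assume A: "A \<subseteq> supp_in I" "A' \<subseteq> supp_in I'" and f: "f \<in> box A A'"
  have "f (i, i') = 0" if "i \<notin> I \<or> i' \<notin> I'" for i i'
  proof -
    have "(\<lambda>i. f (i, i')) \<in> supp_in I" "(\<lambda>i'. f (i, i')) \<in> supp_in I'"
      using f A by (auto simp: box_def)
    then show ?thesis using that by (auto simp: supp_in_def)
  qed
  then show "f \<in> supp_in (I \<times> I')" by (auto simp: supp_in_def)
qed

text \<open>Once one index is fixed, the total degree determines the degree of the other one. On a
  slice, a graded part of \<open>f\<close> is therefore a graded part of that slice, or zero if no
  index completes the degree.\<close>

lemma graded_space_box:
  assumes "graded_space I \<gamma> A" "graded_space I' \<gamma>' A'"
  shows "graded_space (I \<times> I') (add_grade \<gamma> \<gamma>') (box A A')"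
  unfolding graded_space_def
proof (intro conjI ballI allI)
  have sA: "fv.subspace A" "fv.subspace A'" "A \<subseteq> supp_in I" "A' \<subseteq> supp_in I'"
    using assms by (auto simp: graded_space_def)
  show "fv.subspace (box A A')" by (rule subspace_box[OF sA(1,2)])
  show "box A A' \<subseteq> supp_in (I \<times> I')" by (rule box_supp_in[OF sA(3,4)])
  fix f t assume f: "f \<in> box A A'"
  let ?f = "comp_part (add_grade \<gamma> \<gamma>') t f"
  have "(\<lambda>i. ?f (i, i')) \<in> A" for i'
  proof (cases "\<exists>i0. add_grade \<gamma> \<gamma>' (i0, i') = t")
    case True
    then obtain i0 where i0: "add_grade \<gamma> \<gamma>' (i0, i') = t" by blast
    have "(\<lambda>i. ?f (i, i')) = comp_part \<gamma> (\<gamma> i0) (\<lambda>i. f (i, i'))"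
      using i0 by (auto simp: comp_part_def add_grade_def fun_eq_iff prod_eq_iff)
    moreover have "comp_part \<gamma> (\<gamma> i0) (\<lambda>i. f (i, i')) \<in> A"
      using assms(1) f unfolding graded_space_def box_def by blast
    ultimately show ?thesis by simp
  next
    case False
    then have "(\<lambda>i. ?f (i, i')) = 0" by (auto simp: comp_part_def fun_eq_iff)
    then show ?thesis using fv.subspace_0[OF sA(1)] by simp
  qed
  moreover have "(\<lambda>i'. ?f (i, i')) \<in> A'" for i
  proof (cases "\<exists>i0. add_grade \<gamma> \<gamma>' (i, i0) = t")
    case True
    then obtain i0 where i0: "add_grade \<gamma> \<gamma>' (i, i0) = t" by blast
    have "(\<lambda>i'. ?f (i, i')) = comp_part \<gamma>' (\<gamma>' i0) (\<lambda>i'. f (i, i'))"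
      using i0 by (auto simp: comp_part_def add_grade_def fun_eq_iff prod_eq_iff)
    moreover have "comp_part \<gamma>' (\<gamma>' i0) (\<lambda>i'. f (i, i')) \<in> A'"
      using assms(2) f unfolding graded_space_def box_def by blast
    ultimately show ?thesis by simp
  next
    case False
    then have "(\<lambda>i'. ?f (i, i')) = 0" by (auto simp: comp_part_def fun_eq_iff)
    then show ?thesis using fv.subspace_0[OF sA(2)] by simp
  qed
  ultimately show "?f \<in> box A A'" by (simp add: box_def)
qed

lemma grade_monom_add_grade: "grade_monom (add_grade \<gamma> \<gamma>' (i, j)) = grade_monom (\<gamma> i) * grade_monom (\<gamma>' j)"
  by (simp add: grade_monom_def add_grade_def uv_monom_def mult_monom)

lemma hilb_box:
  fixes A :: "('i \<Rightarrow> 'k::field) set" and A' :: "('j \<Rightarrow> 'k) set"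
  assumes "finite I" "finite I'" "graded_space I \<gamma> A" "graded_space I' \<gamma>' A'"
  shows "hilb (I \<times> I') (add_grade \<gamma> \<gamma>') (box A A') = hilb I \<gamma> A * hilb I' \<gamma>' A'"
proof -
  have s: "fv.subspace A" "fv.subspace A'" "A \<subseteq> supp_in I" "A' \<subseteq> supp_in I'"
    using assms by (auto simp: graded_space_def)
  obtain J e where J: "coords A J e" using coords_exist[OF assms(1) s(1,3)] by blast
  obtain J' e' where J': "coords A' J' e'" using coords_exist[OF assms(2) s(2,4)] by blast
  have "hilb (I \<times> I') (add_grade \<gamma> \<gamma>') (box A A') = (\<Sum>j\<in>J \<times> J'. grade_monom (add_grade \<gamma> \<gamma>' j))"
    using hilb_coords[OF _ coords_box[OF J J' s(1,2)] graded_space_box[OF assms(3,4)]] assms by simp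
  also have "\<dots> = (\<Sum>(i,j)\<in>J \<times> J'. grade_monom (\<gamma> i) * grade_monom (\<gamma>' j))"
    by (rule sum.cong) (auto simp: grade_monom_add_grade)
  also have "\<dots> = (\<Sum>j\<in>J. grade_monom (\<gamma> j)) * (\<Sum>j\<in>J'. grade_monom (\<gamma>' j))"
    by (simp add: sum_product sum.cartesian_product)
  finally show ?thesis using hilb_coords[OF assms(1) J assms(3)] hilb_coords[OF assms(2) J' assms(4)] by simp
qed

text \<open>The Koszul sign rule: \<open>\<epsilon>\<close> stands for (-1) to the homological
  degree of the first factor. The context below knows it only through its square and its change of
  sign along \<open>a\<close>.\<close>

definition tensor_matrix ::
    "('i \<Rightarrow> 'k::field) \<Rightarrow> ('i \<Rightarrow> 'i \<Rightarrow> 'k) \<Rightarrow> ('j \<Rightarrow> 'j \<Rightarrow> 'k) \<Rightarrow> ('i \<times> 'j \<Rightarrow> 'i \<times> 'j \<Rightarrow> 'k)" where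
  "tensor_matrix \<epsilon> a a' = (\<lambda>(i, i') (j, j').
     (if i' = j' then a i j else 0) + (if i = j then \<epsilon> i * a' i' j' else 0))"

definition dif_left :: "'i set \<Rightarrow> ('i \<Rightarrow> 'i \<Rightarrow> 'k::field) \<Rightarrow> ('i \<times> 'j \<Rightarrow> 'k) \<Rightarrow> ('i \<times> 'j \<Rightarrow> 'k)" where
  "dif_left I a f = (\<lambda>(i, i'). dif I a (\<lambda>j. f (j, i')) i)"

definition dif_right :: "'j set \<Rightarrow> ('j \<Rightarrow> 'j \<Rightarrow> 'k::field) \<Rightarrow> ('i \<times> 'j \<Rightarrow> 'k) \<Rightarrow> ('i \<times> 'j \<Rightarrow> 'k)" where
  "dif_right I' a' f = (\<lambda>(i, i'). dif I' a' (\<lambda>j'. f (i, j')) i')"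

definition twist_by :: "('i \<Rightarrow> 'k::field) \<Rightarrow> ('i \<times> 'j \<Rightarrow> 'k) \<Rightarrow> ('i \<times> 'j \<Rightarrow> 'k)" where
  "twist_by \<epsilon> f = (\<lambda>(i, i'). \<epsilon> i * f (i, i'))"

context
  fixes I :: "'i set" and I' :: "'j set" and \<gamma> \<gamma>' and a :: "'i \<Rightarrow> 'i \<Rightarrow> 'k::field"
    and a' :: "'j \<Rightarrow> 'j \<Rightarrow> 'k" and \<epsilon> :: "'i \<Rightarrow> 'k"
  assumes bc: "based_complex I \<gamma> a" and bc': "based_complex I' \<gamma>' a'"
    and eps_sq: "\<And>i. i \<in> I \<Longrightarrow> \<epsilon> i * \<epsilon> i = 1"
    and eps_anti: "\<And>i j. i \<in> I \<Longrightarrow> j \<in> I \<Longrightarrow> a i j \<noteq> 0 \<Longrightarrow> \<epsilon> j = - \<epsilon> i"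
begin

abbreviation "D1 \<equiv> dif_left I a"
abbreviation "D2 \<equiv> dif_right I' a'"
abbreviation "twist \<equiv> twist_by \<epsilon>"
abbreviation "Zt \<equiv> cycles (I \<times> I') (tensor_matrix \<epsilon> a a')"

lemma finI: "finite I" "finite I'"
  using bc bc' by (auto simp: based_complex_def)

lemma supp_in_times:
  assumes "f \<in> supp_in (I \<times> I')"
  shows "(\<lambda>i. f (i, i')) \<in> supp_in I" "(\<lambda>i'. f (i, i')) \<in> supp_in I'"
  using assms by (auto simp: supp_in_def)

lemma dif_tensor:
  assumes "f \<in> supp_in (I \<times> I')"
  shows "dif (I \<times> I') (tensor_matrix \<epsilon> a a') f = D1 f + twist (D2 f)"
proof (rule ext, clarify)
  fix i i'
  show "dif (I \<times> I') (tensor_matrix \<epsilon> a a') f (i, i') = (D1 f + twist (D2 f)) (i, i')"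
  proof (cases "i \<in> I \<and> i' \<in> I'")
    case True
    have "(\<Sum>x\<in>I \<times> I'. tensor_matrix \<epsilon> a a' (i, i') x * f x) =
      (\<Sum>j\<in>I. \<Sum>j'\<in>I'. (if i' = j' then a i j * f (j, j') else 0) + (if i = j then \<epsilon> i * a' i' j' * f (j, j') else 0))"
      unfolding sum.cartesian_product tensor_matrix_def
      by (rule sum.cong) (auto simp: algebra_simps)
    also have "\<dots> = (\<Sum>j\<in>I. a i j * f (j, i')) + (\<Sum>j\<in>I. \<Sum>j'\<in>I'. if i = j then \<epsilon> i * a' i' j' * f (j, j') else 0)"
      using finI True by (simp add: sum.distrib)
    also have "(\<Sum>j\<in>I. \<Sum>j'\<in>I'. if i = j then \<epsilon> i * a' i' j' * f (j, j') else 0) =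
      (\<Sum>j\<in>I. if i = j then (\<Sum>j'\<in>I'. \<epsilon> i * a' i' j' * f (j, j')) else 0)"
      by (rule sum.cong) auto
    also have "\<dots> = \<epsilon> i * (\<Sum>j'\<in>I'. a' i' j' * f (i, j'))"
      using finI True by (simp add: sum_distrib_left mult.assoc)
    finally show ?thesis using True by (simp add: dif_left_def dif_right_def twist_by_def dif_def)
  next
    case False
    have "D1 f (i, i') = 0"
      using False assms by (auto simp: dif_left_def dif_def supp_in_def)
    moreover have "D2 f (i, i') = 0"
      using False assms by (auto simp: dif_right_def dif_def supp_in_def)
    ultimately show ?thesis using False by (auto simp: twist_by_def dif_def)
  qed
qed

lemma D_supp:
  assumes "f \<in> supp_in (I \<times> I')"
  shows "D1 f \<in> supp_in (I \<times> I')" "D2 f \<in> supp_in (I \<times> I')" "twist f \<in> supp_in (I \<times> I')"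
  using assms by (auto simp: supp_in_def dif_left_def dif_right_def twist_by_def dif_def)

lemma D_lin:
  "D1 (f + g) = D1 f + D1 g" "D2 (f + g) = D2 f + D2 g" "twist (f + g) = twist f + twist g"
  "D1 (fscale c f) = fscale c (D1 f)" "D2 (fscale c f) = fscale c (D2 f)"
  by (auto simp: dif_left_def dif_right_def twist_by_def dif_def fun_eq_iff fscale_apply algebra_simps sum.distrib sum_distrib_left)

lemma D_zero [simp]: "D1 0 = 0" "D2 0 = 0" "twist 0 = 0"
  by (auto simp: dif_left_def dif_right_def twist_by_def dif_def fun_eq_iff)

lemma D_minus: "D1 (f - g) = D1 f - D1 g" "D2 (f - g) = D2 f - D2 g" "twist (f - g) = twist f - twist g"
  by (auto simp: dif_left_def dif_right_def twist_by_def dif_def fun_eq_iff algebra_simps sum_subtractf)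

lemma D1_D1: "D1 (D1 f) = 0"
proof (rule ext, clarify)
  fix i i'
  have "D1 (D1 f) (i, i') = dif I a (dif I a (\<lambda>j. f (j, i'))) i" by (simp add: dif_left_def)
  then show "D1 (D1 f) (i, i') = 0 (i, i')" using bc by (simp add: based_complex_def)
qed

lemma D2_D2: "D2 (D2 f) = 0"
proof (rule ext, clarify)
  fix i i'
  have "D2 (D2 f) (i, i') = dif I' a' (dif I' a' (\<lambda>j. f (i, j))) i'" by (simp add: dif_right_def)
  then show "D2 (D2 f) (i, i') = 0 (i, i')" using bc' by (simp add: based_complex_def)
qed

lemma D1_D2: "D1 (D2 f) = D2 (D1 f)"
proof -
  have "(\<Sum>j\<in>I. \<Sum>j'\<in>I'. a i j * (a' i' j' * f (j, j'))) = (\<Sum>j'\<in>I'. \<Sum>j\<in>I. a' i' j' * (a i j * f (j, j')))" for i i'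
    by (subst sum.swap) (simp add: algebra_simps)
  then show ?thesis
    by (auto simp: dif_left_def dif_right_def dif_def fun_eq_iff sum_distrib_left cong: if_cong)
qed

lemma D2_twist: "D2 (twist f) = twist (D2 f)"
  by (auto simp: dif_right_def twist_by_def dif_def fun_eq_iff sum_distrib_left algebra_simps)

lemma D1_twist: "D1 (twist f) = - twist (D1 f)"
proof (rule ext, clarify)
  fix i i'
  have "(\<Sum>j\<in>I. a i j * (\<epsilon> j * f (j, i'))) = (\<Sum>j\<in>I. - (\<epsilon> i * (a i j * f (j, i'))))" if "i \<in> I"
  proof (rule sum.cong[OF refl])
    fix j assume j: "j \<in> I"
    show "a i j * (\<epsilon> j * f (j, i')) = - (\<epsilon> i * (a i j * f (j, i')))"
    proof (cases "a i j = 0")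
      case False
      then show ?thesis using eps_anti[OF that j] by (simp add: algebra_simps)
    qed simp
  qed
  then show "D1 (twist f) (i, i') = (- twist (D1 f)) (i, i')"
    by (simp add: dif_left_def twist_by_def dif_def sum_distrib_left sum_negf)
qed

lemma twist_twist: "f \<in> supp_in (I \<times> I') \<Longrightarrow> twist (twist f) = f"
proof (rule ext, clarify)
  fix i i' assume "f \<in> supp_in (I \<times> I')"
  then show "twist (twist f) (i, i') = f (i, i')"
    using eps_sq[of i] by (cases "i \<in> I") (auto simp: twist_by_def mult.assoc[symmetric] supp_in_def)
qed

lemma based_complex_tensor: "based_complex (I \<times> I') (add_grade \<gamma> \<gamma>') (tensor_matrix \<epsilon> a a')"
  unfolding based_complex_def
proof (intro conjI ballI allI impI)
  show "finite (I \<times> I')" using finI by simp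
next
  fix x y assume xy: "x \<in> I \<times> I'" "y \<in> I \<times> I'" "tensor_matrix \<epsilon> a a' x y \<noteq> 0"
  obtain i i' j j' where x: "x = (i, i')" "y = (j, j')" by (metis surj_pair)
  have "i' = j' \<and> a i j \<noteq> 0 \<or> i = j \<and> a' i' j' \<noteq> 0"
    using xy(3) by (auto simp: x tensor_matrix_def split: if_splits)
  then show "add_grade \<gamma> \<gamma>' y = (Suc (fst (add_grade \<gamma> \<gamma>' x)), snd (add_grade \<gamma> \<gamma>' x))"
  proof
    assume *: "i' = j' \<and> a i j \<noteq> 0"
    then have "\<gamma> j = (Suc (fst (\<gamma> i)), snd (\<gamma> i))"
      using bc xy(1,2) unfolding based_complex_def x by blast
    then show ?thesis using * by (simp add: x add_grade_def)
  next
    assume *: "i = j \<and> a' i' j' \<noteq> 0"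
    then have "\<gamma>' j' = (Suc (fst (\<gamma>' i')), snd (\<gamma>' i'))"
      using bc' xy(1,2) unfolding based_complex_def x by blast
    then show ?thesis using * by (simp add: x add_grade_def)
  qed
next
  fix f :: "'i \<times> 'j \<Rightarrow> 'k"
  let ?T = "dif (I \<times> I') (tensor_matrix \<epsilon> a a')"
  define g where "g = (\<lambda>x. if x \<in> I \<times> I' then f x else 0)"
  have g: "g \<in> supp_in (I \<times> I')" by (simp add: g_def supp_in_def)
  have "?T f = ?T g" unfolding dif_def g_def by (auto intro!: sum.cong)
  moreover have "?T (?T g) = 0"
    unfolding dif_tensor[OF dif_supp_in] unfolding dif_tensor[OF g]
    by (simp add: D_lin D1_D1 D1_D2 D2_D2 D1_twist D2_twist)
  ultimately show "?T (?T f) = 0" by simp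
qed

lemma linear_D1: "Vector_Spaces.linear fscale fscale (D1 :: ('i \<times> 'j \<Rightarrow> 'k) \<Rightarrow> _)"
  unfolding Vector_Spaces.linear_iff by (auto simp: fv.vector_space_axioms D_lin)

lemma comp_part_add_grade:
  "(\<lambda>i. comp_part (add_grade \<gamma> \<gamma>') (k, d) f (i, i')) =
    (if fst (\<gamma>' i') \<le> k \<and> snd (\<gamma>' i') \<le> d
     then comp_part \<gamma> (k - fst (\<gamma>' i'), d - snd (\<gamma>' i')) (\<lambda>i. f (i, i')) else 0)"
  by (auto simp: comp_part_def add_grade_def fun_eq_iff prod_eq_iff)

lemma D1_comp_part:
  shows "comp_part (add_grade \<gamma> \<gamma>') (k, d) (D1 f) = D1 (comp_part (add_grade \<gamma> \<gamma>') (Suc k, d) f)"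
    and "D1 (comp_part (add_grade \<gamma> \<gamma>') (0, d) f) = 0"
proof -
  have dif0: "dif I a 0 = 0" by (simp add: dif_def fun_eq_iff)
  have "comp_part (add_grade \<gamma> \<gamma>') (k, d) (D1 f) (i, i') = D1 (comp_part (add_grade \<gamma> \<gamma>') (Suc k, d) f) (i, i')" for i i'
  proof -
    have "D1 (comp_part (add_grade \<gamma> \<gamma>') (Suc k, d) f) (i, i') =
      dif I a (if fst (\<gamma>' i') \<le> Suc k \<and> snd (\<gamma>' i') \<le> d
       then comp_part \<gamma> (Suc k - fst (\<gamma>' i'), d - snd (\<gamma>' i')) (\<lambda>i. f (i, i')) else 0) i"
      unfolding dif_left_def prod.case comp_part_add_grade ..
    also have "\<dots> = (if fst (\<gamma>' i') \<le> k \<and> snd (\<gamma>' i') \<le> d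
       then comp_part \<gamma> (k - fst (\<gamma>' i'), d - snd (\<gamma>' i')) (dif I a (\<lambda>i. f (i, i'))) i else 0)"
    proof (cases "fst (\<gamma>' i') \<le> k")
      case True
      then show ?thesis using dif_comp_part(1)[OF bc, of "k - fst (\<gamma>' i')" "d - snd (\<gamma>' i')" "\<lambda>i. f (i, i')"]
        by (simp add: Suc_diff_le dif0)
    next
      case False
      then have "fst (\<gamma>' i') \<le> Suc k \<Longrightarrow> fst (\<gamma>' i') = Suc k" by simp
      then show ?thesis using False dif_comp_part(2)[OF bc, of "d - snd (\<gamma>' i')" "\<lambda>i. f (i, i')"]
        by (auto simp: dif0)
    qed
    also have "\<dots> = comp_part (add_grade \<gamma> \<gamma>') (k, d) (D1 f) (i, i')"
      using fun_cong[OF comp_part_add_grade[of k d "D1 f" i'], of i] by (simp add: dif_left_def)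
    finally show ?thesis by simp
  qed
  then show "comp_part (add_grade \<gamma> \<gamma>') (k, d) (D1 f) = D1 (comp_part (add_grade \<gamma> \<gamma>') (Suc k, d) f)"
    by (auto simp: fun_eq_iff)
  have "D1 (comp_part (add_grade \<gamma> \<gamma>') (0, d) f) (i, i') = 0" for i i'
    unfolding dif_left_def prod.case comp_part_add_grade
    using dif_comp_part(2)[OF bc, of "d - snd (\<gamma>' i')" "\<lambda>i. f (i, i')"] by (auto simp: dif0)
  then show "D1 (comp_part (add_grade \<gamma> \<gamma>') (0, d) f) = 0" by (auto simp: fun_eq_iff)
qed

text \<open>The Kuenneth formula is obtained from rank-nullity for \<open>D1\<close> on the cycles
  of the product. For a cycle, \<open>D1 f = 0\<close> forces \<open>D2 f = 0\<close> because
  \<open>twist\<close> is invertible on supported functions, so the kernel is the product of the two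
  cycle spaces.\<close>

lemma kernel_D1: "{f \<in> Zt. D1 f = 0} = box (cycles I a) (cycles I' a')"
proof (intro equalityI subsetI)
  fix f assume "f \<in> {f \<in> Zt. D1 f = 0}"
  then have f: "f \<in> supp_in (I \<times> I')" "D1 f = 0" "D1 f + twist (D2 f) = 0"
    using dif_tensor by (auto simp: cycles_def)
  then have "twist (D2 f) = 0" by simp
  then have "D2 f = 0" using twist_twist[OF D_supp(2)[OF f(1)]] by simp
  then have "dif I a (\<lambda>i. f (i, i')) = 0" "dif I' a' (\<lambda>i'. f (i, i')) = 0" for i i'
    using f(2) by (auto simp: dif_left_def dif_right_def fun_eq_iff)
  then show "f \<in> box (cycles I a) (cycles I' a')"
    using supp_in_times[OF f(1)] by (simp add: box_def cycles_def)
next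
  fix f assume f: "f \<in> box (cycles I a) (cycles I' a')"
  have s: "f \<in> supp_in (I \<times> I')"
    using f box_supp_in[of "cycles I a" I "cycles I' a'" I'] by (auto simp: cycles_def)
  have "D1 f = 0" "D2 f = 0" using f by (auto simp: box_def cycles_def dif_left_def dif_right_def fun_eq_iff)
  then show "f \<in> {f \<in> Zt. D1 f = 0}" using s dif_tensor[OF s] by (simp add: cycles_def)
qed

text \<open>On a cycle \<open>D1 f\<close> equals \<open>- twist (D2 f)\<close>, so it is a boundary
  in each variable. Conversely every element of the product of the boundary spaces is reached by an
  explicit cycle.\<close>

lemma image_D1: "D1 ` Zt = box (boundaries I a) (boundaries I' a')"
proof (intro equalityI subsetI)
  fix g assume "g \<in> D1 ` Zt"
  then obtain f where f: "f \<in> supp_in (I \<times> I')" "g = D1 f" "D1 f + twist (D2 f) = 0"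
    using dif_tensor by (auto simp: cycles_def)
  have "(\<lambda>i. g (i, i')) \<in> boundaries I a" for i'
    using supp_in_times(1)[OF f(1)] by (auto simp: f(2) dif_left_def boundaries_def)
  moreover have "(\<lambda>i'. g (i, i')) \<in> boundaries I' a'" for i
  proof -
    have "(D1 f + twist (D2 f)) (i, i') = 0" for i' using f(3) by simp
    then have "g (i, i') = - (\<epsilon> i) * D2 f (i, i')" for i'
      unfolding f(2) by (simp add: twist_by_def add_eq_0_iff2)
    then have "(\<lambda>i'. g (i, i')) = dif I' a' (fscale (- \<epsilon> i) (\<lambda>i'. f (i, i')))"
      using fvp.linear_scale[OF linear_dif[of I' a'], of "- \<epsilon> i" "\<lambda>i'. f (i, i')"]
      by (auto simp: dif_right_def fun_eq_iff fscale_apply)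
    moreover have "fscale (- \<epsilon> i) (\<lambda>i'. f (i, i')) \<in> supp_in I'"
      using fv.subspace_scale[OF subspace_supp_in supp_in_times(2)[OF f(1)]] by blast
    ultimately show ?thesis unfolding boundaries_def by blast
  qed
  ultimately show "g \<in> box (boundaries I a) (boundaries I' a')" by (simp add: box_def)
next
  fix g assume g: "g \<in> box (boundaries I a) (boundaries I' a')"
  have s: "fv.subspace (boundaries I a)" "boundaries I a \<subseteq> supp_in I"
    "fv.subspace (boundaries I' a')" "boundaries I' a' \<subseteq> supp_in I'"
    using graded_space_boundaries[OF bc] graded_space_boundaries[OF bc'] by (auto simp: graded_space_def)
  obtain J e where J: "coords (boundaries I a) J e" using coords_exist[OF finI(1) s(1,2)] by blast
  obtain J' e' where J': "coords (boundaries I' a') J' e'" using coords_exist[OF finI(2) s(3,4)] by blast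
  have "\<forall>j\<in>J. \<exists>u\<in>supp_in I. e j = dif I a u" using J by (auto simp: coords_def boundaries_def)
  then obtain u where u: "\<And>j. j \<in> J \<Longrightarrow> u j \<in> supp_in I \<and> e j = dif I a (u j)" by metis
  have "\<forall>j\<in>J'. \<exists>u\<in>supp_in I'. e' j = dif I' a' u" using J' by (auto simp: coords_def boundaries_def)
  then obtain u' where u': "\<And>j. j \<in> J' \<Longrightarrow> u' j \<in> supp_in I' \<and> e' j = dif I' a' (u' j)" by metis
  \<comment> \<open>Expanding \<open>g\<close> at the pivots and replacing each pivot vector by a
    preimage gives \<open>k\<close> with \<open>D1 (D2 k) = g\<close>.\<close>
  define k where "k = (\<Sum>x\<in>J \<times> J'. fscale (g x) (elem_tensor (u (fst x)) (u' (snd x))))"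
  have ks: "k \<in> supp_in (I \<times> I')"
    unfolding k_def
  proof (intro fv.subspace_sum[OF subspace_supp_in] fv.subspace_scale[OF subspace_supp_in])
    fix x assume "x \<in> J \<times> J'"
    then show "elem_tensor (u (fst x)) (u' (snd x)) \<in> supp_in (I \<times> I')"
      using u[of "fst x"] u'[of "snd x"] by (auto simp: elem_tensor_def supp_in_def)
  qed
  have lin12: "Vector_Spaces.linear fscale fscale (\<lambda>f. D1 (D2 f))"
    unfolding Vector_Spaces.linear_iff by (auto simp: fv.vector_space_axioms D_lin)
  have et: "D1 (D2 (elem_tensor x y)) = elem_tensor (dif I a x) (dif I' a' y)" for x y
    by (auto simp: fun_eq_iff dif_left_def dif_right_def elem_tensor_def dif_def sum_distrib_left sum_distrib_right algebra_simps)
  have "D1 (D2 k) = (\<Sum>x\<in>J \<times> J'. fscale (g x) (D1 (D2 (elem_tensor (u (fst x)) (u' (snd x))))))"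
    unfolding k_def fvp.linear_sum[OF lin12] fvp.linear_scale[OF lin12] ..
  also have "\<dots> = (\<Sum>x\<in>J \<times> J'. fscale (g x) (case x of (j, j') \<Rightarrow> elem_tensor (e j) (e' j')))"
    using u u' by (intro sum.cong) (auto simp: et)
  also have "\<dots> = g"
    using coords_expand[OF coords_box[OF J J' s(1,3)] subspace_box[OF s(1,3)] g] by (rule sym)
  finally have D12: "D1 (D2 k) = g" .
  \<comment> \<open>The correction term makes the two parts of the total differential cancel:
    \<open>D1 f = g\<close> and \<open>twist (D2 f) = - g\<close>.\<close>
  define f where "f = D2 k - twist (D1 k)"
  have f: "f \<in> supp_in (I \<times> I')"
    unfolding f_def using D_supp ks fv.subspace_diff[OF subspace_supp_in] by blast
  have f1: "D1 f = g" unfolding f_def by (simp add: D_minus D12 D1_twist D1_D1)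
  have "D2 f = - twist g" unfolding f_def by (simp add: D_minus D2_D2 D2_twist D1_D2[symmetric] D12)
  moreover have "g \<in> supp_in (I \<times> I')" using box_supp_in[OF s(2,4)] g by blast
  ultimately have "twist (D2 f) = - g" using twist_twist[of g] D_minus(3)[of 0 "twist g"] by simp
  then have "f \<in> Zt" using f1 f dif_tensor[OF f] by (simp add: cycles_def)
  then show "g \<in> D1 ` Zt" using f1 by blast
qed

text \<open>With \<open>z\<close> for cycles and \<open>b\<close> for boundaries, the cycles of the
  product have series \<open>z * z' + u_var * (b * b')\<close>, and all chains together have
  \<open>(z + u_var * b) * (z' + u_var * b')\<close>. The boundaries of the product are known only
  after multiplication by \<open>u_var\<close>, which is cancelled at the end.\<close>

lemma hom_poly_tensor:
  "hom_poly (I \<times> I') (add_grade \<gamma> \<gamma>') (tensor_matrix \<epsilon> a a') = hom_poly I \<gamma> a * hom_poly I' \<gamma>' a'"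
proof -
  let ?\<gamma> = "add_grade \<gamma> \<gamma>'" and ?I = "I \<times> I'" and ?a = "tensor_matrix \<epsilon> a a'"
  define z z' b b' where "z = hilb I \<gamma> (cycles I a)" "z' = hilb I' \<gamma>' (cycles I' a')"
    "b = hilb I \<gamma> (boundaries I a)" "b' = hilb I' \<gamma>' (boundaries I' a')"
  have Z: "hilb ?I ?\<gamma> Zt = hilb ?I ?\<gamma> {f \<in> Zt. D1 f = 0} + u_var * hilb ?I ?\<gamma> (D1 ` Zt)"
  proof (rule hilb_rank_nullity[OF _ graded_space_cycles[OF based_complex_tensor] linear_D1])
    show "D1 ` Zt \<subseteq> supp_in ?I" using D_supp(1) by (auto simp: cycles_def)
  qed (use finI D1_comp_part in auto)
  have Z': "hilb ?I ?\<gamma> Zt = z * z' + u_var * (b * b')"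
    unfolding Z kernel_D1 image_D1 z_z'_b_b'_def
    using hilb_box[OF finI graded_space_cycles[OF bc] graded_space_cycles[OF bc']]
      hilb_box[OF finI graded_space_boundaries[OF bc] graded_space_boundaries[OF bc']] by simp
  have n: "(\<Sum>x\<in>?I. grade_monom (?\<gamma> x)) = (z + u_var * b) * (z' + u_var * b')"
  proof -
    have "(\<Sum>x\<in>?I. grade_monom (?\<gamma> x)) = (\<Sum>(i,j)\<in>?I. grade_monom (\<gamma> i) * grade_monom (\<gamma>' j))"
      by (rule sum.cong) (auto simp: grade_monom_add_grade)
    also have "\<dots> = (\<Sum>i\<in>I. grade_monom (\<gamma> i)) * (\<Sum>i\<in>I'. grade_monom (\<gamma>' i))"
      by (simp add: sum_product sum.cartesian_product)
    finally show ?thesis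
      using hilb_cycles_boundaries[OF bc] hilb_cycles_boundaries[OF bc'] by (simp add: z_z'_b_b'_def)
  qed
  define B where "B = hilb ?I ?\<gamma> (boundaries ?I ?a)"
  have B: "u_var * B = (z + u_var * b) * (z' + u_var * b') - (z * z' + u_var * (b * b'))"
    using hilb_cycles_boundaries[OF based_complex_tensor] unfolding n Z' B_def by (simp add: algebra_simps)
  have "u_var * (hilb ?I ?\<gamma> Zt - B) = u_var * ((z - b) * (z' - b'))"
    unfolding Z' right_diff_distrib[of u_var _ B] B by (simp add: algebra_simps)
  moreover have "u_var \<noteq> 0" by (simp add: u_var_def)
  ultimately have "hilb ?I ?\<gamma> Zt - B = (z - b) * (z' - b')" by simp
  then show ?thesis by (simp add: hom_poly_def B_def z_z'_b_b'_def)
qed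

end

subsection \<open>The squarefree part of the Koszul complex of an edge ideal\<close>

text \<open>Each off-diagonal term is added to its mirror image in the induction, so the sum cancels
  in any abelian group and characteristic two is no exception. Both Koszul differentials square to
  zero for this reason.\<close>

lemma sum_antisym_pairs:
  fixes F :: "'v \<Rightarrow> 'v \<Rightarrow> 'a::ab_group_add"
  assumes "finite A" "\<And>v w. v \<in> A \<Longrightarrow> w \<in> A \<Longrightarrow> v \<noteq> w \<Longrightarrow> F w v = - F v w"
  shows "(\<Sum>v\<in>A. \<Sum>w\<in>A - {v}. F v w) = 0"
  using assms
proof (induction A rule: finite_induct)
  case (insert x A)
  have "(\<Sum>v\<in>insert x A. \<Sum>w\<in>insert x A - {v}. F v w) =
    (\<Sum>w\<in>A. F x w) + (\<Sum>v\<in>A. \<Sum>w\<in>insert x A - {v}. F v w)"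
    using insert.hyps by simp
  also have "(\<Sum>v\<in>A. \<Sum>w\<in>insert x A - {v}. F v w) = (\<Sum>v\<in>A. F v x + (\<Sum>w\<in>A - {v}. F v w))"
  proof (rule sum.cong[OF refl])
    fix v assume "v \<in> A"
    then have "insert x A - {v} = insert x (A - {v})" using insert.hyps by auto
    then show "(\<Sum>w\<in>insert x A - {v}. F v w) = F v x + (\<Sum>w\<in>A - {v}. F v w)"
      using insert.hyps by simp
  qed
  also have "\<dots> = (\<Sum>v\<in>A. F v x)"
  proof -
    have "(\<Sum>v\<in>A. \<Sum>w\<in>A - {v}. F v w) = 0"
      by (rule insert.IH) (rule insert.prems; simp)
    then show ?thesis by (simp add: sum.distrib)
  qed
  also have "\<dots> = (\<Sum>v\<in>A. - F x v)"
  proof (rule sum.cong[OF refl])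
    fix v assume "v \<in> A"
    then show "F v x = - F x v" using insert.hyps by (intro insert.prems) auto
  qed
  finally show ?case by (simp add: sum_negf)
qed simp

section \<open>Signs of the Koszul differential\<close>

definition strict_total :: "('v \<Rightarrow> 'v \<Rightarrow> bool) \<Rightarrow> bool" where
  "strict_total lt \<longleftrightarrow> (\<forall>v w. \<not> (lt v w \<and> lt w v)) \<and> (\<forall>v w. v \<noteq> w \<longrightarrow> lt v w \<or> lt w v)"

text \<open>The sign that sorts \<open>v\<close> into the wedge product of the elements of
  \<open>T\<close>.\<close>

definition koszul_sign :: "('v \<Rightarrow> 'v \<Rightarrow> bool) \<Rightarrow> 'v \<Rightarrow> 'v set \<Rightarrow> 'k::field" where
  "koszul_sign lt v T = (-1) ^ card {w \<in> T. lt w v}"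

lemma koszul_sign_sq: "koszul_sign lt v T * koszul_sign lt v T = (1 :: 'k::field)"
  unfolding koszul_sign_def power_add[symmetric] by simp

lemma koszul_sign_nonzero: "koszul_sign lt v T \<noteq> (0 :: 'k::field)"
  by (simp add: koszul_sign_def)

lemma koszul_sign_insert:
  assumes "finite T" "v \<notin> T"
  shows "koszul_sign lt w (insert v T) = (if lt v w then - koszul_sign lt w T else koszul_sign lt w T :: 'k::field)"
proof -
  have "{x \<in> insert v T. lt x w} = (if lt v w then insert v {x \<in> T. lt x w} else {x \<in> T. lt x w})" by auto
  then show ?thesis using assms by (simp add: koszul_sign_def)
qed

text \<open>Of two distinct vertices exactly one precedes the other, so exactly one of the two
  insertions flips a sign.\<close>

lemma koszul_sign_anticomm:
  assumes "strict_total lt" "finite T" "v \<notin> T" "w \<notin> T" "v \<noteq> w"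
  shows "koszul_sign lt v T * koszul_sign lt w (insert v T) =
    - (koszul_sign lt w T * koszul_sign lt v (insert w T) :: 'k::field)"
  using assms by (auto simp: koszul_sign_insert strict_total_def)

definition indep :: "'v set set \<Rightarrow> 'v set \<Rightarrow> bool" where
  "indep E \<sigma> \<longleftrightarrow> (\<forall>x\<in>\<sigma>. \<forall>y\<in>\<sigma>. {x, y} \<notin> E)"

lemma indep_subset: "indep E \<sigma> \<Longrightarrow> \<tau> \<subseteq> \<sigma> \<Longrightarrow> indep E \<tau>"
  by (auto simp: indep_def)

text \<open>
  The cell \<open>(S, \<sigma>)\<close> stands for the basis element \<open>e\<^sub>S \<otimes> x\<^sup>\<sigma>\<close> of the Koszul complex of
  \<open>R/I(G)\<close>; only squarefree multidegrees \<open>S \<union> \<sigma>\<close> contribute to its homology.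
\<close>

definition cells :: "'v set \<Rightarrow> 'v set set \<Rightarrow> ('v set \<times> 'v set) set" where
  "cells V E = {(S, \<sigma>). S \<subseteq> V \<and> \<sigma> \<subseteq> V \<and> S \<inter> \<sigma> = {} \<and> indep E \<sigma>}"

definition cell_grade :: "'v set \<times> 'v set \<Rightarrow> nat \<times> nat" where
  "cell_grade = (\<lambda>(S, \<sigma>). (card S, card S + card \<sigma>))"

text \<open>The boundary moves a vertex from the exterior part to the monomial part. Read from the
  target \<open>(T, \<tau>)\<close> it is a sum over the vertices of \<open>\<tau>\<close> that may
  have been moved; for a given source at most one of them contributes.\<close>

definition cell_matrix :: "('v \<Rightarrow> 'v \<Rightarrow> bool) \<Rightarrow> 'v set \<times> 'v set \<Rightarrow> 'v set \<times> 'v set \<Rightarrow> 'k::field" where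
  "cell_matrix lt = (\<lambda>(T, \<tau>) (S, \<sigma>).
     \<Sum>v\<in>\<tau>. if S = insert v T \<and> \<sigma> = \<tau> - {v} then koszul_sign lt v T else 0)"

lemma finite_cells: "finite V \<Longrightarrow> finite (cells V E)"
  by (rule finite_subset[of _ "Pow V \<times> Pow V"]) (auto simp: cells_def)

lemma cells_move: "(T, \<tau>) \<in> cells V E \<Longrightarrow> v \<in> \<tau> \<Longrightarrow> (insert v T, \<tau> - {v}) \<in> cells V E"
  by (auto simp: cells_def intro: indep_subset)

lemma dif_cells:
  assumes V: "finite V" and c: "(T, \<tau>) \<in> cells V E"
  shows "dif (cells V E) (cell_matrix lt) f (T, \<tau>) =
    (\<Sum>v\<in>\<tau>. koszul_sign lt v T * f (insert v T, \<tau> - {v}))"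
proof -
  have "(\<Sum>x\<in>cells V E. cell_matrix lt (T, \<tau>) x * f x) =
    (\<Sum>x\<in>cells V E. \<Sum>v\<in>\<tau>. if x = (insert v T, \<tau> - {v}) then koszul_sign lt v T * f x else 0)"
    by (rule sum.cong) (auto simp: cell_matrix_def sum_distrib_right intro!: sum.cong)
  also have "\<dots> = (\<Sum>v\<in>\<tau>. \<Sum>x\<in>cells V E. if x = (insert v T, \<tau> - {v}) then koszul_sign lt v T * f x else 0)"
    by (rule sum.swap)
  also have "\<dots> = (\<Sum>v\<in>\<tau>. koszul_sign lt v T * f (insert v T, \<tau> - {v}))"
    using cells_move[OF c] finite_cells[OF V] by (intro sum.cong) auto
  finally show ?thesis using c by (simp add: dif_def)
qed

lemma based_complex_cells:
  assumes V: "finite V" and lt: "strict_total lt"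
  shows "based_complex (cells V E) cell_grade (cell_matrix lt :: _ \<Rightarrow> _ \<Rightarrow> 'k::field)"
  unfolding based_complex_def
proof (intro conjI ballI allI impI)
  show "finite (cells V E)" by (rule finite_cells[OF V])
next
  fix x y assume xy: "x \<in> cells V E" "y \<in> cells V E" "cell_matrix lt x y \<noteq> (0::'k)"
  obtain T \<tau> S \<sigma> where x: "x = (T, \<tau>)" "y = (S, \<sigma>)" by (metis surj_pair)
  have "\<exists>v\<in>\<tau>. S = insert v T \<and> \<sigma> = \<tau> - {v}"
  proof (rule ccontr)
    assume "\<not> ?thesis"
    then have "cell_matrix lt x y = (0::'k)" unfolding cell_matrix_def x by (auto intro!: sum.neutral)
    then show False using xy(3) by simp
  qed
  then obtain v where v: "v \<in> \<tau>" "S = insert v T" "\<sigma> = \<tau> - {v}" by blast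
  have f: "finite T" "finite \<tau>" "v \<notin> T" using xy(1) v V finite_subset by (auto simp: x cells_def)
  then have "card \<tau> = Suc (card \<sigma>)" using v by (metis card_Suc_Diff1)
  then show "cell_grade y = (Suc (fst (cell_grade x)), snd (cell_grade x))"
    using v f by (simp add: x cell_grade_def)
next
  fix f :: "_ \<Rightarrow> 'k"
  let ?D = "dif (cells V E) (cell_matrix lt)"
  have "?D (?D f) (T, \<tau>) = 0" for T \<tau>
  proof (cases "(T, \<tau>) \<in> cells V E")
    case True
    have fin: "finite T" "finite \<tau>" "T \<inter> \<tau> = {}" using True V finite_subset by (auto simp: cells_def)
    let ?F = "\<lambda>v w. koszul_sign lt v T * (koszul_sign lt w (insert v T) * f (insert w (insert v T), \<tau> - {v} - {w}))"
    have "?D (?D f) (T, \<tau>) = (\<Sum>v\<in>\<tau>. \<Sum>w\<in>\<tau> - {v}. ?F v w)"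
      unfolding dif_cells[OF V True]
      by (rule sum.cong) (auto simp: dif_cells[OF V cells_move[OF True]] sum_distrib_left)
    also have "\<dots> = 0"
    proof (rule sum_antisym_pairs[OF fin(2)])
      fix v w assume vw: "v \<in> \<tau>" "w \<in> \<tau>" "v \<noteq> w"
      have "koszul_sign lt w T * koszul_sign lt v (insert w T) = - (koszul_sign lt v T * koszul_sign lt w (insert v T) :: 'k)"
        using vw fin by (intro koszul_sign_anticomm[OF lt]) auto
      moreover have "\<tau> - {v} - {w} = \<tau> - {w} - {v}" "insert w (insert v T) = insert v (insert w T)" by auto
      ultimately show "?F w v = - ?F v w" by (simp add: mult.assoc[symmetric])
    qed
    finally show ?thesis .
  next
    case False
    then show ?thesis by (simp add: dif_def)
  qed
  then show "?D (?D f) = 0" by (auto simp: fun_eq_iff)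
qed

definition cell_poly :: "'k::field itself \<Rightarrow> ('v \<Rightarrow> 'v \<Rightarrow> bool) \<Rightarrow> 'v set \<Rightarrow> 'v set set \<Rightarrow> int poly poly" where
  "cell_poly K lt V E = hom_poly (cells V E) cell_grade (cell_matrix lt :: _ \<Rightarrow> _ \<Rightarrow> 'k)"

text \<open>Splitting both components of a cell along the partition of the vertices gives a tensor
  product. As \<open>V1\<close> precedes the image of \<open>U\<close>, moving a vertex of
  \<open>U\<close> picks up one sign for each exterior vertex from \<open>V1\<close>, which is
  exactly the twist in \<open>tensor_matrix\<close>.\<close>

lemma cell_poly_disjoint_union:
  fixes g :: "'u \<Rightarrow> 'v" and K :: "'k::field itself"
  assumes V1: "finite V1" and U: "finite U" and g: "inj g" and disj: "V1 \<inter> g ` U = {}"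
    and lt: "strict_total lt" and lt': "strict_total lt'"
    and lt1: "\<And>x y. x \<in> V1 \<Longrightarrow> y \<in> U \<Longrightarrow> lt x (g y)"
    and lt2: "\<And>y y'. y \<in> U \<Longrightarrow> y' \<in> U \<Longrightarrow> lt (g y) (g y') \<longleftrightarrow> lt' y y'"
    and ind: "\<And>\<sigma> \<sigma>'. \<sigma> \<subseteq> V1 \<Longrightarrow> \<sigma>' \<subseteq> U \<Longrightarrow> indep E (\<sigma> \<union> g ` \<sigma>') \<longleftrightarrow> indep E1 \<sigma> \<and> indep E' \<sigma>'"
  shows "cell_poly K lt (V1 \<union> g ` U) E = cell_poly K lt V1 E1 * cell_poly K lt' U E'"
proof -
  let ?I1 = "cells V1 E1" and ?I2 = "cells U E'" and ?I = "cells (V1 \<union> g ` U) E"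
  let ?a = "cell_matrix lt :: _ \<Rightarrow> _ \<Rightarrow> 'k" and ?a' = "cell_matrix lt' :: _ \<Rightarrow> _ \<Rightarrow> 'k"
  define \<epsilon> :: "'v set \<times> 'v set \<Rightarrow> 'k" where "\<epsilon> = (\<lambda>x. (-1) ^ card (fst x))"
  define h :: "('v set \<times> 'v set) \<times> ('u set \<times> 'u set) \<Rightarrow> 'v set \<times> 'v set"
    where "h = (\<lambda>((S, \<sigma>), (S', \<sigma>')). (S \<union> g ` S', \<sigma> \<union> g ` \<sigma>'))"
  have fV: "finite (V1 \<union> g ` U)" using V1 U by simp
  have un_eq: "A \<union> g ` A' = B \<union> g ` B' \<longleftrightarrow> A = B \<and> A' = B'"
    if "A \<subseteq> V1" "B \<subseteq> V1" "A' \<subseteq> U" "B' \<subseteq> U" for A B A' B'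
  proof
    assume eq: "A \<union> g ` A' = B \<union> g ` B'"
    have "A = (A \<union> g ` A') \<inter> V1" "B = (B \<union> g ` B') \<inter> V1" using that disj by blast+
    then have AB: "A = B" using eq by simp
    have "g ` A' = (A \<union> g ` A') \<inter> g ` U" "g ` B' = (B \<union> g ` B') \<inter> g ` U" using that disj by blast+
    then have "g ` A' = g ` B'" using eq by simp
    then show "A = B \<and> A' = B'" using AB inj_image_eq_iff[OF g, of A' B'] by simp
  qed simp
  have decomp: "\<exists>A A'. A \<subseteq> V1 \<and> A' \<subseteq> U \<and> S = A \<union> g ` A'" if "S \<subseteq> V1 \<union> g ` U" for S
    using that by (intro exI[of _ "S \<inter> V1"] exI[of _ "{u \<in> U. g u \<in> S}"]) auto
  have int: "(A \<union> g ` A') \<inter> (B \<union> g ` B') = {} \<longleftrightarrow> A \<inter> B = {} \<and> A' \<inter> B' = {}"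
    if "A \<subseteq> V1" "B \<subseteq> V1" "A' \<subseteq> U" "B' \<subseteq> U" for A B A' B'
  proof -
    have "(A \<union> g ` A') \<inter> (B \<union> g ` B') = (A \<inter> B) \<union> (g ` A' \<inter> g ` B')" using that disj by blast
    then show ?thesis by (simp add: image_Int[OF g, symmetric])
  qed
  have bij: "bij_betw h (?I1 \<times> ?I2) ?I"
    unfolding bij_betw_def
  proof
    show "inj_on h (?I1 \<times> ?I2)"
    proof (rule inj_onI)
      fix x y assume xy: "x \<in> ?I1 \<times> ?I2" "y \<in> ?I1 \<times> ?I2" "h x = h y"
      obtain S \<sigma> S' \<sigma>' T \<tau> T' \<tau>' where x: "x = ((S, \<sigma>), (S', \<sigma>'))" "y = ((T, \<tau>), (T', \<tau>'))"
        by (metis surj_pair)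
      show "x = y" using xy un_eq[of S T S' T'] un_eq[of \<sigma> \<tau> \<sigma>' \<tau>'] by (simp add: x h_def cells_def)
    qed
    show "h ` (?I1 \<times> ?I2) = ?I"
    proof (intro equalityI subsetI)
      fix y assume "y \<in> h ` (?I1 \<times> ?I2)"
      then obtain S \<sigma> S' \<sigma>' where y: "y = h ((S, \<sigma>), (S', \<sigma>'))" "(S, \<sigma>) \<in> ?I1" "(S', \<sigma>') \<in> ?I2" by auto
      then show "y \<in> ?I" using ind[of \<sigma> \<sigma>'] int[of S \<sigma> S' \<sigma>'] by (auto simp: h_def cells_def)
    next
      fix y assume y: "y \<in> ?I"
      obtain P \<rho> where P: "y = (P, \<rho>)" by force
      obtain S S' where S: "S \<subseteq> V1" "S' \<subseteq> U" "P = S \<union> g ` S'" using decomp[of P] y P by (auto simp: cells_def)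
      obtain \<sigma> \<sigma>' where s: "\<sigma> \<subseteq> V1" "\<sigma>' \<subseteq> U" "\<rho> = \<sigma> \<union> g ` \<sigma>'" using decomp[of \<rho>] y P by (auto simp: cells_def)
      have "(S, \<sigma>) \<in> ?I1 \<and> (S', \<sigma>') \<in> ?I2"
        using y ind[OF s(1,2)] int[OF S(1) s(1) S(2) s(2)] S s unfolding P by (simp add: cells_def)
      moreover have "y = h ((S, \<sigma>), (S', \<sigma>'))" by (simp add: P h_def S s)
      ultimately show "y \<in> h ` (?I1 \<times> ?I2)" by blast
    qed
  qed
  have card_un: "card (A \<union> g ` A') = card A + card A'" if "A \<subseteq> V1" "A' \<subseteq> U" for A A'
  proof -
    have "finite A" "finite (g ` A')" "A \<inter> g ` A' = {}"
      using that V1 U disj finite_subset by blast+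
    then show ?thesis using card_Un_disjoint card_image[OF inj_on_subset[OF g subset_UNIV]] by metis
  qed
  have gr: "cell_grade (h x) = add_grade cell_grade cell_grade x" if "x \<in> ?I1 \<times> ?I2" for x
    using that card_un by (auto simp: h_def cells_def cell_grade_def add_grade_def)
  have sgn1: "koszul_sign lt v (T \<union> g ` T') = (koszul_sign lt v T :: 'k)"
    if "v \<in> V1" "T \<subseteq> V1" "T' \<subseteq> U" for v T T'
  proof -
    have "{w \<in> T \<union> g ` T'. lt w v} = {w \<in> T. lt w v}"
      using that lt1[OF that(1)] lt unfolding strict_total_def by blast
    then show ?thesis by (simp add: koszul_sign_def)
  qed
  have sgn2: "koszul_sign lt (g v) (T \<union> g ` T') = (\<epsilon> (T, \<tau>) * koszul_sign lt' v T' :: 'k)"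
    if "v \<in> U" "T \<subseteq> V1" "T' \<subseteq> U" for v T T' \<tau>
  proof -
    \<comment> \<open>All of \<open>T\<close> comes before \<open>g v\<close>; its size is the
      exponent in \<open>\<epsilon>\<close>.\<close>
    have "{w \<in> T \<union> g ` T'. lt w (g v)} = T \<union> g ` {w \<in> T'. lt' w v}"
      using that lt1[OF _ that(1)] lt2[OF _ that(1)] by auto
    moreover have "card \<dots> = card T + card {w \<in> T'. lt' w v}" using that by (intro card_un) auto
    ultimately show ?thesis by (simp add: koszul_sign_def \<epsilon>_def power_add)
  qed
  have mat: "?a (h x) (h y) = tensor_matrix \<epsilon> ?a ?a' x y" if xy: "x \<in> ?I1 \<times> ?I2" "y \<in> ?I1 \<times> ?I2" for x y
  proof -
    obtain T \<tau> T' \<tau>' S \<sigma> S' \<sigma>' where x: "x = ((T, \<tau>), (T', \<tau>'))" "y = ((S, \<sigma>), (S', \<sigma>'))"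
      by (metis surj_pair)
    have sub: "T \<subseteq> V1" "\<tau> \<subseteq> V1" "T' \<subseteq> U" "\<tau>' \<subseteq> U" "S \<subseteq> V1" "\<sigma> \<subseteq> V1" "S' \<subseteq> U" "\<sigma>' \<subseteq> U"
      using xy by (auto simp: x cells_def)
    have fin: "finite \<tau>" "finite (g ` \<tau>')" "\<tau> \<inter> g ` \<tau>' = {}" using sub V1 U disj finite_subset by blast+
    let ?G = "\<lambda>v. if S \<union> g ` S' = insert v (T \<union> g ` T') \<and> \<sigma> \<union> g ` \<sigma>' = (\<tau> \<union> g ` \<tau>') - {v}
      then koszul_sign lt v (T \<union> g ` T') else (0::'k)"
    have "?a (h x) (h y) = (\<Sum>v\<in>\<tau> \<union> g ` \<tau>'. ?G v)" by (simp add: x h_def cell_matrix_def)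
    also have "\<dots> = (\<Sum>v\<in>\<tau>. ?G v) + (\<Sum>v\<in>g ` \<tau>'. ?G v)" by (rule sum.union_disjoint[OF fin])
    also have "(\<Sum>v\<in>\<tau>. ?G v) = (if (T', \<tau>') = (S', \<sigma>') then ?a (T, \<tau>) (S, \<sigma>) else 0)"
    proof -
      have "?G v = (if (T', \<tau>') = (S', \<sigma>') then if S = insert v T \<and> \<sigma> = \<tau> - {v} then koszul_sign lt v T else 0 else 0)"
        if "v \<in> \<tau>" for v
      proof -
        have v: "v \<in> V1" "v \<notin> g ` \<tau>'" using that fin sub by auto
        have "insert v (T \<union> g ` T') = insert v T \<union> g ` T'" "(\<tau> \<union> g ` \<tau>') - {v} = (\<tau> - {v}) \<union> g ` \<tau>'"
          using v by auto
        moreover have "S \<union> g ` S' = insert v T \<union> g ` T' \<longleftrightarrow> S = insert v T \<and> S' = T'"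
          using sub v by (intro un_eq) auto
        moreover have "\<sigma> \<union> g ` \<sigma>' = (\<tau> - {v}) \<union> g ` \<tau>' \<longleftrightarrow> \<sigma> = \<tau> - {v} \<and> \<sigma>' = \<tau>'"
          using sub v by (intro un_eq) auto
        ultimately show ?thesis using sgn1[OF v(1) sub(1,3)] by auto
      qed
      then have "(\<Sum>v\<in>\<tau>. ?G v) = (\<Sum>v\<in>\<tau>. if (T', \<tau>') = (S', \<sigma>')
          then if S = insert v T \<and> \<sigma> = \<tau> - {v} then koszul_sign lt v T else 0 else 0)"
        by (rule sum.cong[OF refl])
      then show ?thesis
        by (cases "(T', \<tau>') = (S', \<sigma>')") (simp_all add: cell_matrix_def del: prod.inject)
    qed
    also have "(\<Sum>v\<in>g ` \<tau>'. ?G v) = (if (T, \<tau>) = (S, \<sigma>) then \<epsilon> (T, \<tau>) * ?a' (T', \<tau>') (S', \<sigma>') else 0)"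
    proof -
      have "?G (g v) = (if (T, \<tau>) = (S, \<sigma>) then if S' = insert v T' \<and> \<sigma>' = \<tau>' - {v}
          then \<epsilon> (T, \<tau>) * koszul_sign lt' v T' else 0 else 0)"
        if "v \<in> \<tau>'" for v
      proof -
        have v: "v \<in> U" "g v \<notin> \<tau>" using that fin sub by auto
        have "insert (g v) (T \<union> g ` T') = T \<union> g ` insert v T'" by auto
        moreover have "(\<tau> \<union> g ` \<tau>') - {g v} = \<tau> \<union> g ` (\<tau>' - {v})"
          using v injD[OF g] by auto
        moreover have "S \<union> g ` S' = T \<union> g ` insert v T' \<longleftrightarrow> S = T \<and> S' = insert v T'"
          using sub v by (intro un_eq) auto
        moreover have "\<sigma> \<union> g ` \<sigma>' = \<tau> \<union> g ` (\<tau>' - {v}) \<longleftrightarrow> \<sigma> = \<tau> \<and> \<sigma>' = \<tau>' - {v}"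
          using sub v by (intro un_eq) auto
        ultimately show ?thesis using sgn2[OF v(1) sub(1,3), of \<tau>] by auto
      qed
      then have "(\<Sum>v\<in>\<tau>'. ?G (g v)) = (\<Sum>v\<in>\<tau>'. if (T, \<tau>) = (S, \<sigma>)
          then if S' = insert v T' \<and> \<sigma>' = \<tau>' - {v} then \<epsilon> (T, \<tau>) * koszul_sign lt' v T' else 0 else 0)"
        by (rule sum.cong[OF refl])
      moreover have "(\<Sum>v\<in>g ` \<tau>'. ?G v) = (\<Sum>v\<in>\<tau>'. ?G (g v))"
        using sum.reindex[OF inj_on_subset[OF g subset_UNIV]] by (simp add: o_def)
      moreover have "\<epsilon> (T, \<tau>) * ?a' (T', \<tau>') (S', \<sigma>') =
        (\<Sum>v\<in>\<tau>'. if S' = insert v T' \<and> \<sigma>' = \<tau>' - {v} then \<epsilon> (T, \<tau>) * koszul_sign lt' v T' else 0)"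
        unfolding cell_matrix_def prod.case sum_distrib_left by (rule sum.cong) auto
      ultimately show ?thesis
        by (cases "(T, \<tau>) = (S, \<sigma>)") (simp_all del: prod.inject)
    qed
    finally show ?thesis by (simp add: x tensor_matrix_def)
  qed
  have eps: "\<epsilon> y = - \<epsilon> x" if "x \<in> ?I1" "y \<in> ?I1" "?a x y \<noteq> 0" for x y
  proof -
    have "cell_grade y = (Suc (fst (cell_grade x)), snd (cell_grade x))"
      using based_complex_cells[OF V1 lt, of E1, where 'k='k] that unfolding based_complex_def by blast
    then show ?thesis by (cases x; cases y) (simp add: \<epsilon>_def cell_grade_def)
  qed
  have "cell_poly K lt (V1 \<union> g ` U) E =
      hom_poly (?I1 \<times> ?I2) (add_grade cell_grade cell_grade) (tensor_matrix \<epsilon> ?a ?a')"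
    unfolding cell_poly_def
    by (rule hom_poly_transport[symmetric, OF bij based_complex_cells[OF fV lt]]) (use gr mat in auto)
  also have "\<dots> = hom_poly ?I1 cell_grade ?a * hom_poly ?I2 cell_grade ?a'"
    by (rule hom_poly_tensor[OF based_complex_cells[OF V1 lt] based_complex_cells[OF U lt']])
      (use eps in \<open>auto simp: \<epsilon>_def power_add[symmetric]\<close>)
  finally show ?thesis by (simp add: cell_poly_def)
qed

lemma cell_poly_empty:
  fixes K :: "'k::field itself"
  shows "cell_poly K lt {} E = 1"
proof -
  have I: "cells {} E = {({}, {})}" by (auto simp: cells_def indep_def)
  have D: "dif {({}, {})} (cell_matrix lt) f = (0 :: _ \<Rightarrow> 'k)" for f
    by (auto simp: dif_def cell_matrix_def fun_eq_iff)
  have "hilb {({}, {})} cell_grade (supp_in {({}, {})} :: ('a set \<times> 'a set \<Rightarrow> 'k) set) = 1"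
    by (subst hilb_supp_in) (auto simp: grade_monom_def cell_grade_def uv_monom_def)
  moreover have "hilb {({}, {})} cell_grade {0 :: 'a set \<times> 'a set \<Rightarrow> 'k} = 0"
  proof (rule uv_poly_eqI)
    fix i d
    have "graded_part cell_grade (i, d) {0 :: 'a set \<times> 'a set \<Rightarrow> 'k} = {0}"
      by (auto simp: graded_part_def)
    then show "uv_coeff (hilb {({}, {})} cell_grade {0 :: 'a set \<times> 'a set \<Rightarrow> 'k}) i d = uv_coeff 0 i d"
      by (subst uv_coeff_hilb) (auto simp: supp_in_def fv.dim_zero_space uv_coeff_simps)
  qed
  moreover have "(\<lambda>f :: 'a set \<times> 'a set \<Rightarrow> 'k. 0) ` supp_in {({}, {})} = {0 :: 'a set \<times> 'a set \<Rightarrow> 'k}"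
    using fv.subspace_0[OF subspace_supp_in] by auto
  ultimately show ?thesis by (simp add: cell_poly_def I hom_poly_def cycles_def boundaries_def D)
qed

subsection \<open>Cycles in the linear strand\<close>

definition cycle_dim :: "'k::field itself \<Rightarrow> ('v \<Rightarrow> 'v \<Rightarrow> bool) \<Rightarrow> 'v set \<Rightarrow> 'v set set \<Rightarrow> nat \<Rightarrow> nat \<Rightarrow> nat" where
  "cycle_dim K lt V E i d =
     fv.dim (graded_part cell_grade (i, d) (cycles (cells V E) (cell_matrix lt :: _ \<Rightarrow> _ \<Rightarrow> 'k)))"

definition cell_count :: "'v set \<Rightarrow> 'v set set \<Rightarrow> nat \<Rightarrow> nat \<Rightarrow> nat" where
  "cell_count V E i d = card {c \<in> cells V E. cell_grade c = (i, d)}"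

text \<open>Homology is cycles minus boundaries, and rank-nullity one step higher expresses the
  boundaries as cells minus cycles in degree \<open>Suc i\<close>. Cycle dimensions and cell counts
  are thus all that is needed.\<close>

lemma uv_coeff_cell_poly:
  fixes K :: "'k::field itself"
  assumes V: "finite V" and lt: "strict_total lt"
  shows "uv_coeff (cell_poly K lt V E) i d =
    int (cycle_dim K lt V E i d) + int (cycle_dim K lt V E (Suc i) d) - int (cell_count V E (Suc i) d)"
proof -
  let ?I = "cells V E" and ?a = "cell_matrix lt :: _ \<Rightarrow> _ \<Rightarrow> 'k"
  have I: "finite ?I" by (rule finite_cells[OF V])
  have bc: "based_complex ?I cell_grade ?a" by (rule based_complex_cells[OF V lt])
  have Z: "cycles ?I ?a \<subseteq> supp_in ?I" by (auto simp: cycles_def)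
  have "int (cell_count V E (Suc i) d) = uv_coeff (\<Sum>c\<in>?I. grade_monom (cell_grade c)) (Suc i) d"
    by (simp add: uv_coeff_sum_grade_monom[OF I] cell_count_def)
  also have "\<dots> = int (cycle_dim K lt V E (Suc i) d) + uv_coeff (hilb ?I cell_grade (boundaries ?I ?a)) i d"
    unfolding hilb_cycles_boundaries[OF bc] uv_coeff_simps uv_coeff_u_var_mult uv_coeff_hilb[OF I Z]
    by (simp add: cycle_dim_def)
  finally show ?thesis
    unfolding cell_poly_def hom_poly_def uv_coeff_simps uv_coeff_hilb[OF I Z]
    by (simp add: cycle_dim_def)
qed

text \<open>With no cell one step lower in the same internal degree, the differential has no target
  and every chain is a cycle.\<close>

lemma cycle_dim_full:
  fixes K :: "'k::field itself"
  assumes V: "finite V" and lt: "strict_total lt"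
    and prev: "i = 0 \<or> cell_count V E (i - 1) d = 0"
  shows "cycle_dim K lt V E i d = cell_count V E i d"
proof -
  let ?I = "cells V E" and ?a = "cell_matrix lt :: _ \<Rightarrow> _ \<Rightarrow> 'k"
  have I: "finite ?I" by (rule finite_cells[OF V])
  have bc: "based_complex ?I cell_grade ?a" by (rule based_complex_cells[OF V lt])
  have "graded_part cell_grade (i, d) (cycles ?I ?a) = graded_part cell_grade (i, d) (supp_in ?I)"
  proof (intro equalityI subsetI)
    fix f :: "_ \<Rightarrow> 'k" assume f: "f \<in> graded_part cell_grade (i, d) (supp_in ?I)"
    have "dif ?I ?a f = 0"
    proof (cases i)
      case 0
      then show ?thesis using dif_comp_part(2)[OF bc, of d f] comp_part_eq[OF f] by simp
    next
      case (Suc k)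
      have "{c \<in> ?I. cell_grade c = (k, d)} = {}" using prev Suc I by (simp add: cell_count_def)
      then have "comp_part cell_grade (k, d) (dif ?I ?a f) = 0"
        by (auto simp: comp_part_def dif_def fun_eq_iff)
      then show ?thesis using dif_comp_part(1)[OF bc, of k d f] comp_part_eq[OF f] Suc by simp
    qed
    then show "f \<in> graded_part cell_grade (i, d) (cycles ?I ?a)"
      using f by (simp add: graded_part_def cycles_def)
  qed (auto simp: graded_part_def cycles_def)
  then have "int (cycle_dim K lt V E i d) = uv_coeff (hilb ?I cell_grade (supp_in ?I :: (_ \<Rightarrow> 'k) set)) i d"
    by (simp add: cycle_dim_def uv_coeff_hilb[OF I subset_refl])
  also have "\<dots> = int (cell_count V E i d)"
    unfolding hilb_supp_in[OF I] uv_coeff_sum_grade_monom[OF I] cell_count_def ..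
  finally show ?thesis by simp
qed

lemma cycle_dim_no_cells:
  fixes K :: "'k::field itself"
  assumes "cell_count V E i d = 0" "finite V"
  shows "cycle_dim K lt V E i d = 0"
proof -
  have "{c \<in> cells V E. cell_grade c = (i, d)} = {}"
    using assms finite_cells[of V E] by (simp add: cell_count_def)
  then have "graded_part cell_grade (i, d) (cycles (cells V E) (cell_matrix lt :: _ \<Rightarrow> _ \<Rightarrow> 'k)) \<subseteq> {0}"
    by (fastforce simp: graded_part_def cycles_def supp_in_def fun_eq_iff)
  then show ?thesis unfolding cycle_dim_def
    using fv.dim_le_card[of "graded_part cell_grade (i, d) (cycles (cells V E) (cell_matrix lt :: _ \<Rightarrow> _ \<Rightarrow> 'k))" "{}"]
    by simp
qed

text \<open>The independent set is chosen first; the exterior part is then any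
  \<open>i\<close>-element subset of its complement.\<close>

lemma cell_count_eq:
  assumes V: "finite V"
  shows "cell_count V E i (i + q) = card {\<sigma>. \<sigma> \<subseteq> V \<and> indep E \<sigma> \<and> card \<sigma> = q} * ((card V - q) choose i)"
proof -
  let ?P = "{\<sigma>. \<sigma> \<subseteq> V \<and> indep E \<sigma> \<and> card \<sigma> = q}"
  let ?Q = "\<lambda>\<sigma>. {S. S \<subseteq> V - \<sigma> \<and> card S = i}"
  have P: "finite ?P" by (rule finite_subset[of _ "Pow V"]) (use V in auto)
  have "{c \<in> cells V E. cell_grade c = (i, i + q)} = prod.swap ` Sigma ?P ?Q"
    by (fastforce simp: cells_def cell_grade_def image_iff)
  then have "cell_count V E i (i + q) = card (Sigma ?P ?Q)"
    unfolding cell_count_def by (simp add: card_image)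
  also have "\<dots> = (\<Sum>\<sigma>\<in>?P. card (?Q \<sigma>))" using P V by (intro card_SigmaI) auto
  also have "\<dots> = (\<Sum>\<sigma>\<in>?P. (card V - q) choose i)"
  proof (rule sum.cong[OF refl])
    fix \<sigma> assume s: "\<sigma> \<in> ?P"
    then have "card (V - \<sigma>) = card V - q" using V by (auto simp: card_Diff_subset finite_subset)
    then show "card (?Q \<sigma>) = (card V - q) choose i" using n_subsets[of "V - \<sigma>" i] V by simp
  qed
  finally show ?thesis by simp
qed

lemma cell_count_below: "d < i \<Longrightarrow> cell_count V E i d = 0"
  by (auto simp: cell_count_def cell_grade_def card_eq_0_iff)

lemma dif_cells_singleton:
  assumes "finite V" "(T, {x}) \<in> cells V E"
  shows "dif (cells V E) (cell_matrix lt) f (T, {x}) = koszul_sign lt x T * f (insert x T, {})"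
  by (simp add: dif_cells[OF assms])

lemma dif_cells_pair:
  assumes "finite V" "(T, {x, y}) \<in> cells V E" "x \<noteq> y"
  shows "dif (cells V E) (cell_matrix lt) f (T, {x, y}) =
    koszul_sign lt x T * f (insert x T, {y}) + koszul_sign lt y T * f (insert y T, {x})"
proof -
  have "{x, y} - {x} = {y}" "{x, y} - {y} = {x}" using assms(3) by auto
  then show ?thesis using assms(3) by (simp add: dif_cells[OF assms(1,2)])
qed

text \<open>Here the monomial part is empty, and the boundary at \<open>(S - {x}, {x})\<close> is
  the single term \<open>f (S, {})\<close> up to sign. The positive degree provides the vertex
  \<open>x\<close>.\<close>

lemma cycle_dim_diagonal:
  fixes K :: "'k::field itself"
  assumes V: "finite V" and loops: "\<And>x. {x} \<notin> E"
  shows "cycle_dim K lt V E (Suc d) (Suc d) = 0"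
proof -
  let ?A = "graded_part cell_grade (Suc d, Suc d) (cycles (cells V E) (cell_matrix lt :: _ \<Rightarrow> _ \<Rightarrow> 'k))"
  have "f c = 0" if f: "f \<in> ?A" for f c
  proof (rule ccontr)
    assume c: "f c \<noteq> 0"
    obtain S \<sigma> where c': "c = (S, \<sigma>)" by force
    have "c \<in> cells V E" using f c unfolding graded_part_def cycles_def supp_in_def by blast
    then have S: "S \<subseteq> V" "finite S" "finite \<sigma>" using V finite_subset by (auto simp: cells_def c')
    have "cell_grade c = (Suc d, Suc d)" using f c unfolding graded_part_def by blast
    then have "card S = Suc d" "\<sigma> = {}" using S by (auto simp: cell_grade_def c')
    then obtain x where x: "x \<in> S" by fastforce
    have cell: "(S - {x}, {x}) \<in> cells V E" using S x loops by (auto simp: cells_def indep_def)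
    have "koszul_sign lt x (S - {x}) * f (insert x (S - {x}), {}) = 0"
      using dif_cells_singleton[OF V cell, of lt f] f by (simp add: graded_part_def cycles_def)
    then show False using c \<open>\<sigma> = {}\<close> x koszul_sign_nonzero[of lt x "S - {x}", where 'k='k]
      by (simp add: c' insert_absorb)
  qed
  then have "?A \<subseteq> {0}" by (auto simp: fun_eq_iff)
  then show ?thesis unfolding cycle_dim_def using fv.dim_le_card[of ?A "{}"] by simp
qed

text \<open>Adjacency in the complement graph on \<open>W\<close>.\<close>

definition nonadj :: "'v set set \<Rightarrow> 'v set \<Rightarrow> ('v \<times> 'v) set" where
  "nonadj E W = {(x, y). x \<in> W \<and> y \<in> W \<and> x \<noteq> y \<and> {x, y} \<notin> E}"

text \<open>\<open>\<kappa>\<close> retracts \<open>W\<close> to a set of representatives of the components of the complement graph on \<open>W\<close>.\<close>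

definition comp_retract :: "'v set set \<Rightarrow> 'v set \<Rightarrow> ('v \<Rightarrow> 'v) \<Rightarrow> bool" where
  "comp_retract E W \<kappa> \<longleftrightarrow> (\<forall>x\<in>W. (x, \<kappa> x) \<in> (nonadj E W)\<^sup>*) \<and> (\<forall>(x, y)\<in>nonadj E W. \<kappa> x = \<kappa> y)"

lemma comp_retract_in: "comp_retract E W \<kappa> \<Longrightarrow> x \<in> W \<Longrightarrow> \<kappa> x \<in> W"
  unfolding comp_retract_def by (metis (no_types, lifting) nonadj_def case_prodD mem_Collect_eq rtranclE)

lemma comp_retract_idem: "comp_retract E W \<kappa> \<Longrightarrow> x \<in> W \<Longrightarrow> \<kappa> (\<kappa> x) = \<kappa> x"
proof -
  assume k: "comp_retract E W \<kappa>" and x: "x \<in> W"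
  have eq: "\<kappa> y = \<kappa> z" if "(y, z) \<in> nonadj E W" for y z
    using k that unfolding comp_retract_def by blast
  have "(x, y) \<in> (nonadj E W)\<^sup>* \<Longrightarrow> \<kappa> y = \<kappa> x" for y
  proof (induction rule: rtrancl_induct)
    case (step y z)
    then show ?case using eq[OF step.hyps(2)] by simp
  qed simp
  moreover have "(x, \<kappa> x) \<in> (nonadj E W)\<^sup>*" using k x unfolding comp_retract_def by blast
  ultimately show ?thesis by blast
qed

text \<open>
  Cycles in degree \<open>(i, i + 1)\<close> with support \<open>W\<close> become, after dividing by Koszul signs, functions
  on \<open>W\<close> that are constant on the components of the complement graph.
\<close>

lemma cycle_dim_linear_strand:
  fixes K :: "'k::field itself"
  assumes V: "finite V" and lt: "strict_total lt" and loops: "\<And>x. {x} \<notin> E"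
    and ret: "\<And>W. W \<subseteq> V \<Longrightarrow> card W = Suc i \<Longrightarrow> comp_retract E W (\<kappa> W)"
  shows "cycle_dim K lt V E i (Suc i) = (\<Sum>W | W \<subseteq> V \<and> card W = Suc i. card (\<kappa> W ` W))"
proof -
  let ?s = "koszul_sign lt :: _ \<Rightarrow> _ \<Rightarrow> 'k"
  let ?Z = "cycles (cells V E) (cell_matrix lt :: _ \<Rightarrow> _ \<Rightarrow> 'k)"
  let ?A = "graded_part cell_grade (i, Suc i) ?Z"
  let ?\<W> = "{W. W \<subseteq> V \<and> card W = Suc i}"
  \<comment> \<open>One pivot for each vertex set \<open>W\<close> and each component representative
    \<open>r\<close>: the cell with monomial part \<open>r\<close>.\<close>
  define J where "J = (\<lambda>(W, r). (W - {r}, {r})) ` Sigma ?\<W> (\<lambda>W. \<kappa> W ` W)"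
  \<comment> \<open>The dual vector is the indicator of the component of \<open>r\<close> in
    \<open>W\<close>, multiplied by Koszul signs and normalised so that its entry at the own pivot
    is a squared sign, hence 1.\<close>
  define e :: "'a set \<times> 'a set \<Rightarrow> 'a set \<times> 'a set \<Rightarrow> 'k" where
    "e = (\<lambda>(T, \<rho>) (S, \<sigma>). if card S = i \<and> card \<sigma> = 1 \<and> (S, \<sigma>) \<in> cells V E \<and> S \<union> \<sigma> = T \<union> \<rho> \<and>
       \<kappa> (T \<union> \<rho>) (the_elem \<sigma>) = the_elem \<rho>
       then ?s (the_elem \<sigma>) S * ?s (the_elem \<rho>) T else 0)"
  have finW: "finite ?\<W>" by (rule finite_subset[of _ "Pow V"]) (use V in auto)
  have fin: "finite W" if "W \<subseteq> V" for W using that V finite_subset by blast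
  have sq: "?s x T * ?s x T = 1" for x T by (rule koszul_sign_sq)
  have cell1: "(W - {x}, {x}) \<in> cells V E" if "W \<subseteq> V" "x \<in> W" for W x
    using that loops by (auto simp: cells_def indep_def)
  have inj: "inj_on (\<lambda>(W, r). (W - {r}, {r})) (Sigma ?\<W> (\<lambda>W. \<kappa> W ` W))"
  proof (rule inj_onI)
    fix p p' assume p: "p \<in> Sigma ?\<W> (\<lambda>W. \<kappa> W ` W)" "p' \<in> Sigma ?\<W> (\<lambda>W. \<kappa> W ` W)"
      and eq: "(case p of (W, r) \<Rightarrow> (W - {r}, {r})) = (case p' of (W, r) \<Rightarrow> (W - {r}, {r}))"
    obtain W r W' r' where pp: "p = (W, r)" "p' = (W', r')" by force
    have "r \<in> W" "r' \<in> W'" using p comp_retract_in[OF ret] by (auto simp: pp)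
    then show "p = p'" using eq by (auto simp: pp)
  qed
  have cardJ: "card J = (\<Sum>W\<in>?\<W>. card (\<kappa> W ` W))"
    unfolding J_def card_image[OF inj] using finW fin by (intro card_SigmaI) auto
  have JE: "\<exists>W r. W \<subseteq> V \<and> card W = Suc i \<and> r \<in> W \<and> \<kappa> W r = r \<and> j = (W - {r}, {r})" if "j \<in> J" for j
  proof -
    obtain W x where W: "W \<subseteq> V" "card W = Suc i" "x \<in> W" "j = (W - {\<kappa> W x}, {\<kappa> W x})"
    proof -
      obtain p where p: "p \<in> Sigma ?\<W> (\<lambda>W. \<kappa> W ` W)" "j = (case p of (W, r) \<Rightarrow> (W - {r}, {r}))"
        using \<open>j \<in> J\<close> unfolding J_def by blast
      obtain W r where "p = (W, r)" by force
      then show thesis using p that by auto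
    qed
    then show ?thesis using comp_retract_in[OF ret] comp_retract_idem[OF ret] by metis
  qed
  have subA: "fv.subspace ?A"
    using graded_space_cycles[OF based_complex_cells[OF V lt]] by (intro subspace_graded_part) (auto simp: graded_space_def)
  \<comment> \<open>By anticommutativity of the signs, the cycle condition at the cell with monomial
    part {x, y} says that the sign-corrected values at \<open>x\<close> and \<open>y\<close>
    agree.\<close>
  have eqn: "(?s x T * f (insert x T, {y}) + ?s y T * f (insert y T, {x}) = 0) \<longleftrightarrow>
      ?s y (insert x T) * f (insert x T, {y}) = ?s x (insert y T) * f (insert y T, {x})"
    if "finite T" "x \<notin> T" "y \<notin> T" "x \<noteq> y" for f :: "_ \<Rightarrow> 'k" and x y T
  proof -
    define p q where "p = ?s y (insert x T) * f (insert x T, {y})" "q = ?s x (insert y T) * f (insert y T, {x})"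
    have f1: "f (insert x T, {y}) = ?s y (insert x T) * p" "f (insert y T, {x}) = ?s x (insert y T) * q"
      using sq by (simp_all add: p_q_def mult.assoc[symmetric])
    have "?s x T * f (insert x T, {y}) + ?s y T * f (insert y T, {x}) =
      (?s x T * ?s y (insert x T)) * p + (?s y T * ?s x (insert y T)) * q"
      by (simp add: f1 mult.assoc)
    also have "?s y T * ?s x (insert y T) = - (?s x T * ?s y (insert x T))"
      using koszul_sign_anticomm[OF lt that(1) that(3) that(2)] that(4) by metis
    also have "(?s x T * ?s y (insert x T)) * p + - (?s x T * ?s y (insert x T)) * q =
      (?s x T * ?s y (insert x T)) * (p - q)" by (simp add: algebra_simps)
    finally show ?thesis by (simp add: p_q_def[symmetric] koszul_sign_nonzero)
  qed
  have "coords ?A J e"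
    unfolding coords_def
  proof (intro conjI ballI impI)
    show "finite J" unfolding J_def using finW fin by (intro finite_imageI finite_SigmaI) auto
  next
    fix j assume "j \<in> J"
    then obtain W r where W: "W \<subseteq> V" "card W = Suc i" "r \<in> W" "\<kappa> W r = r" "j = (W - {r}, {r})" using JE by blast
    have Wr: "W - {r} \<union> {r} = W" using W by auto
    have e1: "e j (S, {x}) = (if insert x S = W \<and> x \<notin> S \<and> \<kappa> W x = r then ?s x S * ?s r (W - {r}) else 0)" for S x
      using W fin[OF W(1)] cell1[OF W(1), of x]
      by (auto simp: e_def Wr insert_absorb cells_def split: if_splits)
    have supp: "c \<in> cells V E \<and> cell_grade c = (i, Suc i)" if "e j c \<noteq> 0" for c
      using that by (auto simp: e_def W cell_grade_def split: prod.splits if_splits)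
    have "dif (cells V E) (cell_matrix lt) (e j) = 0"
    proof -
      have "dif (cells V E) (cell_matrix lt) (e j) (T, \<tau>) = 0" for T \<tau>
      proof (cases "(T, \<tau>) \<in> cells V E")
        case True
        show ?thesis
        \<comment> \<open>Only targets with a two-element monomial part receive anything from cells
          whose monomial part is a singleton.\<close>
        proof (cases "card \<tau> = 2")
          case two: True
          then obtain x y where xy: "\<tau> = {x, y}" "x \<noteq> y" by (auto simp: card_2_iff)
          have T: "finite T" "x \<notin> T" "y \<notin> T" "x \<in> V" "y \<in> V" "T \<subseteq> V" "{x, y} \<notin> E"
            using True fin by (auto simp: cells_def xy indep_def)
          have "?s y (insert x T) * e j (insert x T, {y}) = ?s x (insert y T) * e j (insert y T, {x})"
          proof (cases "insert x (insert y T) = W")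
            case W': True
            have "(x, y) \<in> nonadj E W" using T xy W' by (auto simp: nonadj_def)
            then have "\<kappa> W x = \<kappa> W y" using ret[OF W(1,2)] by (auto simp: comp_retract_def)
            moreover have "insert y (insert x T) = W" using W' by auto
            ultimately show ?thesis using sq W' T xy(2) by (simp add: e1 mult.assoc[symmetric])
          next
            case False
            then have "insert y (insert x T) \<noteq> W" by auto
            then show ?thesis using False by (simp add: e1)
          qed
          then show ?thesis using eqn[OF T(1-3) xy(2), of "e j"] True
            unfolding xy(1) by (subst dif_cells_pair[OF V _ xy(2)]) auto
        next
          case False
          have "e j (insert v T, \<tau> - {v}) = 0" if "v \<in> \<tau>" for v
          proof (rule ccontr)
            assume "e j (insert v T, \<tau> - {v}) \<noteq> 0"
            then have "card (\<tau> - {v}) = 1" by (auto simp: e_def W split: if_splits)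
            then have "card \<tau> = 2" using that by (simp add: card_Diff_singleton_if split: if_splits)
            then show False using False by simp
          qed
          then show ?thesis by (simp add: dif_cells[OF V True])
        qed
      next
        case False
        then show ?thesis by (simp add: dif_def)
      qed
      then show ?thesis by (auto simp: fun_eq_iff)
    qed
    then show "e j \<in> ?A" using supp by (auto simp: graded_part_def cycles_def supp_in_def)
    fix j' assume "j' \<in> J"
    then obtain W' r' where W': "W' \<subseteq> V" "card W' = Suc i" "r' \<in> W'" "\<kappa> W' r' = r'" "j' = (W' - {r'}, {r'})"
      using JE by blast
    show "e j j' = (if j = j' then 1 else 0)"
    proof (cases "W' = W \<and> r' = r")
      case True
      have "e j (W - {r}, {r}) = 1" using W(3,4) sq by (simp add: e1 insert_absorb)
      then show ?thesis using True W(5) W'(5) by simp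
    next
      case False
      have "insert r' (W' - {r'}) = W'" using W' by auto
      then have "e j j' = 0" using False W'(4) by (auto simp: W'(5) e1)
      moreover have "j \<noteq> j'" using False W W' by (auto simp: insert_Diff)
      ultimately show ?thesis by simp
    qed
  next
    fix f assume f: "f \<in> ?A" and 0: "\<forall>j\<in>J. f j = 0"
    have zero: "f (W - {x}, {x}) = 0" if W: "W \<subseteq> V" "card W = Suc i" "x \<in> W" for W x
    proof -
      have step: "?s y (W - {y}) * f (W - {y}, {y}) = ?s x (W - {x}) * f (W - {x}, {x})"
        if "(x, y) \<in> nonadj E W" for x y
      proof -
        define T where "T = W - {x, y}"
        have T: "x \<in> W" "y \<in> W" "x \<noteq> y" "{x, y} \<notin> E" "insert x T = W - {y}" "insert y T = W - {x}"
          "finite T" "x \<notin> T" "y \<notin> T" "T \<subseteq> V"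
          using that W fin[OF W(1)] by (auto simp: nonadj_def T_def)
        have "(T, {x, y}) \<in> cells V E"
          using T W loops by (auto simp: cells_def indep_def insert_commute)
        then have "?s x T * f (insert x T, {y}) + ?s y T * f (insert y T, {x}) = 0"
          using dif_cells_pair[OF V _ T(3), of T E lt f] f by (simp add: graded_part_def cycles_def)
        then show ?thesis using eqn[OF T(7,8,9,3), of f] unfolding T(5,6) by simp
      qed
      \<comment> \<open>Constancy along the edges of the complement graph spreads over a component,
        up to its representative, where \<open>f\<close> is zero by assumption.\<close>
      have path: "?s y (W - {y}) * f (W - {y}, {y}) = ?s x (W - {x}) * f (W - {x}, {x})"
        if "(x, y) \<in> (nonadj E W)\<^sup>*" for y
        using that by (induction rule: rtrancl_induct) (use step in force)+
      have "(W - {\<kappa> W x}, {\<kappa> W x}) \<in> J" unfolding J_def using W by force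
      then have "f (W - {\<kappa> W x}, {\<kappa> W x}) = 0" using 0 by blast
      then show ?thesis
        using path[of "\<kappa> W x"] ret[OF W(1,2)] W(3) by (auto simp: comp_retract_def koszul_sign_nonzero)
    qed
    have "f c = 0" for c
    proof (rule ccontr)
      assume c: "f c \<noteq> 0"
      obtain S \<sigma> where c': "c = (S, \<sigma>)" by force
      have "c \<in> cells V E" using f c unfolding graded_part_def cycles_def supp_in_def by blast
      then have S: "S \<subseteq> V" "finite S" "\<sigma> \<subseteq> V" "S \<inter> \<sigma> = {}" using fin by (auto simp: cells_def c')
      have "cell_grade c = (i, Suc i)" using f c unfolding graded_part_def by blast
      then have card: "card S = i" "card \<sigma> = 1" by (auto simp: cell_grade_def c')
      then obtain x where x: "\<sigma> = {x}" by (auto simp: card_1_singleton_iff)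
      have "insert x S - {x} = S" using S x by auto
      then show False using zero[of "insert x S" x] S card x c c' by simp
    qed
    then show "f = 0" by (auto simp: fun_eq_iff)
  qed
  from coords_dim[OF this subA] show ?thesis using cardJ by (simp add: cycle_dim_def)
qed

subsection \<open>The graph \<open>B\<^sub>b\<close>\<close>

abbreviation "B_vert b \<equiv> fst (B_graph b)"
abbreviation "B_edge b \<equiv> snd (B_graph b)"

lemma B_vert_eq: "B_vert b = Inl ` {1..b} \<union> Inr ` {1..b}"
  by (simp add: B_graph_def)

lemma finite_B_vert: "finite (B_vert b)"
  by (simp add: B_vert_eq)

lemma card_B_vert: "card (B_vert b) = 2 * b"
  unfolding B_vert_eq by (subst card_Un_disjoint) (auto simp: card_image inj_on_def)

lemma B_edge_loops: "{x} \<notin> B_edge b"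
  by (auto simp: B_graph_def)

lemma B_edge_iff:
  assumes "x \<in> B_vert b" "y \<in> B_vert b"
  shows "{x, y} \<in> B_edge b \<longleftrightarrow> x \<noteq> y \<and> (\<nexists>i j. i \<noteq> j \<and> (x = Inl i \<and> y = Inr j \<or> x = Inr i \<and> y = Inl j))"
proof -
  have 1: "{Inl i, Inl j} \<in> B_edge b \<longleftrightarrow> i \<noteq> j" if "i \<in> {1..b}" "j \<in> {1..b}" for i j
    using that by (auto simp: B_graph_def doubleton_eq_iff) (metis linorder_neqE_nat)
  have 2: "{Inr i, Inr j} \<in> B_edge b \<longleftrightarrow> i \<noteq> j" if "i \<in> {1..b}" "j \<in> {1..b}" for i j
    using that by (auto simp: B_graph_def doubleton_eq_iff) (metis linorder_neqE_nat)
  have 3: "{Inl i, Inr j} \<in> B_edge b \<longleftrightarrow> i = j" if "i \<in> {1..b}" "j \<in> {1..b}" for i j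
    using that by (auto simp: B_graph_def doubleton_eq_iff)
  have 4: "{Inr i, Inl j} \<in> B_edge b \<longleftrightarrow> i = j" if "i \<in> {1..b}" "j \<in> {1..b}" for i j
    using 3[OF that(2,1)] by (auto simp: insert_commute)
  show ?thesis using assms 1 2 3 4 by (auto simp: B_vert_eq B_edge_loops)
qed

text \<open>The complement of \<open>B_b\<close> is the complete bipartite graph on the two sides
  minus the perfect matching of equal indices.\<close>

lemma nonadj_B:
  assumes "W \<subseteq> B_vert b"
  shows "nonadj (B_edge b) W =
    {(x, y). x \<in> W \<and> y \<in> W \<and> (\<exists>i j. i \<noteq> j \<and> (x = Inl i \<and> y = Inr j \<or> x = Inr i \<and> y = Inl j))}"
proof -
  have *: "x \<noteq> y \<and> {x, y} \<notin> B_edge b \<longleftrightarrow>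
      (\<exists>i j. i \<noteq> j \<and> (x = Inl i \<and> y = Inr j \<or> x = Inr i \<and> y = Inl j))" if "x \<in> W" "y \<in> W" for x y
    using B_edge_iff[of x b y] that assms by auto
  show ?thesis unfolding nonadj_def using * by (intro Collect_cong) (clarify, blast)
qed

text \<open>The number of components of the complement graph on left indices \<open>A\<close> and
  right indices \<open>B\<close>, a complete bipartite graph minus a matching. It is disconnected if
  a side is empty, if a side is one vertex whose partner is then isolated, or if two full pairs
  leave two disjoint edges.\<close>

definition comp_count :: "nat set \<Rightarrow> nat set \<Rightarrow> nat" where
  "comp_count A B = (if A = {} \<or> B = {} then card A + card B
     else if (\<exists>a. A = {a} \<and> a \<in> B) \<or> (\<exists>a. B = {a} \<and> a \<in> A) \<or> (A = B \<and> card A = 2) then 2 else 1)"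

lemma comp_retract_B:
  assumes W: "W \<subseteq> B_vert b" "W \<noteq> {}" and A: "A = Inl -` W" and B: "B = Inr -` W"
  shows "\<exists>\<kappa>. comp_retract (B_edge b) W \<kappa> \<and> card (\<kappa> ` W) = comp_count A B"
proof -
  let ?R = "nonadj (B_edge b) W"
  have "x \<in> W \<longleftrightarrow> x \<in> Inl ` A \<union> Inr ` B" for x by (cases x) (auto simp: A B)
  then have WAB: "W = Inl ` A \<union> Inr ` B" by blast
  have fin: "finite W" "finite A" "finite B"
    using W finite_B_vert finite_subset by (auto simp: A B intro!: finite_vimageI)
  have lr: "(Inl i, Inr j) \<in> ?R" "(Inr j, Inl i) \<in> ?R" if "i \<in> A" "j \<in> B" "i \<noteq> j" for i j
    using that unfolding nonadj_B[OF W(1)] by (auto simp: WAB)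
  have Rc: "\<exists>i j. i \<in> A \<and> j \<in> B \<and> i \<noteq> j \<and> (x = Inl i \<and> y = Inr j \<or> x = Inr j \<and> y = Inl i)"
    if "(x, y) \<in> ?R" for x y
    using that unfolding nonadj_B[OF W(1)] by (auto simp: A B)
  have retI: "comp_retract (B_edge b) W \<kappa>"
    if "\<And>x. x \<in> W \<Longrightarrow> (x, \<kappa> x) \<in> ?R\<^sup>*" "\<And>i j. i \<in> A \<Longrightarrow> j \<in> B \<Longrightarrow> i \<noteq> j \<Longrightarrow> \<kappa> (Inl i) = \<kappa> (Inr j)" for \<kappa>
    unfolding comp_retract_def using that(1) that(2) Rc by fastforce
  consider (e) "A = {} \<or> B = {}"
    | (l) a where "A = {a}" "a \<in> B" | (r) a where "B = {a}" "a \<in> A"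
    | (m) "A = B" "card A = 2"
    | (c) "A \<noteq> {}" "B \<noteq> {}" "\<nexists>a. A = {a} \<and> a \<in> B" "\<nexists>a. B = {a} \<and> a \<in> A" "\<not> (A = B \<and> card A = 2)"
    by blast
  then show ?thesis
  proof cases
    case e
    have "comp_retract (B_edge b) W id" by (rule retI) (use e in auto)
    moreover have "card (id ` W) = card A + card B"
      unfolding WAB using fin by (simp, subst card_Un_disjoint) (auto simp: card_image)
    ultimately show ?thesis using e by (auto simp: comp_count_def)
  next
    case l
    \<comment> \<open>The partner \<open>Inr a\<close> is isolated; every other vertex on the right
      is joined to \<open>Inl a\<close>.\<close>
    let ?\<kappa> = "\<lambda>x. if x = Inr a then x else Inl a"
    have "comp_retract (B_edge b) W ?\<kappa>"
    proof (rule retI)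
      fix x assume "x \<in> W"
      then show "(x, ?\<kappa> x) \<in> ?R\<^sup>*" using lr(2)[of a] l by (auto simp: WAB)
    qed (use l in auto)
    moreover have "?\<kappa> ` W = {Inr a, Inl a}" using l by (auto simp: WAB)
    then have "card (?\<kappa> ` W) = 2" by simp
    ultimately show ?thesis using l by (auto simp: comp_count_def)
  next
    case r
    let ?\<kappa> = "\<lambda>x. if x = Inl a then x else Inr a"
    have "comp_retract (B_edge b) W ?\<kappa>"
    proof (rule retI)
      fix x assume "x \<in> W"
      then show "(x, ?\<kappa> x) \<in> ?R\<^sup>*" using lr(1)[of _ a] r by (auto simp: WAB)
    qed (use r in auto)
    moreover have "?\<kappa> ` W = {Inl a, Inr a}" using r by (auto simp: WAB)
    then have "card (?\<kappa> ` W) = 2" by simp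
    ultimately show ?thesis using r by (auto simp: comp_count_def)
  next
    case m
    then obtain a c where ac: "A = {a, c}" "a \<noteq> c" by (auto simp: card_2_iff)
    \<comment> \<open>The two remaining edges join \<open>Inl a\<close> to \<open>Inr c\<close> and
      \<open>Inl c\<close> to \<open>Inr a\<close>.\<close>
    let ?\<kappa> = "\<lambda>x. if x = Inl a \<or> x = Inr c then Inl a else (Inl c :: nat + nat)"
    have "comp_retract (B_edge b) W ?\<kappa>"
    proof (rule retI)
      fix x assume "x \<in> W"
      then show "(x, ?\<kappa> x) \<in> ?R\<^sup>*" using lr(2)[of a c] lr(2)[of c a] m ac by (auto simp: WAB)
    qed (use m ac in auto)
    moreover have "?\<kappa> ` W = {Inl a, Inl c}" using m ac by (auto simp: WAB)
    then have "card (?\<kappa> ` W) = 2" using ac by simp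
    ultimately show ?thesis using m ac by (auto simp: comp_count_def)
  next
    case c
    \<comment> \<open>Two left vertices have a common right neighbour unless \<open>B\<close> is {i,
      i'}. In that case \<open>A\<close> differs from \<open>B\<close> and contains a third index
      \<open>k\<close>, which gives a path of length four.\<close>
    have LL: "(Inl i, Inl i') \<in> ?R\<^sup>*" if i: "i \<in> A" "i' \<in> A" for i i'
    proof (cases "i = i'")
      case False
      show ?thesis
      proof (cases "B \<subseteq> {i, i'}")
        case False
        then obtain j where "j \<in> B" "j \<noteq> i" "j \<noteq> i'" by blast
        then have "(Inl i, Inr j) \<in> ?R" "(Inr j, Inl i') \<in> ?R" using lr i by auto
        then show ?thesis by (rule converse_rtrancl_into_rtrancl[OF _ r_into_rtrancl])
      next
        case True
        \<comment> \<open>A one-element \<open>B\<close> inside \<open>A\<close> is excluded in this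
          case.\<close>
        have "B = {i, i'}" using True c i \<open>i \<noteq> i'\<close> by (cases "i \<in> B"; cases "i' \<in> B") auto
        then have "A \<noteq> {i, i'}" using c \<open>i \<noteq> i'\<close> by auto
        then obtain k where "k \<in> A" "k \<noteq> i" "k \<noteq> i'" using i by blast
        then have p: "(Inl i, Inr i') \<in> ?R" "(Inr i', Inl k) \<in> ?R" "(Inl k, Inr i) \<in> ?R" "(Inr i, Inl i') \<in> ?R"
          using lr i \<open>B = {i, i'}\<close> \<open>i \<noteq> i'\<close> by auto
        show ?thesis
          by (rule converse_rtrancl_into_rtrancl[OF p(1)] converse_rtrancl_into_rtrancl[OF p(2)]
            converse_rtrancl_into_rtrancl[OF p(3)] r_into_rtrancl[OF p(4)])+
      qed
    qed simp
    have RL: "\<exists>i\<in>A. (Inr j, Inl i) \<in> ?R" if "j \<in> B" for j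
    proof -
      have "\<not> A \<subseteq> {j}" using c that by auto
      then show ?thesis using lr(2) that by blast
    qed
    obtain a where a: "a \<in> A" using c by blast
    have "comp_retract (B_edge b) W (\<lambda>x. Inl a)"
    proof (rule retI)
      fix x assume "x \<in> W"
      then consider i where "x = Inl i" "i \<in> A" | j where "x = Inr j" "j \<in> B" by (auto simp: WAB)
      then show "(x, Inl a) \<in> ?R\<^sup>*"
        using LL a RL by cases (auto, meson converse_rtrancl_into_rtrancl)
    qed simp
    moreover have "(\<lambda>x. Inl a :: nat + nat) ` W = {Inl a}" using W by auto
    moreover have "comp_count A B = 1" using c by (auto simp: comp_count_def)
    ultimately show ?thesis by (metis card_1_singleton_iff One_nat_def)
  qed
qed

text \<open>Stated for two injections so that it serves both sides. Such a \<open>W\<close> consists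
  of a single vertex on one side, its partner, and \<open>i - 1\<close> further vertices on the
  partner's side. For \<open>i = 0\<close> the truncated subtraction would give \<open>b\<close>
  instead of 0.\<close>

lemma card_singleton_overlap:
  fixes f g :: "nat \<Rightarrow> 'v"
  assumes f: "inj f" and g: "inj g" and disj: "range f \<inter> range g = {}"
  shows "card {W. W \<subseteq> f ` {1..b} \<union> g ` {1..b} \<and> card W = Suc i \<and> (\<exists>a. f -` W = {a} \<and> a \<in> g -` W)} =
    (if i = 0 then 0 else b * ((b - 1) choose (i - 1)))"
proof -
  let ?X = "{W. W \<subseteq> f ` {1..b} \<union> g ` {1..b} \<and> card W = Suc i \<and> (\<exists>a. f -` W = {a} \<and> a \<in> g -` W)}"
  let ?Q = "\<lambda>a. {C. C \<subseteq> {1..b} - {a} \<and> card C = i - 1}"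
  define h where "h = (\<lambda>(a, C). insert (f a) (insert (g a) (g ` C)))"
  have fg: "f x \<noteq> g y" for x y using disj by (metis IntI empty_iff rangeI)
  have gi: "g x = g y \<longleftrightarrow> x = y" for x y using g by (auto simp: inj_def)
  have fi: "f x = f y \<longleftrightarrow> x = y" for x y using f by (auto simp: inj_def)
  have vf: "f -` h (a, C) = {a}" for a C by (auto simp: h_def fi fg)
  have vg: "g -` h (a, C) = insert a C" for a C by (auto simp: h_def gi fg[symmetric])
  have inj: "inj_on h (Sigma {1..b} ?Q)"
  proof (rule inj_onI)
    fix p q assume p: "p \<in> Sigma {1..b} ?Q" "q \<in> Sigma {1..b} ?Q" and eq: "h p = h q"
    obtain a C a' C' where pq: "p = (a, C)" "q = (a', C')" by force
    have "a = a'" using vf[of a C] vf[of a' C'] eq by (simp add: pq)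
    moreover have "insert a C = insert a' C'" using vg[of a C] vg[of a' C'] eq by (simp add: pq)
    ultimately show "p = q" using p by (auto simp: pq)
  qed
  have cardh: "card (h (a, C)) = Suc (Suc (card C))" if "a \<notin> C" "finite C" for a C
  proof -
    have "f a \<notin> insert (g a) (g ` C)" "g a \<notin> g ` C" using that fg gi by auto
    then show ?thesis using that by (simp add: h_def card_image inj_on_subset[OF g])
  qed
  have X: "?X = (if i = 0 then {} else h ` Sigma {1..b} ?Q)"
  proof (intro equalityI subsetI)
    fix W assume W: "W \<in> ?X"
    then obtain a where a: "f -` W = {a}" "g a \<in> W" by auto
    have "f a \<in> W" using a by auto
    then have ab: "a \<in> {1..b}" using W by (auto simp: fi fg)
    define C where "C = g -` W - {a}"
    have "g -` W \<subseteq> {1..b}" using W by (auto simp: gi fg[symmetric])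
    then have C: "C \<subseteq> {1..b} - {a}" "finite C" using finite_subset by (auto simp: C_def)
    have Wh: "W = h (a, C)"
    proof (intro equalityI subsetI)
      fix x assume x: "x \<in> W"
      then consider y where "x = f y" | y where "x = g y" using W by auto
      then show "x \<in> h (a, C)"
      proof cases
        case 1
        then have "y \<in> f -` W" using x by simp
        then show ?thesis using a 1 by (simp add: h_def)
      next
        case 2
        then show ?thesis using x by (auto simp: h_def C_def)
      qed
    next
      fix x assume "x \<in> h (a, C)"
      then show "x \<in> W" using a \<open>f a \<in> W\<close> by (auto simp: h_def C_def)
    qed
    have "Suc i = Suc (Suc (card C))" using W cardh[of a C] C unfolding Wh by auto
    then show "W \<in> (if i = 0 then {} else h ` Sigma {1..b} ?Q)"
      using Wh C ab by auto
  next
    fix W assume W: "W \<in> (if i = 0 then {} else h ` Sigma {1..b} ?Q)"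
    then obtain a C where C: "i \<noteq> 0" "a \<in> {1..b}" "C \<subseteq> {1..b} - {a}" "card C = i - 1" "W = h (a, C)"
      by (auto split: if_splits)
    have "finite C" using C(3) finite_subset by blast
    then have "card W = Suc i" using C cardh[of a C] by auto
    moreover have "W \<subseteq> f ` {1..b} \<union> g ` {1..b}" using C by (auto simp: h_def)
    moreover have "f -` W = {a}" "a \<in> g -` W" unfolding C(5) vf vg by blast+
    ultimately show "W \<in> ?X" by blast
  qed
  have "card (h ` Sigma {1..b} ?Q) = (\<Sum>a\<in>{1..b}. card (?Q a))"
    unfolding card_image[OF inj] by (intro card_SigmaI) auto
  also have "\<dots> = (\<Sum>a\<in>{1..b}. (b - 1) choose (i - 1))"
    by (rule sum.cong) (auto simp: n_subsets)
  finally show ?thesis unfolding X by simp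
qed

text \<open>The origin of \<open>lam\<close>. A vertex set has one component plus corrections:
  \<open>i\<close> more if it lies on one side (\<open>?X1\<close>, \<open>?X2\<close>), one more
  for a singleton side with its partner present (\<open>?X3\<close>, \<open>?X4\<close>), and one
  more for two full pairs (\<open>?X6\<close>). A set that is a single pair is counted in both
  \<open>?X3\<close> and \<open>?X4\<close>; removing it once (\<open>?X5\<close>) gives the special
  value at \<open>i = 1\<close>, and \<open>?X6\<close> gives the one at
  \<open>i = 3\<close>.\<close>

lemma sum_comp_count:
  assumes b: "b \<ge> 3"
  shows "(\<Sum>W | W \<subseteq> B_vert b \<and> card W = Suc i. int (comp_count (Inl -` W) (Inr -` W))) =
    int ((2 * b) choose Suc i) + lam b i"
proof -
  let ?X = "{W. W \<subseteq> B_vert b \<and> card W = Suc i}"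
  let ?X1 = "{W\<in>?X. Inr -` W = {}}" and ?X2 = "{W\<in>?X. Inl -` W = {}}"
  let ?X3 = "{W\<in>?X. \<exists>a. Inl -` W = {a} \<and> a \<in> Inr -` W}" and ?X4 = "{W\<in>?X. \<exists>a. Inr -` W = {a} \<and> a \<in> Inl -` W}"
  let ?X5 = "{W\<in>?X. \<exists>a. Inl -` W = {a} \<and> Inr -` W = {a}}"
  let ?X6 = "{W\<in>?X. Inl -` W = Inr -` W \<and> card (Inl -` W) = 2}"
  have fin: "finite ?X" by (rule finite_subset[of _ "Pow (B_vert b)"]) (use finite_B_vert in auto)
  have "x \<in> W \<longleftrightarrow> x \<in> Inl ` (Inl -` W) \<union> Inr ` (Inr -` W)" for x and W :: "(nat + nat) set"
    by (cases x) auto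
  then have split: "W = Inl ` (Inl -` W) \<union> Inr ` (Inr -` W)" for W :: "(nat + nat) set" by blast
  have cW: "card W = card (Inl -` W) + card (Inr -` W)" if "W \<in> ?X" for W
  proof -
    have f: "finite W" using that finite_B_vert finite_subset by auto
    have "card W = card (Inl ` (Inl -` W) \<union> Inr ` (Inr -` W))" using split by metis
    also have "\<dots> = card (Inl ` (Inl -` W) :: (nat + nat) set) + card (Inr ` (Inr -` W) :: (nat + nat) set)"
      by (rule card_Un_disjoint) (use f in \<open>auto intro!: finite_vimageI\<close>)
    finally show ?thesis by (simp add: card_image del: image_vimage_eq)
  qed
  have point: "int (comp_count (Inl -` W) (Inr -` W)) = 1 + (if W \<in> ?X1 then int i else 0) + (if W \<in> ?X2 then int i else 0)
      + (if W \<in> ?X3 then 1 else 0) + (if W \<in> ?X4 then 1 else 0) - (if W \<in> ?X5 then 1 else 0) + (if W \<in> ?X6 then 1 else 0)"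
    if W: "W \<in> ?X" for W
  proof -
    define A B where "A = Inl -` W" "B = Inr -` W"
    have c: "card A + card B = Suc i" using cW[OF W] W by (simp add: A_B_def)
    have m: "W \<in> ?X1 \<longleftrightarrow> B = {}" "W \<in> ?X2 \<longleftrightarrow> A = {}" "W \<in> ?X3 \<longleftrightarrow> (\<exists>a. A = {a} \<and> a \<in> B)"
      "W \<in> ?X4 \<longleftrightarrow> (\<exists>a. B = {a} \<and> a \<in> A)" "W \<in> ?X5 \<longleftrightarrow> (\<exists>a. A = {a} \<and> B = {a})"
      "W \<in> ?X6 \<longleftrightarrow> A = B \<and> card A = 2"
      using W unfolding A_B_def by blast+
    consider "A = {}" | "A \<noteq> {}" "B = {}" | "A \<noteq> {}" "B \<noteq> {}" by blast
    then show ?thesis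
      unfolding m A_B_def(1)[symmetric] A_B_def(2)[symmetric]
    proof cases
      case 1
      then have "B \<noteq> {}" using c by auto
      then show "int (comp_count A B) = 1 + (if B = {} then int i else 0) + (if A = {} then int i else 0)
        + (if \<exists>a. A = {a} \<and> a \<in> B then 1 else 0) + (if \<exists>a. B = {a} \<and> a \<in> A then 1 else 0)
        - (if \<exists>a. A = {a} \<and> B = {a} then 1 else 0) + (if A = B \<and> card A = 2 then 1 else 0)"
        using 1 c by (auto simp: comp_count_def)
    next
      case 2
      then show "int (comp_count A B) = 1 + (if B = {} then int i else 0) + (if A = {} then int i else 0)
        + (if \<exists>a. A = {a} \<and> a \<in> B then 1 else 0) + (if \<exists>a. B = {a} \<and> a \<in> A then 1 else 0)
        - (if \<exists>a. A = {a} \<and> B = {a} then 1 else 0) + (if A = B \<and> card A = 2 then 1 else 0)"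
        using c by (auto simp: comp_count_def)
    next
      case 3
      have x: "A = B \<and> card A = 2 \<Longrightarrow> \<not> (\<exists>a. A = {a} \<and> a \<in> B) \<and> \<not> (\<exists>a. B = {a} \<and> a \<in> A)" by auto
      have y: "(\<exists>a. A = {a} \<and> B = {a}) \<longleftrightarrow> (\<exists>a. A = {a} \<and> a \<in> B) \<and> (\<exists>a. B = {a} \<and> a \<in> A)" by auto
      show "int (comp_count A B) = 1 + (if B = {} then int i else 0) + (if A = {} then int i else 0)
        + (if \<exists>a. A = {a} \<and> a \<in> B then 1 else 0) + (if \<exists>a. B = {a} \<and> a \<in> A then 1 else 0)
        - (if \<exists>a. A = {a} \<and> B = {a} then 1 else 0) + (if A = B \<and> card A = 2 then 1 else 0)"
        using 3 x unfolding y comp_count_def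
        by (cases "\<exists>a. A = {a} \<and> a \<in> B"; cases "\<exists>a. B = {a} \<and> a \<in> A"; cases "A = B \<and> card A = 2")
          (simp_all only: if_True if_False simp_thms, auto)
    qed
  qed
  have ind: "(\<Sum>W\<in>?X. if W \<in> Y then c else 0) = int (card Y) * c" if "Y \<subseteq> ?X" for Y and c :: int
  proof -
    have "(\<Sum>W\<in>?X. if W \<in> Y then c else 0) = (\<Sum>W\<in>?X \<inter> Y. c)" by (rule sum.inter_restrict[OF fin, symmetric])
    also have "?X \<inter> Y = Y" using that by blast
    finally show ?thesis by simp
  qed
  have "(\<Sum>W\<in>?X. int (comp_count (Inl -` W) (Inr -` W))) = (\<Sum>W\<in>?X. 1 + (if W \<in> ?X1 then int i else 0) + (if W \<in> ?X2 then int i else 0)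
      + (if W \<in> ?X3 then 1 else 0) + (if W \<in> ?X4 then 1 else 0) - (if W \<in> ?X5 then 1 else 0) + (if W \<in> ?X6 then 1 else 0))"
    by (rule sum.cong[OF refl]) (rule point)
  also have "\<dots> = int (card ?X) + int (card ?X1) * int i + int (card ?X2) * int i + int (card ?X3) + int (card ?X4)
      - int (card ?X5) + int (card ?X6)"
    unfolding sum.distrib sum_subtractf by (subst ind, blast)+ simp
  finally have S: "(\<Sum>W\<in>?X. int (comp_count (Inl -` W) (Inr -` W))) = int (card ?X) + int (card ?X1) * int i
     + int (card ?X2) * int i + int (card ?X3) + int (card ?X4) - int (card ?X5) + int (card ?X6)" .
  have c0: "card ?X = (2 * b) choose Suc i"
    using n_subsets[OF finite_B_vert, of b "Suc i"] card_B_vert by simp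
  have "?X1 = {W. W \<subseteq> Inl ` {1..b} \<and> card W = Suc i}" by (auto simp: B_vert_eq vimage_def)
  then have c1: "card ?X1 = b choose Suc i"
    using n_subsets[of "Inl ` {1..b} :: (nat + nat) set" "Suc i"] by (simp add: card_image)
  have "?X2 = {W. W \<subseteq> Inr ` {1..b} \<and> card W = Suc i}" by (auto simp: B_vert_eq vimage_def)
  then have c2: "card ?X2 = b choose Suc i"
    using n_subsets[of "Inr ` {1..b} :: (nat + nat) set" "Suc i"] by (simp add: card_image)
  have rr: "range (Inl :: nat \<Rightarrow> nat + nat) \<inter> range (Inr :: nat \<Rightarrow> nat + nat) = {}"
    "range (Inr :: nat \<Rightarrow> nat + nat) \<inter> range (Inl :: nat \<Rightarrow> nat + nat) = {}" by auto
  have c3: "card ?X3 = (if i = 0 then 0 else b * ((b - 1) choose (i - 1)))"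
    using card_singleton_overlap[OF inj_Inl inj_Inr rr(1), of b i] by (simp add: B_vert_eq conj_assoc)
  have c4: "card ?X4 = (if i = 0 then 0 else b * ((b - 1) choose (i - 1)))"
    using card_singleton_overlap[OF inj_Inr inj_Inl rr(2), of b i] by (simp add: B_vert_eq conj_assoc Un_commute)
  have c5: "card ?X5 = (if i = 1 then b else 0)"
  proof -
    have "?X5 = (if i = 1 then (\<lambda>a. {Inl a, Inr a}) ` {1..b} else {})"
    proof (intro equalityI subsetI)
      fix W assume W: "W \<in> ?X5"
      then obtain a where a: "Inl -` W = {a}" "Inr -` W = {a}" by blast
      then have Wa: "W = {Inl a, Inr a}" using split[of W] by auto
      moreover have "i = 1" using cW[of W] W a by auto
      moreover have "a \<in> {1..b}" using W Wa by (auto simp: B_vert_eq)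
      ultimately show "W \<in> (if i = 1 then (\<lambda>a. {Inl a, Inr a}) ` {1..b} else {})" using Wa by auto
    next
      fix W assume "W \<in> (if i = 1 then (\<lambda>a. {Inl a, Inr a :: nat + nat}) ` {1..b} else {})"
      then show "W \<in> ?X5" by (auto simp: B_vert_eq split: if_splits)
    qed
    moreover have "inj_on (\<lambda>a. {Inl a, Inr a :: nat + nat}) {1..b}" by (auto simp: inj_on_def doubleton_eq_iff)
    ultimately show ?thesis by (simp add: card_image)
  qed
  have c6: "card ?X6 = (if i = 3 then b choose 2 else 0)"
  proof -
    let ?h = "\<lambda>A. Inl ` A \<union> Inr ` A :: (nat + nat) set"
    let ?Q = "{A. A \<subseteq> {1..b} \<and> card A = 2}"
    have v: "Inl -` ?h A = A" "Inr -` ?h A = A" for A by auto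
    have "?X6 = (if i = 3 then ?h ` ?Q else {})"
    proof (intro equalityI subsetI)
      fix W assume W: "W \<in> ?X6"
      then have "W = ?h (Inl -` W)" using split[of W] by auto
      moreover have "i = 3" using cW[of W] W by auto
      moreover have "Inl -` W \<in> ?Q" using W by (auto simp: B_vert_eq)
      ultimately show "W \<in> (if i = 3 then ?h ` ?Q else {})" by (simp del: image_vimage_eq)
    next
      fix W assume "W \<in> (if i = 3 then ?h ` ?Q else {})"
      then obtain A where A: "i = 3" "A \<subseteq> {1..b}" "card A = 2" "W = ?h A" by (auto split: if_splits)
      have "finite A" using A(2) finite_subset by blast
      then have "card W = 4" unfolding A(4) using A(3) by (subst card_Un_disjoint) (auto simp: card_image)
      then show "W \<in> ?X6" using A v[of A] by (auto simp: B_vert_eq)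
    qed
    moreover have "inj_on ?h ?Q" by (rule inj_onI) (metis v(1))
    ultimately show ?thesis by (simp add: card_image n_subsets)
  qed
  have "int (b choose Suc i) * int i + int (b choose Suc i) * int i
      + int (if i = 0 then 0 else b * ((b - 1) choose (i - 1))) + int (if i = 0 then 0 else b * ((b - 1) choose (i - 1)))
      - int (if i = 1 then b else 0) + int (if i = 3 then b choose 2 else 0) = lam b i" (is "?L = _")
  proof (cases "i = 0")
    case True
    then show ?thesis by (simp add: lam_def)
  next
    case False
    \<comment> \<open>Beyond \<open>2 * b - 2\<close> the value of \<open>lam\<close> is zero by
      definition, and the binomials vanish as well. The bound on \<open>b\<close> also keeps the
      special indices 1 and 3 inside the range.\<close>
    have big: "b choose Suc i = 0" "(b - 1) choose (i - 1) = 0" if "i > 2 * b - 2"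
      using that b by (auto intro!: binomial_eq_0)
    show ?thesis
    proof (cases "i > 2 * b - 2")
      case True
      then have "i \<noteq> Suc 0" "i \<noteq> 3" "b - Suc 0 < i - Suc 0" using b by auto
      then show ?thesis using True b False by (simp add: lam_def big[OF True])
    next
      case nb: False
      consider "i = 1" | "i = 3" | "i \<noteq> 1" "i \<noteq> 3" by blast
      then show ?thesis
      proof cases
        case 1
        then show ?thesis using b by (simp add: lam_def numeral_2_eq_2)
      next
        case 2
        then show ?thesis using b by (simp add: lam_def)
      next
        case 3
        then show ?thesis using b False nb by (simp add: lam_def)
      qed
    qed
  qed
  from this[symmetric] show ?thesis unfolding S c0 c1 c2 c3 c4 c5 c6 by (simp only: algebra_simps)
qed

lemma cycle_dim_linear_strand_B:
  fixes K :: "'k::field itself"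
  assumes b: "b \<ge> 3" and lt: "strict_total lt"
  shows "int (cycle_dim K lt (B_vert b) (B_edge b) i (Suc i)) = int ((2 * b) choose Suc i) + lam b i"
proof -
  have "\<forall>W. \<exists>\<kappa>. W \<subseteq> B_vert b \<and> card W = Suc i \<longrightarrow>
      comp_retract (B_edge b) W \<kappa> \<and> card (\<kappa> ` W) = comp_count (Inl -` W) (Inr -` W)"
  proof
    fix W
    show "\<exists>\<kappa>. W \<subseteq> B_vert b \<and> card W = Suc i \<longrightarrow>
      comp_retract (B_edge b) W \<kappa> \<and> card (\<kappa> ` W) = comp_count (Inl -` W) (Inr -` W)"
      using comp_retract_B[of W b "Inl -` W" "Inr -` W"] by (cases "W = {}") auto
  qed
  then obtain \<kappa> where \<kappa>: "\<And>W. W \<subseteq> B_vert b \<Longrightarrow> card W = Suc i \<Longrightarrow>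
      comp_retract (B_edge b) W (\<kappa> W) \<and> card (\<kappa> W ` W) = comp_count (Inl -` W) (Inr -` W)"
    by metis
  have "cycle_dim K lt (B_vert b) (B_edge b) i (Suc i) =
      (\<Sum>W | W \<subseteq> B_vert b \<and> card W = Suc i. card (\<kappa> W ` W))"
    by (rule cycle_dim_linear_strand[OF finite_B_vert lt B_edge_loops]) (use \<kappa> in blast)
  also have "\<dots> = (\<Sum>W | W \<subseteq> B_vert b \<and> card W = Suc i. comp_count (Inl -` W) (Inr -` W))"
    by (rule sum.cong) (use \<kappa> in auto)
  finally show ?thesis using sum_comp_count[OF b, of i] by simp
qed

lemma indep_B_card:
  shows "{\<sigma>. \<sigma> \<subseteq> B_vert b \<and> indep (B_edge b) \<sigma> \<and> card \<sigma> = 0} = {{}}"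
    and "{\<sigma>. \<sigma> \<subseteq> B_vert b \<and> indep (B_edge b) \<sigma> \<and> card \<sigma> = 1} = (\<lambda>x. {x}) ` B_vert b"
    and "{\<sigma>. \<sigma> \<subseteq> B_vert b \<and> indep (B_edge b) \<sigma> \<and> card \<sigma> = 2} =
      (\<lambda>(i, j). {Inl i, Inr j}) ` ({1..b} \<times> {1..b} - (\<lambda>i. (i, i)) ` {1..b})"
    and "q \<ge> 3 \<Longrightarrow> {\<sigma>. \<sigma> \<subseteq> B_vert b \<and> indep (B_edge b) \<sigma> \<and> card \<sigma> = q} = {}"
proof -
  have fin: "finite \<sigma>" if "\<sigma> \<subseteq> B_vert b" for \<sigma> using that finite_B_vert finite_subset by blast
  show "{\<sigma>. \<sigma> \<subseteq> B_vert b \<and> indep (B_edge b) \<sigma> \<and> card \<sigma> = 0} = {{}}"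
  proof (intro equalityI subsetI)
    fix \<sigma> assume s: "\<sigma> \<in> {\<sigma>. \<sigma> \<subseteq> B_vert b \<and> indep (B_edge b) \<sigma> \<and> card \<sigma> = 0}"
    then have "finite \<sigma>" using fin by blast
    then show "\<sigma> \<in> {{}}" using s by simp
  qed (simp add: indep_def)
  show "{\<sigma>. \<sigma> \<subseteq> B_vert b \<and> indep (B_edge b) \<sigma> \<and> card \<sigma> = 1} = (\<lambda>x. {x}) ` B_vert b"
    using B_edge_loops by (auto simp: indep_def card_1_singleton_iff)
  have pair: "{x, y} \<in> B_edge b \<longleftrightarrow> x \<noteq> y \<and> (\<nexists>i j. i \<noteq> j \<and> (x = Inl i \<and> y = Inr j \<or> x = Inr i \<and> y = Inl j))"
    if "x \<in> \<sigma>" "y \<in> \<sigma>" "\<sigma> \<subseteq> B_vert b" for x y \<sigma>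
    using that by (intro B_edge_iff) auto
  show "{\<sigma>. \<sigma> \<subseteq> B_vert b \<and> indep (B_edge b) \<sigma> \<and> card \<sigma> = 2} =
      (\<lambda>(i, j). {Inl i, Inr j}) ` ({1..b} \<times> {1..b} - (\<lambda>i. (i, i)) ` {1..b})" (is "?L = ?R")
  proof (intro equalityI subsetI)
    fix \<sigma> assume s: "\<sigma> \<in> ?L"
    then obtain x y where xy: "\<sigma> = {x, y}" "x \<noteq> y" by (auto simp: card_2_iff)
    have "{x, y} \<notin> B_edge b" using s by (auto simp: xy indep_def)
    then obtain i j where ij: "i \<noteq> j" "x = Inl i \<and> y = Inr j \<or> x = Inr i \<and> y = Inl j"
      using pair[of x \<sigma> y] s xy by auto
    then have "\<sigma> = {Inl i, Inr j} \<and> i \<in> {1..b} \<and> j \<in> {1..b} \<or> \<sigma> = {Inl j, Inr i} \<and> i \<in> {1..b} \<and> j \<in> {1..b}"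
      using s xy by (auto simp: B_vert_eq)
    then obtain i' j' where "\<sigma> = {Inl i', Inr j'}" "i' \<in> {1..b}" "j' \<in> {1..b}" "i' \<noteq> j'"
      using ij(1) by metis
    then show "\<sigma> \<in> ?R" by (intro image_eqI[of _ _ "(i', j')"]) auto
  next
    fix \<sigma> assume "\<sigma> \<in> ?R"
    then obtain p where p: "p \<in> {1..b} \<times> {1..b} - (\<lambda>i. (i, i)) ` {1..b}" "\<sigma> = (case p of (i, j) \<Rightarrow> {Inl i, Inr j})"
      by blast
    obtain i j where pij: "p = (i, j)" by force
    then have ij: "\<sigma> = {Inl i, Inr j}" "i \<in> {1..b}" "j \<in> {1..b}" "i \<noteq> j" using p by auto
    then have sub: "\<sigma> \<subseteq> B_vert b" by (auto simp: B_vert_eq)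
    then show "\<sigma> \<in> ?L" using ij pair[OF _ _ sub] by (auto simp: indep_def)
  qed
  show "{\<sigma>. \<sigma> \<subseteq> B_vert b \<and> indep (B_edge b) \<sigma> \<and> card \<sigma> = q} = {}" if q: "q \<ge> 3"
  proof -
    have "False" if s: "\<sigma> \<subseteq> B_vert b" "indep (B_edge b) \<sigma>" "card \<sigma> = q" for \<sigma>
    proof -
      have side: "isl x \<noteq> isl y" if "x \<in> \<sigma>" "y \<in> \<sigma>" "x \<noteq> y" for x y
        using pair[OF that(1,2) s(1)] that s(2) by (auto simp: indep_def)
      \<comment> \<open>Each side is a clique, so an independent set has at most one vertex on
        each.\<close>
      have "inj_on isl \<sigma>" using side by (auto simp: inj_on_def)
      then have "card \<sigma> \<le> card (UNIV :: bool set)" by (intro card_inj_on_le) auto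
      then show False using s q by simp
    qed
    then show ?thesis by blast
  qed
qed

lemma card_indep_pairs_B:
  "card ((\<lambda>(i, j). {Inl i, Inr j :: nat + nat}) ` ({1..b} \<times> {1..b} - (\<lambda>i. (i, i)) ` {1..b})) = b * b - b"
proof -
  have "inj_on (\<lambda>(i, j). {Inl i, Inr j :: nat + nat}) S" for S by (auto simp: inj_on_def doubleton_eq_iff)
  then have "card ((\<lambda>(i, j). {Inl i, Inr j :: nat + nat}) ` ({1..b} \<times> {1..b} - (\<lambda>i. (i, i)) ` {1..b})) =
    card ({1..b} \<times> {1..b} - (\<lambda>i. (i, i)) ` {1..b})" by (rule card_image)
  also have "\<dots> = card ({1..b} \<times> {1..b}) - card ((\<lambda>i. (i, i)) ` {1..b})"
    by (rule card_Diff_subset) auto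
  also have "\<dots> = b * b - b" by (simp add: card_image inj_on_def)
  finally show ?thesis .
qed

lemma cell_count_B:
  "cell_count (B_vert b) (B_edge b) i i = (2 * b) choose i"
  "cell_count (B_vert b) (B_edge b) i (i + 1) = 2 * b * ((2 * b - 1) choose i)"
  "cell_count (B_vert b) (B_edge b) i (i + 2) = (b * b - b) * ((2 * b - 2) choose i)"
  "q \<ge> 3 \<Longrightarrow> cell_count (B_vert b) (B_edge b) i (i + q) = 0"
proof -
  note cc = cell_count_eq[OF finite_B_vert, of b "B_edge b" i]
  show "cell_count (B_vert b) (B_edge b) i i = (2 * b) choose i"
    using cc[of 0] unfolding indep_B_card(1) card_B_vert by simp
  show "cell_count (B_vert b) (B_edge b) i (i + 1) = 2 * b * ((2 * b - 1) choose i)"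
    using cc[of 1] unfolding indep_B_card(2) card_B_vert by (simp add: card_image card_B_vert)
  show "cell_count (B_vert b) (B_edge b) i (i + 2) = (b * b - b) * ((2 * b - 2) choose i)"
    using cc[of 2] unfolding indep_B_card(3) card_B_vert card_indep_pairs_B .
  show "cell_count (B_vert b) (B_edge b) i (i + q) = 0" if "q \<ge> 3"
    using cc[of q] unfolding indep_B_card(4)[OF that] by simp
qed

text \<open>The left side is what cell counts and the linear strand give for internal degree
  \<open>i + 2\<close>. Pascal's rule with \<open>m = 2 * b - 2\<close> turns all binomials into
  those of \<open>m\<close>, with coefficients \<open>b^2 - 3 b + 1\<close>, \<open>2 - 2 b\<close>
  and 1; this is the shape of \<open>mu\<close>.\<close>

lemma mu_alt:
  assumes b: "b \<ge> 3"
  shows "int ((b * b - b) * ((2 * b - 2) choose i)) + int ((2 * b) choose (i + 2)) + lam b (i + 1)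
    - int (2 * b * ((2 * b - 1) choose (i + 1))) = mu b i"
proof -
  define m where "m = 2 * b - 2"
  have m: "2 * b = Suc (Suc m)" "m = 2 * b - 2" using b by (simp_all add: m_def)
  have m1: "2 * b - 1 = Suc m" using m by simp
  have bb: "int (b * b - b) = int b * int b - int b" using b by (simp add: of_nat_diff)
  have pas: "Suc (Suc m) choose (i + 2) = (m choose i) + 2 * (m choose (i + 1)) + (m choose (i + 2))"
    "Suc m choose (i + 1) = (m choose i) + (m choose (i + 1))" by (simp_all add: numeral_2_eq_2)
  have "int ((b * b - b) * (m choose i)) + int ((2 * b) choose (i + 2)) + lam b (i + 1)
    - int (2 * b * ((2 * b - 1) choose (i + 1))) =
    (int b * int b - int b) * int (m choose i) + int ((m choose i) + 2 * (m choose (i + 1)) + (m choose (i + 2))) + lam b (i + 1)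
    - 2 * int b * int ((m choose i) + (m choose (i + 1)))"
    unfolding m1 pas[symmetric] m(1)[symmetric] of_nat_mult bb by simp
  also have "\<dots> = mu b i"
    unfolding mu_def m(2)[symmetric] by (simp add: algebra_simps power2_eq_square)
  finally show ?thesis unfolding m(2) .
qed

lemma uv_coeff_P_poly:
  fixes i d :: nat
  shows "uv_coeff (P_poly b) i d = (if i = 0 \<and> d = 0 then 1 else 0)
     + (if 1 \<le> i \<and> i \<le> 2 * b - 2 \<and> d = i + 1 then lam b i else 0)
     + (if 1 \<le> i \<and> i \<le> 2 * b - 2 \<and> d = i + 2 then mu b i else 0)"
proof -
  have 1: "uv_coeff 1 i d = (if i = 0 \<and> d = 0 then 1 else 0)" by (auto simp: uv_coeff_def)
  have sumk: "(\<Sum>r = 1..2 * b - 2. if i = r \<and> d = r + k then f r else 0) =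
      (if 1 \<le> i \<and> i \<le> 2 * b - 2 \<and> d = i + k then f i else 0)" for f :: "nat \<Rightarrow> int" and k
  proof -
    have "(\<Sum>r = 1..2 * b - 2. if i = r \<and> d = r + k then f r else 0) =
      (\<Sum>r = 1..2 * b - 2. if i = r then (if d = i + k then f i else 0) else 0)"
      by (rule sum.cong) auto
    then show ?thesis by simp
  qed
  show ?thesis unfolding P_poly_def uv_coeff_simps uv_coeff_sum uv_coeff_monom 1 sumk ..
qed

text \<open>A cell has at most two monomial vertices, so everything happens on the diagonals where
  \<open>d - i\<close> is 0, 1 or 2, and each is evaluated by
  \<open>uv_coeff_cell_poly\<close>.\<close>

lemma cell_poly_B:
  fixes K :: "'k::field itself"
  assumes b: "b \<ge> 3" and lt: "strict_total lt"
  shows "cell_poly K lt (B_vert b) (B_edge b) = P_poly b"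
proof (rule uv_poly_eqI)
  fix i d :: nat
  let ?z = "cycle_dim K lt (B_vert b) (B_edge b)" and ?n = "cell_count (B_vert b) (B_edge b)"
  note coeff = uv_coeff_cell_poly[OF finite_B_vert[of b] lt, of K "B_edge b" i d]
  have z0: "?z j k = 0" if "?n j k = 0" for j k using cycle_dim_no_cells[OF that finite_B_vert] .
  have zfull: "?z j k = ?n j k" if "j = 0 \<or> ?n (j - 1) k = 0" for j k
    using cycle_dim_full[OF finite_B_vert lt that] .
  have big: "(2 * b) choose j = 0" if "j > 2 * b" for j using that by simp
  consider (below) "d < i" | (diag) "d = i" | (lin) "d = i + 1" | (quad) "d = i + 2" | (high) q where "d = i + q" "q \<ge> 3"
  proof -
    consider "d < i" | q where "d = i + q" using le_Suc_ex[of i d] by (cases "d < i") auto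
    then show thesis
    proof cases
      case 2
      then show thesis using that by (cases "q = 0 \<or> q = 1 \<or> q = 2") auto
    qed (use that in blast)
  qed
  then show "uv_coeff (cell_poly K lt (B_vert b) (B_edge b)) i d = uv_coeff (P_poly b) i d"
  proof cases
    case below
    then have "?n i d = 0" "?n (Suc i) d = 0" by (simp_all add: cell_count_below)
    then show ?thesis unfolding coeff using below z0 by (simp add: uv_coeff_P_poly)
  next
    case diag
    then have n: "?n (Suc i) d = 0" by (simp add: cell_count_below)
    have "?z i i = (if i = 0 then 1 else 0)"
    proof (cases i)
      case 0
      then show ?thesis using zfull[of 0 0] cell_count_B(1)[of b 0] by simp
    next
      case (Suc k)
      then show ?thesis using cycle_dim_diagonal[OF finite_B_vert B_edge_loops] by simp
    qed
    then show ?thesis unfolding coeff using diag n z0[OF n] by (simp add: uv_coeff_P_poly)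
  next
    case lin
    \<comment> \<open>With no cycles one step higher, the binomial coefficient in the linear strand
      cancels against the cell count, and \<open>lam b i\<close> remains.\<close>
    have "?z (Suc i) (Suc i) = 0" using cycle_dim_diagonal[OF finite_B_vert B_edge_loops] .
    moreover have "int (?z i (Suc i)) = int ((2 * b) choose Suc i) + lam b i"
      by (rule cycle_dim_linear_strand_B[OF b lt])
    ultimately have "uv_coeff (cell_poly K lt (B_vert b) (B_edge b)) i d = lam b i"
      unfolding coeff using cell_count_B(1)[of b "Suc i"] lin by simp
    then show ?thesis using lin by (auto simp: uv_coeff_P_poly lam_def)
  next
    case quad
    \<comment> \<open>One step below lie cells whose monomial part would be an independent triple.
      There are none, so all chains here are cycles.\<close>
    have "?n (i - 1) (i - 1 + 3) = 0" using cell_count_B(4)[of 3] by simp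
    then have "i = 0 \<or> ?n (i - 1) d = 0" using quad by (cases i) (auto simp: numeral_eq_Suc)
    then have "?z i d = (b * b - b) * ((2 * b - 2) choose i)" using zfull cell_count_B(3) quad by simp
    moreover have "int (?z (Suc i) d) = int ((2 * b) choose (i + 2)) + lam b (i + 1)"
      using cycle_dim_linear_strand_B[OF b lt, of K "Suc i"] quad by simp
    moreover have "?n (Suc i) d = 2 * b * ((2 * b - 1) choose (i + 1))"
      using cell_count_B(2)[of b "Suc i"] quad by simp
    ultimately have c: "uv_coeff (cell_poly K lt (B_vert b) (B_edge b)) i d = mu b i"
      unfolding coeff mu_alt[OF b, of i, symmetric] by simp
    have "mu b i = 0" if "\<not> (1 \<le> i \<and> i \<le> 2 * b - 2)"
    \<comment> \<open>At \<open>i = 0\<close> the vanishing is a genuine cancellation among the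
      summands, which \<open>P_poly\<close> presupposes by starting its second sum at 1.\<close>
    proof (cases "i = 0")
      case True
      have p: "int (b choose 2) * 2 = int b * int b - int b"
      proof -
        have "2 * (b choose 2) = b * (b - 1)" using times_binomial_minus1_eq[of 2 b] by simp
        then have "int (2 * (b choose 2)) = int (b * (b - 1))" by simp
        then show ?thesis using b by (simp add: of_nat_diff algebra_simps)
      qed
      have t: "int (2 * b * (2 * b - 1)) = 2 * int b * (2 * int b - 1)"
        using b by (cases b) (simp_all add: algebra_simps)
      have q: "int ((2 * b) choose 2) * 2 = 2 * int b * (2 * int b - 1)"
      proof -
        have "2 * ((2 * b) choose 2) = 2 * b * (2 * b - 1)" using times_binomial_minus1_eq[of 2 "2 * b"] by simp
        then have "int (2 * ((2 * b) choose 2)) = 2 * int b * (2 * int b - 1)" unfolding t[symmetric] by simp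
        then show ?thesis by simp
      qed
      have r: "int (b * b - b) = int b * int b - int b" using b by (simp add: of_nat_diff)
      have l: "lam b 1 = 2 * int (b choose 2) + int b" using b by (simp add: lam_def)
      have "mu b 0 = int (b * b - b) + int ((2 * b) choose 2) + lam b 1 - int (2 * b * (2 * b - 1))"
        using mu_alt[OF b, of 0] by (simp add: numeral_2_eq_2)
      then show ?thesis using p q unfolding True r l t by (simp add: algebra_simps)
    next
      case False
      then have i: "i > 2 * b - 2" using that by simp
      then have z: "(2 * b - 2) choose i = 0" "(2 * b - 2) choose (i + 1) = 0" "(2 * b - 2) choose (i + 2) = 0"
        by (auto intro!: binomial_eq_0)
      show ?thesis using i unfolding mu_def z lam_def by simp
    qed
    then show ?thesis unfolding c using quad by (auto simp: uv_coeff_P_poly)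
  next
    case high
    have n1: "?n i d = 0" using cell_count_B(4)[of q] high by simp
    have "?z (Suc i) d = ?n (Suc i) d" using zfull[of "Suc i" d] n1 by simp
    then show ?thesis unfolding coeff using high z0[OF n1] by (simp add: uv_coeff_P_poly)
  qed
qed

subsection \<open>Koszul homology and short exact sequences\<close>

type_synonym ('v, 'k) fmod = "nat \<Rightarrow>\<^sub>0 ('v, 'k) mpol"

definition cof :: "('v, 'k::field) fmod \<Rightarrow> nat \<Rightarrow> ('v \<Rightarrow>\<^sub>0 nat) \<Rightarrow> 'k" where
  "cof f k m = Poly_Mapping.lookup (Poly_Mapping.lookup f k) m"

lemma cof_eqI: "(\<And>k m. cof f k m = cof g k m) \<Longrightarrow> f = g"
  by (simp add: cof_def poly_mapping_eqI)

lemma cof_add [simp]: "cof (f + g) k m = cof f k m + cof g k m"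
  by (simp add: cof_def lookup_add)

lemma cof_zero [simp]: "cof 0 k m = 0"
  by (simp add: cof_def)

lemma cof_diff [simp]: "cof (f - g) k m = cof f k m - cof g k m"
  by (simp add: cof_def lookup_minus)

lemma cof_sum: "cof (\<Sum>x\<in>A. f x) k m = (\<Sum>x\<in>A. cof (f x) k m)"
  by (simp add: cof_def lookup_sum)

lemma finite_cof: "finite {(k, m). cof f k m \<noteq> 0}"
proof -
  have "{(k, m). cof f k m \<noteq> 0} \<subseteq> Sigma (Poly_Mapping.keys f) (\<lambda>k. Poly_Mapping.keys (Poly_Mapping.lookup f k))"
    by (auto simp: cof_def in_keys_iff)
  then show ?thesis by (rule finite_subset) (intro finite_SigmaI; simp)
qed

lemma lookup_map_mult: "Poly_Mapping.lookup (Poly_Mapping.map ((*) p) f) k = p * Poly_Mapping.lookup f k"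
  for p :: "'a::semiring_0"
  by (simp add: map.rep_eq when_def)

lemma lookup_single_mult:
  fixes p :: "('v, 'k::field) mpol"
  shows "Poly_Mapping.lookup (Poly_Mapping.single t c * p) m =
    (if \<exists>q. m = t + q then c * Poly_Mapping.lookup p (m - t) else 0)"
proof -
  have "Poly_Mapping.lookup (Poly_Mapping.single t c * p) m =
      (\<Sum>l. (c when t = l) * (\<Sum>q. Poly_Mapping.lookup p q when m = l + q))"
    by (simp add: lookup_mult lookup_single)
  also have "\<dots> = (\<Sum>l. (c * (\<Sum>q. Poly_Mapping.lookup p q when m = l + q)) when l = t)"
    by (intro Sum_any.cong) (auto simp: when_def)
  also have "\<dots> = c * (\<Sum>q. Poly_Mapping.lookup p q when m = t + q)" by simp
  also have "(\<Sum>q. Poly_Mapping.lookup p q when m = t + q) =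
      (if \<exists>q. m = t + q then Poly_Mapping.lookup p (m - t) else 0)"
  proof (cases "\<exists>q. m = t + q")
    case True
    then have "m = t + q \<longleftrightarrow> q = m - t" for q by auto
    then show ?thesis using True by simp
  qed simp
  finally show ?thesis by simp
qed

lemma mon_single_le: "(\<exists>q. m = Poly_Mapping.single v (1::nat) + q) \<longleftrightarrow> 0 < Poly_Mapping.lookup m v"
proof
  assume "\<exists>q. m = Poly_Mapping.single v 1 + q"
  then show "0 < Poly_Mapping.lookup m v" by (auto simp: lookup_add)
next
  assume *: "0 < Poly_Mapping.lookup m v"
  have "m = Poly_Mapping.single v 1 + (m - Poly_Mapping.single v 1)"
    using * by (intro poly_mapping_eqI) (auto simp: lookup_add lookup_minus lookup_single when_def)
  then show "\<exists>q. m = Poly_Mapping.single v 1 + q" by blast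
qed

definition fm_scale :: "'k::field \<Rightarrow> ('v, 'k) fmod \<Rightarrow> ('v, 'k) fmod" where
  "fm_scale a f = Poly_Mapping.map ((*) (Poly_Mapping.single 0 a)) f"

lemma cof_fm_scale [simp]: "cof (fm_scale a f) k m = a * cof f k m"
proof -
  have "\<exists>q. m = 0 + q" by simp
  then show ?thesis unfolding cof_def fm_scale_def lookup_map_mult lookup_single_mult by simp
qed

global_interpretation fm: vector_space fm_scale
  by unfold_locales (auto intro!: cof_eqI simp: algebra_simps)

global_interpretation fmp: vector_space_pair fm_scale fm_scale ..

definition ch_scale :: "'k::field \<Rightarrow> ('c \<Rightarrow> ('v, 'k) fmod) \<Rightarrow> ('c \<Rightarrow> ('v, 'k) fmod)" where
  "ch_scale a c = (\<lambda>S. fm_scale a (c S))"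

global_interpretation ch: vector_space ch_scale
  by unfold_locales
    (auto simp: ch_scale_def fun_eq_iff fm.scale_right_distrib fm.scale_left_distrib)

global_interpretation chp: vector_space_pair ch_scale ch_scale ..
global_interpretation fmch: vector_space_pair fm_scale ch_scale ..
global_interpretation chf: vector_space_pair ch_scale fscale ..

definition restr :: "(nat \<times> ('v \<Rightarrow>\<^sub>0 nat)) set \<Rightarrow> ('v, 'k::field) fmod \<Rightarrow> ('v, 'k) fmod" where
  "restr Q f = Poly_Mapping.mapp (\<lambda>k p. Poly_Mapping.mapp (\<lambda>m c. if (k, m) \<in> Q then c else 0) p) f"

lemma cof_restr [simp]: "cof (restr Q f) k m = (if (k, m) \<in> Q then cof f k m else 0)"
  by (auto simp: cof_def restr_def lookup_mapp when_def in_keys_iff)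

definition var_act :: "(nat \<times> ('v \<Rightarrow>\<^sub>0 nat)) set \<Rightarrow> 'v \<Rightarrow> ('v, 'k::field) fmod \<Rightarrow> ('v, 'k) fmod" where
  "var_act Q v f = restr Q (Poly_Mapping.map ((*) (variable v)) f)"

lemma lookup_variable_mult:
  "Poly_Mapping.lookup (variable v * p) m =
    (if 0 < Poly_Mapping.lookup m v then Poly_Mapping.lookup p (m - Poly_Mapping.single v 1) else 0)"
  unfolding variable_def lookup_single_mult mon_single_le by simp

lemma cof_var_act [simp]: "cof (var_act Q v f) k m =
    (if (k, m) \<in> Q \<and> 0 < Poly_Mapping.lookup m v then cof f k (m - Poly_Mapping.single v 1) else 0)"
  by (simp add: var_act_def) (simp add: cof_def lookup_map_mult lookup_variable_mult)

lemma linear_var_act: "Vector_Spaces.linear fm_scale fm_scale (var_act Q v)"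
  unfolding Vector_Spaces.linear_iff by (auto simp: fm.vector_space_axioms intro!: cof_eqI)

lemma mon_degree_superset:
  assumes "finite A" "Poly_Mapping.keys m \<subseteq> A"
  shows "mon_degree m = (\<Sum>x\<in>A. Poly_Mapping.lookup m x)"
  unfolding mon_degree_def using assms by (intro sum.mono_neutral_left) (auto simp: in_keys_iff)

lemma mon_degree_add: "mon_degree (m + n) = mon_degree m + mon_degree n"
proof -
  let ?A = "Poly_Mapping.keys m \<union> Poly_Mapping.keys n"
  have "mon_degree (m + n) = (\<Sum>x\<in>?A. Poly_Mapping.lookup (m + n) x)"
    by (rule mon_degree_superset) (use keys_add[of m n] in auto)
  then show ?thesis
    using mon_degree_superset[of ?A m] mon_degree_superset[of ?A n] by (simp add: lookup_add sum.distrib)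
qed

lemma mon_degree_single [simp]: "mon_degree (Poly_Mapping.single v n) = n"
  by (cases "n = 0") (auto simp: mon_degree_def)

lemma mon_degree_zero_iff: "mon_degree m = 0 \<longleftrightarrow> m = 0"
  by (auto simp: mon_degree_def in_keys_iff simp flip: keys_eq_empty)

lemma mon_degree_zero [simp]: "mon_degree 0 = 0"
  by (simp add: mon_degree_zero_iff)

lemma finite_monomials:
  assumes "finite V"
  shows "finite {m :: 'v \<Rightarrow>\<^sub>0 nat. Poly_Mapping.keys m \<subseteq> V \<and> mon_degree m \<le> d}"
proof (rule finite_imageD)
  let ?M = "{m :: 'v \<Rightarrow>\<^sub>0 nat. Poly_Mapping.keys m \<subseteq> V \<and> mon_degree m \<le> d}"
  show "inj_on Poly_Mapping.lookup ?M" by (simp add: inj_on_def)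
  have "Poly_Mapping.lookup ` ?M \<subseteq> {f. \<forall>x. (x \<in> V \<longrightarrow> f x \<in> {..d}) \<and> (x \<notin> V \<longrightarrow> f x = 0)}"
  proof (rule image_subsetI)
    fix m assume m: "m \<in> ?M"
    have "Poly_Mapping.lookup m x \<le> d" if "x \<in> V" for x
    proof -
      have "Poly_Mapping.lookup m x \<le> (\<Sum>x\<in>V. Poly_Mapping.lookup m x)"
        using that assms by (intro member_le_sum) auto
      then show ?thesis using mon_degree_superset[OF assms, of m] m by simp
    qed
    moreover have "Poly_Mapping.lookup m x = 0" if "x \<notin> V" for x
      using m that by (auto simp: in_keys_iff)
    ultimately show "Poly_Mapping.lookup m \<in> {f. \<forall>x. (x \<in> V \<longrightarrow> f x \<in> {..d}) \<and> (x \<notin> V \<longrightarrow> f x = 0)}" by auto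
  qed
  moreover have "finite {f. \<forall>x. (x \<in> V \<longrightarrow> f x \<in> {..d}) \<and> (x \<notin> V \<longrightarrow> f x = (0::nat))}"
    by (rule finite_set_of_finite_funs) (use assms in auto)
  ultimately show "finite (Poly_Mapping.lookup ` ?M)" by (rule finite_subset)
qed

text \<open>
  \<open>fspace Q dg d\<close> is the degree-\<open>d\<close> part of the span of the terms \<open>x\<^sup>m e\<^sub>k\<close> with \<open>(k, m) \<in> Q\<close>,
  where \<open>e\<^sub>k\<close> has degree \<open>dg k\<close>. Both free modules and \<open>R/I(G)\<close> (via standard monomials, with
  \<open>var_act Q\<close> truncating products) have this form.
\<close>

definition fspace :: "(nat \<times> ('v \<Rightarrow>\<^sub>0 nat)) set \<Rightarrow> (nat \<Rightarrow> nat) \<Rightarrow> nat \<Rightarrow> ('v, 'k::field) fmod set" where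
  "fspace Q dg d = {f. \<forall>k m. cof f k m \<noteq> 0 \<longrightarrow> (k, m) \<in> Q \<and> dg k + mon_degree m = d}"

lemma subspace_fspace: "fm.subspace (fspace Q dg d :: ('v, 'k::field) fmod set)"
proof (rule fm.subspaceI)
  fix f g :: "('v, 'k) fmod" assume f: "f \<in> fspace Q dg d" and g: "g \<in> fspace Q dg d"
  have "cof f k m \<noteq> 0 \<or> cof g k m \<noteq> 0" if "cof (f + g) k m \<noteq> 0" for k m using that by auto
  then show "f + g \<in> fspace Q dg d" using f g unfolding fspace_def by blast
qed (auto simp: fspace_def)

lemma fin_dim_fspace:
  assumes "finite {(k, m). (k, m) \<in> Q \<and> dg k + mon_degree m = d}"
  shows "fin_dim fm_scale (fspace Q dg d :: ('v, 'k::field) fmod set)"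
proof -
  let ?I = "{(k, m). (k, m) \<in> Q \<and> dg k + mon_degree m = d}"
  let ?e = "\<lambda>(k, m). Poly_Mapping.single k (Poly_Mapping.single m (1::'k))"
  have cofe: "cof (?e x) k m = (if x = (k, m) then 1 else 0)" for x k m
    by (cases x) (auto simp: cof_def lookup_single when_def)
  have "fspace Q dg d \<subseteq> fm.span (?e ` ?I)"
  proof
    fix f :: "('v, 'k) fmod" assume f: "f \<in> fspace Q dg d"
    have "f = (\<Sum>x\<in>?I. fm_scale (cof f (fst x) (snd x)) (?e x))"
    proof (rule cof_eqI)
      fix k m
      have "cof (\<Sum>x\<in>?I. fm_scale (cof f (fst x) (snd x)) (?e x)) k m =
          (\<Sum>x\<in>?I. if x = (k, m) then cof f k m else 0)"
        unfolding cof_sum by (rule sum.cong) (auto simp: cofe simp del: split_paired_All)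
      also have "\<dots> = (if (k, m) \<in> ?I then cof f k m else 0)" using assms by simp
      also have "\<dots> = cof f k m" using f by (auto simp: fspace_def)
      finally show "cof f k m = cof (\<Sum>x\<in>?I. fm_scale (cof f (fst x) (snd x)) (?e x)) k m" by simp
    qed
    also have "\<dots> \<in> fm.span (?e ` ?I)"
      by (intro fm.span_sum fm.span_scale fm.span_base) auto
    finally show "f \<in> fm.span (?e ` ?I)" .
  qed
  then show ?thesis unfolding fin_dim_def using assms by blast
qed

text \<open>Internal degree \<open>d\<close> of the Koszul complex: exterior generators have degree
  1, so the coefficients lie in degree \<open>d - p\<close>. The guard \<open>p \<le> d\<close>
  protects against truncated subtraction.\<close>

definition kchains :: "'v set \<Rightarrow> (nat \<Rightarrow> ('v, 'k::field) fmod set) \<Rightarrow> nat \<Rightarrow> nat \<Rightarrow> ('v set \<Rightarrow> ('v, 'k) fmod) set" where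
  "kchains V M p d = {c. \<forall>S. c S \<in> (if S \<subseteq> V \<and> card S = p \<and> p \<le> d then M (d - p) else {0})}"

definition bd :: "('v \<Rightarrow> 'v \<Rightarrow> bool) \<Rightarrow> 'v set \<Rightarrow> ('v \<Rightarrow> ('v, 'k::field) fmod \<Rightarrow> ('v, 'k) fmod) \<Rightarrow>
    ('v set \<Rightarrow> ('v, 'k) fmod) \<Rightarrow> ('v set \<Rightarrow> ('v, 'k) fmod)" where
  "bd lt V X c = (\<lambda>T. if T \<subseteq> V then \<Sum>v\<in>V - T. fm_scale (koszul_sign lt v T) (X v (c (insert v T))) else 0)"

text \<open>Finite dimension is asked of each graded piece, where the rank arguments take place; the
  module as a whole may be infinite-dimensional.\<close>

definition graded_mod :: "'v set \<Rightarrow> ('v \<Rightarrow> ('v, 'k::field) fmod \<Rightarrow> ('v, 'k) fmod) \<Rightarrow> (nat \<Rightarrow> ('v, 'k) fmod set) \<Rightarrow> bool" where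
  "graded_mod V X M \<longleftrightarrow> (\<forall>v. Vector_Spaces.linear fm_scale fm_scale (X v)) \<and>
     (\<forall>d. fm.subspace (M d) \<and> fin_dim fm_scale (M d)) \<and>
     (\<forall>v\<in>V. \<forall>d. \<forall>f\<in>M d. X v f \<in> M (Suc d)) \<and>
     (\<forall>v\<in>V. \<forall>w\<in>V. \<forall>d. \<forall>f\<in>M d. X v (X w f) = X w (X v f))"

definition kcycles where
  "kcycles lt V X M p d = {c \<in> kchains V M p d. bd lt V X c = 0}"

definition kboundaries where
  "kboundaries lt V X M p d = bd lt V X ` kchains V M (Suc p) d"

definition kdim :: "('v \<Rightarrow> 'v \<Rightarrow> bool) \<Rightarrow> 'v set \<Rightarrow> ('v \<Rightarrow> ('v, 'k::field) fmod \<Rightarrow> ('v, 'k) fmod) \<Rightarrow>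
    (nat \<Rightarrow> ('v, 'k) fmod set) \<Rightarrow> nat \<Rightarrow> nat \<Rightarrow> int" where
  "kdim lt V X M p d = int (ch.dim (kcycles lt V X M p d)) - int (ch.dim (kboundaries lt V X M p d))"

lemma linear_bd:
  assumes "\<And>v. Vector_Spaces.linear fm_scale fm_scale (X v)"
  shows "Vector_Spaces.linear ch_scale ch_scale (bd lt V X)"
proof -
  have "bd lt V X (f + g) = bd lt V X f + bd lt V X g" for f g
    by (auto simp: bd_def fun_eq_iff fmp.linear_add[OF assms] fm.scale_right_distrib sum.distrib)
  moreover have "bd lt V X (ch_scale c f) = ch_scale c (bd lt V X f)" for c f
    by (auto simp: bd_def ch_scale_def fun_eq_iff fmp.linear_scale[OF assms] fm.scale_sum_right mult.commute)
  ultimately show ?thesis unfolding Vector_Spaces.linear_iff by (auto simp: ch.vector_space_axioms)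
qed

lemma subspace_kchains:
  assumes "\<And>d. fm.subspace (M d)"
  shows "ch.subspace (kchains V M p d)"
proof (rule ch.subspaceI)
  let ?P = "\<lambda>S. if S \<subseteq> V \<and> card S = p \<and> p \<le> d then M (d - p) else {0}"
  have P: "fm.subspace (?P S)" for S using assms by simp
  show "0 \<in> kchains V M p d" using fm.subspace_0[OF P] by (simp add: kchains_def)
  fix c c' assume c: "c \<in> kchains V M p d"
  show "ch_scale a c \<in> kchains V M p d" for a
    using c fm.subspace_scale[OF P] unfolding kchains_def ch_scale_def by blast
  assume "c' \<in> kchains V M p d"
  then show "c + c' \<in> kchains V M p d"
    using c fm.subspace_add[OF P] unfolding kchains_def plus_fun_def by blast
qed

lemma kchainsD:
  assumes "c \<in> kchains V M p d" "S \<subseteq> V" "card S = p" "p \<le> d"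
  shows "c S \<in> M (d - p)"
  using assms(1) unfolding kchains_def by (drule_tac CollectD, drule_tac spec[of _ S]) (simp add: assms)

lemma kchains_zero:
  assumes "c \<in> kchains V M p d" "\<not> (S \<subseteq> V \<and> card S = p \<and> p \<le> d)"
  shows "c S = 0"
proof -
  have "c S \<in> (if S \<subseteq> V \<and> card S = p \<and> p \<le> d then M (d - p) else {0})"
    using assms(1) unfolding kchains_def by blast
  then show ?thesis unfolding if_not_P[OF assms(2)] by simp
qed

lemma kchains_in:
  assumes "c \<in> kchains V M p d" "fm.subspace (M (d - p))"
  shows "c S \<in> M (d - p)"
  using kchainsD[OF assms(1), of S] kchains_zero[OF assms(1), of S] fm.subspace_0[OF assms(2)] by metis

lemma kchainsI:
  assumes "\<And>S. S \<subseteq> V \<Longrightarrow> card S = p \<Longrightarrow> p \<le> d \<Longrightarrow> c S \<in> M (d - p)"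
    and "\<And>S. \<not> (S \<subseteq> V \<and> card S = p \<and> p \<le> d) \<Longrightarrow> c S = 0"
  shows "c \<in> kchains V M p d"
  using assms unfolding kchains_def by simp

lemma fin_dim_kchains:
  assumes V: "finite V" and M: "\<And>d. fin_dim fm_scale (M d)"
  shows "fin_dim ch_scale (kchains V M p d)"
proof -
  obtain B where B: "finite B" "M (d - p) \<subseteq> fm.span B" using M[of "d - p"] unfolding fin_dim_def by blast
  define \<delta> :: "'a set \<Rightarrow> ('a, 'b) fmod \<Rightarrow> 'a set \<Rightarrow> ('a, 'b) fmod" where "\<delta> = (\<lambda>T f S. if S = T then f else 0)"
  have lin: "Vector_Spaces.linear fm_scale ch_scale (\<delta> T)" for T
    unfolding Vector_Spaces.linear_iff
    by (auto simp: fm.vector_space_axioms ch.vector_space_axioms \<delta>_def ch_scale_def fun_eq_iff)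
  let ?G = "\<Union>T\<in>Pow V. \<delta> T ` B"
  have "kchains V M p d \<subseteq> ch.span ?G"
  proof
    fix c assume c: "c \<in> kchains V M p d"
    have cT: "c T \<in> fm.span B" for T
      using kchainsD[OF c, of T] kchains_zero[OF c, of T] B(2) fm.span_zero[of B] by (metis subsetD)
    have "\<delta> T (c T) \<in> ch.span ?G" if "T \<in> Pow V" for T
    proof -
      have "\<delta> T (c T) \<in> ch.span (\<delta> T ` B)" using fmch.linear_span_image[OF lin] cT by blast
      moreover have "ch.span (\<delta> T ` B) \<subseteq> ch.span ?G" using that by (intro ch.span_mono) auto
      ultimately show ?thesis by blast
    qed
    then have "(\<Sum>T\<in>Pow V. \<delta> T (c T)) \<in> ch.span ?G" by (rule ch.span_sum)
    moreover have "(\<Sum>T\<in>Pow V. \<delta> T (c T)) = c"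
    proof
      fix S
      have "(\<Sum>T\<in>Pow V. \<delta> T (c T)) S = (\<Sum>T\<in>Pow V. if S = T then c T else 0)"
        by (simp add: sum_fun_apply \<delta>_def)
      also have "\<dots> = (if S \<in> Pow V then c S else 0)" using V by simp
      also have "\<dots> = c S" using c by (auto simp: kchains_def split: if_splits)
      finally show "(\<Sum>T\<in>Pow V. \<delta> T (c T)) S = c S" .
    qed
    ultimately show "c \<in> ch.span ?G" by simp
  qed
  moreover have "finite ?G" using V B by simp
  ultimately show ?thesis unfolding fin_dim_def by blast
qed

lemma bd_kchains:
  assumes V: "finite V" and M: "graded_mod V X M" and c: "c \<in> kchains V M (Suc p) d"
  shows "bd lt V X c \<in> kchains V M p d"
proof (rule kchainsI)
  have lin: "Vector_Spaces.linear fm_scale fm_scale (X v)" for v using M by (simp add: graded_mod_def)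
  have sub: "fm.subspace (M d)" for d using M by (simp add: graded_mod_def)
  fix T
  {
    assume T: "T \<subseteq> V" "card T = p" "p \<le> d"
    have "X v (c (insert v T)) \<in> M (d - p)" if v: "v \<in> V - T" for v
    proof (cases "Suc p \<le> d")
      case True
      have "c (insert v T) \<in> M (d - Suc p)" by (rule kchains_in[OF c sub])
      then have "X v (c (insert v T)) \<in> M (Suc (d - Suc p))" using M v by (auto simp: graded_mod_def)
      then show ?thesis using True by (simp add: Suc_diff_Suc)
    next
      case False
      then have "c (insert v T) = 0" using kchains_zero[OF c] by blast
      then show ?thesis using fmp.linear_0[OF lin] fm.subspace_0[OF sub] by simp
    qed
    then have "(\<Sum>v\<in>V - T. fm_scale (koszul_sign lt v T) (X v (c (insert v T)))) \<in> M (d - p)"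
      by (intro fm.subspace_sum[OF sub] fm.subspace_scale[OF sub])
    then show "bd lt V X c T \<in> M (d - p)" using T by (simp add: bd_def)
  }
  assume T: "\<not> (T \<subseteq> V \<and> card T = p \<and> p \<le> d)"
  have "c (insert v T) = 0" if "v \<in> V - T" "T \<subseteq> V" for v
  proof (rule kchains_zero[OF c])
    have "finite T" using that V finite_subset by blast
    then show "\<not> (insert v T \<subseteq> V \<and> card (insert v T) = Suc p \<and> Suc p \<le> d)" using T that by auto
  qed
  then show "bd lt V X c T = 0" by (auto simp: bd_def fmp.linear_0[OF lin])
qed

text \<open>Signs anticommute and variables commute on \<open>M\<close>, so the double sum over
  pairs of variables is antisymmetric.\<close>

lemma bd_bd:
  assumes V: "finite V" and lt: "strict_total lt" and M: "graded_mod V X M" and c: "c \<in> kchains V M p d"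
  shows "bd lt V X (bd lt V X c) = 0"
proof
  have lin: "Vector_Spaces.linear fm_scale fm_scale (X v)" for v using M by (simp add: graded_mod_def)
  have sub: "fm.subspace (M d)" for d using M by (simp add: graded_mod_def)
  let ?s = "koszul_sign lt"
  fix T
  show "bd lt V X (bd lt V X c) T = 0 T"
  proof (cases "T \<subseteq> V")
    case True
    then have fT: "finite T" using V finite_subset by blast
    let ?F = "\<lambda>v w. fm_scale (?s v T * ?s w (insert v T)) (X v (X w (c (insert w (insert v T)))))"
    have "bd lt V X (bd lt V X c) T = (\<Sum>v\<in>V - T. \<Sum>w\<in>(V - T) - {v}. ?F v w)"
    proof -
      have "X v (bd lt V X c (insert v T)) = (\<Sum>w\<in>(V - T) - {v}. fm_scale (?s w (insert v T)) (X v (X w (c (insert w (insert v T))))))"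
        if "v \<in> V - T" for v
      proof -
        have "V - insert v T = (V - T) - {v}" by auto
        then have "bd lt V X c (insert v T) = (\<Sum>w\<in>(V - T) - {v}. fm_scale (?s w (insert v T)) (X w (c (insert w (insert v T)))))"
          using that True by (simp add: bd_def)
        then show ?thesis by (simp add: fmp.linear_sum[OF lin] fmp.linear_scale[OF lin])
      qed
      moreover have "bd lt V X (bd lt V X c) T = (\<Sum>v\<in>V - T. fm_scale (?s v T) (X v (bd lt V X c (insert v T))))"
        using True by (simp add: bd_def[of lt V X "bd lt V X c"])
      ultimately show ?thesis by (simp add: fm.scale_sum_right)
    qed
    also have "\<dots> = 0"
    proof (rule sum_antisym_pairs)
      show "finite (V - T)" using V by simp
      fix v w assume vw: "v \<in> V - T" "w \<in> V - T" "v \<noteq> w"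
      have "?s w T * ?s v (insert w T) = - (?s v T * ?s w (insert v T) :: 'b)"
        using vw fT by (intro koszul_sign_anticomm[OF lt]) auto
      moreover have "X w (X v (c (insert v (insert w T)))) = X v (X w (c (insert w (insert v T))))"
      proof -
        have "insert v (insert w T) = insert w (insert v T)" by auto
        moreover have "c (insert w (insert v T)) \<in> M (d - p)" by (rule kchains_in[OF c sub])
        ultimately show ?thesis using M vw unfolding graded_mod_def by (metis DiffD1)
      qed
      ultimately show "?F w v = - ?F v w" by (simp add: fm.scale_minus_left)
    qed
    finally show ?thesis by simp
  next
    case False
    then show ?thesis by (simp add: bd_def)
  qed
qed

lemma bd_zero_chains:
  assumes V: "finite V" and M: "graded_mod V X M" and c: "c \<in> kchains V M 0 d"
  shows "bd lt V X c = 0"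
proof
  fix T
  have "c (insert v T) = 0" if "T \<subseteq> V" "v \<in> V" for v
    using kchains_zero[OF c, of "insert v T"] that V finite_subset[of T V] by auto
  moreover have "X v 0 = 0" for v using M fmp.linear_0 by (auto simp: graded_mod_def)
  ultimately show "bd lt V X c T = 0 T" by (auto simp: bd_def)
qed

lemma subspace_kcycles:
  assumes "graded_mod V X M"
  shows "ch.subspace (kcycles lt V X M p d)"
proof -
  have lin: "Vector_Spaces.linear ch_scale ch_scale (bd lt V X)"
    using assms by (intro linear_bd) (simp add: graded_mod_def)
  have "ch.subspace (kchains V M p d)" using assms by (intro subspace_kchains) (simp add: graded_mod_def)
  then show ?thesis
    using ch.subspace_inter[OF _ chp.linear_subspace_kernel[OF lin]] by (simp add: kcycles_def Int_def)
qed

lemma subspace_kboundaries: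
  assumes "graded_mod V X M"
  shows "ch.subspace (kboundaries lt V X M p d)"
  unfolding kboundaries_def using assms
  by (intro chp.linear_subspace_image linear_bd subspace_kchains) (simp_all add: graded_mod_def)

text \<open>\<open>M'\<close> is the kernel of a surjection from \<open>F\<close> to
  \<open>M\<close>. The last clause is minimality in Koszul terms: 0-chains of \<open>M'\<close> are
  boundaries in \<open>F\<close>, that is, \<open>M'\<close> lies in the irrelevant ideal times
  \<open>F\<close>.\<close>

definition short_exact :: "('v \<Rightarrow> 'v \<Rightarrow> bool) \<Rightarrow> 'v set \<Rightarrow> ('v \<Rightarrow> ('v, 'k::field) fmod \<Rightarrow> ('v, 'k) fmod) \<Rightarrow> (nat \<Rightarrow> ('v, 'k) fmod set) \<Rightarrow>
    (nat \<Rightarrow> ('v, 'k) fmod set) \<Rightarrow> ('v \<Rightarrow> ('v, 'k) fmod \<Rightarrow> ('v, 'k) fmod) \<Rightarrow> (nat \<Rightarrow> ('v, 'k) fmod set) \<Rightarrow>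
    (('v, 'k) fmod \<Rightarrow> ('v, 'k) fmod) \<Rightarrow> bool" where
  "short_exact lt V X M' F Y M \<phi> \<longleftrightarrow>
     graded_mod V X F \<and> graded_mod V Y M \<and> Vector_Spaces.linear fm_scale fm_scale \<phi> \<and>
     (\<forall>d. \<phi> ` F d = M d) \<and> (\<forall>d. M' d = {f \<in> F d. \<phi> f = 0}) \<and>
     (\<forall>v\<in>V. \<forall>d. \<forall>f\<in>F d. \<phi> (X v f) = Y v (\<phi> f)) \<and>
     (\<forall>d. kchains V M' 0 d \<subseteq> kboundaries lt V X F 0 d)"

context
  fixes lt :: "'v \<Rightarrow> 'v \<Rightarrow> bool" and V X and M' :: "nat \<Rightarrow> ('v, 'k::field) fmod set" and F Y M \<phi>
  assumes V: "finite V" and lt: "strict_total lt" and ex: "short_exact lt V X M' F Y M \<phi>"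
begin

lemma ex_facts:
  "graded_mod V X F" "graded_mod V Y M" "Vector_Spaces.linear fm_scale fm_scale \<phi>"
  "\<phi> ` F d = M d" "M' d = {f \<in> F d. \<phi> f = 0}" "v \<in> V \<Longrightarrow> f \<in> F d \<Longrightarrow> \<phi> (X v f) = Y v (\<phi> f)"
  "kchains V M' 0 d \<subseteq> kboundaries lt V X F 0 d"
  using ex by (auto simp: short_exact_def)

lemma graded_mod_kernel: "graded_mod V X M'"
proof -
  have "fm.subspace (M' d)" for d
    unfolding ex_facts(5) using fm.subspace_inter[OF _ fmp.linear_subspace_kernel[OF ex_facts(3)]] ex_facts(1)
    by (simp add: graded_mod_def Int_def)
  moreover have "M' d \<subseteq> F d" for d unfolding ex_facts(5) by auto
  moreover have "X v f \<in> M' (Suc d)" if "v \<in> V" "f \<in> M' d" for v f d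
  proof -
    have "\<phi> (X v f) = Y v 0" using that ex_facts(6)[of v f d] by (simp add: ex_facts(5))
    also have "\<dots> = 0" using ex_facts(2) fmp.linear_0 by (auto simp: graded_mod_def)
    finally show ?thesis using that ex_facts(1) by (simp add: ex_facts(5) graded_mod_def)
  qed
  ultimately show ?thesis using ex_facts(1) fin_dim_subset unfolding graded_mod_def by (meson subsetD)
qed

lemma kchains_kernel: "c \<in> kchains V M' p d \<longleftrightarrow> c \<in> kchains V F p d \<and> (\<lambda>S. \<phi> (c S)) = 0"
proof
  assume c: "c \<in> kchains V M' p d"
  have "c \<in> kchains V F p d"
    using kchainsD[OF c] kchains_zero[OF c] by (intro kchainsI) (auto simp: ex_facts(5))
  moreover have "\<phi> (c S) = 0" for S
  proof (cases "S \<subseteq> V \<and> card S = p \<and> p \<le> d")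
    case True
    then show ?thesis using kchainsD[OF c, of S] by (simp add: ex_facts(5))
  next
    case False
    then show ?thesis using kchains_zero[OF c] by (simp add: fmp.linear_0[OF ex_facts(3)])
  qed
  ultimately show "c \<in> kchains V F p d \<and> (\<lambda>S. \<phi> (c S)) = 0" by (auto simp: fun_eq_iff)
next
  assume c: "c \<in> kchains V F p d \<and> (\<lambda>S. \<phi> (c S)) = 0"
  then have z: "\<phi> (c S) = 0" for S by (auto simp: fun_eq_iff)
  have c': "c \<in> kchains V F p d" using c by blast
  show "c \<in> kchains V M' p d"
    using kchainsD[OF c'] kchains_zero[OF c'] z by (intro kchainsI) (auto simp: ex_facts(5))
qed

lemma linear_push: "Vector_Spaces.linear ch_scale ch_scale (\<lambda>c S. \<phi> (c S))"
  unfolding Vector_Spaces.linear_iff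
  by (auto simp: ch.vector_space_axioms ch_scale_def fun_eq_iff fmp.linear_add[OF ex_facts(3)] fmp.linear_scale[OF ex_facts(3)])

lemma push_kchains: "c \<in> kchains V F p d \<Longrightarrow> (\<lambda>S. \<phi> (c S)) \<in> kchains V M p d"
proof -
  assume c: "c \<in> kchains V F p d"
  show ?thesis
    using kchainsD[OF c] kchains_zero[OF c]
    by (intro kchainsI) (auto simp: ex_facts(4)[symmetric] fmp.linear_0[OF ex_facts(3)])
qed

lemma lift_kchains:
  assumes "c \<in> kchains V M p d"
  shows "\<exists>x\<in>kchains V F p d. c = (\<lambda>S. \<phi> (x S))"
proof -
  have "\<exists>f. f \<in> (if S \<subseteq> V \<and> card S = p \<and> p \<le> d then F (d - p) else {0}) \<and> c S = \<phi> f" for S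
  proof (cases "S \<subseteq> V \<and> card S = p \<and> p \<le> d")
    case True
    then have "c S \<in> \<phi> ` F (d - p)" using kchainsD[OF assms, of S] by (simp add: ex_facts(4))
    then show ?thesis using True by auto
  next
    case False
    then show ?thesis using kchains_zero[OF assms False] fmp.linear_0[OF ex_facts(3)] by auto
  qed
  then obtain x where "\<And>S. x S \<in> (if S \<subseteq> V \<and> card S = p \<and> p \<le> d then F (d - p) else {0}) \<and> c S = \<phi> (x S)"
    by metis
  then show ?thesis by (intro bexI[of _ x]) (auto simp: kchains_def)
qed

lemma push_bd: "c \<in> kchains V F p d \<Longrightarrow> (\<lambda>S. \<phi> (bd lt V X c S)) = bd lt V Y (\<lambda>S. \<phi> (c S))"
proof
  fix T assume c: "c \<in> kchains V F p d"
  have "\<phi> (X v (c (insert v T))) = Y v (\<phi> (c (insert v T)))" if "v \<in> V" for v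
    using ex_facts(1) by (intro ex_facts(6)[OF that kchains_in[OF c]]) (simp add: graded_mod_def)
  then show "\<phi> (bd lt V X c T) = bd lt V Y (\<lambda>S. \<phi> (c S)) T"
    by (auto simp: bd_def fmp.linear_sum[OF ex_facts(3)] fmp.linear_scale[OF ex_facts(3)] fmp.linear_0[OF ex_facts(3)]
        intro!: sum.cong)
qed

lemma subsp: "ch.subspace (kchains V F p d)" "ch.subspace (kchains V M' p d)"
  using ex_facts(1) graded_mod_kernel by (auto intro!: subspace_kchains simp: graded_mod_def)

lemma lin_bd: "Vector_Spaces.linear ch_scale ch_scale (bd lt V X)"
  using ex_facts(1) by (intro linear_bd) (simp add: graded_mod_def)

lemma fd_F: "fin_dim ch_scale (kchains V F p d)"
  using ex_facts(1) by (intro fin_dim_kchains[OF V]) (simp add: graded_mod_def)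

text \<open>Koszul homology in degree zero is the module modulo the variables. The kernel of
  \<open>\<phi>\<close> already lies in what is divided out of \<open>F\<close>, so nothing changes
  in passing to \<open>M\<close>.\<close>

lemma kdim_zero: "kdim lt V Y M 0 d = kdim lt V X F 0 d"
proof -
  let ?f = "\<lambda>c S. \<phi> (c S)"
  have Z: "kcycles lt V X F 0 d = kchains V F 0 d" "kcycles lt V Y M 0 d = kchains V M 0 d"
    using bd_zero_chains[OF V ex_facts(1)] bd_zero_chains[OF V ex_facts(2)] by (auto simp: kcycles_def)
  have "int (ch.dim (kchains V F 0 d)) - int (ch.dim (kboundaries lt V X F 0 d)) =
    int (ch.dim (?f ` kchains V F 0 d)) - int (ch.dim (?f ` kboundaries lt V X F 0 d))"
  proof (rule chp.dim_diff_image[OF linear_push subsp(1) subspace_kboundaries[OF ex_facts(1)] fd_F])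
    show "kboundaries lt V X F 0 d \<subseteq> kchains V F 0 d"
      using bd_kchains[OF V ex_facts(1)] by (auto simp: kboundaries_def)
    fix x assume "x \<in> kchains V F 0 d" "(\<lambda>S. \<phi> (x S)) = 0"
    then show "x \<in> kboundaries lt V X F 0 d" using kchains_kernel ex_facts(7) by blast
  qed
  moreover have "?f ` kchains V F 0 d = kchains V M 0 d"
    using push_kchains lift_kchains by (auto simp: image_iff)
  moreover have "?f ` kboundaries lt V X F 0 d = kboundaries lt V Y M 0 d"
  proof (intro equalityI subsetI)
    fix z assume "z \<in> ?f ` kboundaries lt V X F 0 d"
    then obtain c where "c \<in> kchains V F (Suc 0) d" "z = ?f (bd lt V X c)" by (auto simp: kboundaries_def)
    then show "z \<in> kboundaries lt V Y M 0 d" using push_bd push_kchains by (auto simp: kboundaries_def)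
  next
    fix z assume "z \<in> kboundaries lt V Y M 0 d"
    then obtain c where c: "c \<in> kchains V M (Suc 0) d" "z = bd lt V Y c" by (auto simp: kboundaries_def)
    then obtain x where x: "x \<in> kchains V F (Suc 0) d" "c = ?f x" using lift_kchains by blast
    then have "z = ?f (bd lt V X x)" using push_bd c by metis
    then show "z \<in> ?f ` kboundaries lt V X F 0 d" using x by (auto simp: kboundaries_def)
  qed
  ultimately show ?thesis by (simp add: kdim_def Z)
qed

text \<open>The connecting isomorphism of the long exact sequence, without quotients.
  \<open>U\<close> consists of the chains of \<open>F\<close> with boundary in \<open>M'\<close>,
  and \<open>U0\<close> of boundaries of \<open>F\<close> plus chains of \<open>M'\<close>. The
  differential and \<open>\<phi>\<close> both have their kernel on \<open>U\<close> inside
  \<open>U0\<close>, so the same difference of dimensions is the homology of \<open>M'\<close> at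
  \<open>p\<close> and that of \<open>M\<close> at \<open>Suc p\<close>.\<close>

lemma kdim_shift:
  assumes acyc: "\<And>p d. kcycles lt V X F (Suc p) d \<subseteq> kboundaries lt V X F (Suc p) d"
  shows "kdim lt V X M' p d = kdim lt V Y M (Suc p) d"
proof -
  let ?f = "\<lambda>c S. \<phi> (c S)"
  let ?b = "bd lt V X"
  define U where "U = {c \<in> kchains V F (Suc p) d. ?f (?b c) = 0}"
  define U0 where "U0 = {x + y |x y. x \<in> kboundaries lt V X F (Suc p) d \<and> y \<in> kchains V M' (Suc p) d}"
  have f0: "\<phi> 0 = 0" by (rule fmp.linear_0[OF ex_facts(3)])
  have sU: "ch.subspace U"
  proof -
    have "Vector_Spaces.linear ch_scale ch_scale (?f \<circ> ?b)"
      by (rule Vector_Spaces.linear_compose[OF lin_bd linear_push])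
    from ch.subspace_inter[OF subsp(1) chp.linear_subspace_kernel[OF this]] show ?thesis
      by (simp add: U_def Int_def o_def)
  qed
  have sU0: "ch.subspace U0"
    unfolding U0_def by (rule ch.subspace_sums[OF subspace_kboundaries[OF ex_facts(1)] subsp(2)])
  have fdU: "fin_dim ch_scale U" by (rule fin_dim_subset[OF fd_F]) (auto simp: U_def)
  have Bsub: "kboundaries lt V X F (Suc p) d \<subseteq> U"
  proof
    fix x assume "x \<in> kboundaries lt V X F (Suc p) d"
    then obtain c where c: "c \<in> kchains V F (Suc (Suc p)) d" "x = ?b c" by (auto simp: kboundaries_def)
    have "?b x = 0" unfolding c(2) by (rule bd_bd[OF V lt ex_facts(1) c(1)])
    moreover have "x \<in> kchains V F (Suc p) d" unfolding c(2) by (rule bd_kchains[OF V ex_facts(1) c(1)])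
    ultimately show "x \<in> U" using f0 by (simp add: U_def zero_fun_def)
  qed
  have M'U: "kchains V M' (Suc p) d \<subseteq> U"
  proof
    fix x assume "x \<in> kchains V M' (Suc p) d"
    then have "x \<in> kchains V F (Suc p) d" "?b x \<in> kchains V M' p d"
      using kchains_kernel bd_kchains[OF V graded_mod_kernel] by blast+
    then show "x \<in> U" using kchains_kernel by (simp add: U_def)
  qed
  have sub: "U0 \<subseteq> U" unfolding U0_def using Bsub M'U ch.subspace_add[OF sU] by blast
  have BU0: "kboundaries lt V X F (Suc p) d \<subseteq> U0"
  proof
    fix x assume "x \<in> kboundaries lt V X F (Suc p) d"
    moreover have "x = x + 0" by simp
    ultimately show "x \<in> U0" unfolding U0_def using ch.subspace_0[OF subsp(2)] by blast
  qed
  have MU0: "kchains V M' (Suc p) d \<subseteq> U0"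
  proof
    fix x assume "x \<in> kchains V M' (Suc p) d"
    moreover have "x = 0 + x" by simp
    ultimately show "x \<in> U0" unfolding U0_def using ch.subspace_0[OF subspace_kboundaries[OF ex_facts(1)]] by blast
  qed
  have 1: "int (ch.dim U) - int (ch.dim U0) = int (ch.dim (?b ` U)) - int (ch.dim (?b ` U0))"
  proof (rule chp.dim_diff_image[OF lin_bd sU sU0 fdU sub])
    fix x assume "x \<in> U" "?b x = 0"
    then have "x \<in> kcycles lt V X F (Suc p) d" by (simp add: U_def kcycles_def)
    then show "x \<in> U0" using acyc BU0 by blast
  qed
  have 2: "int (ch.dim U) - int (ch.dim U0) = int (ch.dim (?f ` U)) - int (ch.dim (?f ` U0))"
  proof (rule chp.dim_diff_image[OF linear_push sU sU0 fdU sub])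
    fix x assume "x \<in> U" "?f x = 0"
    then have "x \<in> kchains V M' (Suc p) d" using kchains_kernel by (simp add: U_def)
    then show "x \<in> U0" using MU0 by blast
  qed
  have bU: "?b ` U = kcycles lt V X M' p d"
  proof (intro equalityI subsetI)
    fix z assume "z \<in> ?b ` U"
    then obtain c where c: "c \<in> kchains V F (Suc p) d" "?f (?b c) = 0" "z = ?b c" by (auto simp: U_def)
    then have "z \<in> kchains V M' p d" using kchains_kernel bd_kchains[OF V ex_facts(1)] by blast
    then show "z \<in> kcycles lt V X M' p d" using bd_bd[OF V lt ex_facts(1) c(1)] c by (simp add: kcycles_def)
  next
    fix z assume z: "z \<in> kcycles lt V X M' p d"
    then have zM: "z \<in> kchains V M' p d" by (simp add: kcycles_def)
    then have zF: "z \<in> kchains V F p d" "?f z = 0" using kchains_kernel by blast+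
    \<comment> \<open>A cycle of \<open>M'\<close> bounds in \<open>F\<close>, by minimality if
      \<open>p = 0\<close> and by acyclicity otherwise.\<close>
    have "z \<in> kboundaries lt V X F p d"
    proof (cases p)
      case 0
      then show ?thesis using zM ex_facts(7) by blast
    next
      case (Suc q)
      then show ?thesis using z zF acyc by (auto simp: kcycles_def)
    qed
    then obtain c where "c \<in> kchains V F (Suc p) d" "z = ?b c" by (auto simp: kboundaries_def)
    then show "z \<in> ?b ` U" using zF by (auto simp: U_def)
  qed
  have bU0: "?b ` U0 = kboundaries lt V X M' p d"
  proof (intro equalityI subsetI)
    fix z assume "z \<in> ?b ` U0"
    then obtain c y where c: "c \<in> kchains V F (Suc (Suc p)) d" "y \<in> kchains V M' (Suc p) d" "z = ?b (?b c + y)"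
      by (auto simp: U0_def kboundaries_def)
    then have "z = ?b y" using bd_bd[OF V lt ex_facts(1) c(1)] chp.linear_add[OF lin_bd] by simp
    then show "z \<in> kboundaries lt V X M' p d" using c by (auto simp: kboundaries_def)
  next
    fix z assume "z \<in> kboundaries lt V X M' p d"
    then show "z \<in> ?b ` U0" using MU0 by (auto simp: kboundaries_def)
  qed
  have fU: "?f ` U = kcycles lt V Y M (Suc p) d"
  proof (intro equalityI subsetI)
    fix z assume "z \<in> ?f ` U"
    then obtain c where c: "c \<in> kchains V F (Suc p) d" "?f (?b c) = 0" "z = ?f c" by (auto simp: U_def)
    then show "z \<in> kcycles lt V Y M (Suc p) d" using push_kchains push_bd[OF c(1)] by (simp add: kcycles_def)
  next
    fix z assume z: "z \<in> kcycles lt V Y M (Suc p) d"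
    then obtain c where c: "c \<in> kchains V F (Suc p) d" "z = ?f c"
      using lift_kchains[of z "Suc p" d] by (auto simp: kcycles_def)
    then have "c \<in> U" using push_bd[OF c(1)] z by (simp add: U_def kcycles_def)
    then show "z \<in> ?f ` U" using c by blast
  qed
  have fU0: "?f ` U0 = kboundaries lt V Y M (Suc p) d"
  proof (intro equalityI subsetI)
    fix z assume "z \<in> ?f ` U0"
    then obtain c y where c: "c \<in> kchains V F (Suc (Suc p)) d" "y \<in> kchains V M' (Suc p) d" "z = ?f (?b c + y)"
      by (auto simp: U0_def kboundaries_def)
    have "z = ?f (?b c) + ?f y" unfolding c(3) by (rule chp.linear_add[OF linear_push])
    also have "?f y = 0" using c kchains_kernel by blast
    finally have "z = bd lt V Y (?f c)" using push_bd[OF c(1)] by simp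
    then show "z \<in> kboundaries lt V Y M (Suc p) d" using push_kchains[OF c(1)] by (auto simp: kboundaries_def)
  next
    fix z assume "z \<in> kboundaries lt V Y M (Suc p) d"
    then obtain c where c: "c \<in> kchains V M (Suc (Suc p)) d" "z = bd lt V Y c" by (auto simp: kboundaries_def)
    then obtain x where x: "x \<in> kchains V F (Suc (Suc p)) d" "c = ?f x" using lift_kchains by blast
    then have "z = ?f (?b x)" using push_bd c by metis
    moreover have "?b x \<in> U0" using x BU0 by (auto simp: kboundaries_def)
    ultimately show "z \<in> ?f ` U0" by blast
  qed
  show ?thesis using 1 2 unfolding bU bU0 fU fU0 kdim_def by simp
qed

end

subsection \<open>Koszul homology of free modules and of \<open>R/I(G)\<close>\<close>

definition monv :: "'v \<Rightarrow> ('v \<Rightarrow>\<^sub>0 nat)" where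
  "monv v = Poly_Mapping.single v 1"

lemma lookup_monv: "Poly_Mapping.lookup (monv v) x = (if x = v then 1 else 0)"
  by (simp add: monv_def lookup_single when_def)

lemma mon_degree_monv: "mon_degree (monv v) = 1"
  by (simp add: monv_def)

declare cof_var_act [simp del]

lemma cof_var_act_monv [simp]: "cof (var_act Q v f) k m =
    (if (k, m) \<in> Q \<and> 0 < Poly_Mapping.lookup m v then cof f k (m - monv v) else 0)"
  unfolding cof_var_act monv_def by simp

text \<open>The multidegree of the Koszul basis element with exterior part \<open>S\<close> and
  monomial \<open>m\<close>; the differential preserves it.\<close>

definition tot :: "'v set \<Rightarrow> ('v \<Rightarrow>\<^sub>0 nat) \<Rightarrow> ('v \<Rightarrow>\<^sub>0 nat)" where
  "tot S m = m + (\<Sum>v\<in>S. monv v)"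

lemma lookup_tot: "finite S \<Longrightarrow> Poly_Mapping.lookup (tot S m) x = Poly_Mapping.lookup m x + (if x \<in> S then 1 else 0)"
  by (simp add: tot_def lookup_add lookup_sum lookup_monv)

lemma tot_insert_minus:
  assumes "finite T" "v \<notin> T" "0 < Poly_Mapping.lookup m v"
  shows "tot (insert v T) (m - monv v) = tot T m"
  using assms by (intro poly_mapping_eqI) (auto simp: lookup_tot lookup_minus lookup_monv)

text \<open>Division by \<open>v\<close>; terms not divisible by \<open>v\<close> are
  dropped.\<close>

definition shift_down :: "'v \<Rightarrow> ('v, 'k::field) fmod \<Rightarrow> ('v, 'k) fmod" where
  "shift_down v f = Poly_Mapping.map (Poly_Mapping.map_key (\<lambda>m. m + monv v)) f"

lemma cof_shift_down [simp]: "cof (shift_down v f) k m = cof f k (m + monv v)"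
proof -
  have "inj (\<lambda>m. m + monv v)" by (auto simp: inj_def)
  then show ?thesis by (auto simp: cof_def shift_down_def map.rep_eq map_key.rep_eq when_def)
qed

text \<open>The variable moved into the exterior part is \<open>\<chi>\<close> of the multidegree,
  so within one multidegree a single summand survives the restriction.\<close>

definition koszul_htpy :: "('v \<Rightarrow> 'v \<Rightarrow> bool) \<Rightarrow> (('v \<Rightarrow>\<^sub>0 nat) \<Rightarrow> 'v) \<Rightarrow> ('v set \<Rightarrow> ('v, 'k::field) fmod) \<Rightarrow> ('v set \<Rightarrow> ('v, 'k) fmod)" where
  "koszul_htpy lt \<chi> c S = (\<Sum>v\<in>S. fm_scale (koszul_sign lt v (S - {v}))
     (restr {(k, m). \<chi> (tot S m) = v} (shift_down v (c (S - {v})))))"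

lemma cof_koszul_htpy:
  assumes "finite S"
  shows "cof (koszul_htpy lt \<chi> c S) k m =
    (if \<chi> (tot S m) \<in> S then koszul_sign lt (\<chi> (tot S m)) (S - {\<chi> (tot S m)}) *
       cof (c (S - {\<chi> (tot S m)})) k (m + monv (\<chi> (tot S m))) else 0)"
proof -
  have "cof (koszul_htpy lt \<chi> c S) k m = (\<Sum>v\<in>S. if v = \<chi> (tot S m) then
      koszul_sign lt v (S - {v}) * cof (c (S - {v})) k (m + monv v) else 0)"
    unfolding koszul_htpy_def cof_sum by (rule sum.cong) auto
  then show ?thesis using assms by simp
qed

lemma cof_bd: "cof (bd lt V (var_act Q) c T) k m = (if T \<subseteq> V then
    \<Sum>v\<in>V - T. koszul_sign lt v T * (if (k, m) \<in> Q \<and> 0 < Poly_Mapping.lookup m v then cof (c (insert v T)) k (m - monv v) else 0)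
    else 0)"
  by (simp add: bd_def cof_sum)

lemma minus_single_add: "0 < Poly_Mapping.lookup m v \<Longrightarrow> m - monv v + monv v = m"
  by (intro poly_mapping_eqI) (auto simp: lookup_add lookup_minus lookup_monv)

text \<open>
  The Koszul complex of a span of monomials is a direct sum over multidegrees, and the summand of
  multidegree \<open>a\<close> is contracted by moving a variable \<open>\<chi> a\<close> into the exterior part whenever
  membership in \<open>Q\<close> does not depend on the exponent of \<open>\<chi> a\<close> there. \<open>G\<close> collects such \<open>a\<close>.
\<close>

lemma koszul_homotopy:
  fixes c :: "'v set \<Rightarrow> ('v, 'k::field) fmod"
  assumes V: "finite V" and lt: "strict_total lt"
    and Qdown: "\<And>k m v. (k, m + monv v) \<in> Q \<Longrightarrow> (k, m) \<in> Q"
    and QV: "\<And>k m. (k, m) \<in> Q \<Longrightarrow> Poly_Mapping.keys m \<subseteq> V"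
    and c: "c \<in> kchains V (fspace Q dg) p d" and bd0: "bd lt V (var_act Q) c = 0"
    and Gc: "\<And>S k m. cof (c S) k m \<noteq> 0 \<Longrightarrow> G (tot S m)"
    and G\<chi>: "\<And>S k m. S \<subseteq> V \<Longrightarrow> (k, m) \<in> Q \<Longrightarrow> G (tot S m) \<Longrightarrow>
      \<chi> (tot S m) \<in> S \<union> Poly_Mapping.keys m \<and> (\<chi> (tot S m) \<in> S \<longrightarrow> (k, m + monv (\<chi> (tot S m))) \<in> Q)"
  shows "c \<in> kboundaries lt V (var_act Q) (fspace Q dg) p d"
proof -
  let ?s = "koszul_sign lt :: _ \<Rightarrow> _ \<Rightarrow> 'k"
  define x where "x = (\<lambda>S. if S \<subseteq> V then koszul_htpy lt \<chi> c S else 0)"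
  have fin: "finite S" if "S \<subseteq> V" for S using that V finite_subset by blast
  have cD: "S \<subseteq> V \<and> card S = p \<and> p \<le> d \<and> (k, m) \<in> Q \<and> dg k + mon_degree m = d - p" if "cof (c S) k m \<noteq> 0" for S k m
  proof -
    have *: "S \<subseteq> V \<and> card S = p \<and> p \<le> d" using kchains_zero[OF c, of S] that by (cases "S \<subseteq> V \<and> card S = p \<and> p \<le> d") auto
    then have "c S \<in> fspace Q dg (d - p)" using kchainsD[OF c] by blast
    then show ?thesis using * that by (auto simp: fspace_def)
  qed
  have xD: "S \<subseteq> V \<and> \<chi> (tot S m) \<in> S \<and> cof (c (S - {\<chi> (tot S m)})) k (m + monv (\<chi> (tot S m))) \<noteq> 0"
    if "cof (x S) k m \<noteq> 0" for S k m
    using that by (auto simp: x_def cof_koszul_htpy[OF fin] split: if_splits)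
  have xx: "S \<subseteq> V \<and> card S = Suc p \<and> Suc p \<le> d \<and> (k, m) \<in> Q \<and> dg k + mon_degree m = d - Suc p"
    if "cof (x S) k m \<noteq> 0" for S k m
  proof -
    let ?v = "\<chi> (tot S m)"
    note 1 = xD[OF that]
    note 2 = cD[of "S - {?v}" k "m + monv ?v"]
    have e: "card (S - {?v}) = p" "p \<le> d" "(k, m + monv ?v) \<in> Q" "dg k + mon_degree m + 1 = d - p"
      using 1 2 by (auto simp: mon_degree_add mon_degree_monv)
    have "S \<subseteq> V" "?v \<in> S" using 1 by blast+
    then have "card S = Suc p" using fin[of S] e(1) by (metis card.remove)
    moreover have "Suc p \<le> d" "dg k + mon_degree m = d - Suc p" using e(2,4) by arith+
    ultimately show ?thesis using \<open>S \<subseteq> V\<close> Qdown[OF e(3)] by blast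
  qed
  have "x \<in> kchains V (fspace Q dg) (Suc p) d"
  proof (rule kchainsI)
    show "x S \<in> fspace Q dg (d - Suc p)" for S using xx by (auto simp: fspace_def)
    show "x S = 0" if "\<not> (S \<subseteq> V \<and> card S = Suc p \<and> Suc p \<le> d)" for S
      using xx that by (intro cof_eqI) (metis cof_zero)
  qed
  moreover have "bd lt V (var_act Q) x T = c T" for T
  proof (rule cof_eqI)
    fix k m
    show "cof (bd lt V (var_act Q) x T) k m = cof (c T) k m"
    proof (cases "T \<subseteq> V \<and> (k, m) \<in> Q")
      case False
      then show ?thesis using cD[of T k m] by (auto simp: cof_bd)
    next
      case True
      then have T: "T \<subseteq> V" "finite T" "(k, m) \<in> Q" using fin by auto
      define a v where "a = tot T m" "v = \<chi> a"
      have keysV: "w \<in> V" if "0 < Poly_Mapping.lookup m w" for w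
        using QV[OF T(3)] that by (auto simp: in_keys_iff)
      let ?W = "{w \<in> V - T. 0 < Poly_Mapping.lookup m w}"
      have bdx: "cof (bd lt V (var_act Q) x T) k m = (\<Sum>w\<in>?W. ?s w T * (if v \<in> insert w T then
          ?s v (insert w T - {v}) * cof (c (insert w T - {v})) k (m - monv w + monv v) else 0))"
      proof -
        have "cof (bd lt V (var_act Q) x T) k m = (\<Sum>w\<in>V - T. if 0 < Poly_Mapping.lookup m w then
            ?s w T * cof (x (insert w T)) k (m - monv w) else 0)"
          unfolding cof_bd using T by (auto intro!: sum.cong)
        also have "\<dots> = (\<Sum>w\<in>?W. ?s w T * cof (x (insert w T)) k (m - monv w))"
          using V by (intro sum.inter_filter[symmetric]) simp
        also have "\<dots> = (\<Sum>w\<in>?W. ?s w T * (if v \<in> insert w T then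
          ?s v (insert w T - {v}) * cof (c (insert w T - {v})) k (m - monv w + monv v) else 0))"
        proof (rule sum.cong[OF refl])
          fix w assume w: "w \<in> ?W"
          then have "tot (insert w T) (m - monv w) = a" using T by (simp add: tot_insert_minus a_v_def)
          then show "?s w T * cof (x (insert w T)) k (m - monv w) = ?s w T * (if v \<in> insert w T then
            ?s v (insert w T - {v}) * cof (c (insert w T - {v})) k (m - monv w + monv v) else 0)"
            using w T by (simp add: x_def cof_koszul_htpy a_v_def)
        qed
        finally show ?thesis .
      qed
      show ?thesis
      proof (cases "G a")
        \<comment> \<open>Outside \<open>G\<close> the chain \<open>c\<close> has no terms, and
          every term that the homotopy could produce has the same multidegree
          \<open>a\<close>.\<close>
        case nG: False
        have "cof (c (insert w T - {v})) k (m - monv w + monv v) = 0" if "w \<in> ?W" "v \<in> insert w T" for w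
        proof -
          have "tot (insert w T - {v}) (m - monv w + monv v) = a"
            using that T by (intro poly_mapping_eqI) (auto simp: a_v_def lookup_tot lookup_add lookup_minus lookup_monv)
          then show ?thesis using Gc nG by metis
        qed
        then have "cof (bd lt V (var_act Q) x T) k m = 0" unfolding bdx by (intro sum.neutral) auto
        moreover have "cof (c T) k m = 0" using Gc nG unfolding a_v_def by blast
        ultimately show ?thesis by simp
      next
        case Ga: True
        then have v: "v \<in> T \<union> Poly_Mapping.keys m" "v \<in> T \<Longrightarrow> (k, m + monv v) \<in> Q"
          using G\<chi>[OF T(1,3)] unfolding a_v_def by blast+
        show ?thesis
        proof (cases "v \<in> T")
          case False
          \<comment> \<open>With \<open>v\<close> outside \<open>T\<close>, only
            \<open>w = v\<close> brings \<open>v\<close> into the exterior part, and its two equal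
            signs cancel.\<close>
          then have vW: "v \<in> ?W" using v keysV by (auto simp: in_keys_iff)
          have "cof (bd lt V (var_act Q) x T) k m = (\<Sum>w\<in>?W. if w = v then ?s v T * ?s v T * cof (c T) k m else 0)"
            unfolding bdx using False by (intro sum.cong) (auto simp: minus_single_add)
          also have "\<dots> = cof (c T) k m"
            using vW V by (simp add: koszul_sign_sq)
          finally show ?thesis .
        next
          case vT: True
          \<comment> \<open>With \<open>v\<close> in \<open>T\<close>, the cycle condition at
            \<open>U\<close> and the monomial \<open>m + monv v\<close> expresses the coefficient at
            \<open>T\<close> through those at \<open>insert w U\<close>. For this the product with
            \<open>v\<close> must stay in \<open>Q\<close>.\<close>
          define U where "U = T - {v}"
          have U: "T = insert v U" "v \<notin> U" "finite U" "U \<subseteq> V" "v \<in> V" using vT T by (auto simp: U_def)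
          have WU: "{w \<in> V - U. 0 < Poly_Mapping.lookup (m + monv v) w} = insert v ?W"
            using U by (auto simp: lookup_add lookup_monv)
          have "0 = cof (bd lt V (var_act Q) c U) k (m + monv v)" using bd0 by simp
          also have "\<dots> = (\<Sum>w\<in>V - U. if 0 < Poly_Mapping.lookup (m + monv v) w then
              ?s w U * cof (c (insert w U)) k (m + monv v - monv w) else 0)"
            unfolding cof_bd using U v(2)[OF vT] by (auto intro!: sum.cong)
          also have "\<dots> = (\<Sum>w\<in>{w \<in> V - U. 0 < Poly_Mapping.lookup (m + monv v) w}.
              ?s w U * cof (c (insert w U)) k (m + monv v - monv w))"
            using V by (intro sum.inter_filter[symmetric]) simp
          also have "\<dots> = ?s v U * cof (c T) k m + (\<Sum>w\<in>?W. ?s w U * cof (c (insert w U)) k (m + monv v - monv w))"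
            unfolding WU using V vT U(1) by (subst sum.insert) auto
          finally have "?s v U * cof (c T) k m = - (\<Sum>w\<in>?W. ?s w U * cof (c (insert w U)) k (m + monv v - monv w))"
            by (simp add: eq_neg_iff_add_eq_0)
          then have "?s v U * (?s v U * cof (c T) k m) = - (\<Sum>w\<in>?W. ?s v U * (?s w U * cof (c (insert w U)) k (m + monv v - monv w)))"
            by (simp add: sum_distrib_left)
          then have cT: "cof (c T) k m = (\<Sum>w\<in>?W. - (?s v U * ?s w U * cof (c (insert w U)) k (m + monv v - monv w)))"
            unfolding mult.assoc[symmetric] koszul_sign_sq by (simp add: sum_negf)
          show ?thesis
            unfolding bdx cT
          proof (rule sum.cong[OF refl])
            fix w assume w: "w \<in> ?W"
            then have wv: "w \<noteq> v" "w \<notin> U" using vT U by auto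
            have 1: "insert w T - {v} = insert w U" using wv U by auto
            have 2: "m - monv w + monv v = m + monv v - monv w"
              using w wv by (intro poly_mapping_eqI) (auto simp: lookup_add lookup_minus lookup_monv)
            have "?s v U * ?s w (insert v U) = - (?s w U * ?s v (insert w U))"
              using U wv by (intro koszul_sign_anticomm[OF lt]) auto
            then have "?s v U * (?s v U * ?s w T) * ?s v (insert w U) = - (?s v U * ?s w U * (?s v (insert w U) * ?s v (insert w U)))"
              unfolding U(1)[symmetric] by (simp add: mult.assoc)
            then have "?s w T * ?s v (insert w U) = - (?s v U * ?s w U)"
              unfolding mult.assoc[of "?s v U" "?s v U", symmetric] koszul_sign_sq by simp
            then show "?s w T * (if v \<in> insert w T then
                ?s v (insert w T - {v}) * cof (c (insert w T - {v})) k (m - monv w + monv v) else 0) =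
              - (?s v U * ?s w U * cof (c (insert w U)) k (m + monv v - monv w))"
              using vT unfolding 1 2 by (simp add: mult.assoc[symmetric])
          qed
        qed
      qed
    qed
  qed
  then have "bd lt V (var_act Q) x = c" by auto
  ultimately show ?thesis unfolding kboundaries_def by blast
qed

text \<open>The actions commute in spite of truncation because \<open>Q\<close> is closed under
  divisors: a product that has left \<open>Q\<close> cannot return to it.\<close>

lemma graded_mod_fspace:
  assumes Qdown: "\<And>k m v. (k, m + monv v) \<in> Q \<Longrightarrow> (k, m) \<in> Q"
    and fin: "\<And>d. finite {(k, m). (k, m) \<in> Q \<and> dg k + mon_degree m = d}"
  shows "graded_mod V (var_act Q) (fspace Q dg :: nat \<Rightarrow> ('v, 'k::field) fmod set)"
  unfolding graded_mod_def
proof (intro conjI allI ballI)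
  show "Vector_Spaces.linear fm_scale fm_scale (var_act Q v)" for v by (rule linear_var_act)
  show "fm.subspace (fspace Q dg d)" for d by (rule subspace_fspace)
  show "fin_dim fm_scale (fspace Q dg d :: ('v, 'k) fmod set)" for d by (rule fin_dim_fspace[OF fin])
  fix v d and f :: "('v, 'k) fmod" assume f: "f \<in> fspace Q dg d"
  show "var_act Q v f \<in> fspace Q dg (Suc d)"
    unfolding fspace_def
  proof (intro CollectI allI impI)
    fix k m assume "cof (var_act Q v f) k m \<noteq> 0"
    then have *: "(k, m) \<in> Q" "0 < Poly_Mapping.lookup m v" "cof f k (m - monv v) \<noteq> 0" by (auto split: if_splits)
    then have "dg k + mon_degree (m - monv v) = d" using f by (auto simp: fspace_def)
    moreover have "mon_degree m = mon_degree (m - monv v) + 1"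
      using minus_single_add[OF *(2)] mon_degree_add[of "m - monv v" "monv v"] by (simp add: mon_degree_monv)
    ultimately show "(k, m) \<in> Q \<and> dg k + mon_degree m = Suc d" using * by simp
  qed
next
  fix v w d and f :: "('v, 'k) fmod" assume f: "f \<in> fspace Q dg d"
  have Qm: "(k, m - monv v) \<in> Q" if "(k, m) \<in> Q" "0 < Poly_Mapping.lookup m v" for k m v
    using Qdown minus_single_add[OF that(2)] that(1) by metis
  show "var_act Q v (var_act Q w f) = var_act Q w (var_act Q v f)"
  proof (cases "v = w")
    case False
    show ?thesis
    proof (rule cof_eqI)
      fix k m
      have "m - monv v - monv w = m - monv w - monv v"
        by (intro poly_mapping_eqI) (simp add: lookup_minus)
      then show "cof (var_act Q v (var_act Q w f)) k m = cof (var_act Q w (var_act Q v f)) k m"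
        using False Qm by (auto simp: lookup_minus lookup_monv)
    qed
  qed simp
qed

text \<open>The monomials outside the edge ideal, placed in component 0 of the common module type.
  They form a basis of R/I(G), on which \<open>var_act\<close> is multiplication by a
  variable.\<close>

definition std_terms :: "'v set \<Rightarrow> 'v set set \<Rightarrow> (nat \<times> ('v \<Rightarrow>\<^sub>0 nat)) set" where
  "std_terms V E = {(k, m). k = 0 \<and> Poly_Mapping.keys m \<subseteq> V \<and> indep E (Poly_Mapping.keys m)}"

definition free_terms :: "'v set \<Rightarrow> nat set \<Rightarrow> (nat \<times> ('v \<Rightarrow>\<^sub>0 nat)) set" where
  "free_terms V B = {(k, m). k \<in> B \<and> Poly_Mapping.keys m \<subseteq> V}"

lemma keys_plus_monv: "Poly_Mapping.keys (m + monv v) = insert v (Poly_Mapping.keys m)"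
  by (auto simp: in_keys_iff lookup_add lookup_monv split: if_splits)

lemma std_terms_down: "(k, m + monv v) \<in> std_terms V E \<Longrightarrow> (k, m) \<in> std_terms V E"
  unfolding std_terms_def by (auto simp: keys_plus_monv intro: indep_subset)

lemma free_terms_down: "(k, m + monv v) \<in> free_terms V B \<Longrightarrow> (k, m) \<in> free_terms V B"
  unfolding free_terms_def by (auto simp: keys_plus_monv)

lemma finite_free_terms:
  assumes V: "finite V" and B: "\<And>d. finite {k \<in> B. dg k = d}"
  shows "finite {(k, m). (k, m) \<in> free_terms V B \<and> dg k + mon_degree m = d}"
proof (rule finite_subset)
  show "{(k, m). (k, m) \<in> free_terms V B \<and> dg k + mon_degree m = d} \<subseteq>
    (\<Union>e\<le>d. {k \<in> B. dg k = e}) \<times> {m. Poly_Mapping.keys m \<subseteq> V \<and> mon_degree m \<le> d}"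
    by (auto simp: free_terms_def)
  show "finite ((\<Union>e\<le>d. {k \<in> B. dg k = e}) \<times> {m. Poly_Mapping.keys m \<subseteq> V \<and> mon_degree m \<le> d})"
    using B finite_monomials[OF V] by auto
qed

lemma finite_std_terms:
  assumes V: "finite V"
  shows "finite {(k, m). (k, m) \<in> std_terms V E \<and> 0 + mon_degree m = d}"
proof (rule finite_subset)
  show "{(k, m). (k, m) \<in> std_terms V E \<and> 0 + mon_degree m = d} \<subseteq>
    {0} \<times> {m. Poly_Mapping.keys m \<subseteq> V \<and> mon_degree m \<le> d}" by (auto simp: std_terms_def)
  show "finite ({0::nat} \<times> {m. Poly_Mapping.keys m \<subseteq> V \<and> mon_degree m \<le> d})" using finite_monomials[OF V] by auto
qed

lemma graded_mod_std:
  "finite V \<Longrightarrow> graded_mod V (var_act (std_terms V E)) (fspace (std_terms V E) (\<lambda>_. 0) :: nat \<Rightarrow> ('v, 'k::field) fmod set)"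
  by (rule graded_mod_fspace[OF std_terms_down finite_std_terms])

lemma graded_mod_free:
  assumes "finite V" "\<And>d. finite {k \<in> B. dg k = d}"
  shows "graded_mod V (var_act (free_terms V B)) (fspace (free_terms V B) dg :: nat \<Rightarrow> ('v, 'k::field) fmod set)"
  by (rule graded_mod_fspace[OF free_terms_down finite_free_terms[OF assms]])

context
  fixes V :: "'v set" and lt :: "'v \<Rightarrow> 'v \<Rightarrow> bool" and B :: "nat set" and dg :: "nat \<Rightarrow> nat"
  assumes V: "finite V" and lt: "strict_total lt"
begin

text \<open>Free terms stay free terms under multiplication by any variable of \<open>V\<close>, so
  each variable occurring in the multidegree can serve for the contraction. Only multidegree zero
  obstructs it.\<close>

lemma free_boundary:
  fixes c :: "'v set \<Rightarrow> ('v, 'k::field) fmod"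
  assumes c: "c \<in> kchains V (fspace (free_terms V B) dg) p d" and bd0: "bd lt V (var_act (free_terms V B)) c = 0"
    and nz: "\<And>S k m. cof (c S) k m \<noteq> 0 \<Longrightarrow> tot S m \<noteq> 0"
  shows "c \<in> kboundaries lt V (var_act (free_terms V B)) (fspace (free_terms V B) dg) p d"
proof (rule koszul_homotopy[OF V lt free_terms_down _ c bd0, where G = "\<lambda>a. a \<noteq> 0" and \<chi> = "\<lambda>a. SOME v. v \<in> Poly_Mapping.keys a"])
  show "Poly_Mapping.keys m \<subseteq> V" if "(k, m) \<in> free_terms V B" for k m using that by (simp add: free_terms_def)
  show "tot S m \<noteq> 0" if "cof (c S) k m \<noteq> 0" for S k m using nz that .
  fix S k m assume S: "S \<subseteq> V" "(k, m) \<in> free_terms V B" "tot S m \<noteq> 0"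
  define v where "v = (SOME v. v \<in> Poly_Mapping.keys (tot S m))"
  have "\<exists>v. v \<in> Poly_Mapping.keys (tot S m)" using S(3) by (metis ex_in_conv keys_eq_empty)
  then have v: "v \<in> Poly_Mapping.keys (tot S m)" unfolding v_def by (rule someI_ex)
  have "finite S" using S V finite_subset by blast
  then have "v \<in> S \<union> Poly_Mapping.keys m" using v by (auto simp: in_keys_iff lookup_tot split: if_splits)
  then have "v \<in> S \<union> Poly_Mapping.keys m \<and> (v \<in> S \<longrightarrow> (k, m + monv v) \<in> free_terms V B)"
    using S by (auto simp: free_terms_def keys_plus_monv)
  then show "(SOME v. v \<in> Poly_Mapping.keys (tot S m)) \<in> S \<union> Poly_Mapping.keys m \<and>
      ((SOME v. v \<in> Poly_Mapping.keys (tot S m)) \<in> S \<longrightarrow>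
        (k, m + monv (SOME v. v \<in> Poly_Mapping.keys (tot S m))) \<in> free_terms V B)"
    unfolding v_def .
qed

text \<open>A nonempty exterior part makes the multidegree nonzero.\<close>

lemma free_acyclic:
  "kcycles lt V (var_act (free_terms V B)) (fspace (free_terms V B) dg :: nat \<Rightarrow> ('v, 'k::field) fmod set) (Suc p) d
    \<subseteq> kboundaries lt V (var_act (free_terms V B)) (fspace (free_terms V B) dg) (Suc p) d"
proof
  fix c :: "'v set \<Rightarrow> ('v, 'k) fmod"
  assume "c \<in> kcycles lt V (var_act (free_terms V B)) (fspace (free_terms V B) dg) (Suc p) d"
  then have c: "c \<in> kchains V (fspace (free_terms V B) dg) (Suc p) d" "bd lt V (var_act (free_terms V B)) c = 0"
    by (auto simp: kcycles_def)
  show "c \<in> kboundaries lt V (var_act (free_terms V B)) (fspace (free_terms V B) dg) (Suc p) d"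
  proof (rule free_boundary[OF c])
    fix S k m assume "cof (c S) k m \<noteq> 0"
    then have "c S \<noteq> 0" by auto
    then have S: "S \<subseteq> V" "card S = Suc p" using kchains_zero[OF c(1)] by blast+
    then obtain v where "v \<in> S" by fastforce
    moreover have "finite S" using S V finite_subset by blast
    ultimately have "Poly_Mapping.lookup (tot S m) v \<noteq> 0" by (simp add: lookup_tot)
    then show "tot S m \<noteq> 0" by auto
  qed
qed

text \<open>Reading off constant coefficients identifies the free module modulo the variables, in
  degree \<open>d\<close>, with the functions on the basis elements of that degree: a 0-chain
  without constant coefficients bounds by \<open>free_boundary\<close>.\<close>

lemma kdim_free_zero:
  assumes B: "\<And>d. finite {k \<in> B. dg k = d}"
  shows "kdim lt V (var_act (free_terms V B)) (fspace (free_terms V B) dg :: nat \<Rightarrow> ('v, 'k::field) fmod set) 0 d =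
    int (card {k \<in> B. dg k = d})"
proof -
  let ?X = "var_act (free_terms V B) :: _ \<Rightarrow> ('v, 'k) fmod \<Rightarrow> _" and ?F = "fspace (free_terms V B) dg :: nat \<Rightarrow> ('v, 'k) fmod set"
  define g :: "('v set \<Rightarrow> ('v, 'k) fmod) \<Rightarrow> nat \<Rightarrow> 'k" where "g = (\<lambda>c k. cof (c {}) k 0)"
  have gm: "graded_mod V ?X ?F" by (rule graded_mod_free[OF V B])
  have lin: "Vector_Spaces.linear ch_scale fscale g"
    unfolding Vector_Spaces.linear_iff
    by (auto simp: ch.vector_space_axioms fv.vector_space_axioms g_def ch_scale_def fscale_apply fun_eq_iff)
  have sub: "ch.subspace (kchains V ?F 0 d)" by (rule subspace_kchains[OF subspace_fspace])
  have Z: "kcycles lt V ?X ?F 0 d = kchains V ?F 0 d" using bd_zero_chains[OF V gm] by (auto simp: kcycles_def)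
  have bnd0: "g c = 0" if "c \<in> kboundaries lt V ?X ?F 0 d" for c
    using that by (auto simp: g_def kboundaries_def cof_bd fun_eq_iff)
  have "int (ch.dim (kchains V ?F 0 d)) - int (ch.dim (kboundaries lt V ?X ?F 0 d)) =
      int (fv.dim (g ` kchains V ?F 0 d)) - int (fv.dim (g ` kboundaries lt V ?X ?F 0 d))"
  proof (rule chf.dim_diff_image[OF lin sub subspace_kboundaries[OF gm]])
    show "fin_dim ch_scale (kchains V ?F 0 d)"
      using gm by (intro fin_dim_kchains[OF V]) (simp add: graded_mod_def)
    show "kboundaries lt V ?X ?F 0 d \<subseteq> kchains V ?F 0 d"
      using bd_kchains[OF V gm] by (auto simp: kboundaries_def)
    fix c assume c: "c \<in> kchains V ?F 0 d" "g c = 0"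
    show "c \<in> kboundaries lt V ?X ?F 0 d"
    proof (rule free_boundary[OF c(1) bd_zero_chains[OF V gm c(1)]])
      fix S k m assume nz: "cof (c S) k m \<noteq> 0"
      then have "c S \<noteq> 0" by auto
      then have "S \<subseteq> V" "card S = 0" using kchains_zero[OF c(1)] by blast+
      then have S: "S = {}" using V finite_subset by fastforce
      show "tot S m \<noteq> 0"
      proof
        assume "tot S m = 0"
        then have "m = 0" by (simp add: S tot_def)
        then show False using nz fun_cong[OF c(2), of k] by (simp add: S g_def)
      qed
    qed
  qed
  moreover have "g ` kboundaries lt V ?X ?F 0 d = {0}"
    using bnd0 ch.subspace_0[OF subspace_kboundaries[OF gm]] by (auto simp: image_iff) (metis)
  moreover have "g ` kchains V ?F 0 d = supp_in {k \<in> B. dg k = d}"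
  proof (intro equalityI subsetI)
    fix f assume "f \<in> g ` kchains V ?F 0 d"
    then obtain c where c: "c \<in> kchains V ?F 0 d" "f = g c" by blast
    have "c {} \<in> ?F d" using kchainsD[OF c(1), of "{}"] by simp
    then have "(k, 0) \<in> free_terms V B \<and> dg k + mon_degree (0 :: 'v \<Rightarrow>\<^sub>0 nat) = d" if "cof (c {}) k 0 \<noteq> 0" for k
      using that unfolding fspace_def by blast
    then have "k \<in> B \<and> dg k = d" if "cof (c {}) k 0 \<noteq> 0" for k
      using that by (simp add: free_terms_def)
    then show "f \<in> supp_in {k \<in> B. dg k = d}" unfolding c(2) g_def supp_in_def by blast
  next
    fix f :: "nat \<Rightarrow> 'k" assume f: "f \<in> supp_in {k \<in> B. dg k = d}"
    define h where "h = (\<Sum>k\<in>{k \<in> B. dg k = d}. Poly_Mapping.single k (Poly_Mapping.single (0 :: 'v \<Rightarrow>\<^sub>0 nat) (f k)))"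
    have ch: "cof h k m = (if m = 0 then f k else 0)" for k m
    proof -
      have "cof h k m = (\<Sum>j\<in>{k \<in> B. dg k = d}. if j = k then (if m = 0 then f k else 0) else 0)"
        unfolding h_def cof_sum by (rule sum.cong) (auto simp: cof_def lookup_single when_def)
      then show ?thesis using B[of d] f by (auto simp: supp_in_def)
    qed
    define c where "c = (\<lambda>S :: 'v set. if S = {} then h else 0)"
    have "h \<in> ?F d" using f by (auto simp: fspace_def ch free_terms_def supp_in_def split: if_splits)
    moreover have "S = {}" if "S \<subseteq> V" "card S = 0" for S using that V finite_subset by fastforce
    ultimately have "c S \<in> ?F (d - 0)" if "S \<subseteq> V" "card S = 0" for S
      using that by (simp add: c_def)
    then have "c \<in> kchains V ?F 0 d" by (rule kchainsI) (auto simp: c_def)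
    moreover have "g c = f" by (auto simp: g_def c_def ch)
    ultimately show "f \<in> g ` kchains V ?F 0 d" by blast
  qed
  ultimately show ?thesis using dim_supp_in[OF B[of d], where 'k='k]
    by (simp add: kdim_def Z fv.dim_zero_space)
qed

end

section \<open>Reduction to squarefree multidegrees\<close>

definition mon_ind :: "'v set \<Rightarrow> ('v \<Rightarrow>\<^sub>0 nat)" where
  "mon_ind \<sigma> = (\<Sum>v\<in>\<sigma>. monv v)"

lemma lookup_mon_ind: "finite \<sigma> \<Longrightarrow> Poly_Mapping.lookup (mon_ind \<sigma>) x = (if x \<in> \<sigma> then 1 else 0)"
  by (simp add: mon_ind_def lookup_sum lookup_monv)

lemma keys_mon_ind: "finite \<sigma> \<Longrightarrow> Poly_Mapping.keys (mon_ind \<sigma>) = \<sigma>"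
  by (auto simp: in_keys_iff lookup_mon_ind split: if_splits)

lemma mon_degree_mon_ind: "finite \<sigma> \<Longrightarrow> mon_degree (mon_ind \<sigma>) = card \<sigma>"
  by (simp add: mon_degree_def keys_mon_ind lookup_mon_ind)

lemma mon_ind_minus: "finite \<tau> \<Longrightarrow> v \<in> \<tau> \<Longrightarrow> mon_ind \<tau> - monv v = mon_ind (\<tau> - {v})"
proof (rule poly_mapping_eqI)
  fix x assume "finite \<tau>" "v \<in> \<tau>"
  then show "Poly_Mapping.lookup (mon_ind \<tau> - monv v) x = Poly_Mapping.lookup (mon_ind (\<tau> - {v})) x"
    by (cases "x = v") (simp_all add: lookup_minus lookup_mon_ind lookup_monv)
qed

text \<open>Restriction to squarefree multidegrees is a homology isomorphism onto the complex of cells.\<close>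

lemma kdim_std:
  fixes K :: "'k::field itself" and V :: "'v set"
  assumes V: "finite V" and lt: "strict_total lt"
  shows "kdim lt V (var_act (std_terms V E)) (fspace (std_terms V E) (\<lambda>_. 0) :: nat \<Rightarrow> ('v, 'k) fmod set) p d =
    uv_coeff (cell_poly K lt V E) p d"
proof -
  let ?Q = "std_terms V E"
  let ?X = "var_act ?Q :: _ \<Rightarrow> ('v, 'k) fmod \<Rightarrow> _" and ?F = "fspace ?Q (\<lambda>_. 0) :: nat \<Rightarrow> ('v, 'k) fmod set"
  let ?C = "cells V E" and ?a = "cell_matrix lt :: _ \<Rightarrow> _ \<Rightarrow> 'k"
  let ?b = "bd lt V ?X" and ?d = "dif ?C ?a"
  have fin: "finite S" if "S \<subseteq> V" for S using that V finite_subset by blast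
  have gm: "graded_mod V ?X ?F" by (rule graded_mod_std[OF V])
  have bc: "based_complex ?C cell_grade ?a" by (rule based_complex_cells[OF V lt])
  \<comment> \<open>\<open>\<theta>\<close> keeps the squarefree terms whose monomial is disjoint
    from the exterior part; it is a chain map to the cell complex, with \<open>\<psi>\<close> as a
    section.\<close>
  define \<theta> :: "('v set \<Rightarrow> ('v, 'k) fmod) \<Rightarrow> 'v set \<times> 'v set \<Rightarrow> 'k" where
    "\<theta> = (\<lambda>c (S, \<sigma>). if (S, \<sigma>) \<in> ?C then cof (c S) 0 (mon_ind \<sigma>) else 0)"
  define \<psi> :: "('v set \<times> 'v set \<Rightarrow> 'k) \<Rightarrow> 'v set \<Rightarrow> ('v, 'k) fmod" where
    "\<psi> = (\<lambda>f S. \<Sum>\<sigma>\<in>Pow V. if (S, \<sigma>) \<in> ?C then Poly_Mapping.single 0 (Poly_Mapping.single (mon_ind \<sigma>) (f (S, \<sigma>))) else 0)"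
  have cof\<psi>: "cof (\<psi> f S) k m = (if k = 0 \<and> (S, Poly_Mapping.keys m) \<in> ?C \<and> m = mon_ind (Poly_Mapping.keys m)
      then f (S, Poly_Mapping.keys m) else 0)" for f S k m
  proof -
    have "cof (\<psi> f S) k m = (\<Sum>\<sigma>\<in>Pow V. if \<sigma> = Poly_Mapping.keys m then
        (if k = 0 \<and> (S, Poly_Mapping.keys m) \<in> ?C \<and> m = mon_ind (Poly_Mapping.keys m)
         then f (S, Poly_Mapping.keys m) else 0) else 0)"
      unfolding \<psi>_def cof_sum
      by (rule sum.cong) (auto simp: cof_def lookup_single when_def keys_mon_ind fin)
    also have "\<dots> = (if k = 0 \<and> (S, Poly_Mapping.keys m) \<in> ?C \<and> m = mon_ind (Poly_Mapping.keys m)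
      then f (S, Poly_Mapping.keys m) else 0)"
      using V by (auto simp: cells_def)
    finally show ?thesis .
  qed
  have lin: "Vector_Spaces.linear ch_scale fscale \<theta>"
    unfolding Vector_Spaces.linear_iff
    by (auto simp: ch.vector_space_axioms fv.vector_space_axioms \<theta>_def ch_scale_def fscale_apply fun_eq_iff)
  have cD: "S \<subseteq> V \<and> card S = p \<and> p \<le> d \<and> k = 0 \<and> (k, m) \<in> ?Q \<and> mon_degree m = d - p"
    if c: "c \<in> kchains V ?F p d" and nz: "cof (c S) k m \<noteq> 0" for c S k m p d
  proof -
    have "c S \<noteq> 0" using nz by auto
    then have *: "S \<subseteq> V \<and> card S = p \<and> p \<le> d" using kchains_zero[OF c] by blast
    then have "c S \<in> ?F (d - p)" using kchainsD[OF c] by blast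
    then show ?thesis using * nz by (auto simp: fspace_def std_terms_def)
  qed
  have \<theta>_gr: "\<theta> c \<in> graded_part cell_grade (p, d) (supp_in ?C)" if c: "c \<in> kchains V ?F p d" for c p d
  proof -
    have "cell_grade (S, \<sigma>) = (p, d)" if "\<theta> c (S, \<sigma>) \<noteq> 0" for S \<sigma>
    proof -
      have s: "(S, \<sigma>) \<in> ?C" "cof (c S) 0 (mon_ind \<sigma>) \<noteq> 0" using that by (auto simp: \<theta>_def split: if_splits)
      then have "card S = p" "p \<le> d" "mon_degree (mon_ind \<sigma>) = d - p" using cD[OF c] by blast+
      moreover have "finite \<sigma>" using s(1) fin by (auto simp: cells_def)
      ultimately show ?thesis by (simp add: cell_grade_def mon_degree_mon_ind)
    qed
    moreover have "\<theta> c \<in> supp_in ?C" by (auto simp: \<theta>_def supp_in_def)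
    ultimately show ?thesis by (auto simp: graded_part_def)
  qed
  have \<theta>_bd: "\<theta> (?b c) = ?d (\<theta> c)" for c
  proof -
    have "\<theta> (?b c) (T, \<tau>) = ?d (\<theta> c) (T, \<tau>)" for T \<tau>
    proof (cases "(T, \<tau>) \<in> ?C")
      case True
      then have T: "T \<subseteq> V" "\<tau> \<subseteq> V" "T \<inter> \<tau> = {}" "finite \<tau>" "(0, mon_ind \<tau>) \<in> ?Q"
        using fin by (auto simp: cells_def std_terms_def keys_mon_ind)
      have "\<theta> (?b c) (T, \<tau>) = (\<Sum>v\<in>V - T. if v \<in> \<tau> then
          koszul_sign lt v T * cof (c (insert v T)) 0 (mon_ind (\<tau> - {v})) else 0)"
        using True T by (auto simp: \<theta>_def cof_bd lookup_mon_ind mon_ind_minus intro!: sum.cong)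
      also have "\<dots> = (\<Sum>v\<in>(V - T) \<inter> \<tau>. koszul_sign lt v T * cof (c (insert v T)) 0 (mon_ind (\<tau> - {v})))"
        using V by (intro sum.inter_restrict[symmetric]) simp
      also have "(V - T) \<inter> \<tau> = \<tau>" using T by blast
      also have "(\<Sum>v\<in>\<tau>. koszul_sign lt v T * cof (c (insert v T)) 0 (mon_ind (\<tau> - {v}))) = ?d (\<theta> c) (T, \<tau>)"
        unfolding dif_cells[OF V True] using cells_move[OF True] by (intro sum.cong) (auto simp: \<theta>_def)
      finally show ?thesis .
    next
      case False
      then show ?thesis by (simp add: \<theta>_def dif_def)
    qed
    then show ?thesis by auto
  qed
  have \<psi>_ch: "\<psi> f \<in> kchains V ?F p d" if f: "f \<in> graded_part cell_grade (p, d) (supp_in ?C)" for f p d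
  proof -
    have *: "S \<subseteq> V \<and> card S = p \<and> p \<le> d \<and> (k, m) \<in> ?Q \<and> mon_degree m = d - p" if "cof (\<psi> f S) k m \<noteq> 0" for S k m
    proof -
      have s: "k = 0" "(S, Poly_Mapping.keys m) \<in> ?C" "m = mon_ind (Poly_Mapping.keys m)" "f (S, Poly_Mapping.keys m) \<noteq> 0"
        using that unfolding cof\<psi> by (auto split: if_splits)
      then have "cell_grade (S, Poly_Mapping.keys m) = (p, d)" using f by (auto simp: graded_part_def)
      moreover have "mon_degree m = card (Poly_Mapping.keys m)"
        using mon_degree_mon_ind[of "Poly_Mapping.keys m"] s(3) by simp
      ultimately show ?thesis using s by (auto simp: cell_grade_def std_terms_def cells_def)
    qed
    show ?thesis
    proof (rule kchainsI)
      show "\<psi> f S \<in> ?F (d - p)" for S using * by (auto simp: fspace_def)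
      show "\<psi> f S = 0" if "\<not> (S \<subseteq> V \<and> card S = p \<and> p \<le> d)" for S
        using * that by (intro cof_eqI) (metis cof_zero)
    qed
  qed
  have \<theta>\<psi>: "\<theta> (\<psi> f) = f" if f: "f \<in> supp_in ?C" for f
  proof -
    have "\<theta> (\<psi> f) (S, \<sigma>) = f (S, \<sigma>)" for S \<sigma>
    proof (cases "(S, \<sigma>) \<in> ?C")
      case True
      then have "finite \<sigma>" using fin by (auto simp: cells_def)
      then show ?thesis using True by (simp add: \<theta>_def cof\<psi> keys_mon_ind)
    next
      case False
      then show ?thesis using f by (simp add: \<theta>_def supp_in_def)
    qed
    then show ?thesis by auto
  qed
  let ?G = "\<lambda>a :: 'v \<Rightarrow>\<^sub>0 nat. \<exists>v. 2 \<le> Poly_Mapping.lookup a v"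
  have sqfree: "(S, Poly_Mapping.keys m) \<in> ?C \<and> \<theta> c (S, Poly_Mapping.keys m) \<noteq> 0"
    if c: "c \<in> kchains V ?F p d" and nz: "cof (c S) k m \<noteq> 0" and nG: "\<not> ?G (tot S m)" for c S k m p d
  proof -
    have S: "S \<subseteq> V" "k = 0" "(k, m) \<in> ?Q" using cD[OF c nz] by auto
    have le: "Poly_Mapping.lookup m v + (if v \<in> S then 1 else 0) < 2" for v
      using nG lookup_tot[OF fin[OF S(1)], of m v] by (metis not_le)
    have "m = mon_ind (Poly_Mapping.keys m)"
    proof (rule poly_mapping_eqI)
      fix v
      show "Poly_Mapping.lookup m v = Poly_Mapping.lookup (mon_ind (Poly_Mapping.keys m)) v"
        using le[of v] by (auto simp: lookup_mon_ind in_keys_iff split: if_splits)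
    qed
    moreover have "v \<notin> Poly_Mapping.keys m" if "v \<in> S" for v
      using le[of v] that by (simp add: in_keys_iff)
    then have "(S, Poly_Mapping.keys m) \<in> ?C" using S by (auto simp: cells_def std_terms_def)
    ultimately show ?thesis using nz S by (simp add: \<theta>_def)
  qed
  \<comment> \<open>A cycle killed by \<open>\<theta>\<close> lives in multidegrees with an exponent
    of at least 2. That variable occurs in the monomial even if it is also exterior, so multiplying
    by it changes neither the support nor membership in the standard terms, and the contraction
    applies.\<close>
  have ker: "c \<in> kboundaries lt V ?X ?F p d" if c: "c \<in> kcycles lt V ?X ?F p d" and 0: "\<theta> c = 0" for c
  proof -
    have cc: "c \<in> kchains V ?F p d" "?b c = 0" using c by (auto simp: kcycles_def)
    show ?thesis
    proof (rule koszul_homotopy[OF V lt std_terms_down _ cc, where G = ?G and \<chi> = "\<lambda>a. SOME v. 2 \<le> Poly_Mapping.lookup a v"])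
      show "Poly_Mapping.keys m \<subseteq> V" if "(k, m) \<in> ?Q" for k m using that by (simp add: std_terms_def)
      show "?G (tot S m)" if "cof (c S) k m \<noteq> 0" for S k m
        using sqfree[OF cc(1) that] 0 by auto
      fix S k m assume S: "S \<subseteq> V" "(k, m) \<in> ?Q" "?G (tot S m)"
      define v where "v = (SOME v. 2 \<le> Poly_Mapping.lookup (tot S m) v)"
      have "2 \<le> Poly_Mapping.lookup (tot S m) v" unfolding v_def using S(3) by (rule someI_ex)
      then have v: "v \<in> Poly_Mapping.keys m"
        unfolding lookup_tot[OF fin[OF S(1)]] by (auto simp: in_keys_iff split: if_splits)
      then have "Poly_Mapping.keys (m + monv v) = Poly_Mapping.keys m" by (auto simp: keys_plus_monv)
      then have "v \<in> S \<union> Poly_Mapping.keys m \<and> (v \<in> S \<longrightarrow> (k, m + monv v) \<in> ?Q)"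
        using v S(2) by (simp add: std_terms_def)
      then show "(SOME v. 2 \<le> Poly_Mapping.lookup (tot S m) v) \<in> S \<union> Poly_Mapping.keys m \<and>
        ((SOME v. 2 \<le> Poly_Mapping.lookup (tot S m) v) \<in> S \<longrightarrow>
          (k, m + monv (SOME v. 2 \<le> Poly_Mapping.lookup (tot S m) v)) \<in> ?Q)"
        unfolding v_def .
    qed
  qed
  have im_cyc: "\<theta> ` kcycles lt V ?X ?F p d = graded_part cell_grade (p, d) (cycles ?C ?a)"
  proof (intro equalityI subsetI)
    fix z assume "z \<in> \<theta> ` kcycles lt V ?X ?F p d"
    then obtain c where c: "c \<in> kchains V ?F p d" "?b c = 0" "z = \<theta> c" by (auto simp: kcycles_def)
    have "?d z = 0" using \<theta>_bd[of c] c chf.linear_0[OF lin] by simp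
    then show "z \<in> graded_part cell_grade (p, d) (cycles ?C ?a)"
      using \<theta>_gr[OF c(1)] c(3) by (auto simp: graded_part_def cycles_def)
  next
    fix z assume z: "z \<in> graded_part cell_grade (p, d) (cycles ?C ?a)"
    then have zs: "z \<in> graded_part cell_grade (p, d) (supp_in ?C)" "z \<in> supp_in ?C" "?d z = 0"
      by (auto simp: graded_part_def cycles_def)
    have \<psi>z: "\<psi> z \<in> kchains V ?F p d" by (rule \<psi>_ch[OF zs(1)])
    \<comment> \<open>A nonzero boundary coefficient of \<open>\<psi> z\<close> would be squarefree
      and hence visible to \<open>\<theta>\<close>, which sends this boundary to the differential of
      \<open>z\<close>, that is, to zero.\<close>
    have "cof (?b (\<psi> z) T) k m = 0" for T k m
    proof (rule ccontr)
      assume nz: "cof (?b (\<psi> z) T) k m \<noteq> 0"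
      then have TV: "T \<subseteq> V" by (auto simp: cof_bd split: if_splits)
      obtain v where v: "v \<in> V - T" "0 < Poly_Mapping.lookup m v" "cof (\<psi> z (insert v T)) k (m - monv v) \<noteq> 0" "(k, m) \<in> ?Q"
      proof -
        have "(\<Sum>v\<in>V - T. koszul_sign lt v T * (if (k, m) \<in> ?Q \<and> 0 < Poly_Mapping.lookup m v
          then cof (\<psi> z (insert v T)) k (m - monv v) else 0)) \<noteq> 0" using nz TV by (simp add: cof_bd)
        then obtain v where "v \<in> V - T" "koszul_sign lt v T * (if (k, m) \<in> ?Q \<and> 0 < Poly_Mapping.lookup m v
          then cof (\<psi> z (insert v T)) k (m - monv v) else 0) \<noteq> 0"
          by (rule sum.not_neutral_contains_not_neutral)
        then show thesis using that[of v] by (auto split: if_splits)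
      qed
      have cell: "(insert v T, Poly_Mapping.keys (m - monv v)) \<in> ?C" "m - monv v = mon_ind (Poly_Mapping.keys (m - monv v))" "k = 0"
        using v(3) unfolding cof\<psi> by (auto split: if_splits)
      have v': "v \<notin> Poly_Mapping.keys (m - monv v)" using cell(1) by (auto simp: cells_def)
      have "m = mon_ind (Poly_Mapping.keys m)"
      proof (rule poly_mapping_eqI)
        fix x
        have "Poly_Mapping.lookup (m - monv v) x \<le> 1"
          using cell(2) lookup_mon_ind[of "Poly_Mapping.keys (m - monv v)" x] by simp
        then show "Poly_Mapping.lookup m x = Poly_Mapping.lookup (mon_ind (Poly_Mapping.keys m)) x"
          using v' v(2) by (cases "x = v") (auto simp: lookup_minus lookup_monv lookup_mon_ind in_keys_iff)
      qed
      moreover have "T \<inter> Poly_Mapping.keys m = {}"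
      proof -
        have "Poly_Mapping.keys m = insert v (Poly_Mapping.keys (m - monv v))"
          using keys_plus_monv[of "m - monv v" v] minus_single_add[OF v(2)] by simp
        then show ?thesis using cell(1) v(1) by (auto simp: cells_def)
      qed
      ultimately have "\<theta> (?b (\<psi> z)) (T, Poly_Mapping.keys m) = cof (?b (\<psi> z) T) k m"
        using TV v(4) cell(3) by (auto simp: \<theta>_def cells_def std_terms_def)
      then show False using nz \<theta>_bd[of "\<psi> z"] \<theta>\<psi>[OF zs(2)] zs(3) by simp
    qed
    then have "?b (\<psi> z) = 0" by (auto simp: fun_eq_iff intro: cof_eqI)
    then have "\<psi> z \<in> kcycles lt V ?X ?F p d" using \<psi>z by (simp add: kcycles_def)
    then show "z \<in> \<theta> ` kcycles lt V ?X ?F p d" using \<theta>\<psi>[OF zs(2)] by (metis image_eqI)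
  qed
  have im_bnd: "\<theta> ` kboundaries lt V ?X ?F p d = graded_part cell_grade (p, d) (boundaries ?C ?a)"
  proof (intro equalityI subsetI)
    fix z assume "z \<in> \<theta> ` kboundaries lt V ?X ?F p d"
    then obtain c where c: "c \<in> kchains V ?F (Suc p) d" "z = \<theta> (?b c)" by (auto simp: kboundaries_def)
    have "z \<in> graded_part cell_grade (p, d) (supp_in ?C)" using \<theta>_gr[OF bd_kchains[OF V gm c(1)]] c by simp
    moreover have "z \<in> boundaries ?C ?a"
      using \<theta>_gr[OF c(1)] c \<theta>_bd[of c] by (auto simp: boundaries_def graded_part_def)
    ultimately show "z \<in> graded_part cell_grade (p, d) (boundaries ?C ?a)" by (auto simp: graded_part_def)
  next
    fix z assume z: "z \<in> graded_part cell_grade (p, d) (boundaries ?C ?a)"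
    then obtain f where f: "f \<in> supp_in ?C" "z = ?d f" by (auto simp: graded_part_def boundaries_def)
    \<comment> \<open>Only the part of \<open>f\<close> one homological degree higher contributes to
      a boundary of pure degree.\<close>
    define f' where "f' = comp_part cell_grade (Suc p, d) f"
    have f': "f' \<in> graded_part cell_grade (Suc p, d) (supp_in ?C)" "f' \<in> supp_in ?C"
      using f by (auto simp: f'_def graded_part_def comp_part_def supp_in_def split: if_splits)
    have "z = ?d f'" using dif_comp_part(1)[OF bc, of p d f] comp_part_eq[OF z] f by (simp add: f'_def)
    also have "\<dots> = \<theta> (?b (\<psi> f'))" using \<theta>_bd \<theta>\<psi>[OF f'(2)] by simp
    finally show "z \<in> \<theta> ` kboundaries lt V ?X ?F p d" using \<psi>_ch[OF f'(1)] by (auto simp: kboundaries_def)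
  qed
  have "kdim lt V ?X ?F p d = int (fv.dim (\<theta> ` kcycles lt V ?X ?F p d)) - int (fv.dim (\<theta> ` kboundaries lt V ?X ?F p d))"
    unfolding kdim_def
  proof (rule chf.dim_diff_image[OF lin subspace_kcycles[OF gm] subspace_kboundaries[OF gm]])
    show "fin_dim ch_scale (kcycles lt V ?X ?F p d)"
      using gm by (intro fin_dim_subset[OF fin_dim_kchains[OF V]]) (auto simp: graded_mod_def kcycles_def)
    show "kboundaries lt V ?X ?F p d \<subseteq> kcycles lt V ?X ?F p d"
      using bd_kchains[OF V gm] bd_bd[OF V lt gm] by (auto simp: kboundaries_def kcycles_def)
  qed (use ker in auto)
  also have "\<dots> = uv_coeff (cell_poly K lt V E) p d"
  proof -
    have I: "finite ?C" by (rule finite_cells[OF V])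
    have "cycles ?C ?a \<subseteq> supp_in ?C" "boundaries ?C ?a \<subseteq> supp_in ?C"
      using dif_supp_in by (auto simp: cycles_def boundaries_def)
    then show ?thesis
      unfolding im_cyc im_bnd cell_poly_def hom_poly_def uv_coeff_simps by (simp add: uv_coeff_hilb[OF I])
  qed
  finally show ?thesis .
qed

subsection \<open>Betti numbers from Koszul homology\<close>

definition fm_term :: "nat \<Rightarrow> ('v \<Rightarrow>\<^sub>0 nat) \<Rightarrow> ('v, 'k::field) fmod" where
  "fm_term k a = Poly_Mapping.single k (Poly_Mapping.single a 1)"

definition mon_act :: "('v \<Rightarrow>\<^sub>0 nat) \<Rightarrow> ('v, 'k::field) fmod \<Rightarrow> ('v, 'k) fmod" where
  "mon_act a g = Poly_Mapping.map ((*) (Poly_Mapping.single a 1)) g"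

definition cof_supp :: "('v, 'k::field) fmod \<Rightarrow> (nat \<times> ('v \<Rightarrow>\<^sub>0 nat)) set" where
  "cof_supp f = {(k, m). cof f k m \<noteq> 0}"

text \<open>The ungraded counterpart of \<open>fspace\<close>; for free terms it is the whole module
  \<open>vectors (poly_ring V) B\<close>.\<close>

definition span_terms :: "(nat \<times> ('v \<Rightarrow>\<^sub>0 nat)) set \<Rightarrow> ('v, 'k::field) fmod set" where
  "span_terms Q = {f. cof_supp f \<subseteq> Q}"

definition deg_part :: "(nat \<Rightarrow> nat) \<Rightarrow> nat \<Rightarrow> ('v, 'k::field) fmod \<Rightarrow> ('v, 'k) fmod" where
  "deg_part dg d f = restr {(k, m). dg k + mon_degree m = d} f"

lemma cof_fm_term: "cof (fm_term k a) j m = (if j = k \<and> m = a then 1 else 0)"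
  by (auto simp: cof_def fm_term_def lookup_single when_def)

lemma cof_mon_act: "cof (mon_act a g) j m = (if \<exists>q. m = a + q then cof g j (m - a) else 0)"
  by (simp add: cof_def mon_act_def lookup_map_mult lookup_single_mult)

lemma cof_deg_part [simp]: "cof (deg_part dg d f) k m = (if dg k + mon_degree m = d then cof f k m else 0)"
  by (simp add: deg_part_def)

lemma finite_cof_supp: "finite (cof_supp f)"
  using finite_cof by (simp add: cof_supp_def)

lemma fm_expand: "f = (\<Sum>(k, a)\<in>cof_supp f. fm_scale (cof f k a) (fm_term k a))"
proof (rule cof_eqI)
  fix j m
  have "cof (\<Sum>(k, a)\<in>cof_supp f. fm_scale (cof f k a) (fm_term k a)) j m =
      (\<Sum>x\<in>cof_supp f. if x = (j, m) then cof f j m else 0)"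
    unfolding cof_sum by (rule sum.cong) (auto simp: cof_fm_term split: if_splits)
  also have "\<dots> = cof f j m" using finite_cof_supp[of f] by (auto simp: cof_supp_def)
  finally show "cof f j m = cof (\<Sum>(k, a)\<in>cof_supp f. fm_scale (cof f k a) (fm_term k a)) j m" by simp
qed

lemma fspace_eq: "fspace Q dg d = {f \<in> span_terms Q. deg_part dg d f = f}"
proof (intro equalityI subsetI)
  fix f assume f: "f \<in> fspace Q dg d"
  have "deg_part dg d f = f" using f by (intro cof_eqI) (auto simp: fspace_def)
  then show "f \<in> {f \<in> span_terms Q. deg_part dg d f = f}" using f by (auto simp: fspace_def span_terms_def cof_supp_def)
next
  fix f assume f: "f \<in> {f \<in> span_terms Q. deg_part dg d f = f}"
  then have "cof f k m = (if dg k + mon_degree m = d then cof f k m else 0)" for k m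
    using cof_deg_part[of dg d f k m] by simp
  then show "f \<in> fspace Q dg d" using f unfolding fspace_def span_terms_def cof_supp_def by (auto; metis)
qed

lemma deg_part_in_fspace: "f \<in> span_terms Q \<Longrightarrow> deg_part dg d f \<in> fspace Q dg d"
  by (auto simp: fspace_def span_terms_def cof_supp_def)

lemma deg_part_sum: "f = (\<Sum>d\<in>(\<lambda>(k, m). dg k + mon_degree m) ` cof_supp f. deg_part dg d f)"
proof (rule cof_eqI)
  fix k m
  let ?D = "(\<lambda>(k, m). dg k + mon_degree m) ` cof_supp f"
  have "cof (\<Sum>d\<in>?D. deg_part dg d f) k m = (\<Sum>d\<in>?D. if d = dg k + mon_degree m then cof f k m else 0)"
    unfolding cof_sum by (rule sum.cong) auto
  also have "\<dots> = (if dg k + mon_degree m \<in> ?D then cof f k m else 0)" using finite_cof_supp[of f] by simp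
  also have "\<dots> = cof f k m" by (force simp: cof_supp_def)
  finally show "cof f k m = cof (\<Sum>d\<in>?D. deg_part dg d f) k m" by simp
qed

lemma lookup_extend_free:
  assumes "finite A" "Poly_Mapping.keys f \<subseteq> A"
  shows "Poly_Mapping.lookup (extend_free D f) j = (\<Sum>k\<in>A. Poly_Mapping.lookup f k * Poly_Mapping.lookup (D k) j)"
  unfolding extend_free_def lookup_sum lookup_map_mult
  using assms by (intro sum.mono_neutral_left) (auto simp: in_keys_iff)

lemma extend_free_add: "extend_free D (f + g) = extend_free D f + extend_free D g"
proof (rule poly_mapping_eqI)
  fix j
  let ?A = "Poly_Mapping.keys f \<union> Poly_Mapping.keys g"
  have A: "finite ?A" by simp
  have sub: "Poly_Mapping.keys (f + g) \<subseteq> ?A" by (rule keys_add)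
  show "Poly_Mapping.lookup (extend_free D (f + g)) j = Poly_Mapping.lookup (extend_free D f + extend_free D g) j"
    unfolding lookup_add lookup_extend_free[OF A sub] lookup_extend_free[OF A Un_upper1] lookup_extend_free[OF A Un_upper2]
    by (simp add: distrib_right sum.distrib)
qed

lemma extend_free_scale: "extend_free D (Poly_Mapping.map ((*) p) f) = Poly_Mapping.map ((*) p) (extend_free D f)"
proof (rule poly_mapping_eqI)
  fix j
  let ?A = "Poly_Mapping.keys f"
  have sub: "Poly_Mapping.keys (Poly_Mapping.map ((*) p) f) \<subseteq> ?A" by (auto simp: in_keys_iff lookup_map_mult)
  show "Poly_Mapping.lookup (extend_free D (Poly_Mapping.map ((*) p) f)) j =
      Poly_Mapping.lookup (Poly_Mapping.map ((*) p) (extend_free D f)) j"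
    unfolding lookup_map_mult lookup_extend_free[OF finite_keys sub] lookup_extend_free[of "Poly_Mapping.keys f" f, OF finite_keys subset_refl]
    by (simp add: sum_distrib_left mult.assoc)
qed

lemma linear_extend_free: "Vector_Spaces.linear fm_scale fm_scale (extend_free D)"
  unfolding Vector_Spaces.linear_iff
  by (auto simp: fm.vector_space_axioms extend_free_add fm_scale_def extend_free_scale)

lemma extend_free_term: "extend_free D (fm_term k a) = mon_act a (D k)"
  by (rule poly_mapping_eqI)
    (simp add: lookup_extend_free[of "{k}"] fm_term_def mon_act_def lookup_map_mult)

lemma cof_extend_free:
  "cof (extend_free D f) j m = (\<Sum>(k, a)\<in>cof_supp f. cof f k a * cof (mon_act a (D k)) j m)"
proof -
  have "extend_free D f = extend_free D (\<Sum>(k, a)\<in>cof_supp f. fm_scale (cof f k a) (fm_term k a))"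
    by (rule arg_cong[OF fm_expand])
  also have "\<dots> = (\<Sum>(k, a)\<in>cof_supp f. fm_scale (cof f k a) (mon_act a (D k)))"
    by (simp add: fmp.linear_sum[OF linear_extend_free] fmp.linear_scale[OF linear_extend_free]
        extend_free_term case_prod_beta)
  finally show ?thesis by (simp add: cof_sum case_prod_beta)
qed

text \<open>The values of \<open>D\<close> off the basis are arbitrary, so homogeneity is assumed
  along the support of \<open>f\<close>.\<close>

lemma deg_part_extend_free:
  assumes hom: "\<And>k a j b. (k, a) \<in> cof_supp f \<Longrightarrow> cof (D k) j b \<noteq> 0 \<Longrightarrow> dg' j + mon_degree b = dg k"
  shows "deg_part dg' d (extend_free D f) = extend_free D (deg_part dg d f)"
proof (rule cof_eqI)
  fix j m
  have sub: "cof_supp (deg_part dg d f) \<subseteq> cof_supp f" by (auto simp: cof_supp_def split: if_splits)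
  have "cof (extend_free D (deg_part dg d f)) j m =
      (\<Sum>(k, a)\<in>cof_supp f. cof (deg_part dg d f) k a * cof (mon_act a (D k)) j m)"
    unfolding cof_extend_free using sub finite_cof_supp
    by (intro sum.mono_neutral_left) (auto simp: cof_supp_def split: if_splits)
  also have "\<dots> = (\<Sum>(k, a)\<in>cof_supp f. if dg' j + mon_degree m = d then cof f k a * cof (mon_act a (D k)) j m else 0)"
  proof (rule sum.cong[OF refl], clarify)
    fix k a assume ka: "(k, a) \<in> cof_supp f"
    show "cof (deg_part dg d f) k a * cof (mon_act a (D k)) j m =
      (if dg' j + mon_degree m = d then cof f k a * cof (mon_act a (D k)) j m else 0)"
    proof (cases "cof (mon_act a (D k)) j m = 0")
      case False
      then obtain q where q: "m = a + q" "cof (D k) j q \<noteq> 0" by (auto simp: cof_mon_act split: if_splits)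
      then have "dg' j + mon_degree m = dg k + mon_degree a"
        using hom[OF ka q(2)] by (simp add: mon_degree_add)
      then show ?thesis by simp
    qed simp
  qed
  also have "\<dots> = cof (deg_part dg' d (extend_free D f)) j m"
    by (simp add: cof_extend_free)
  finally show "cof (deg_part dg' d (extend_free D f)) j m = cof (extend_free D (deg_part dg d f)) j m" by simp
qed

lemma extend_free_span_terms:
  assumes "\<And>k a. (k, a) \<in> cof_supp f \<Longrightarrow> Poly_Mapping.keys a \<subseteq> V \<and> D k \<in> span_terms (free_terms V B')"
  shows "extend_free D f \<in> span_terms (free_terms V B')"
proof -
  have "(j, m) \<in> free_terms V B'" if nz: "cof (extend_free D f) j m \<noteq> 0" for j m
  proof -
    obtain x where x: "x \<in> cof_supp f" "(case x of (k, a) \<Rightarrow> cof f k a * cof (mon_act a (D k)) j m) \<noteq> 0"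
      using nz unfolding cof_extend_free by (rule sum.not_neutral_contains_not_neutral)
    obtain k a where ka: "x = (k, a)" by force
    then have "cof (mon_act a (D k)) j m \<noteq> 0" using x(2) by auto
    then obtain q where q: "m = a + q" "cof (D k) j q \<noteq> 0" by (auto simp: cof_mon_act split: if_splits)
    then have "(j, q) \<in> free_terms V B'" "Poly_Mapping.keys a \<subseteq> V"
      using assms x(1) unfolding ka span_terms_def cof_supp_def by blast+
    then show ?thesis using keys_add[of a q] by (auto simp: free_terms_def q(1))
  qed
  then show ?thesis by (auto simp: span_terms_def cof_supp_def)
qed

lemma vectors_eq:
  "(vectors (poly_ring V) B :: ('v, 'k::field) fmod set) = span_terms (free_terms V B)"
proof (intro equalityI subsetI)
  fix f :: "('v, 'k) fmod" assume f: "f \<in> vectors (poly_ring V) B"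
  have "(k, m) \<in> free_terms V B" if "cof f k m \<noteq> 0" for k m
  proof -
    have km: "k \<in> Poly_Mapping.keys f" "m \<in> Poly_Mapping.keys (Poly_Mapping.lookup f k)"
      using that by (auto simp: cof_def in_keys_iff)
    then have "k \<in> B" "Poly_Mapping.lookup f k \<in> poly_ring V" using f by (auto simp: vectors_def)
    then show ?thesis using km by (auto simp: poly_ring_def free_terms_def)
  qed
  then show "f \<in> span_terms (free_terms V B)" by (auto simp: span_terms_def cof_supp_def)
next
  fix f :: "('v, 'k) fmod" assume "f \<in> span_terms (free_terms V B)"
  then have f: "k \<in> B \<and> Poly_Mapping.keys m \<subseteq> V" if "cof f k m \<noteq> 0" for k m
    using that unfolding span_terms_def cof_supp_def free_terms_def by blast
  have "k \<in> B" if k: "k \<in> Poly_Mapping.keys f" for k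
  proof -
    have "Poly_Mapping.keys (Poly_Mapping.lookup f k) \<noteq> {}" using k by (simp add: in_keys_iff)
    then obtain m where "m \<in> Poly_Mapping.keys (Poly_Mapping.lookup f k)" by blast
    then have "cof f k m \<noteq> 0" by (simp add: cof_def in_keys_iff)
    then show ?thesis using f by blast
  qed
  moreover have "Poly_Mapping.lookup f k \<in> poly_ring V" for k
    using f[of k] unfolding poly_ring_def by (auto simp: cof_def in_keys_iff)
  ultimately show "f \<in> vectors (poly_ring V) B" by (auto simp: vectors_def)
qed

lemma cof_variable_mult: "cof (Poly_Mapping.map ((*) (variable v)) f) k m =
    (if 0 < Poly_Mapping.lookup m v then cof f k (m - monv v) else 0)"
  unfolding cof_def lookup_map_mult lookup_variable_mult monv_def ..

lemma homogeneous_vector_eq: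
  "homogeneous_vector dg d f \<longleftrightarrow> (\<forall>k m. cof f k m \<noteq> 0 \<longrightarrow> dg k + mon_degree m = d)"
proof
  assume h: "homogeneous_vector dg d f"
  show "\<forall>k m. cof f k m \<noteq> 0 \<longrightarrow> dg k + mon_degree m = d"
  proof (intro allI impI)
    fix k m assume nz: "cof f k m \<noteq> 0"
    then have "k \<in> Poly_Mapping.keys f" "m \<in> Poly_Mapping.keys (Poly_Mapping.lookup f k)"
      by (auto simp: cof_def in_keys_iff)
    then have "dg k \<le> d" "mon_degree m = d - dg k"
      using h by (auto simp: homogeneous_vector_def homogeneous_def)
    then show "dg k + mon_degree m = d" by simp
  qed
next
  assume h: "\<forall>k m. cof f k m \<noteq> 0 \<longrightarrow> dg k + mon_degree m = d"
  show "homogeneous_vector dg d f"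
    unfolding homogeneous_vector_def homogeneous_def
  proof (intro ballI conjI)
    fix k assume k: "k \<in> Poly_Mapping.keys f"
    then have "Poly_Mapping.keys (Poly_Mapping.lookup f k) \<noteq> {}" by (simp add: in_keys_iff)
    then obtain m where "m \<in> Poly_Mapping.keys (Poly_Mapping.lookup f k)" by blast
    then have "cof f k m \<noteq> 0" by (simp add: cof_def in_keys_iff)
    then have "dg k + mon_degree m = d" using h by blast
    then show "dg k \<le> d" by simp
    fix m assume "m \<in> Poly_Mapping.keys (Poly_Mapping.lookup f k)"
    then have "dg k + mon_degree m = d" using h by (auto simp: cof_def in_keys_iff)
    then show "mon_degree m = d - dg k" by simp
  qed
qed

text \<open>A free module is closed under multiplication by variables, so nothing is
  truncated.\<close>

lemma var_act_free:
  assumes "f \<in> span_terms (free_terms V B)" "v \<in> V"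
  shows "var_act (free_terms V B) v f = Poly_Mapping.map ((*) (variable v)) f"
proof (rule cof_eqI)
  fix k m
  have "(k, m) \<in> free_terms V B" if "0 < Poly_Mapping.lookup m v" "cof f k (m - monv v) \<noteq> 0"
  proof -
    have "(k, m - monv v) \<in> free_terms V B" using assms(1) that(2) by (auto simp: span_terms_def cof_supp_def)
    then show ?thesis using keys_plus_monv[of "m - monv v" v] minus_single_add[OF that(1)] assms(2)
      by (auto simp: free_terms_def)
  qed
  then show "cof (var_act (free_terms V B) v f) k m = cof (Poly_Mapping.map ((*) (variable v)) f) k m"
    by (auto simp: cof_variable_mult)
qed

text \<open>Places the ring in component 0, which gives the augmentation to R/I(G) the same type as
  the differentials.\<close>

definition embed0 :: "('v, 'k::field) mpol \<Rightarrow> ('v, 'k) fmod" where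
  "embed0 p = Poly_Mapping.single 0 p"

lemma cof_embed0: "cof (embed0 p) k m = (if k = 0 then Poly_Mapping.lookup p m else 0)"
  by (auto simp: cof_def embed0_def lookup_single when_def)

lemma extend_free_embed0: "extend_free (\<lambda>k. embed0 (e k)) f = embed0 (extend_ring e f)"
proof (rule poly_mapping_eqI)
  fix j
  have "Poly_Mapping.lookup (extend_free (\<lambda>k. embed0 (e k)) f) j =
    (\<Sum>k\<in>Poly_Mapping.keys f. Poly_Mapping.lookup f k * Poly_Mapping.lookup (embed0 (e k)) j)"
    by (rule lookup_extend_free) auto
  then show "Poly_Mapping.lookup (extend_free (\<lambda>k. embed0 (e k)) f) j = Poly_Mapping.lookup (embed0 (extend_ring e f)) j"
    by (simp add: embed0_def extend_ring_def lookup_single when_def)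
qed

section \<open>Edge ideals as monomial ideals\<close>

definition simple_graph :: "'v set \<Rightarrow> 'v set set \<Rightarrow> bool" where
  "simple_graph V E \<longleftrightarrow> (\<forall>x y. {x, y} \<in> E \<longrightarrow> x \<in> V \<and> y \<in> V \<and> x \<noteq> y)"

lemma mpol_expand: "p = (\<Sum>m\<in>Poly_Mapping.keys p. Poly_Mapping.single m (Poly_Mapping.lookup p m))"
proof (rule poly_mapping_eqI)
  fix m
  have "Poly_Mapping.lookup (\<Sum>m\<in>Poly_Mapping.keys p. Poly_Mapping.single m (Poly_Mapping.lookup p m)) m =
    (\<Sum>n\<in>Poly_Mapping.keys p. if n = m then Poly_Mapping.lookup p m else 0)"
    unfolding lookup_sum by (rule sum.cong) (auto simp: lookup_single when_def)
  also have "\<dots> = Poly_Mapping.lookup p m" by (simp add: in_keys_iff)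
  finally show "Poly_Mapping.lookup p m = Poly_Mapping.lookup (\<Sum>m\<in>Poly_Mapping.keys p. Poly_Mapping.single m (Poly_Mapping.lookup p m)) m" by simp
qed

text \<open>Membership in a monomial ideal is decided term by term, and a monomial is divisible by a
  generator exactly when its support contains an edge. The ends of an edge are distinct, so both
  variables can be divided out one after the other.\<close>

lemma edge_ideal_iff:
  fixes p :: "('v, 'k::field) mpol"
  assumes G: "simple_graph V E"
  shows "p \<in> edge_ideal (V, E) \<longleftrightarrow> p \<in> poly_ring V \<and> (\<forall>m\<in>Poly_Mapping.keys p. \<not> indep E (Poly_Mapping.keys m))"
proof
  assume "p \<in> edge_ideal (V, E)"
  then obtain T c where T: "finite T" "T \<subseteq> {variable x * variable y | x y. {x, y} \<in> E}"
    "\<forall>s\<in>T. c s \<in> poly_ring V" "p = (\<Sum>s\<in>T. c s * s)"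
    unfolding edge_ideal_def generated_ideal_def by auto
  have "Poly_Mapping.keys m \<subseteq> V \<and> \<not> indep E (Poly_Mapping.keys m)" if m: "m \<in> Poly_Mapping.keys p" for m
  proof -
    obtain s where s: "s \<in> T" "m \<in> Poly_Mapping.keys (c s * s)"
      using m keys_sum[of "\<lambda>s. c s * s" T] unfolding T(4) by blast
    obtain x y where xy: "s = variable x * variable y" "{x, y} \<in> E" using T(2) s(1) by blast
    have sk: "Poly_Mapping.keys s \<subseteq> {monv x + monv y}"
      unfolding xy(1) variable_def mult_single monv_def by simp
    then obtain a where a: "a \<in> Poly_Mapping.keys (c s)" "m = a + (monv x + monv y)"
      using s(2) keys_mult[of "c s" s] by blast
    have "Poly_Mapping.keys a \<subseteq> V" using a(1) T(3) s(1) by (auto simp: poly_ring_def)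
    moreover have "Poly_Mapping.keys m = insert x (insert y (Poly_Mapping.keys a))"
      unfolding a(2) using keys_plus_monv[of "a + monv x" y] keys_plus_monv[of a x] by (auto simp: add.assoc)
    moreover have "x \<in> V" "y \<in> V" using G xy(2) unfolding simple_graph_def by blast+
    ultimately have "Poly_Mapping.keys m \<subseteq> V" "x \<in> Poly_Mapping.keys m" "y \<in> Poly_Mapping.keys m" by auto
    then show ?thesis using xy(2) unfolding indep_def by blast
  qed
  then show "p \<in> poly_ring V \<and> (\<forall>m\<in>Poly_Mapping.keys p. \<not> indep E (Poly_Mapping.keys m))"
    by (auto simp: poly_ring_def)
next
  assume p: "p \<in> poly_ring V \<and> (\<forall>m\<in>Poly_Mapping.keys p. \<not> indep E (Poly_Mapping.keys m))"
  have "\<exists>x y a. {x, y} \<in> E \<and> m = a + (monv x + monv y)" if m: "m \<in> Poly_Mapping.keys p" for m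
  proof -
    obtain x y where xy: "x \<in> Poly_Mapping.keys m" "y \<in> Poly_Mapping.keys m" "{x, y} \<in> E"
      using p m unfolding indep_def by blast
    have ne: "x \<noteq> y" using G xy(3) by (auto simp: simple_graph_def)
    have 1: "m - monv x + monv x = m" using xy(1) by (intro minus_single_add) (simp add: in_keys_iff)
    have 2: "m - monv x - monv y + monv y = m - monv x"
      using xy(2) ne by (intro minus_single_add) (simp add: in_keys_iff lookup_minus lookup_monv)
    have "m = (m - monv x - monv y) + (monv y + monv x)" using 1 2 by (metis add.assoc)
    then have "m = (m - monv x - monv y) + (monv x + monv y)" by (simp add: add.commute)
    then show ?thesis using xy(3) by blast
  qed
  then obtain X Y A where XYA: "\<And>m. m \<in> Poly_Mapping.keys p \<Longrightarrow> {X m, Y m} \<in> E \<and> m = A m + (monv (X m) + monv (Y m))"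
    by metis
  define t :: "('v \<Rightarrow>\<^sub>0 nat) \<Rightarrow> ('v, 'k) mpol" where "t = (\<lambda>m. variable (X m) * variable (Y m))"
  \<comment> \<open>\<open>generated_ideal\<close> provides one coefficient per generator, so the
    cofactors of all monomials assigned to the same generator are added up.\<close>
  define c where "c = (\<lambda>s. \<Sum>m\<in>{m \<in> Poly_Mapping.keys p. t m = s}. Poly_Mapping.single (A m) (Poly_Mapping.lookup p m))"
  have single: "Poly_Mapping.single m (Poly_Mapping.lookup p m) = Poly_Mapping.single (A m) (Poly_Mapping.lookup p m) * t m"
    if "m \<in> Poly_Mapping.keys p" for m
    using XYA[OF that] by (simp add: t_def variable_def mult_single monv_def)
  have "p = (\<Sum>m\<in>Poly_Mapping.keys p. Poly_Mapping.single (A m) (Poly_Mapping.lookup p m) * t m)"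
    by (rule trans[OF mpol_expand]) (rule sum.cong[OF refl single])
  also have "\<dots> = (\<Sum>s\<in>t ` Poly_Mapping.keys p. \<Sum>m\<in>{m \<in> Poly_Mapping.keys p. t m = s}. Poly_Mapping.single (A m) (Poly_Mapping.lookup p m) * t m)"
    by (rule sum.image_gen) simp
  also have "\<dots> = (\<Sum>s\<in>t ` Poly_Mapping.keys p. c s * s)"
    unfolding c_def sum_distrib_right by (intro sum.cong) auto
  finally have "p = (\<Sum>s\<in>t ` Poly_Mapping.keys p. c s * s)" .
  moreover have "t ` Poly_Mapping.keys p \<subseteq> {variable x * variable y | x y. {x, y} \<in> E}"
    using XYA by (auto simp: t_def)
  moreover have "c s \<in> poly_ring V" for s
  proof -
    have "Poly_Mapping.keys a \<subseteq> V" if a: "a \<in> Poly_Mapping.keys (c s)" for a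
    proof -
      obtain m where m: "m \<in> Poly_Mapping.keys p" "a \<in> Poly_Mapping.keys (Poly_Mapping.single (A m) (Poly_Mapping.lookup p m))"
        using a keys_sum unfolding c_def by fastforce
      then have aA: "a = A m" by (simp split: if_splits)
      obtain r where r: "m = a + r" using XYA[OF m(1)] unfolding aA by blast
      have "Poly_Mapping.keys a \<subseteq> Poly_Mapping.keys m"
        unfolding r by (auto simp: in_keys_iff lookup_add)
      then show ?thesis using p m(1) by (auto simp: poly_ring_def)
    qed
    then show ?thesis by (auto simp: poly_ring_def)
  qed
  ultimately show "p \<in> edge_ideal (V, E)"
    unfolding edge_ideal_def generated_ideal_def by (intro CollectI exI[of _ "t ` Poly_Mapping.keys p"] exI[of _ c]) auto
qed

context
  fixes V :: "'v set" and E and lt :: "'v \<Rightarrow> 'v \<Rightarrow> bool" and B deg and e :: "nat \<Rightarrow> ('v, 'k::field) mpol" and D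
  assumes V: "finite V" and lt: "strict_total lt" and G: "simple_graph V E"
    and res: "minimal_graded_free_resolution V (edge_ideal (V, E)) B deg e D"
begin

abbreviation "std \<equiv> std_terms V E"
abbreviation "ft i \<equiv> free_terms V (B i)"

text \<open>One family for the augmentation and the differentials: \<open>aug i\<close> maps the
  i-th free module onto \<open>syz i\<close>. At 0 a polynomial is reduced to its standard
  monomials, a normal form modulo the edge ideal.\<close>

definition aug :: "nat \<Rightarrow> ('v, 'k) fmod \<Rightarrow> ('v, 'k) fmod" where
  "aug i = (case i of 0 \<Rightarrow> (\<lambda>f. restr std (extend_free (\<lambda>k. embed0 (e k)) f)) | Suc j \<Rightarrow> extend_free (D j))"

definition tgt :: "nat \<Rightarrow> (nat \<times> ('v \<Rightarrow>\<^sub>0 nat)) set" where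
  "tgt i = (case i of 0 \<Rightarrow> std | Suc j \<Rightarrow> ft j)"

text \<open>The index is shifted: \<open>syz 0\<close> stands for R/I(G), and
  \<open>syz (Suc j)\<close> sits inside the j-th free module. Accordingly \<open>tgt\<close> names
  the terms on which the variables act.\<close>

definition syz :: "nat \<Rightarrow> nat \<Rightarrow> ('v, 'k) fmod set" where
  "syz i d = (case i of 0 \<Rightarrow> fspace std (\<lambda>_. 0) d | Suc j \<Rightarrow> {f \<in> fspace (ft j) (deg j) d. aug j f = 0})"

lemma aug_0: "aug 0 f = restr std (embed0 (extend_ring e f))"
  by (simp add: aug_def extend_free_embed0)

lemma res_facts:
  "k \<in> B 0 \<Longrightarrow> e k \<in> poly_ring V \<and> homogeneous (deg 0 k) (e k)"
  "k \<in> B (Suc i) \<Longrightarrow> D i k \<in> span_terms (ft i) \<and> homogeneous_vector (deg i) (deg (Suc i) k) (D i k)"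
  "p \<in> poly_ring V \<Longrightarrow> \<exists>f \<in> span_terms (ft 0). p - extend_ring e f \<in> edge_ideal (V, E)"
  "{f \<in> span_terms (ft 0). extend_ring e f \<in> edge_ideal (V, E)} = extend_free (D 0) ` span_terms (ft 1)"
  "{f \<in> span_terms (ft (Suc i)). extend_free (D i) f = 0} = extend_free (D (Suc i)) ` span_terms (ft (Suc (Suc i)))"
  "extend_free (D i) ` span_terms (ft (Suc i)) \<subseteq> vectors (irrelevant_ideal V) (B i)"
proof -
  note r = res[unfolded minimal_graded_free_resolution_def Let_def vectors_eq]
  note r1 = r[THEN conjunct1] and q1 = r[THEN conjunct2]
  note r2 = q1[THEN conjunct1] and q2 = q1[THEN conjunct2]
  note r3 = q2[THEN conjunct1] and q3 = q2[THEN conjunct2]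
  note r4 = q3[THEN conjunct1] and q4 = q3[THEN conjunct2]
  note r5 = q4[THEN conjunct1] and r6 = q4[THEN conjunct2]
  show "k \<in> B 0 \<Longrightarrow> e k \<in> poly_ring V \<and> homogeneous (deg 0 k) (e k)" by (rule bspec[OF r1])
  show "k \<in> B (Suc i) \<Longrightarrow> D i k \<in> span_terms (ft i) \<and> homogeneous_vector (deg i) (deg (Suc i) k) (D i k)"
    by (rule bspec[OF spec[OF r2]])
  show "p \<in> poly_ring V \<Longrightarrow> \<exists>f \<in> span_terms (ft 0). p - extend_ring e f \<in> edge_ideal (V, E)"
    by (rule bspec[OF r3])
  show "{f \<in> span_terms (ft 0). extend_ring e f \<in> edge_ideal (V, E)} = extend_free (D 0) ` span_terms (ft 1)"
    by (rule r4)
  show "{f \<in> span_terms (ft (Suc i)). extend_free (D i) f = 0} = extend_free (D (Suc i)) ` span_terms (ft (Suc (Suc i)))"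
    by (rule spec[OF r5])
  show "extend_free (D i) ` span_terms (ft (Suc i)) \<subseteq> vectors (irrelevant_ideal V) (B i)"
    by (rule spec[OF r6])
qed

lemma extend_ring_in:
  assumes "f \<in> span_terms (ft 0)"
  shows "extend_ring e f \<in> poly_ring V"
proof -
  have e: "embed0 (e k) \<in> span_terms (free_terms V {0})" if "k \<in> B 0" for k
    using res_facts(1)[OF that] by (auto simp: span_terms_def cof_supp_def cof_embed0 free_terms_def poly_ring_def in_keys_iff split: if_splits)
  have "embed0 (extend_ring e f) \<in> span_terms (free_terms V {0})"
    unfolding extend_free_embed0[symmetric]
    by (rule extend_free_span_terms) (use assms e in \<open>auto simp: span_terms_def free_terms_def\<close>)
  then have "(0, m) \<in> free_terms V {0}" if "m \<in> Poly_Mapping.keys (extend_ring e f)" for m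
    using that unfolding span_terms_def cof_supp_def by (auto simp: cof_embed0 in_keys_iff)
  then show ?thesis by (auto simp: poly_ring_def free_terms_def)
qed

lemma restr_std_eq_0_iff:
  assumes "p \<in> poly_ring V"
  shows "restr std (embed0 p) = 0 \<longleftrightarrow> p \<in> edge_ideal (V, E)"
proof
  assume 0: "restr std (embed0 p) = 0"
  have "\<not> indep E (Poly_Mapping.keys m)" if m: "m \<in> Poly_Mapping.keys p" for m
  proof
    assume "indep E (Poly_Mapping.keys m)"
    then have "(0, m) \<in> std" using m assms by (auto simp: std_terms_def poly_ring_def)
    then have "cof (restr std (embed0 p)) 0 m = Poly_Mapping.lookup p m" by (simp add: cof_embed0)
    then show False using 0 m by (simp add: in_keys_iff)
  qed
  then show "p \<in> edge_ideal (V, E)" using edge_ideal_iff[OF G] assms by blast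
next
  assume "p \<in> edge_ideal (V, E)"
  then have "m \<notin> Poly_Mapping.keys p" if "indep E (Poly_Mapping.keys m)" for m
    using edge_ideal_iff[OF G, of p] that by blast
  then have "Poly_Mapping.lookup p m = 0" if "indep E (Poly_Mapping.keys m)" for m
    using that by (simp add: in_keys_iff)
  then show "restr std (embed0 p) = 0" by (intro cof_eqI) (auto simp: cof_embed0 std_terms_def)
qed

lemma kernel_aug: "{f \<in> span_terms (ft i). aug i f = 0} = extend_free (D i) ` span_terms (ft (Suc i))"
proof (cases i)
  case 0
  have "{f \<in> span_terms (ft 0). aug 0 f = 0} = {f \<in> span_terms (ft 0). extend_ring e f \<in> edge_ideal (V, E)}"
    using restr_std_eq_0_iff extend_ring_in by (auto simp: aug_0)
  then show ?thesis using res_facts(4) 0 by simp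
next
  case (Suc j)
  then show ?thesis using res_facts(5)[of j] by (simp add: aug_def)
qed

text \<open>This is the minimality clause: kernel elements are images of the next differential, so
  their coefficients lie in the irrelevant ideal.\<close>

lemma kernel_const: "f \<in> span_terms (ft i) \<Longrightarrow> aug i f = 0 \<Longrightarrow> cof f k 0 = 0"
proof -
  assume "f \<in> span_terms (ft i)" "aug i f = 0"
  then have "f \<in> vectors (irrelevant_ideal V) (B i)" using kernel_aug res_facts(6) by blast
  then show ?thesis by (cases "k \<in> Poly_Mapping.keys f") (auto simp: vectors_def irrelevant_ideal_def cof_def in_keys_iff)
qed

lemma linear_aug: "Vector_Spaces.linear fm_scale fm_scale (aug i)"
proof (cases i)
  case 0
  have "Vector_Spaces.linear fm_scale fm_scale (restr std :: ('v, 'k) fmod \<Rightarrow> _)"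
    unfolding Vector_Spaces.linear_iff by (auto simp: fm.vector_space_axioms intro!: cof_eqI)
  from Vector_Spaces.linear_compose[OF linear_extend_free this] show ?thesis
    by (simp add: aug_def 0 o_def)
qed (simp add: aug_def linear_extend_free)

lemma aug_deg_part:
  assumes f: "f \<in> span_terms (ft i)"
  shows "aug i (deg_part (deg i) d f) = deg_part (case i of 0 \<Rightarrow> (\<lambda>_. 0) | Suc j \<Rightarrow> deg j) d (aug i f)"
proof (cases i)
  case 0
  have "deg_part (\<lambda>_. 0) d (extend_free (\<lambda>k. embed0 (e k)) f) = extend_free (\<lambda>k. embed0 (e k)) (deg_part (deg 0) d f)"
  proof (rule deg_part_extend_free)
    fix k a j b assume "(k, a) \<in> cof_supp f" "cof (embed0 (e k)) j b \<noteq> 0"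
    then have "k \<in> B 0" "b \<in> Poly_Mapping.keys (e k)"
      using f 0 by (auto simp: span_terms_def free_terms_def cof_embed0 in_keys_iff split: if_splits)
    then show "0 + mon_degree b = deg 0 k" using res_facts(1) by (simp add: homogeneous_def)
  qed
  moreover have "deg_part (\<lambda>_. 0) d (restr std g) = restr std (deg_part (\<lambda>_. 0) d g)" for g :: "('v, 'k) fmod"
    by (intro cof_eqI) simp
  ultimately show ?thesis using 0 by (simp add: aug_def)
next
  case (Suc i')
  have "deg_part (deg i') d (extend_free (D i') f) = extend_free (D i') (deg_part (deg (Suc i')) d f)"
  proof (rule deg_part_extend_free)
    fix k a j b assume "(k, a) \<in> cof_supp f" "cof (D i' k) j b \<noteq> 0"
    moreover from this have "k \<in> B (Suc i')" using f Suc by (auto simp: span_terms_def free_terms_def)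
    ultimately show "deg i' j + mon_degree b = deg (Suc i') k"
      using res_facts(2) homogeneous_vector_eq by blast
  qed
  then show ?thesis using Suc by (simp add: aug_def)
qed

text \<open>A resolution is exact as a sequence of whole modules. Since its maps preserve degrees, a
  preimage of a homogeneous element can be replaced by its degree part.\<close>

lemma aug_image: "aug i ` fspace (ft i) (deg i) d = syz i d"
proof -
  let ?dg = "case i of 0 \<Rightarrow> (\<lambda>_. 0) | Suc j \<Rightarrow> deg j"
  let ?N = "case i of 0 \<Rightarrow> span_terms std | Suc j \<Rightarrow> {f \<in> span_terms (ft j). aug j f = 0}"
  have N: "aug i ` span_terms (ft i) = ?N"
  proof (cases i)
    case 0
    have "aug 0 ` span_terms (ft 0) = span_terms std"
    proof (intro equalityI subsetI)
      fix g assume "g \<in> aug 0 ` span_terms (ft 0)"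
      then show "g \<in> span_terms std" by (auto simp: aug_def span_terms_def cof_supp_def split: if_splits)
    next
      fix g :: "('v, 'k) fmod" assume g: "g \<in> span_terms std"
      define p where "p = Poly_Mapping.lookup g 0"
      have gs: "cof g k m \<noteq> 0 \<Longrightarrow> (k, m) \<in> std" for k m using g by (auto simp: span_terms_def cof_supp_def)
      have pV: "p \<in> poly_ring V"
        using gs[of 0] by (auto simp: poly_ring_def p_def cof_def in_keys_iff std_terms_def)
      then obtain f where f: "f \<in> span_terms (ft 0)" "p - extend_ring e f \<in> edge_ideal (V, E)"
        using res_facts(3) by blast
      \<comment> \<open>The polynomial and the image of \<open>f\<close> agree modulo the ideal,
        hence have the same normal form.\<close>
      then have "restr std (embed0 (p - extend_ring e f)) = 0"
        using restr_std_eq_0_iff edge_ideal_iff[OF G] by blast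
      moreover have "restr std (embed0 (p - extend_ring e f)) = g - aug 0 f"
      proof (rule cof_eqI)
        fix k m
        show "cof (restr std (embed0 (p - extend_ring e f))) k m = cof (g - aug 0 f) k m"
          using gs[of k m] by (auto simp: aug_0 cof_embed0 p_def cof_def[of g] lookup_minus std_terms_def)
      qed
      ultimately have "g = aug 0 f" by simp
      then show "g \<in> aug 0 ` span_terms (ft 0)" using f by blast
    qed
    then show ?thesis using 0 by simp
  next
    case (Suc j)
    then show ?thesis using kernel_aug[of j] by (simp add: aug_def)
  qed
  have S: "syz i d = {g \<in> ?N. deg_part ?dg d g = g}"
    by (cases i) (auto simp: syz_def fspace_eq)
  show ?thesis
  proof (intro equalityI subsetI)
    fix g assume "g \<in> aug i ` fspace (ft i) (deg i) d"
    then obtain f where f: "f \<in> span_terms (ft i)" "deg_part (deg i) d f = f" "g = aug i f" by (auto simp: fspace_eq)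
    then have "deg_part ?dg d g = g" using aug_deg_part[OF f(1), of d] by simp
    then show "g \<in> syz i d" unfolding S using N f by blast
  next
    fix g assume g: "g \<in> syz i d"
    then obtain f where f: "f \<in> span_terms (ft i)" "g = aug i f" using N unfolding S by blast
    have "deg_part ?dg d g = g" using g unfolding S by blast
    then have "g = aug i (deg_part (deg i) d f)" using aug_deg_part[OF f(1), of d] f(2) by simp
    then show "g \<in> aug i ` fspace (ft i) (deg i) d" using deg_part_in_fspace[OF f(1)] by blast
  qed
qed

lemma aug_var_act:
  assumes f: "f \<in> fspace (ft i) (deg i) d" and v: "v \<in> V"
  shows "aug i (var_act (ft i) v f) = var_act (tgt i) v (aug i f)"
proof -
  have fs: "f \<in> span_terms (ft i)" using f by (simp add: fspace_eq)
  have vf: "var_act (ft i) v f = Poly_Mapping.map ((*) (variable v)) f" by (rule var_act_free[OF fs v])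
  show ?thesis
  proof (cases i)
    case 0
    have "restr std (Poly_Mapping.map ((*) (variable v)) g) = var_act std v (restr std g)" for g :: "('v, 'k) fmod"
    proof (rule cof_eqI)
      fix k m
      have "(k, m - monv v) \<in> std" if "(k, m) \<in> std" "0 < Poly_Mapping.lookup m v"
        using std_terms_down minus_single_add[OF that(2)] that(1) by metis
      then show "cof (restr std (Poly_Mapping.map ((*) (variable v)) g)) k m = cof (var_act std v (restr std g)) k m"
        by (auto simp: cof_variable_mult)
    qed
    then show ?thesis using vf 0 by (simp add: aug_def tgt_def extend_free_scale)
  next
    case (Suc j)
    have "extend_free (D j) f \<in> span_terms (ft j)"
    proof (rule extend_free_span_terms)
      fix k a assume "(k, a) \<in> cof_supp f"
      then have "(k, a) \<in> ft (Suc j)" using fs Suc unfolding span_terms_def by blast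
      then have "k \<in> B (Suc j)" "Poly_Mapping.keys a \<subseteq> V" by (auto simp: free_terms_def)
      then show "Poly_Mapping.keys a \<subseteq> V \<and> D j k \<in> span_terms (ft j)" using res_facts(2) by blast
    qed
    from var_act_free[OF this v] show ?thesis using vf Suc by (simp add: aug_def tgt_def extend_free_scale)
  qed
qed

text \<open>A linear relation between the images of basis vectors of degree \<open>d\<close> would
  be a kernel element with a nonzero constant coefficient, against minimality. These images are thus
  independent in the finite-dimensional space \<open>syz i d\<close>.\<close>

lemma finite_basis:
  assumes M: "graded_mod V (var_act (tgt i)) (syz i)"
  shows "finite {k \<in> B i. deg i k = d}"
proof -
  let ?S = "{k \<in> B i. deg i k = d}"
  let ?u = "\<lambda>k. fm_term k 0 :: ('v, 'k) fmod"
  let ?b = "\<lambda>k. aug i (?u k)"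
  have u: "?u k \<in> fspace (ft i) (deg i) d" if "k \<in> ?S" for k
    using that by (auto simp: fspace_def cof_fm_term free_terms_def split: if_splits)
  have inj: "inj_on ?b ?S"
  proof (rule inj_onI)
    fix k k' assume k: "k \<in> ?S" "k' \<in> ?S" "?b k = ?b k'"
    have "?u k - ?u k' \<in> span_terms (ft i)"
      using fm.subspace_diff[OF subspace_fspace u[OF k(1)] u[OF k(2)]] by (simp add: fspace_eq)
    moreover have "aug i (?u k - ?u k') = 0" using k(3) fmp.linear_diff[OF linear_aug] by simp
    ultimately have "cof (?u k - ?u k') k 0 = 0" by (rule kernel_const)
    then show "k = k'" by (simp add: cof_fm_term split: if_splits)
  qed
  have "fm.independent (?b ` ?S)"
    unfolding fm.independent_explicit_finite_subsets
  proof (intro allI impI ballI)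
    fix T c g assume T: "T \<subseteq> ?b ` ?S" "finite T" "(\<Sum>v\<in>T. fm_scale (c v) v) = 0" "g \<in> T"
    from T(1) obtain U where U: "U \<subseteq> ?S" "T = ?b ` U" by (rule subset_imageE)
    have injU: "inj_on ?b U" using inj U inj_on_subset by blast
    then have finU: "finite U" using T(2) U finite_imageD by blast
    define h where "h = (\<Sum>k\<in>U. fm_scale (c (?b k)) (?u k))"
    have "aug i h = (\<Sum>k\<in>U. fm_scale (c (?b k)) (?b k))"
      unfolding h_def by (simp add: fmp.linear_sum[OF linear_aug] fmp.linear_scale[OF linear_aug])
    also have "\<dots> = 0" using T(3) unfolding U(2) by (simp add: sum.reindex[OF injU])
    finally have h0: "aug i h = 0" .
    have "h \<in> fspace (ft i) (deg i) d"
      unfolding h_def using U(1) by (intro fm.subspace_sum[OF subspace_fspace] fm.subspace_scale[OF subspace_fspace] u) auto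
    then have c0: "cof h k 0 = 0" for k using h0 by (intro kernel_const) (auto simp: fspace_eq)
    obtain k where k: "k \<in> U" "g = ?b k" using T(4) U by blast
    have "cof h k 0 = (\<Sum>j\<in>U. if j = k then c (?b k) else 0)"
      unfolding h_def cof_sum by (rule sum.cong) (auto simp: cof_fm_term)
    then show "c g = 0" using c0[of k] finU k by simp
  qed
  moreover have "?b ` ?S \<subseteq> syz i d" using u aug_image by blast
  moreover have "fin_dim fm_scale (syz i d)" using M by (simp add: graded_mod_def)
  ultimately have "finite (?b ` ?S)" using fm.fin_dim_independent by blast
  then show ?thesis using inj finite_imageD by blast
qed

text \<open>The last clause of \<open>short_exact\<close> comes from \<open>kernel_const\<close>: a
  0-chain of a free module without constant coefficients is a boundary.\<close>

lemma short_exact_res: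
  assumes M: "graded_mod V (var_act (tgt i)) (syz i)"
  shows "short_exact lt V (var_act (ft i)) (syz (Suc i)) (fspace (ft i) (deg i)) (var_act (tgt i)) (syz i) (aug i)"
proof -
  have gF: "graded_mod V (var_act (ft i)) (fspace (ft i) (deg i) :: nat \<Rightarrow> ('v, 'k) fmod set)"
    by (rule graded_mod_free[OF V finite_basis[OF M]])
  have "kchains V (syz (Suc i)) 0 d \<subseteq> kboundaries lt V (var_act (ft i)) (fspace (ft i) (deg i)) 0 d" for d
  proof
    fix c assume c: "c \<in> kchains V (syz (Suc i)) 0 d"
    have cz: "S = {} \<and> c {} \<in> syz (Suc i) d" if "c S \<noteq> 0" for S
    proof -
      have "S \<subseteq> V" "card S = 0" using kchains_zero[OF c, of S] that by blast+
      then have "S = {}" using V finite_subset by fastforce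
      then show ?thesis using kchainsD[OF c, of "{}"] by simp
    qed
    have c': "c \<in> kchains V (fspace (ft i) (deg i)) 0 d"
      using kchainsD[OF c] kchains_zero[OF c] by (intro kchainsI) (auto simp: syz_def)
    show "c \<in> kboundaries lt V (var_act (ft i)) (fspace (ft i) (deg i)) 0 d"
    proof (rule free_boundary[OF V lt c' bd_zero_chains[OF V gF c']])
      fix S k m assume nz: "cof (c S) k m \<noteq> 0"
      then have "c S \<noteq> 0" by auto
      from cz[OF this] have S: "S = {}" "c {} \<in> syz (Suc i) d" by blast+
      then have "cof (c {}) k 0 = 0" by (intro kernel_const[of _ i]) (auto simp: syz_def fspace_eq)
      then have "m \<noteq> 0" using nz S(1) by auto
      then show "tot S m \<noteq> 0" by (simp add: tot_def S(1))
    qed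
  qed
  then show ?thesis
    unfolding short_exact_def using gF M linear_aug aug_image aug_var_act by (auto simp: syz_def)
qed

text \<open>Finiteness climbs the resolution: degreewise finite dimension of \<open>syz i\<close>
  leaves finitely many basis elements in each degree, so the i-th free module and its submodule
  \<open>syz (Suc i)\<close> are degreewise finite-dimensional too.\<close>

lemma graded_mod_syz: "graded_mod V (var_act (tgt i)) (syz i)"
proof (induction i)
  case 0
  have "syz 0 = fspace std (\<lambda>_. 0)" by (simp add: syz_def fun_eq_iff)
  then show ?case using graded_mod_std[OF V] by (simp add: tgt_def)
next
  case (Suc i)
  have "tgt (Suc i) = ft i" by (simp add: tgt_def)
  then show ?case using graded_mod_kernel[OF V lt short_exact_res[OF Suc]] by simp
qed

text \<open>Each use of \<open>kdim_shift\<close> trades one syzygy step for one homological degree,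
  which is why \<open>p\<close> is generalised in the induction.\<close>

lemma kdim_syz: "kdim lt V (var_act (tgt i)) (syz i) p d = kdim lt V (var_act std) (fspace std (\<lambda>_. 0) :: nat \<Rightarrow> ('v, 'k) fmod set) (p + i) d"
proof (induction i arbitrary: p)
  case 0
  have "syz 0 = fspace std (\<lambda>_. 0)" by (simp add: syz_def fun_eq_iff)
  then show ?case by (simp add: tgt_def)
next
  case (Suc i)
  have "kdim lt V (var_act (ft i)) (syz (Suc i)) p d = kdim lt V (var_act (tgt i)) (syz i) (Suc p) d"
    by (rule kdim_shift[OF V lt short_exact_res[OF graded_mod_syz] free_acyclic[OF V lt]])
  then show ?case using Suc by (simp add: tgt_def)
qed

text \<open>The right side does not mention the resolution; this is the independence that the
  definite description in \<open>graded_betti\<close> calls for.\<close>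

theorem resolution_card:
  "int (card {k \<in> B i. deg i k = d}) = kdim lt V (var_act std) (fspace std (\<lambda>_. 0) :: nat \<Rightarrow> ('v, 'k) fmod set) i d"
proof -
  have "int (card {k \<in> B i. deg i k = d}) = kdim lt V (var_act (ft i)) (fspace (ft i) (deg i) :: nat \<Rightarrow> ('v, 'k) fmod set) 0 d"
    by (rule kdim_free_zero[OF V lt finite_basis[OF graded_mod_syz], symmetric])
  also have "\<dots> = kdim lt V (var_act (tgt i)) (syz i) 0 d"
    by (rule kdim_zero[OF V lt short_exact_res[OF graded_mod_syz], symmetric])
  finally show ?thesis using kdim_syz[of i 0 d] by simp
qed

end

subsection \<open>Existence of minimal resolutions\<close>

context vector_space
begin

text \<open>The vectors by which a basis was extended stay independent modulo the span of that
  basis. This excludes constant coefficients in relations between minimal generators.\<close>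

lemma independent_complement_sum:
  assumes C: "independent C" "finite C" and A: "A \<subseteq> C"
    and x: "(\<Sum>g\<in>C - A. scale (c g) g) \<in> span A" and g: "g \<in> C - A"
  shows "c g = 0"
proof -
  have fA: "finite A" using C(2) A finite_subset by blast
  obtain u where u: "(\<Sum>g\<in>C - A. scale (c g) g) = (\<Sum>a\<in>A. scale (u a) a)"
    using x span_finite[OF fA] by auto
  let ?w = "\<lambda>v. if v \<in> A then - u v else c v"
  have "(\<Sum>v\<in>C. scale (?w v) v) = (\<Sum>v\<in>C - A. scale (?w v) v) + (\<Sum>v\<in>A. scale (?w v) v)"
    by (rule sum.subset_diff[OF A C(2)])
  also have "(\<Sum>v\<in>C - A. scale (?w v) v) = (\<Sum>v\<in>C - A. scale (c v) v)" by (rule sum.cong) auto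
  also have "(\<Sum>v\<in>A. scale (?w v) v) = (\<Sum>v\<in>A. - scale (u v) v)" by (rule sum.cong) auto
  also have "(\<Sum>v\<in>C - A. scale (c v) v) + (\<Sum>v\<in>A. - scale (u v) v) = 0" unfolding u by (simp add: sum_negf)
  finally have "?w g = 0" using independentD[OF C(1,2) subset_refl, of ?w g] g by blast
  then show ?thesis using g by simp
qed

end

abbreviation vmul :: "'v \<Rightarrow> ('v, 'k::field) fmod \<Rightarrow> ('v, 'k) fmod" where
  "vmul v f \<equiv> Poly_Mapping.map ((*) (variable v)) f"

lemma extend_free_vmul: "extend_free D (vmul v f) = vmul v (extend_free D f)"
  by (rule extend_free_scale)

lemma vmul_fspace:
  assumes "f \<in> fspace (free_terms V B) dg d" "v \<in> V"
  shows "vmul v f \<in> fspace (free_terms V B) dg (Suc d)"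
proof -
  have "(k, m) \<in> free_terms V B \<and> dg k + mon_degree m = Suc d" if nz: "cof (vmul v f) k m \<noteq> 0" for k m
  proof -
    have *: "0 < Poly_Mapping.lookup m v" "cof f k (m - monv v) \<noteq> 0"
      using nz by (auto simp: cof_variable_mult split: if_splits)
    then have "(k, m - monv v) \<in> free_terms V B" "dg k + mon_degree (m - monv v) = d"
      using assms(1) by (auto simp: fspace_def)
    moreover have "Poly_Mapping.keys m = insert v (Poly_Mapping.keys (m - monv v))"
      using keys_plus_monv[of "m - monv v" v] minus_single_add[OF *(1)] by simp
    moreover have "mon_degree m = mon_degree (m - monv v) + 1"
      using minus_single_add[OF *(1)] mon_degree_add[of "m - monv v" "monv v"] by (simp add: mon_degree_monv)
    ultimately show ?thesis using assms(2) by (auto simp: free_terms_def)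
  qed
  then show ?thesis by (auto simp: fspace_def)
qed

lemma mon_act_zero [simp]: "mon_act 0 f = f"
  by (rule cof_eqI) (simp add: cof_mon_act)

lemma mon_act_add_monv: "mon_act (a + monv v) f = vmul v (mon_act a f)"
proof -
  have "Poly_Mapping.single (a + monv v) (1::'b) = variable v * Poly_Mapping.single a 1"
    by (simp add: variable_def mult_single monv_def add.commute)
  then show ?thesis
    by (intro poly_mapping_eqI) (simp add: mon_act_def lookup_map_mult mult.assoc)
qed

lemma mon_act_closed:
  assumes closed: "\<And>v d f. v \<in> V \<Longrightarrow> f \<in> M d \<Longrightarrow> vmul v f \<in> M (Suc d)"
    and a: "Poly_Mapping.keys a \<subseteq> V" and f: "f \<in> M d"
  shows "mon_act a f \<in> M (d + mon_degree a)"
  using a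
proof (induction "mon_degree a" arbitrary: a)
  case 0
  then have "a = 0" by (simp add: mon_degree_zero_iff)
  then show ?case using f by simp
next
  case (Suc n)
  then have "a \<noteq> 0" by auto
  then obtain v where v: "v \<in> Poly_Mapping.keys a" by (metis ex_in_conv keys_eq_empty)
  define a' where "a' = a - monv v"
  have aa: "a = a' + monv v" using v minus_single_add[of a v] by (simp add: a'_def in_keys_iff)
  have k: "Poly_Mapping.keys a = insert v (Poly_Mapping.keys a')" unfolding aa by (rule keys_plus_monv)
  have dgr: "mon_degree a = Suc (mon_degree a')" unfolding aa by (simp add: mon_degree_add mon_degree_monv)
  have "mon_act a' f \<in> M (d + mon_degree a')" using Suc k dgr by (intro Suc.hyps) auto
  then have "vmul v (mon_act a' f) \<in> M (Suc (d + mon_degree a'))" using closed Suc.prems k by blast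
  then show ?case unfolding dgr unfolding aa mon_act_add_monv by simp
qed

text \<open>A spanning set of the degree-\<open>d\<close> part of the irrelevant ideal times
  \<open>M\<close>.\<close>

definition vgens :: "'v set \<Rightarrow> (nat \<Rightarrow> ('v, 'k::field) fmod set) \<Rightarrow> nat \<Rightarrow> ('v, 'k) fmod set" where
  "vgens V M d = {vmul v f | v f e. v \<in> V \<and> f \<in> M e \<and> d = Suc e}"

text \<open>Graded Nakayama lemma: the generators of degree \<open>d\<close> complete a basis of the
  part generated from lower degrees to a basis of \<open>M d\<close>. They generate by induction on
  the degree, and no relation between them has a constant coefficient, which is minimality.\<close>

lemma minimal_cover:
  fixes M :: "nat \<Rightarrow> ('v, 'k::field) fmod set"
  assumes sub: "\<And>d. fm.subspace (M d)" and fd: "\<And>d. fin_dim fm_scale (M d)"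
    and closed0: "\<forall>v\<in>V. \<forall>d. \<forall>f\<in>M d. vmul v f \<in> M (Suc d)"
  shows "\<exists>B' dg' D. (\<forall>d. finite {k \<in> B'. dg' k = d}) \<and> (\<forall>k\<in>B'. D k \<in> M (dg' k)) \<and>
    (\<forall>d. extend_free D ` fspace (free_terms V B') dg' d = M d) \<and>
    (\<forall>d. \<forall>f\<in>fspace (free_terms V B') dg' d. extend_free D f = 0 \<longrightarrow> (\<forall>k. cof f k 0 = 0))"
proof -
  have closed: "\<And>v d f. v \<in> V \<Longrightarrow> f \<in> M d \<Longrightarrow> vmul v f \<in> M (Suc d)" using closed0 by blast
  have vM: "vgens V M d \<subseteq> M d" for d using closed by (auto simp: vgens_def)
  have "\<exists>A C. A \<subseteq> C \<and> C \<subseteq> M d \<and> fm.independent C \<and> finite C \<and> M d \<subseteq> fm.span C \<and> fm.span A = fm.span (vgens V M d)" for d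
  proof -
    obtain A where A: "A \<subseteq> vgens V M d" "fm.independent A" "vgens V M d \<subseteq> fm.span A"
      using fm.maximal_independent_subset by blast
    have AM: "A \<subseteq> M d" using A(1) vM by blast
    obtain C where C: "A \<subseteq> C" "C \<subseteq> M d" "fm.independent C" "M d \<subseteq> fm.span C"
      using fm.maximal_independent_subset_extend[OF AM A(2)] by blast
    have "finite C" by (rule fm.fin_dim_independent[OF fd C(2,3)])
    moreover have "fm.span A = fm.span (vgens V M d)"
      using A fm.span_mono[OF A(1)] fm.span_minimal[OF A(3)] by (metis fm.subspace_span subset_antisym)
    ultimately show ?thesis using C by blast
  qed
  then obtain A C where AC: "\<And>d. A d \<subseteq> C d \<and> C d \<subseteq> M d \<and> fm.independent (C d) \<and> finite (C d) \<and> M d \<subseteq> fm.span (C d) \<and>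
      fm.span (A d) = fm.span (vgens V M d)" by metis
  define G where "G d = C d - A d" for d
  have "\<exists>h. bij_betw h {0..<card (G d)} (G d)" for d
    using AC[of d] by (intro ex_bij_betw_nat_finite) (auto simp: G_def)
  then obtain h where h: "\<And>d. bij_betw (h d) {0..<card (G d)} (G d)" by metis
  \<comment> \<open>Bases have to be sets of natural numbers, so the \<open>j\<close>-th generator
    of degree \<open>d\<close> receives the code \<open>prod_encode (d, j)\<close>, from which its
    degree can be read off.\<close>
  define dg' :: "nat \<Rightarrow> nat" where "dg' k = fst (prod_decode k)" for k
  define B' where "B' = {k. snd (prod_decode k) < card (G (dg' k))}"
  define D where "D k = h (dg' k) (snd (prod_decode k))" for k
  let ?F = "fspace (free_terms V B') dg' :: nat \<Rightarrow> ('v, 'k) fmod set"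
  have S: "{k \<in> B'. dg' k = d} = (\<lambda>j. prod_encode (d, j)) ` {0..<card (G d)}" for d
  proof (intro equalityI subsetI)
    fix k assume k: "k \<in> {k \<in> B'. dg' k = d}"
    then have "k = prod_encode (d, snd (prod_decode k))"
      by (metis (mono_tags, lifting) dg'_def mem_Collect_eq prod.collapse prod_decode_inverse)
    then show "k \<in> (\<lambda>j. prod_encode (d, j)) ` {0..<card (G d)}" using k by (auto simp: B'_def)
  qed (auto simp: B'_def dg'_def)
  have finS: "finite {k \<in> B'. dg' k = d}" for d unfolding S by simp
  have bijD: "bij_betw D {k \<in> B'. dg' k = d} (G d)" for d
  proof -
    have "bij_betw (\<lambda>j. prod_encode (d, j)) {0..<card (G d)} {k \<in> B'. dg' k = d}"
      unfolding S by (intro inj_on_imp_bij_betw) (auto simp: inj_on_def)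
    moreover have "bij_betw (D \<circ> (\<lambda>j. prod_encode (d, j))) {0..<card (G d)} (G d)"
      using h[of d] by (rule bij_betw_cong[THEN iffD1, rotated]) (simp add: D_def dg'_def)
    ultimately show ?thesis using bij_betw_comp_iff by blast
  qed
  have DG: "D k \<in> G (dg' k)" if "k \<in> B'" for k using bij_betwE[OF bijD[of "dg' k"]] that by blast
  have DM: "D k \<in> M (dg' k)" if "k \<in> B'" for k using DG[OF that] AC[of "dg' k"] by (auto simp: G_def)
  have supp: "k \<in> B' \<and> Poly_Mapping.keys a \<subseteq> V \<and> d = dg' k + mon_degree a" if "f \<in> ?F d" "(k, a) \<in> cof_supp f" for f d k a
    using that by (auto simp: fspace_def cof_supp_def free_terms_def)
  have ef: "extend_free D f = (\<Sum>(k, a)\<in>cof_supp f. fm_scale (cof f k a) (mon_act a (D k)))" for f :: "('v, 'k) fmod"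
    by (rule cof_eqI) (simp add: cof_extend_free cof_sum case_prod_beta)
  have img: "extend_free D ` ?F d \<subseteq> M d" for d
  proof (rule image_subsetI)
    fix f assume f: "f \<in> ?F d"
    have "(case x of (k, a) \<Rightarrow> fm_scale (cof f k a) (mon_act a (D k))) \<in> M d" if x: "x \<in> cof_supp f" for x
    proof -
      obtain k a where ka: "x = (k, a)" by force
      have "mon_act a (D k) \<in> M (dg' k + mon_degree a)"
        using supp[OF f, of k a] x ka by (intro mon_act_closed[where M = M and V = V, OF closed] DM) auto
      then show ?thesis using supp[OF f, of k a] x ka fm.subspace_scale[OF sub] by simp
    qed
    then show "extend_free D f \<in> M d" unfolding ef by (rule fm.subspace_sum[OF sub])
  qed
  have unit_in: "fm_term k 0 \<in> ?F (dg' k)" if "k \<in> B'" for k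
    using that by (auto simp: fspace_def cof_fm_term free_terms_def split: if_splits)
  have surj: "M d \<subseteq> extend_free D ` ?F d" for d
  proof (induction d rule: less_induct)
    case (less d)
    have sI: "fm.subspace (extend_free D ` ?F d)"
      by (rule fmp.linear_subspace_image[OF linear_extend_free subspace_fspace])
    \<comment> \<open>Products with variables are covered by the induction hypothesis; the new
      generators \<open>G d\<close> are images of basis vectors.\<close>
    have "vgens V M d \<subseteq> extend_free D ` ?F d"
    proof
      fix g assume "g \<in> vgens V M d"
      then obtain v f e where g: "g = vmul v f" "v \<in> V" "f \<in> M e" "d = Suc e" by (auto simp: vgens_def)
      then obtain f' where f': "f' \<in> ?F e" "f = extend_free D f'" using less[of e] by auto
      have "vmul v f' \<in> ?F d" unfolding g(4) by (rule vmul_fspace[OF f'(1) g(2)])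
      moreover have "g = extend_free D (vmul v f')" unfolding g(1) f'(2) extend_free_vmul ..
      ultimately show "g \<in> extend_free D ` ?F d" by blast
    qed
    then have "fm.span (A d) \<subseteq> extend_free D ` ?F d" using AC[of d] fm.span_minimal[OF _ sI] by simp
    then have "A d \<subseteq> extend_free D ` ?F d" using fm.span_superset by blast
    moreover have "G d \<subseteq> extend_free D ` ?F d"
    proof
      fix g assume "g \<in> G d"
      then have "g \<in> D ` {k \<in> B'. dg' k = d}" using bijD[of d] by (simp add: bij_betw_def)
      then obtain k where k: "k \<in> B'" "dg' k = d" "g = D k" by blast
      then show "g \<in> extend_free D ` ?F d"
        using unit_in[OF k(1)] extend_free_term[of D k 0] by (metis image_eqI mon_act_zero)
    qed
    ultimately have "C d \<subseteq> extend_free D ` ?F d" by (auto simp: G_def)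
    then show ?case using AC[of d] fm.span_minimal[OF _ sI] by blast
  qed
  have ker: "cof f k 0 = 0" if f: "f \<in> ?F d" and 0: "extend_free D f = 0" for f d k
  proof (rule ccontr)
    assume nz: "cof f k 0 \<noteq> 0"
    then have "(k, 0) \<in> cof_supp f" by (simp add: cof_supp_def)
    then have k: "k \<in> B'" "dg' k = d" using supp[OF f] by auto
    let ?S = "{k \<in> B'. dg' k = d}"
    define c where "c g = cof f (the_inv_into ?S D g) 0" for g
    have injD: "inj_on D ?S" "D ` ?S = C d - A d" using bijD[of d] by (auto simp: bij_betw_def G_def)
    have cD: "c (D k) = cof f k 0" if "k \<in> ?S" for k
      unfolding c_def by (simp only: the_inv_into_f_f[OF injD(1) that])
    let ?t = "\<lambda>(k, a). fm_scale (cof f k a) (mon_act a (D k))"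
    \<comment> \<open>Terms with trivial monomial contribute combinations of the new generators; all
      other terms are multiples of a variable and fall into the span of \<open>A d\<close>.\<close>
    let ?P = "{x \<in> cof_supp f. snd x = 0}"
    have "0 = (\<Sum>x\<in>cof_supp f. ?t x)" using 0 unfolding ef by simp
    also have "\<dots> = (\<Sum>x\<in>cof_supp f - ?P. ?t x) + (\<Sum>x\<in>?P. ?t x)"
      by (rule sum.subset_diff) (use finite_cof_supp in auto)
    also have "(\<Sum>x\<in>?P. ?t x) = (\<Sum>k\<in>?S. fm_scale (cof f k 0) (D k))"
    proof -
      have P: "?P = (\<lambda>k. (k, 0)) ` {k \<in> ?S. cof f k 0 \<noteq> 0}"
      proof (intro equalityI subsetI)
        fix x assume x: "x \<in> ?P"
        then have "x = (fst x, 0)" by (simp add: prod_eq_iff)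
        moreover from this have "(fst x, 0) \<in> cof_supp f" using x by simp
        moreover from this have "fst x \<in> ?S" using supp[OF f, of "fst x" 0] by simp
        ultimately show "x \<in> (\<lambda>k. (k, 0)) ` {k \<in> ?S. cof f k 0 \<noteq> 0}"
          by (auto simp: cof_supp_def)
      qed (auto simp: cof_supp_def)
      have "inj_on (\<lambda>k. (k, 0 :: 'v \<Rightarrow>\<^sub>0 nat)) {k \<in> ?S. cof f k 0 \<noteq> 0}" by (auto simp: inj_on_def)
      then have "(\<Sum>x\<in>?P. ?t x) = (\<Sum>k\<in>{k \<in> ?S. cof f k 0 \<noteq> 0}. fm_scale (cof f k 0) (D k))"
        unfolding P by (subst sum.reindex) auto
      also have "\<dots> = (\<Sum>k\<in>?S. fm_scale (cof f k 0) (D k))"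
        using finS by (intro sum.mono_neutral_left) auto
      finally show ?thesis .
    qed
    also have "(\<Sum>k\<in>?S. fm_scale (cof f k 0) (D k)) = (\<Sum>g\<in>C d - A d. fm_scale (c g) g)"
      unfolding injD(2)[symmetric] sum.reindex[OF injD(1)] o_def by (rule sum.cong) (use cD in auto)
    finally have "(\<Sum>g\<in>C d - A d. fm_scale (c g) g) = - (\<Sum>x\<in>cof_supp f - ?P. ?t x)"
      by (simp add: eq_neg_iff_add_eq_0 add.commute)
    also have "\<dots> \<in> fm.span (A d)"
    proof (intro fm.span_neg fm.span_sum)
      fix x assume x: "x \<in> cof_supp f - ?P"
      obtain k a where ka: "x = (k, a)" by force
      have s: "k \<in> B'" "Poly_Mapping.keys a \<subseteq> V" "d = dg' k + mon_degree a" "a \<noteq> 0"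
        using supp[OF f, of k a] x by (simp_all add: ka)
      obtain v where v: "v \<in> Poly_Mapping.keys a" using s(4) by (metis ex_in_conv keys_eq_empty)
      define a' where "a' = a - monv v"
      have aa: "a = a' + monv v" using v minus_single_add[of a v] by (simp add: a'_def in_keys_iff)
      have keys: "Poly_Mapping.keys a = insert v (Poly_Mapping.keys a')" unfolding aa by (rule keys_plus_monv)
      have "mon_act a' (D k) \<in> M (dg' k + mon_degree a')"
        using keys s by (intro mon_act_closed[where M = M and V = V, OF closed] DM) auto
      moreover have "d = Suc (dg' k + mon_degree a')" unfolding s(3) aa by (simp add: mon_degree_add mon_degree_monv)
      moreover have "v \<in> V" using v s(2) by blast
      ultimately have "mon_act a (D k) \<in> vgens V M d" unfolding aa mon_act_add_monv vgens_def by blast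
      then have "mon_act a (D k) \<in> fm.span (A d)" using AC[of d] fm.span_base by metis
      then show "?t x \<in> fm.span (A d)" unfolding ka prod.case by (rule fm.span_scale)
    qed
    finally have "(\<Sum>g\<in>C d - A d. fm_scale (c g) g) \<in> fm.span (A d)" .
    moreover have kS: "k \<in> ?S" using k by blast
    moreover from this have "D k \<in> C d - A d" using injD(2) by blast
    ultimately have "c (D k) = 0"
      using fm.independent_complement_sum[of "C d" "A d" c "D k"] AC[of d] by blast
    then show False using cD[OF kS] nz by simp
  qed
  have "\<forall>d. extend_free D ` ?F d = M d" using img surj by (intro allI equalityI)
  then show ?thesis using finS DM ker by (intro exI[of _ B'] exI[of _ dg'] exI[of _ D]) blast
qed

section \<open>Iterating minimal covers\<close>

type_synonym ('v, 'k) res_state = "nat set \<times> (nat \<Rightarrow> nat) \<times> (nat \<Rightarrow> ('v, 'k) fmod set)"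

text \<open>A state is a basis with its degrees and the submodule still to be covered. The last
  clause makes the differential that covers this submodule minimal.\<close>

definition res_inv :: "'v set \<Rightarrow> ('v, 'k::field) res_state \<Rightarrow> bool" where
  "res_inv V = (\<lambda>(B, dg, M). (\<forall>d. finite {k \<in> B. dg k = d}) \<and>
     (\<forall>d. fm.subspace (M d) \<and> M d \<subseteq> fspace (free_terms V B) dg d) \<and>
     (\<forall>v\<in>V. \<forall>d. \<forall>f\<in>M d. vmul v f \<in> M (Suc d)) \<and> (\<forall>d. \<forall>f\<in>M d. \<forall>k. cof f k 0 = 0))"

definition res_step :: "'v set \<Rightarrow> ('v, 'k::field) res_state \<Rightarrow> ('v, 'k) res_state \<Rightarrow> (nat \<Rightarrow> ('v, 'k) fmod) \<Rightarrow> bool" where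
  "res_step V = (\<lambda>(B, dg, M) (B', dg', M') D. (\<forall>k\<in>B'. D k \<in> M (dg' k)) \<and>
     (\<forall>d. extend_free D ` fspace (free_terms V B') dg' d = M d) \<and>
     (\<forall>d. M' d = {f \<in> fspace (free_terms V B') dg' d. extend_free D f = 0}))"

lemma res_step_exists:
  fixes s :: "('v, 'k::field) res_state"
  assumes V: "finite V" and s: "res_inv V s"
  shows "\<exists>s'. res_inv V s' \<and> (\<exists>D. res_step V s s' D)"
proof -
  obtain B dg M where sB: "s = (B, dg, M)" by (cases s) auto
  have M: "\<And>d. fm.subspace (M d)" "\<And>d. M d \<subseteq> fspace (free_terms V B) dg d"
    "\<forall>v\<in>V. \<forall>d. \<forall>f\<in>M d. vmul v f \<in> M (Suc d)" "\<And>d. finite {k \<in> B. dg k = d}"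
    using s by (auto simp: sB res_inv_def)
  have fd: "fin_dim fm_scale (M d)" for d
    by (rule fin_dim_subset[OF fin_dim_fspace[OF finite_free_terms[OF V M(4)]] M(2)])
  from minimal_cover[where M = M and V = V, OF M(1) fd M(3)]
  obtain B' dg' D where c0: "(\<forall>d. finite {k \<in> B'. dg' k = d}) \<and> (\<forall>k\<in>B'. D k \<in> M (dg' k)) \<and>
    (\<forall>d. extend_free D ` fspace (free_terms V B') dg' d = M d) \<and>
    (\<forall>d. \<forall>f\<in>fspace (free_terms V B') dg' d. extend_free D f = 0 \<longrightarrow> (\<forall>k. cof f k 0 = 0))"
    by (elim exE)
  note q1 = c0[THEN conjunct2] note q2 = q1[THEN conjunct2]
  have c: "\<And>d. finite {k \<in> B'. dg' k = d}" "\<And>k. k \<in> B' \<Longrightarrow> D k \<in> M (dg' k)"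
      "\<And>d. extend_free D ` fspace (free_terms V B') dg' d = M d"
      "\<And>d f k. f \<in> fspace (free_terms V B') dg' d \<Longrightarrow> extend_free D f = 0 \<Longrightarrow> cof f k 0 = 0"
    by (rule c0[THEN conjunct1, THEN spec], erule bspec[OF q1[THEN conjunct1]],
        rule q2[THEN conjunct1, THEN spec], use q2[THEN conjunct2] in blast)
  define M' where "M' d = {f \<in> fspace (free_terms V B') dg' d. extend_free D f = 0}" for d
  have "fm.subspace (M' d)" for d
    using fm.subspace_inter[OF subspace_fspace fmp.linear_subspace_kernel[OF linear_extend_free]]
    by (simp add: M'_def Int_def)
  moreover have "vmul v f \<in> M' (Suc d)" if "v \<in> V" "f \<in> M' d" for v f d
  proof -
    have "vmul v (0 :: ('v, 'k) fmod) = 0" by (intro poly_mapping_eqI) (simp add: lookup_map_mult)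
    then show ?thesis using that vmul_fspace by (auto simp: M'_def extend_free_vmul)
  qed
  ultimately have "res_inv V (B', dg', M')" using c(1,4) by (auto simp: res_inv_def M'_def)
  moreover have "res_step V s (B', dg', M') D" using c(2,3) by (auto simp: res_step_def sB M'_def)
  ultimately show ?thesis by blast
qed

text \<open>Covers are built degree by degree, while a resolution has to be exact as a sequence of
  whole modules. The passage rests on each element being the finite sum of its degree parts.\<close>

lemma kernel_image_ungraded:
  fixes \<psi> :: "('v, 'k::field) fmod \<Rightarrow> ('v, 'k) fmod"
  assumes lin: "Vector_Spaces.linear fm_scale fm_scale \<psi>"
    and comp: "\<And>f d. f \<in> span_terms Q \<Longrightarrow> \<psi> f = 0 \<Longrightarrow> \<psi> (deg_part dg d f) = 0"
    and im: "\<And>d. extend_free D ` fspace Q' dg' d = {f \<in> fspace Q dg d. \<psi> f = 0}"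
  shows "{f \<in> span_terms Q. \<psi> f = 0} = extend_free D ` span_terms Q'"
proof -
  have sub: "fm.subspace (span_terms R :: ('v, 'k) fmod set)" for R :: "(nat \<times> ('v \<Rightarrow>\<^sub>0 nat)) set"
  proof (rule fm.subspaceI)
    fix f g :: "('v, 'k) fmod" assume f: "f \<in> span_terms R" and g: "g \<in> span_terms R"
    have "cof f k m \<noteq> 0 \<or> cof g k m \<noteq> 0" if "cof (f + g) k m \<noteq> 0" for k m using that by auto
    then show "f + g \<in> span_terms R" using f g unfolding span_terms_def cof_supp_def by blast
  qed (auto simp: span_terms_def cof_supp_def)
  have subK: "fm.subspace {f \<in> span_terms Q. \<psi> f = 0}"
    using fm.subspace_inter[OF sub fmp.linear_subspace_kernel[OF lin]] by (simp add: Int_def)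
  have subI: "fm.subspace (extend_free D ` span_terms Q')"
    by (rule fmp.linear_subspace_image[OF linear_extend_free sub])
  have fs: "fspace R r d \<subseteq> span_terms R" for R r d and f :: "('v, 'k) fmod"
    by (auto simp: fspace_eq)
  show ?thesis
  proof (intro equalityI subsetI)
    fix f assume f: "f \<in> {f \<in> span_terms Q. \<psi> f = 0}"
    have "deg_part dg d f \<in> extend_free D ` span_terms Q'" for d
    proof -
      have "deg_part dg d f \<in> {f \<in> fspace Q dg d. \<psi> f = 0}" using f comp deg_part_in_fspace by blast
      then have "deg_part dg d f \<in> extend_free D ` fspace Q' dg' d" using im by simp
      then show ?thesis using fs by (auto simp: fspace_eq)
    qed
    then have "(\<Sum>d\<in>(\<lambda>(k, m). dg k + mon_degree m) ` cof_supp f. deg_part dg d f) \<in> extend_free D ` span_terms Q'"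
      by (intro fm.subspace_sum[OF subI])
    then show "f \<in> extend_free D ` span_terms Q'" using deg_part_sum[of f dg] by simp
  next
    fix g assume "g \<in> extend_free D ` span_terms Q'"
    then obtain h where h: "h \<in> span_terms Q'" "g = extend_free D h" by blast
    let ?H = "(\<lambda>(k, m). dg' k + mon_degree m) ` cof_supp h"
    have "g = (\<Sum>d\<in>?H. extend_free D (deg_part dg' d h))"
      unfolding h(2) fmp.linear_sum[OF linear_extend_free, symmetric] deg_part_sum[symmetric] ..
    moreover have "(\<Sum>d\<in>?H. extend_free D (deg_part dg' d h)) \<in> {f \<in> span_terms Q. \<psi> f = 0}"
    proof (rule fm.subspace_sum[OF subK])
      fix d
      have "extend_free D (deg_part dg' d h) \<in> {f \<in> fspace Q dg d. \<psi> f = 0}"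
        using im deg_part_in_fspace[OF h(1)] by blast
      then show "extend_free D (deg_part dg' d h) \<in> {f \<in> span_terms Q. \<psi> f = 0}" by (auto simp: fspace_eq)
    qed
    ultimately show "g \<in> {f \<in> span_terms Q. \<psi> f = 0}" by (simp only:)
  qed
qed

theorem minimal_resolution_exists:
  fixes V :: "'v set"
  assumes V: "finite V" and G: "simple_graph V E"
  shows "\<exists>B deg (e :: nat \<Rightarrow> ('v, 'k::field) mpol) D. minimal_graded_free_resolution V (edge_ideal (V, E)) B deg e D"
proof -
  let ?std = "std_terms V E"
  \<comment> \<open>The degree parts of the edge ideal, as the submodule of the ring that the first
    differential has to cover.\<close>
  define M0 :: "nat \<Rightarrow> ('v, 'k) fmod set" where
    "M0 d = {f \<in> fspace (free_terms V {0}) (\<lambda>_. 0) d. restr ?std f = 0}" for d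
  have linr: "Vector_Spaces.linear fm_scale fm_scale (restr ?std :: ('v, 'k) fmod \<Rightarrow> _)"
    unfolding Vector_Spaces.linear_iff by (auto simp: fm.vector_space_axioms intro!: cof_eqI)
  have M0: "res_inv V ({0}, \<lambda>_. 0, M0)"
  proof -
    have "fm.subspace (M0 d)" for d
      using fm.subspace_inter[OF subspace_fspace fmp.linear_subspace_kernel[OF linr]] by (simp add: M0_def Int_def)
    moreover have "vmul v f \<in> M0 (Suc d)" if "v \<in> V" "f \<in> M0 d" for v f d
    proof -
      have z: "cof f k m = 0" if "(k, m) \<in> ?std" for k m
      proof -
        have "cof (restr ?std f) k m = 0" using \<open>f \<in> M0 d\<close> by (simp add: M0_def)
        then show ?thesis using that by simp
      qed
      have "restr ?std (vmul v f) = 0"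
      proof (rule cof_eqI)
        fix k m
        have "(k, m - monv v) \<in> ?std" if "(k, m) \<in> ?std" "0 < Poly_Mapping.lookup m v"
          using std_terms_down minus_single_add[OF that(2)] that(1) by metis
        then show "cof (restr ?std (vmul v f)) k m = cof 0 k m" using z by (simp add: cof_variable_mult)
      qed
      then show ?thesis using that vmul_fspace[of f V "{0}" "\<lambda>_. 0" d v] by (simp add: M0_def)
    qed
    moreover have "cof f k 0 = 0" if "f \<in> M0 d" for f d k
    proof (cases "k = 0")
      case True
      have "cof (restr ?std f) 0 0 = 0" using that by (simp add: M0_def)
      then show ?thesis using True by (simp add: std_terms_def indep_def)
    next
      case False
      then show ?thesis using that by (auto simp: M0_def fspace_def free_terms_def)
    qed
    ultimately show ?thesis by (auto simp: res_inv_def M0_def)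
  qed
  \<comment> \<open>Dependent choice; the implication at index 0 fixes the initial state.\<close>
  have "\<exists>s. \<forall>n. (res_inv V (s n) \<and> (n = 0 \<longrightarrow> s n = ({0}, \<lambda>_. 0, M0))) \<and> (\<exists>D. res_step V (s n) (s (Suc n)) D)"
  proof (rule dependent_nat_choice)
    show "\<exists>x. res_inv V x \<and> (0 = (0::nat) \<longrightarrow> x = ({0}, \<lambda>_. 0, M0))" using M0 by blast
    fix x :: "('v, 'k) res_state" and n :: nat
    assume "res_inv V x \<and> (n = 0 \<longrightarrow> x = ({0}, \<lambda>_. 0, M0))"
    then show "\<exists>y. (res_inv V y \<and> (Suc n = 0 \<longrightarrow> y = ({0}, \<lambda>_. 0, M0))) \<and> (\<exists>D. res_step V x y D)"
      using res_step_exists[OF V] by blast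
  qed
  then obtain s where s: "\<And>n. res_inv V (s n)" "s 0 = ({0}, \<lambda>_. 0, M0)" "\<And>n. \<exists>D. res_step V (s n) (s (Suc n)) D" by metis
  then obtain D where D: "\<And>n. res_step V (s n) (s (Suc n)) (D n)" by metis
  define B where "B n = fst (s n)" for n
  define dg where "dg n = fst (snd (s n))" for n
  define M where "M n = snd (snd (s n))" for n
  let ?Q = "\<lambda>n. free_terms V (B n)"
  have sn: "s n = (B n, dg n, M n)" for n by (simp add: B_def dg_def M_def)
  have init: "B 0 = {0}" "dg 0 = (\<lambda>_. 0)" "M 0 = M0" using s(2) by (simp_all add: B_def dg_def M_def)
  have inv: "M n d \<subseteq> fspace (?Q n) (dg n) d" "f \<in> M n d \<Longrightarrow> cof f k 0 = 0" for n d f k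
    using s(1)[of n] unfolding sn res_inv_def by auto
  have step: "k \<in> B (Suc n) \<Longrightarrow> D n k \<in> M n (dg (Suc n) k)"
    "extend_free (D n) ` fspace (?Q (Suc n)) (dg (Suc n)) d = M n d"
    "M (Suc n) d = {f \<in> fspace (?Q (Suc n)) (dg (Suc n)) d. extend_free (D n) f = 0}" for n d k
    using D[of n] unfolding sn res_step_def by auto
  have DF: "D n k \<in> fspace (?Q n) (dg n) (dg (Suc n) k)" if "k \<in> B (Suc n)" for n k
    using step(1)[OF that] inv(1) by blast
  \<comment> \<open>The zeroth module is the ring itself, with one generator of degree 0 sent to the
    class of 1.\<close>
  let ?e = "\<lambda>_ :: nat. 1 :: ('v, 'k) mpol"
  have er: "extend_ring ?e f = Poly_Mapping.lookup f 0" "f = embed0 (Poly_Mapping.lookup f 0)" if "f \<in> span_terms (?Q 0)" for f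
  proof -
    have "cof f k m = 0" if "k \<noteq> 0" for k m
      using \<open>f \<in> span_terms (?Q 0)\<close> that by (auto simp: span_terms_def cof_supp_def free_terms_def init)
    then have l: "Poly_Mapping.lookup f k = 0" if "k \<noteq> 0" for k
      using that by (intro poly_mapping_eqI) (simp add: cof_def)
    then have "Poly_Mapping.keys f \<subseteq> {0}" by (auto simp: in_keys_iff)
    then show "extend_ring ?e f = Poly_Mapping.lookup f 0"
      unfolding extend_ring_def by (subst sum.mono_neutral_left[of "{0}"]) (auto simp: in_keys_iff)
    show "f = embed0 (Poly_Mapping.lookup f 0)"
      using l by (intro poly_mapping_eqI) (simp add: embed0_def lookup_single when_def)
  qed
  have inI: "extend_ring ?e f \<in> edge_ideal (V, E) \<longleftrightarrow> restr ?std f = 0" if f: "f \<in> span_terms (?Q 0)" for f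
  proof -
    define p where "p = Poly_Mapping.lookup f 0"
    have fp: "f = embed0 p" "extend_ring ?e f = p" using er[OF f] by (simp_all add: p_def)
    have pk: "Poly_Mapping.keys m \<subseteq> V" if "m \<in> Poly_Mapping.keys p" for m
    proof -
      have "(0, m) \<in> cof_supp f" using that by (simp add: cof_supp_def cof_def p_def in_keys_iff)
      then show ?thesis using f by (auto simp: span_terms_def free_terms_def)
    qed
    have "restr ?std f = 0 \<longleftrightarrow> (\<forall>m\<in>Poly_Mapping.keys p. \<not> indep E (Poly_Mapping.keys m))"
    proof
      assume 0: "restr ?std f = 0"
      show "\<forall>m\<in>Poly_Mapping.keys p. \<not> indep E (Poly_Mapping.keys m)"
      proof (intro ballI notI)
        fix m assume m: "m \<in> Poly_Mapping.keys p" "indep E (Poly_Mapping.keys m)"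
        then have "cof (restr ?std f) 0 m = Poly_Mapping.lookup p m" using pk by (simp add: fp(1) cof_embed0 std_terms_def)
        then show False using 0 m by (simp add: in_keys_iff)
      qed
    next
      assume a: "\<forall>m\<in>Poly_Mapping.keys p. \<not> indep E (Poly_Mapping.keys m)"
      have "cof (restr ?std f) k m = 0" for k m
      proof (cases "m \<in> Poly_Mapping.keys p")
        case True
        then show ?thesis using a by (simp add: std_terms_def)
      next
        case False
        then show ?thesis by (simp add: fp(1) cof_embed0 in_keys_iff)
      qed
      then show "restr ?std f = 0" by (intro cof_eqI) simp
    qed
    then show ?thesis unfolding fp(2) edge_ideal_iff[OF G] using pk by (auto simp: poly_ring_def)
  qed
  have hom: "cof (D n k) j b \<noteq> 0 \<Longrightarrow> dg n j + mon_degree b = dg (Suc n) k" if "k \<in> B (Suc n)" for n k j b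
    using DF[OF that] by (auto simp: fspace_def)
  have ex0: "{f \<in> span_terms (?Q 0). restr ?std f = 0} = extend_free (D 0) ` span_terms (?Q 1)"
  proof (rule kernel_image_ungraded[OF linr, where dg = "dg 0" and dg' = "dg 1"])
    show "restr ?std (deg_part (dg 0) d f) = 0" if "restr ?std f = 0" for d and f :: "('v, 'k) fmod"
    proof (rule cof_eqI)
      fix k m
      have "cof (restr ?std f) k m = 0" using that by simp
      then show "cof (restr ?std (deg_part (dg 0) d f)) k m = cof 0 k m" by (simp split: if_splits)
    qed
    show "extend_free (D 0) ` fspace (?Q 1) (dg 1) d = {f \<in> fspace (?Q 0) (dg 0) d. restr ?std f = 0}" for d
      using step(2)[of 0 d] unfolding init(3) M0_def init(1,2) by simp
  qed
  have ex: "{f \<in> span_terms (?Q (Suc n)). extend_free (D n) f = 0} = extend_free (D (Suc n)) ` span_terms (?Q (Suc (Suc n)))" for n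
  proof (rule kernel_image_ungraded[OF linear_extend_free, where dg = "dg (Suc n)" and dg' = "dg (Suc (Suc n))"])
    fix f d assume f: "f \<in> span_terms (?Q (Suc n))" "extend_free (D n) f = 0"
    have "deg_part (dg n) d (extend_free (D n) f) = extend_free (D n) (deg_part (dg (Suc n)) d f)"
      using f(1) by (intro deg_part_extend_free hom) (auto simp: span_terms_def free_terms_def)
    moreover have "deg_part (dg n) d (0 :: ('v, 'k) fmod) = 0" by (intro cof_eqI) simp
    ultimately show "extend_free (D n) (deg_part (dg (Suc n)) d f) = 0" using f(2) by simp
  next
    show "extend_free (D (Suc n)) ` fspace (?Q (Suc (Suc n))) (dg (Suc (Suc n))) d =
        {f \<in> fspace (?Q (Suc n)) (dg (Suc n)) d. extend_free (D n) f = 0}" for d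
      using step(2)[of "Suc n" d] step(3)[of n d] by simp
  qed
  have minimal: "extend_free (D n) ` span_terms (?Q (Suc n)) \<subseteq> vectors (irrelevant_ideal V) (B n)" for n
  proof (rule image_subsetI)
    fix h :: "('v, 'k) fmod" assume h: "h \<in> span_terms (?Q (Suc n))"
    let ?H = "(\<lambda>(k, m). dg (Suc n) k + mon_degree m) ` cof_supp h"
    have g: "extend_free (D n) h = (\<Sum>d\<in>?H. extend_free (D n) (deg_part (dg (Suc n)) d h))"
      unfolding fmp.linear_sum[OF linear_extend_free, symmetric] deg_part_sum[symmetric] ..
    have "extend_free (D n) (deg_part (dg (Suc n)) d h) \<in> M n d" for d
      using step(2)[of n d] deg_part_in_fspace[OF h] by blast
    then have "cof (extend_free (D n) (deg_part (dg (Suc n)) d h)) k 0 = 0" for d k using inv(2) by blast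
    then have c0: "cof (extend_free (D n) h) k 0 = 0" for k unfolding g cof_sum by simp
    have "extend_free (D n) h \<in> span_terms (?Q n)"
    proof (rule extend_free_span_terms)
      fix k a assume "(k, a) \<in> cof_supp h"
      then have "(k, a) \<in> ?Q (Suc n)" using h unfolding span_terms_def by blast
      then have "k \<in> B (Suc n)" "Poly_Mapping.keys a \<subseteq> V" by (auto simp: free_terms_def)
      then show "Poly_Mapping.keys a \<subseteq> V \<and> D n k \<in> span_terms (?Q n)" using DF by (auto simp: fspace_eq)
    qed
    then have "extend_free (D n) h \<in> vectors (poly_ring V) (B n)" unfolding vectors_eq .
    then show "extend_free (D n) h \<in> vectors (irrelevant_ideal V) (B n)"
      using c0 by (auto simp: vectors_def irrelevant_ideal_def cof_def)
  qed
  have "minimal_graded_free_resolution V (edge_ideal (V, E)) B dg ?e D"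
    unfolding minimal_graded_free_resolution_def Let_def vectors_eq
  proof (intro conjI allI ballI)
    show "(1 :: ('v, 'k) mpol) \<in> poly_ring V" by (simp add: poly_ring_def)
    show "homogeneous (dg 0 k) (1 :: ('v, 'k) mpol)" for k by (simp add: homogeneous_def init)
    show "D n k \<in> span_terms (?Q n)" if "k \<in> B (Suc n)" for n k using DF[OF that] by (simp add: fspace_eq)
    show "homogeneous_vector (dg n) (dg (Suc n) k) (D n k)" if "k \<in> B (Suc n)" for n k
      using hom[OF that] by (simp add: homogeneous_vector_eq)
    show "\<exists>f\<in>span_terms (?Q 0). p - extend_ring ?e f \<in> edge_ideal (V, E)" if p: "p \<in> poly_ring V" for p
    proof (rule bexI)
      show f: "embed0 p \<in> span_terms (?Q 0)"
        using p by (auto simp: span_terms_def cof_supp_def cof_embed0 free_terms_def init poly_ring_def in_keys_iff split: if_splits)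
      have "extend_ring ?e (embed0 p) = p" using er(1)[OF f] by (simp add: embed0_def)
      then show "p - extend_ring ?e (embed0 p) \<in> edge_ideal (V, E)"
        by (simp add: edge_ideal_iff[OF G] poly_ring_def)
    qed
    have "{f \<in> span_terms (?Q 0). extend_ring ?e f \<in> edge_ideal (V, E)} = {f \<in> span_terms (?Q 0). restr ?std f = 0}"
      using inI by blast
    then show "{f \<in> span_terms (?Q 0). extend_ring ?e f \<in> edge_ideal (V, E)} = extend_free (D 0) ` span_terms (?Q 1)"
      using ex0 by simp
  qed (use ex minimal in auto)
  then show ?thesis by blast
qed

subsection \<open>Disjoint copies of \<open>B\<^sub>b\<close>\<close>

text \<open>An injective numbering, even on one side and odd on the other, which serves to order the
  vertices for the Koszul signs.\<close>

definition vert_index :: "nat + nat \<Rightarrow> nat" where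
  "vert_index x = (case x of Inl i \<Rightarrow> 2 * i | Inr i \<Rightarrow> 2 * i + 1)"

definition vert_less :: "nat + nat \<Rightarrow> nat + nat \<Rightarrow> bool" where
  "vert_less x y \<longleftrightarrow> vert_index x < vert_index y"

text \<open>Lexicographic with the copy first, so that earlier copies precede later ones as
  \<open>cell_poly_disjoint_union\<close> requires.\<close>

definition copy_less :: "nat \<times> (nat + nat) \<Rightarrow> nat \<times> (nat + nat) \<Rightarrow> bool" where
  "copy_less x y \<longleftrightarrow> fst x < fst y \<or> fst x = fst y \<and> vert_less (snd x) (snd y)"

lemma vert_index_inject: "vert_index x = vert_index y \<longleftrightarrow> x = y"
  by (cases x; cases y; simp add: vert_index_def; presburger)

lemma strict_total_vert_less: "strict_total vert_less"
  unfolding strict_total_def vert_less_def using vert_index_inject by (metis linorder_neqE_nat order_less_asym)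

lemma strict_total_copy_less: "strict_total copy_less"
  unfolding strict_total_def copy_less_def
proof (intro conjI allI impI notI)
  fix v w :: "nat \<times> (nat + nat)"
  show False if "(fst v < fst w \<or> fst v = fst w \<and> vert_less (snd v) (snd w)) \<and>
      (fst w < fst v \<or> fst w = fst v \<and> vert_less (snd w) (snd v))"
    using that strict_total_vert_less by (auto simp: strict_total_def)
  show "(fst v < fst w \<or> fst v = fst w \<and> vert_less (snd v) (snd w)) \<or>
      fst w < fst v \<or> fst w = fst v \<and> vert_less (snd w) (snd v)" if "v \<noteq> w"
    using that strict_total_vert_less unfolding strict_total_def by (metis linorder_neqE_nat prod_eqI)
qed

lemma copies_edge_iff:
  "{(c, u), (c', v)} \<in> snd (copies n G) \<longleftrightarrow> c = c' \<and> c \<in> {1..n} \<and> {u, v} \<in> snd G"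
proof
  assume "{(c, u), (c', v)} \<in> snd (copies n G)"
  then obtain a F where F: "{(c, u), (c', v)} = Pair a ` F" "a \<in> {1..n}" "F \<in> snd G" by (auto simp: copies_def)
  have "snd ` {(c, u), (c', v)} = F" unfolding F(1) by (simp add: image_image)
  then have "{u, v} = F" by simp
  moreover have "(c, u) \<in> Pair a ` F" "(c', v) \<in> Pair a ` F" using F(1) by blast+
  ultimately show "c = c' \<and> c \<in> {1..n} \<and> {u, v} \<in> snd G" using F(2,3) by auto
next
  assume *: "c = c' \<and> c \<in> {1..n} \<and> {u, v} \<in> snd G"
  then have "{(c, u), (c', v)} = Pair c ` {u, v} \<and> c \<in> {1..n} \<and> {u, v} \<in> snd G" by auto
  then show "{(c, u), (c', v)} \<in> snd (copies n G)" unfolding copies_def snd_conv by blast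
qed

lemma indep_copies:
  "indep (snd (copies n G)) \<sigma> \<longleftrightarrow>
    (\<forall>c u v. (c, u) \<in> \<sigma> \<longrightarrow> (c, v) \<in> \<sigma> \<longrightarrow> c \<in> {1..n} \<longrightarrow> {u, v} \<notin> snd G)"
  unfolding indep_def by (metis copies_edge_iff surj_pair)

lemma indep_copies_Suc:
  assumes "\<sigma> \<subseteq> fst (copies n G)" "\<sigma>' \<subseteq> fst G"
  shows "indep (snd (copies (Suc n) G)) (\<sigma> \<union> Pair (Suc n) ` \<sigma>') \<longleftrightarrow>
    indep (snd (copies n G)) \<sigma> \<and> indep (snd G) \<sigma>'"
proof -
  have s: "c \<in> {1..n}" if "(c, u) \<in> \<sigma>" for c u using assms(1) that by (auto simp: copies_def)
  show ?thesis
  proof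
    assume L: "indep (snd (copies (Suc n) G)) (\<sigma> \<union> Pair (Suc n) ` \<sigma>')"
    have "{u, v} \<notin> snd G" if "(c, u) \<in> \<sigma>" "(c, v) \<in> \<sigma>" for c u v
    proof -
      have "c \<in> {1..Suc n}" using s[OF that(1)] by simp
      then show ?thesis using L that unfolding indep_copies by blast
    qed
    moreover have "{u, v} \<notin> snd G" if "u \<in> \<sigma>'" "v \<in> \<sigma>'" for u v
    proof -
      have "Suc n \<in> {1..Suc n}" by simp
      then show ?thesis using L that unfolding indep_copies by blast
    qed
    ultimately show "indep (snd (copies n G)) \<sigma> \<and> indep (snd G) \<sigma>'"
      unfolding indep_copies unfolding indep_def by blast
  next
    assume R: "indep (snd (copies n G)) \<sigma> \<and> indep (snd G) \<sigma>'"
    have "{u, v} \<notin> snd G"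
      if "(c, u) \<in> \<sigma> \<union> Pair (Suc n) ` \<sigma>'" "(c, v) \<in> \<sigma> \<union> Pair (Suc n) ` \<sigma>'" for c u v
    proof (cases "c = Suc n")
      case True
      then have "u \<in> \<sigma>'" "v \<in> \<sigma>'" using that s[of c] by auto
      then show ?thesis using R unfolding indep_def by blast
    next
      case False
      then have "(c, u) \<in> \<sigma>" "(c, v) \<in> \<sigma>" using that by auto
      then show ?thesis using R s unfolding indep_copies by blast
    qed
    then show "indep (snd (copies (Suc n) G)) (\<sigma> \<union> Pair (Suc n) ` \<sigma>')" unfolding indep_copies by blast
  qed
qed

text \<open>The copy with the largest number is split off, since the tensor product argument needs
  the other vertices to come first in the order.\<close>

lemma cell_poly_copies:
  fixes K :: "'k::field itself"
  assumes b: "b \<ge> 3"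
  shows "cell_poly K copy_less (fst (copies n (B_graph b))) (snd (copies n (B_graph b))) = P_poly b ^ n"
proof (induction n)
  case 0
  then show ?case using cell_poly_empty[of K copy_less] by (simp add: copies_def)
next
  case (Suc n)
  let ?G = "B_graph b"
  have V: "fst (copies (Suc n) ?G) = fst (copies n ?G) \<union> Pair (Suc n) ` fst ?G"
    by (auto simp: copies_def le_Suc_eq)
  have "cell_poly K copy_less (fst (copies (Suc n) ?G)) (snd (copies (Suc n) ?G)) =
    cell_poly K copy_less (fst (copies n ?G)) (snd (copies n ?G)) * cell_poly K vert_less (fst ?G) (snd ?G)"
    unfolding V
  proof (rule cell_poly_disjoint_union)
    show "finite (fst (copies n ?G))" using finite_B_vert[of b] by (simp add: copies_def)
    show "finite (fst ?G)" by (rule finite_B_vert)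
    show "inj (Pair (Suc n) :: nat + nat \<Rightarrow> _)" by (simp add: inj_def)
    show "fst (copies n ?G) \<inter> Pair (Suc n) ` fst ?G = {}" by (auto simp: copies_def)
    show "copy_less x (Suc n, y)" if "x \<in> fst (copies n ?G)" for x y
      using that by (auto simp: copies_def copy_less_def)
    show "copy_less (Suc n, y) (Suc n, y') \<longleftrightarrow> vert_less y y'" for y y'
      by (simp add: copy_less_def)
  qed (use strict_total_copy_less strict_total_vert_less indep_copies_Suc in blast)+
  then show ?case using Suc cell_poly_B[OF b strict_total_vert_less, of K] by (simp add: mult.commute)
qed

lemma simple_graph_copies: "simple_graph (fst (copies n (B_graph b))) (snd (copies n (B_graph b)))"
  unfolding simple_graph_def
proof (intro allI impI)
  fix x y :: "nat \<times> (nat + nat)" assume e: "{x, y} \<in> snd (copies n (B_graph b))"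
  obtain c u c' v where xy: "x = (c, u)" "y = (c', v)" by force
  have *: "c = c'" "c \<in> {1..n}" "{u, v} \<in> B_edge b" using e unfolding xy copies_edge_iff by blast+
  then have "u \<in> B_vert b" "v \<in> B_vert b" by (auto simp: B_graph_def doubleton_eq_iff)
  moreover have "u \<noteq> v" using *(3) B_edge_loops by auto
  ultimately show "x \<in> fst (copies n (B_graph b)) \<and> y \<in> fst (copies n (B_graph b)) \<and> x \<noteq> y"
    using * by (simp add: xy copies_def)
qed

text \<open>A resolution exists, and the count in any resolution has the same value; together these
  evaluate the definite description.\<close>

lemma graph_betti_eq:
  fixes K :: "'k::field itself" and V :: "'v set"
  assumes V: "finite V" and lt: "strict_total lt" and G: "simple_graph V E"
  shows "int (graph_betti K (V, E) i d) = uv_coeff (cell_poly K lt V E) i d"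
proof -
  let ?I = "edge_ideal (V, E) :: ('v, 'k) mpol set"
  let ?P = "\<lambda>c. \<exists>B deg e D. minimal_graded_free_resolution V ?I B deg e D \<and> c = card {k \<in> B i. deg i k = d}"
  have card: "int (card {k \<in> B i. deg i k = d}) = uv_coeff (cell_poly K lt V E) i d"
    if "minimal_graded_free_resolution V ?I B deg e D" for B deg e D
    using resolution_card[OF V lt G that] kdim_std[OF V lt, of E i d K] by simp
  obtain B deg and e :: "nat \<Rightarrow> ('v, 'k) mpol" and D where res: "minimal_graded_free_resolution V ?I B deg e D"
    using minimal_resolution_exists[OF V G] by blast
  have "(THE c. ?P c) = card {k \<in> B i. deg i k = d}"
  proof (rule the_equality)
    show "?P (card {k \<in> B i. deg i k = d})" using res by blast
    fix c assume "?P c"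
    then obtain B' deg' e' D' where "minimal_graded_free_resolution V ?I B' deg' e' D'" "c = card {k \<in> B' i. deg' i k = d}"
      by blast
    then have "int c = int (card {k \<in> B i. deg i k = d})" using card[OF res] card by simp
    then show "c = card {k \<in> B i. deg i k = d}" by simp
  qed
  then show ?thesis using card[OF res] by (simp add: graph_betti_def graded_betti_def)
qed

text \<open>This converts a statement about coefficients into an identity of generating
  functions.\<close>

lemma uv_poly_sum_monom:
  shows "finite {(i, d). uv_coeff p i d \<noteq> 0}"
    and "(\<Sum>(i, d) \<in> {(i, d). uv_coeff p i d \<noteq> 0}. uv_monom (uv_coeff p i d) i d) = p"
proof -
  let ?S = "{(i, d). uv_coeff p i d \<noteq> 0}"
  have "?S \<subseteq> Sigma {..degree p} (\<lambda>i. {..degree (coeff p i)})"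
  proof (clarify)
    fix i d assume nz: "uv_coeff p i d \<noteq> 0"
    then have "coeff (coeff p i) d \<noteq> 0" "coeff p i \<noteq> 0" by (auto simp: uv_coeff_def)
    then show "i \<in> {..degree p} \<and> d \<in> {..degree (coeff p i)}" by (simp add: le_degree)
  qed
  then show fin: "finite ?S" by (rule finite_subset) auto
  show "(\<Sum>(i, d) \<in> ?S. uv_monom (uv_coeff p i d) i d) = p"
  proof (rule uv_poly_eqI)
    fix j k
    have "uv_coeff (\<Sum>(i, d) \<in> ?S. uv_monom (uv_coeff p i d) i d) j k =
        (\<Sum>x\<in>?S. if x = (j, k) then uv_coeff p j k else 0)"
      unfolding uv_coeff_sum by (rule sum.cong) (auto simp: uv_coeff_monom split: if_splits)
    also have "\<dots> = uv_coeff p j k" using fin by auto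
    finally show "uv_coeff (\<Sum>(i, d) \<in> ?S. uv_monom (uv_coeff p i d) i d) j k = uv_coeff p j k" .
  qed
qed

theorem theorem4p3:
  fixes b n :: nat and K :: "'k::field itself"
  assumes "b \<ge> 3" and "n \<ge> 1"
  defines "\<beta> \<equiv> graph_betti K (copies n (B_graph b))"
  shows "finite {(i, d). \<beta> i d \<noteq> 0} \<and>
         (\<Sum>(i, d) \<in> {(i, d). \<beta> i d \<noteq> 0}. uv_monom (int (\<beta> i d)) i d) = P_poly b ^ n \<and>
         (\<forall>i d. int (\<beta> i d) = uv_coeff (P_poly b ^ n) i d)"
proof -
  have V: "finite (fst (copies n (B_graph b)))" using finite_B_vert[of b] by (simp add: copies_def)
  have coeff: "int (\<beta> i d) = uv_coeff (P_poly b ^ n) i d" for i d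
    using graph_betti_eq[OF V strict_total_copy_less simple_graph_copies, of K i d]
      cell_poly_copies[OF assms(1), of K n] by (simp add: \<beta>_def)
  have nz: "\<beta> i d \<noteq> 0 \<longleftrightarrow> uv_coeff (P_poly b ^ n) i d \<noteq> 0" for i d
    unfolding coeff[symmetric] by simp
  show ?thesis unfolding nz coeff using uv_poly_sum_monom[of "P_poly b ^ n"] by simp
qed

end
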